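(* For any $N\in2\mathbb{N}$ and $r\in\mathbb{Z}$, the function $$\Theta_{\frac32}(N,r;\tau)=\sum_{n\ge0}\left(n+\frac rN\right)q^{\frac N2\left(n+\frac rN\right)^2}$$ is a strong quantum modular form of weight $\frac32$ on $\Gamma_1(2N)$ with multiplier system $\chi_r$ and quantum set $\widehat{\mathcal Q}_{N,r}$.
   Context: Notation: $q^a=e^{2\pi ia\tau}$, $e(x)=e^{2\pi ix}$, $\operatorname{ord}_2$ is the $2$-adic valuation, and all fractions $\frac hk\in\mathbb{Q}$ are in lowest terms with $k>0$. The quantum set is $$\widehat{\mathcal Q}_{N,r}=\begin{cases}\left\{\frac hk\in\mathbb{Q}:\frac N2\mid k,\ \operatorname{ord}_2(k)=\operatorname{ord}_2(N)-1\right\}&\text{if }\frac N2\nmid r,\\ \left\{\frac hk\in\mathbb{Q}:\operatorname{ord}_2(k)>\operatorname{ord}_2(N)\right\}&\text{if }r\equiv\frac N2\pmod N,\\ \left\{\frac hk\in\mathbb{Q}:\operatorname{ord}_2(k)=\operatorname{ord}_2(N)\right\}&\text{if }r\equiv0\pmod N.\end{cases}$$ The multiplier is, for $\gamma=\begin{pmatrix}a&b\\c&d\end{pmatrix}\in\Gamma_1(2N)$, $\chi_r(\gamma)=e\left(\frac{br^2}{2N}\right)$ if $c=0$ and $\chi_r(\gamma)=e\left(\frac{br^2}{2N}\right)\left(\frac{2Nc}{d}\right)$ if $c\ne0$, with the (Shimura-extended) Jacobi symbol. Strong quantum modular form (Zagier): a function $f$ on $\mathbb{H}$ is a strong quantum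 modular form of weight $k$ on $\Gamma$ with multiplier $\chi$ and quantum set $\mathcal Q\subseteq\mathbb{Q}$ if (i) at every $x\in\mathcal Q$ it has a full asymptotic expansion $f\left(x+\frac{it}{2\pi}\right)\sim\sum_{n\ge0}a_n(x)t^n$ as $t\to0^+$, which defines the formal power series $f(x+\varepsilon)\in\mathbb{C}[[\varepsilon]]$ obtained by setting $\varepsilon=\frac{it}{2\pi}$ (in particular the value $f(x)=a_0(x)$); and (ii) for every $\gamma=\begin{pmatrix}a&b\\c&d\end{pmatrix}\in\Gamma$ there is a real-analytic function $h_\gamma$ on $\mathbb{R}\setminus\{\gamma^{-1}\infty\}$ such that for every $x\in\mathcal Q$ with $x\neq\gamma^{-1}\infty$ the formal power series in $\varepsilon$ $$f(x+\varepsilon)-\chi(\gamma)^{-1}(c(x+\varepsilon)+d)^{-k}f(\gamma(x+\varepsilon))$$ equals the Taylor expansion of $h_\gamma$ at $x$. *)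

theory Defs
  imports
    "HOL-Analysis.Analysis"
    "HOL-Computational_Algebra.Computational_Algebra"
    "HOL-Number_Theory.Number_Theory"
    "HOL-Library.Landau_Symbols"
begin

definition unit_exp :: "complex \<Rightarrow> complex"
  where "unit_exp z = exp (2 * of_real pi * \<i> * z)"

definition partial_theta :: "nat \<Rightarrow> int \<Rightarrow> complex \<Rightarrow> complex"
  where "partial_theta N r \<tau> =
    (\<Sum>n. (of_nat n + of_int r / of_nat N)
          * unit_exp (of_nat N / 2 * (of_nat n + of_int r / of_nat N) ^ 2 * \<tau>))"

definition Gamma1 :: "nat \<Rightarrow> (int ^ 2 ^ 2) set"
  where "Gamma1 M = {\<gamma>. det \<gamma> = 1 \<and>
    [\<gamma> $ 1 $ 1 = 1] (mod int M) \<and> [\<gamma> $ 2 $ 1 = 0] (mod int M) \<and> [\<gamma> $ 2 $ 2 = 1] (mod int M)}"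

text \<open>
  The symbol \<open>(c/d)\<close> for odd \<open>d\<close> of either sign, in Shimura's convention: the Jacobi symbol of
  \<open>c\<close> modulo \<open>\<bar>d\<bar>\<close>, with an additional sign \<open>-1\<close> if \<open>c\<close> and \<open>d\<close> are both negative. In particular
  \<open>(0/1) = (0/-1) = 1\<close> (empty product).
\<close>
definition shimura_symbol :: "int \<Rightarrow> int \<Rightarrow> int"
  where "shimura_symbol c d =
    (if c < 0 \<and> d < 0 then - 1 else 1) * (\<Prod>p\<in>#prime_factorization \<bar>d\<bar>. Legendre c p)"

definition theta_multiplier :: "nat \<Rightarrow> int \<Rightarrow> int ^ 2 ^ 2 \<Rightarrow> complex"
  where "theta_multiplier N r \<gamma> =
    (let b = \<gamma> $ 1 $ 2; c = \<gamma> $ 2 $ 1; d = \<gamma> $ 2 $ 2;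
         w = unit_exp (of_int (b * r ^ 2) / of_nat (2 * N))
     in if c = 0 then w else w * of_int (shimura_symbol (2 * int N * c) d))"

definition rat_denom :: "rat \<Rightarrow> int"
  where "rat_denom x = snd (quotient_of x)"

definition ord2 :: "int \<Rightarrow> nat"
  where "ord2 m = multiplicity 2 m"

text \<open>
  For even \<open>N > 0\<close> the three cases are exhaustive, so the last set is only reached for
  \<open>r \<equiv> 0 (mod N)\<close>.
\<close>
definition quantum_set :: "nat \<Rightarrow> int \<Rightarrow> rat set"
  where "quantum_set N r =
    (if \<not> (int N div 2) dvd r then
       {x. (int N div 2) dvd rat_denom x \<and> int (ord2 (rat_denom x)) = int (ord2 (int N)) - 1}
     else if [r = int N div 2] (mod int N) then
       {x. ord2 (rat_denom x) > ord2 (int N)}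
     else
       {x. ord2 (rat_denom x) = ord2 (int N)})"

text \<open>
  \<open>f (x + it/(2\<pi>)) \<sim> \<Sum>\<^sub>n a n * t ^ n\<close> as \<open>t \<rightarrow> 0\<^sup>+\<close>.
\<close>
definition has_asymptotic_expansion :: "(complex \<Rightarrow> complex) \<Rightarrow> rat \<Rightarrow> (nat \<Rightarrow> complex) \<Rightarrow> bool"
  where "has_asymptotic_expansion f x a \<longleftrightarrow>
    (\<forall>M. (\<lambda>t::real. f (of_rat x + \<i> * of_real t / (2 * of_real pi)) - (\<Sum>n<M. a n * of_real t ^ n))
          \<in> O[at_right 0](\<lambda>t. of_real t ^ M))"

text \<open>
  The power series in \<open>\<epsilon>\<close> obtained from \<open>\<Sum>\<^sub>n a n * t ^ n\<close> by \<open>\<epsilon> = it/(2\<pi>)\<close>, i.e. \<open>t = -2\<pi>i\<epsilon>\<close>.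
\<close>
definition eps_series :: "(nat \<Rightarrow> complex) \<Rightarrow> complex fps"
  where "eps_series a = Abs_fps (\<lambda>n. a n * (- 2 * of_real pi * \<i>) ^ n)"

text \<open>
  The value \<open>(c x + d) ^ s\<close> at real \<open>x\<close>, where \<open>u = c x + d\<close>. If \<open>u < 0\<close> a branch has to be fixed:
  we take the limit of the principal values \<open>(c \<tau> + d) ^ s\<close> as \<open>\<tau> \<rightarrow> x\<close> with \<open>Im \<tau> < 0\<close>, so that
  the argument of a negative \<open>u\<close> is \<open>-\<pi>\<close> if \<open>c > 0\<close> and \<open>\<pi>\<close> otherwise. At rational points the
  formal expansions of partial theta functions are those of non-holomorphic Eichler integrals
  living on the lower half plane, and this is the branch for which those transform. Taking the
  limit from the upper half plane instead (or the principal value at \<open>u\<close> itself, when \<open>c > 0\<close>)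
  flips the sign for \<open>s = -3/2\<close> and \<open>u < 0\<close>, and the modularity statement fails.
\<close>
definition lower_power :: "real \<Rightarrow> int \<Rightarrow> real \<Rightarrow> complex"
  where "lower_power u c s =
    exp (of_real s * (if c > 0 then cnj (Ln (of_real u)) else Ln (of_real u)))"

text \<open>
  \<open>(c (x + \<epsilon>) + d) ^ s = (c x + d) ^ s * (1 + c \<epsilon> / (c x + d)) ^ s\<close>, expanded by the binomial series.
\<close>
definition automorphy_series :: "real \<Rightarrow> int ^ 2 ^ 2 \<Rightarrow> rat \<Rightarrow> complex fps"
  where "automorphy_series s \<gamma> x =
    (let c = \<gamma> $ 2 $ 1; d = \<gamma> $ 2 $ 2; u = of_int c * of_rat x + of_int d :: real
     in fps_const (lower_power u c s)
        * (fps_binomial (of_real s) oo (fps_const (of_int c / of_real u) * fps_X)))"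

definition moebius_rat :: "int ^ 2 ^ 2 \<Rightarrow> rat \<Rightarrow> rat"
  where "moebius_rat \<gamma> x =
    (of_int (\<gamma> $ 1 $ 1) * x + of_int (\<gamma> $ 1 $ 2)) / (of_int (\<gamma> $ 2 $ 1) * x + of_int (\<gamma> $ 2 $ 2))"

text \<open>The series \<open>\<gamma> (x + \<epsilon>) - \<gamma> x\<close>.\<close>
definition moebius_shift :: "int ^ 2 ^ 2 \<Rightarrow> rat \<Rightarrow> complex fps"
  where "moebius_shift \<gamma> x =
    (fps_const (of_int (\<gamma> $ 1 $ 1)) * (fps_const (of_rat x) + fps_X) + fps_const (of_int (\<gamma> $ 1 $ 2)))
    * inverse (fps_const (of_int (\<gamma> $ 2 $ 1)) * (fps_const (of_rat x) + fps_X)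
               + fps_const (of_int (\<gamma> $ 2 $ 2)))
    - fps_const (of_rat (moebius_rat \<gamma> x))"

definition real_analytic_on :: "(real \<Rightarrow> complex) \<Rightarrow> real set \<Rightarrow> bool"
  where "real_analytic_on h S \<longleftrightarrow>
    (\<forall>x\<in>S. \<exists>a. \<exists>\<delta>>0. \<forall>y. \<bar>y - x\<bar> < \<delta> \<longrightarrow> (\<lambda>n. a n * of_real (y - x) ^ n) sums h y)"

definition taylor_series :: "(real \<Rightarrow> complex) \<Rightarrow> real \<Rightarrow> complex fps"
  where "taylor_series h x =
    Abs_fps (\<lambda>n. ((\<lambda>g y. vector_derivative g (at y)) ^^ n) h x / fact n)"

text \<open>
  In the second clause \<open>a\<close> and \<open>a'\<close> are the (uniquely determined) asymptotic expansions of \<open>f\<close> at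
  \<open>x\<close> and \<open>\<gamma> x\<close>. The condition \<open>c y + d \<noteq> 0\<close> on real \<open>y\<close> says \<open>y \<noteq> \<gamma>\<^sup>-\<^sup>1 \<infinity>\<close>; it is
  automatic if \<open>c = 0\<close>.
\<close>
definition strong_quantum_modular_form ::
    "(complex \<Rightarrow> complex) \<Rightarrow> real \<Rightarrow> (int ^ 2 ^ 2) set \<Rightarrow> (int ^ 2 ^ 2 \<Rightarrow> complex) \<Rightarrow> rat set \<Rightarrow> bool"
  where "strong_quantum_modular_form f k \<Gamma> \<nu> Q \<longleftrightarrow>
    (\<forall>x\<in>Q. \<exists>a. has_asymptotic_expansion f x a) \<and>
    (\<forall>\<gamma>\<in>\<Gamma>. \<exists>h :: real \<Rightarrow> complex.
       real_analytic_on h {y. of_int (\<gamma> $ 2 $ 1) * y + of_int (\<gamma> $ 2 $ 2) \<noteq> 0} \<and>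
       (\<forall>x\<in>Q. of_int (\<gamma> $ 2 $ 1) * x + of_int (\<gamma> $ 2 $ 2) \<noteq> 0 \<longrightarrow>
          (\<exists>a a'. has_asymptotic_expansion f x a \<and>
                  has_asymptotic_expansion f (moebius_rat \<gamma> x) a' \<and>
                  eps_series a
                    - fps_const (inverse (\<nu> \<gamma>)) * automorphy_series (- k) \<gamma> x
                      * (eps_series a' oo moebius_shift \<gamma> x)
                  = taylor_series h (of_rat x))))"

end

theory Submission
  imports Defs "HOL-Complex_Analysis.Complex_Analysis" "HOL-Probability.Probability" "HOL-Real_Asymp.Real_Asymp"
begin

text \<open>
  The partial theta function splits into three parts (\<open>partial_theta_decomposition\<close>). With \<open>q = n + r / N\<close>, the
  coefficient \<open>q\<close> for \<open>n \<ge> 0\<close> is \<open>q / 2 + \<bar>q\<bar> / 2\<close> up to finitely many \<open>n\<close>. The sum over all integers with coefficient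
  \<open>q\<close> is an odd theta series and decays faster than any power at every rational point (\<open>theta_odd_eps_expansion\<close>): it
  is invisible in the asymptotic expansions. The finitely many exceptional terms form an entire function, whose
  contribution to the modularity defect is real analytic for trivial reasons (\<open>slash_defect_expansion\<close>). All the
  arithmetic is in the sum with coefficient \<open>\<bar>q\<bar>\<close>.

  This sum is a half-order integral of the derivative of the theta series \<open>theta\<close> of weight \<open>1/2\<close> with the same exponents,
  since the integral of \<open>exp (- \<beta> * s) * s powr (- 1/2)\<close> is \<open>sqrt (pi / \<beta>)\<close> and \<open>\<beta>\<close> is a constant times \<open>q ^ 2\<close>
  (\<open>theta_half_integral\<close>). At the points of the quantum set a quadratic exponential sum vanishes
  (\<open>quantum_set_gauss_sum_zero\<close>), hence \<open>theta\<close> decays there faster than any power (\<open>theta_cusp_decay\<close>). So the binomial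
  expansion of the kernel may be integrated term by term: the asymptotic series at \<open>x\<close> is, up to a constant, the formal
  Taylor series in \<open>\<epsilon>\<close> of the Eichler integral of \<open>theta (w) * (- \<i> * (w - x - \<epsilon>)) powr (- 3/2)\<close> over the vertical line
  from \<open>x\<close> to \<open>\<i>\<infinity>\<close> (\<open>theta_abs_eps_expansion\<close>).

  Modularity is inherited from \<open>theta\<close> (\<open>theta_transform\<close>), whose multiplier is computed from Poisson summation and
  quadratic Gauss sums. The substitution \<open>\<gamma>\<close> transforms the Eichler integral at \<open>\<gamma>x\<close> into the integral with the same
  integrand over the geodesic from \<open>x\<close> to \<open>\<gamma>\<inverse>\<infinity>\<close>, because the weights \<open>1/2\<close> and \<open>3/2\<close> add up to 2
  (\<open>eichler_period\<close>). By Cauchy's theorem the difference of the two integrals is the integral over the third side of an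
  ideal triangle, from \<open>\<gamma>\<inverse>\<infinity>\<close> to \<open>\<i>\<infinity>\<close> (\<open>ideal_triangle\<close>). The point \<open>x\<close> enters that integral only through the kernel,
  which is singular only for \<open>x = \<gamma>\<inverse>\<infinity>\<close>; so it is a real analytic function of \<open>x\<close>, and its Taylor series is the defect
  (\<open>period_function_expansion\<close>). The substitution is formal in \<open>\<epsilon>\<close>, but each coefficient of a composition is a finite
  combination, so it can be done under the integral sign (\<open>fps_mult_compose_nth\<close>, \<open>kern_series_moebius\<close>).
\<close>

section \<open>Sums and series over the integers\<close>

abbreviation zsummable :: "(int \<Rightarrow> complex) \<Rightarrow> bool"
  where "zsummable f \<equiv> (\<lambda>n. norm (f n)) summable_on UNIV"

lemma exp_int_abs_summable: "(\<lambda>n::int. exp (- \<bar>real_of_int n\<bar>)) summable_on UNIV"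
proof -
  have "real (int_encode m) \<le> 2 * \<bar>real_of_int m\<bar> + 1" for m
    by (auto simp: int_encode_def sum_encode_def)
  then have bound: "real k \<le> 2 * \<bar>real_of_int (int_decode k)\<bar> + 1" for k
    by (metis int_decode_inverse)
  have s: "summable (\<lambda>k::nat. exp (1/2) * exp (-1/2::real) ^ k)"
    by (intro summable_mult summable_geometric) auto
  have b: "norm (exp (- \<bar>real_of_int (int_decode k)\<bar>)) \<le> exp (1/2) * exp (-1/2::real) ^ k" for k
  proof -
    have eq: "exp (1/2) * exp (-1/2::real) ^ k = exp (1/2 + real k * (-1/2))"
      by (simp only: exp_add exp_of_nat_mult)
    have "- \<bar>real_of_int (int_decode k)\<bar> \<le> 1/2 + real k * (-1/2)"
      using bound[of k] by linarith
    then show ?thesis by (simp only: eq exp_le_cancel_iff norm_exp_eq_Re real_norm_def abs_exp_cancel)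
  qed
  have "summable (\<lambda>k. norm (exp (- \<bar>real_of_int (int_decode k)\<bar>)))"
    by (rule summable_norm_comparison_test[OF exI[of _ 0] s]) (use b in blast)
  then have "(\<lambda>k. exp (- \<bar>real_of_int (int_decode k)\<bar>)) summable_on UNIV"
    by (rule norm_summable_imp_summable_on)
  then show ?thesis
    using summable_on_reindex_bij_betw[OF bij_int_decode, of "\<lambda>n. exp (- \<bar>real_of_int n\<bar>)"] by simp
qed

text \<open>Completing the square bounds the summand by a multiple of \<open>exp (- \<bar>n\<bar>)\<close>.\<close>
lemma gauss_dominated_summable:
  fixes f :: "int \<Rightarrow> complex"
  assumes "\<epsilon> > 0" and "\<And>n. norm (f n) \<le> C * exp (B * \<bar>real_of_int n\<bar> - \<epsilon> * real_of_int n ^ 2)"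
  shows "zsummable f"
proof (rule Infinite_Sum.abs_summable_on_comparison_test)
  let ?K = "C * exp ((B + 1)^2 / (4 * \<epsilon>))"
  show "(\<lambda>n. norm (?K * exp (- \<bar>real_of_int n\<bar>))) summable_on UNIV"
    using summable_on_cmult_right[OF exp_int_abs_summable, of "\<bar>?K\<bar>"] by (simp add: abs_mult)
  fix n
  have "0 \<le> norm (f n)" by simp
  also have "\<dots> \<le> C * exp (B * \<bar>real_of_int n\<bar> - \<epsilon> * real_of_int n ^ 2)" by (rule assms)
  finally have C: "C \<ge> 0" by (simp add: zero_le_mult_iff)
  let ?x = "\<bar>real_of_int n\<bar>"
  have "0 \<le> (2 * \<epsilon> * ?x - (B + 1))^2 / (4 * \<epsilon>)" using assms by simp
  also have "\<dots> = (B + 1)^2 / (4 * \<epsilon>) - (B + 1) * ?x + \<epsilon> * ?x^2"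
    using assms(1) by (simp add: field_simps power2_eq_square)
  finally have "exp (B * ?x - \<epsilon> * ?x^2) \<le> exp ((B + 1)^2 / (4 * \<epsilon>) + (- ?x))"
    by (simp add: algebra_simps)
  then have "C * exp (B * ?x - \<epsilon> * ?x^2) \<le> C * exp ((B + 1)^2 / (4 * \<epsilon>) + (- ?x))"
    using C by (rule mult_left_mono)
  also have "\<dots> = norm (?K * exp (- ?x))"
    using C by (subst exp_add) (simp add: abs_mult)
  finally show "norm (f n) \<le> norm (?K * exp (- \<bar>real_of_int n\<bar>))"
    using assms(2)[of n] by simp
qed

text \<open>Enumerating the integers turns an absolutely convergent sum over them into a series, to which termwise
  differentiation and dominated convergence apply.\<close>
lemma int_abs_summable_sums:
  fixes f :: "int \<Rightarrow> complex"
  assumes "zsummable f"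
  shows "summable (\<lambda>k. norm (f (int_decode k)))"
    and "(\<lambda>k. f (int_decode k)) sums (\<Sum>\<^sub>\<infinity>n. f n)"
proof -
  have "(\<lambda>k. norm (f (int_decode k))) summable_on UNIV"
    using assms summable_on_reindex_bij_betw[OF bij_int_decode, of "\<lambda>n. norm (f n)"] by simp
  then show "summable (\<lambda>k. norm (f (int_decode k)))"
    by (rule summable_on_imp_summable)
  have "(f has_sum (\<Sum>\<^sub>\<infinity>n. f n)) UNIV"
    by (rule has_sum_infsum[OF Infinite_Sum.abs_summable_summable[OF assms]])
  then have "((\<lambda>k. f (int_decode k)) has_sum (\<Sum>\<^sub>\<infinity>n. f n)) UNIV"
    using has_sum_reindex_bij_betw[OF bij_int_decode, of f] by simp
  then show "(\<lambda>k. f (int_decode k)) sums (\<Sum>\<^sub>\<infinity>n. f n)"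
    by (rule has_sum_imp_sums)
qed

text \<open>The extra factor \<open>exp (\<delta> * norm (\<mu> n))\<close> in the hypothesis does two things: half of the exponent
  dominates the terms on the ball of radius \<open>\<delta> / 2\<close> around \<open>z\<close>, the other half absorbs the factor \<open>\<mu> n\<close>
  of the differentiated terms. So the Weierstrass test covers both series.\<close>
lemma exp_sum_has_derivative:
  fixes c \<mu> :: "int \<Rightarrow> complex"
  assumes "\<delta> > 0"
    and "(\<lambda>n. norm (c n) * exp (Re (\<mu> n * z) + \<delta> * norm (\<mu> n))) summable_on UNIV"
  shows "((\<lambda>z. \<Sum>\<^sub>\<infinity>n. c n * exp (\<mu> n * z)) has_field_derivative
           (\<Sum>\<^sub>\<infinity>n. c n * \<mu> n * exp (\<mu> n * z))) (at z)"
    and "zsummable (\<lambda>n. c n * exp (\<mu> n * z))"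
    and "zsummable (\<lambda>n. c n * \<mu> n * exp (\<mu> n * z))"
proof -
  define M where "M n = norm (c n) * exp (Re (\<mu> n * z) + \<delta> * norm (\<mu> n))" for n
  have near: "norm (exp (\<mu> n * w)) \<le> exp (Re (\<mu> n * z) + \<delta> / 2 * norm (\<mu> n))" if "w \<in> ball z (\<delta>/2)" for n w
  proof -
    have "Re (\<mu> n * w) = Re (\<mu> n * z) + Re (\<mu> n * (w - z))" by (simp add: algebra_simps)
    also have "Re (\<mu> n * (w - z)) \<le> norm (\<mu> n) * norm (w - z)"
      by (metis complex_Re_le_cmod norm_mult)
    also have "\<dots> \<le> norm (\<mu> n) * (\<delta> / 2)"
      using that by (intro mult_left_mono) (auto simp: dist_norm norm_minus_commute)
    finally show ?thesis by (simp add: mult_ac)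
  qed
  have b0: "norm (c n * exp (\<mu> n * w)) \<le> M n" if "w \<in> ball z (\<delta>/2)" for n w
  proof -
    have "norm (exp (\<mu> n * w)) \<le> exp (Re (\<mu> n * z) + \<delta> / 2 * norm (\<mu> n))" by (rule near[OF that])
    also have "\<dots> \<le> exp (Re (\<mu> n * z) + \<delta> * norm (\<mu> n))" using assms(1) by (simp add: mult_right_mono)
    finally show ?thesis unfolding M_def norm_mult by (rule mult_left_mono) auto
  qed
  have b1: "norm (c n * \<mu> n * exp (\<mu> n * w)) \<le> 2 / \<delta> * M n" if "w \<in> ball z (\<delta>/2)" for n w
  proof -
    have "\<delta> / 2 * norm (\<mu> n) \<le> exp (\<delta> / 2 * norm (\<mu> n))"
      using exp_ge_add_one_self[of "\<delta> / 2 * norm (\<mu> n)"] by linarith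
    then have "norm (\<mu> n) \<le> 2 / \<delta> * exp (\<delta> / 2 * norm (\<mu> n))"
      using assms(1) by (simp add: field_simps)
    then have "norm (\<mu> n) * norm (exp (\<mu> n * w)) \<le>
        2 / \<delta> * exp (\<delta> / 2 * norm (\<mu> n)) * exp (Re (\<mu> n * z) + \<delta> / 2 * norm (\<mu> n))"
      by (intro mult_mono near[OF that]) (use assms(1) in auto)
    also have "\<dots> = 2 / \<delta> * exp (Re (\<mu> n * z) + \<delta> * norm (\<mu> n))"
      by (simp add: mult_exp_exp algebra_simps)
    finally have "norm (c n) * (norm (\<mu> n) * norm (exp (\<mu> n * w))) \<le> norm (c n) * (2 / \<delta> * exp (Re (\<mu> n * z) + \<delta> * norm (\<mu> n)))"
      by (rule mult_left_mono) auto
    then show ?thesis by (simp add: M_def norm_mult mult_ac)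
  qed
  have M: "M summable_on UNIV" unfolding M_def by (rule assms(2))
  have Mn: "summable (\<lambda>k. M (int_decode k))"
    using M summable_on_reindex_bij_betw[OF bij_int_decode, of M] summable_on_imp_summable by simp
  have M0: "M n \<ge> 0" for n by (simp add: M_def)
  have s0: "zsummable (\<lambda>n. c n * exp (\<mu> n * w))" if "w \<in> ball z (\<delta>/2)" for w
    by (rule summable_on_comparison_test[OF M b0[OF that]]) auto
  have s1: "zsummable (\<lambda>n. c n * \<mu> n * exp (\<mu> n * w))" if "w \<in> ball z (\<delta>/2)" for w
    by (rule summable_on_comparison_test[OF summable_on_cmult_right[OF M] b1[OF that]]) auto
  have z: "z \<in> ball z (\<delta>/2)" using assms(1) by simp
  show "zsummable (\<lambda>n. c n * exp (\<mu> n * z))" "zsummable (\<lambda>n. c n * \<mu> n * exp (\<mu> n * z))"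
    by (rule s0[OF z], rule s1[OF z])
  have "((\<lambda>w. \<Sum>k. c (int_decode k) * exp (\<mu> (int_decode k) * w)) has_field_derivative
           (\<Sum>k. c (int_decode k) * \<mu> (int_decode k) * exp (\<mu> (int_decode k) * z))) (at z)"
  proof (rule has_field_derivative_series'(2)[where S = "ball z (\<delta>/2)" and ?x0.0 = z])
    show "uniformly_convergent_on (ball z (\<delta>/2)) (\<lambda>n x. \<Sum>i<n. c (int_decode i) * \<mu> (int_decode i) * exp (\<mu> (int_decode i) * x))"
      by (rule Weierstrass_m_test'[OF b1 summable_mult[OF Mn]])
    show "summable (\<lambda>k. c (int_decode k) * exp (\<mu> (int_decode k) * z))"
      using int_abs_summable_sums(2)[OF s0[OF z]] by (rule sums_summable)
    show "z \<in> interior (ball z (\<delta>/2))" using z by (simp add: interior_open)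
  qed (use assms(1) in \<open>auto intro!: derivative_eq_intros\<close>)
  also have "(\<Sum>k. c (int_decode k) * \<mu> (int_decode k) * exp (\<mu> (int_decode k) * z)) = (\<Sum>\<^sub>\<infinity>n. c n * \<mu> n * exp (\<mu> n * z))"
    using int_abs_summable_sums(2)[OF s1[OF z]] by (simp add: sums_iff)
  finally show "((\<lambda>z. \<Sum>\<^sub>\<infinity>n. c n * exp (\<mu> n * z)) has_field_derivative
           (\<Sum>\<^sub>\<infinity>n. c n * \<mu> n * exp (\<mu> n * z))) (at z)"
  proof (rule has_field_derivative_transform_within_open[OF _ open_ball z])
    fix w assume "w \<in> ball z (\<delta>/2)"
    then show "(\<Sum>k. c (int_decode k) * exp (\<mu> (int_decode k) * w)) = (\<Sum>\<^sub>\<infinity>n. c n * exp (\<mu> n * w))"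
      using int_abs_summable_sums(2)[OF s0] by (simp add: sums_iff)
  qed
qed

lemma set_integral_series:
  fixes f :: "nat \<Rightarrow> real \<Rightarrow> complex"
  assumes "\<And>k. set_integrable M A (f k)"
    and "\<And>x. x \<in> A \<Longrightarrow> summable (\<lambda>k. norm (f k x))"
    and "summable (\<lambda>k. LINT x:A|M. norm (f k x))"
  shows "set_integrable M A (\<lambda>x. \<Sum>k. f k x)"
    and "(\<lambda>k. LINT x:A|M. f k x) sums (LINT x:A|M. \<Sum>k. f k x)"
proof -
  have i: "integrable M (\<lambda>x. indicator A x *\<^sub>R f k x)" for k
    using assms(1)[of k] by (simp add: set_integrable_def)
  have s: "AE x in M. summable (\<lambda>k. norm (indicator A x *\<^sub>R f k x))"
    by (rule AE_I2) (auto simp: indicator_def assms(2))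
  have n: "summable (\<lambda>k. LINT x|M. norm (indicator A x *\<^sub>R f k x))"
    using assms(3) by (simp add: set_lebesgue_integral_def)
  have eq: "(\<lambda>x. \<Sum>k. indicator A x *\<^sub>R f k x) = (\<lambda>x. indicator A x *\<^sub>R (\<Sum>k. f k x))"
    by (auto simp: indicator_def)
  show "set_integrable M A (\<lambda>x. \<Sum>k. f k x)"
    using integrable_suminf[OF i s n] by (simp add: set_integrable_def eq)
  show "(\<lambda>k. LINT x:A|M. f k x) sums (LINT x:A|M. \<Sum>k. f k x)"
    using sums_integral[OF i s n] by (simp add: set_lebesgue_integral_def eq)
qed

section \<open>Fourier coefficients of Gaussians\<close>

lemma unit_exp_int [simp]: "unit_exp (of_int n) = 1"
  using exp_integer_2pi[of "of_int n"] by (simp add: unit_exp_def mult_ac)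

lemma unit_exp_add: "unit_exp (a + b) = unit_exp a * unit_exp b"
  by (simp add: unit_exp_def ring_distribs exp_add)

lemma norm_unit_exp_of_real [simp]: "norm (unit_exp (of_real x)) = 1"
  by (simp add: unit_exp_def)

lemma cos_eq_unit_exp: "cos (2 * pi * x) = Re (unit_exp x)"
  "of_real (cos (2 * pi * x)) = (unit_exp (of_real x) + unit_exp (- of_real x)) / 2"
  by (auto simp: unit_exp_def Re_exp cos_exp_eq mult_ac simp flip: cos_of_real)

lemma periodic_of_int:
  fixes D :: "real \<Rightarrow> 'a"
  assumes "\<And>x. D (x + 1) = D x"
  shows "D (x + of_int n) = D x"
proof (induction n rule: int_induct[where k = 0])
  case (step1 i) then show ?case using assms[of "x + of_int i"] by (simp add: add.assoc)
next
  case (step2 i) then show ?case using assms[of "x + of_int i - 1"] by (simp add: algebra_simps)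
qed simp

text \<open>On a period an even function is a continuous function of \<open>cos (2 * pi * x)\<close>, hence a uniform limit of
  polynomials in it. These are trigonometric polynomials, to which \<open>D\<close> is orthogonal. So \<open>D\<close> is orthogonal to its
  own real part, and the integral of \<open>Re (D x) ^ 2\<close> vanishes.\<close>
lemma even_periodic_zero_coeffs_Re:
  fixes D :: "real \<Rightarrow> complex"
  assumes cont: "continuous_on UNIV D" and even: "\<And>x. D (- x) = D x" and per: "\<And>x. D (x + 1) = D x"
    and coeff: "\<And>l::int. integral {0..1} (\<lambda>x. D x * unit_exp (of_int l * of_real x)) = 0"
  shows "Re (D x) = 0"
proof -
  have [continuous_intros]: "continuous_on S D" for S using cont continuous_on_subset by blast
  have ue [continuous_intros]: "continuous_on S (\<lambda>x. unit_exp (f x))" if "continuous_on S f" for S and f :: "real \<Rightarrow> complex"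
    unfolding unit_exp_def by (intro continuous_intros that)
  have cosk: "integral {0..1} (\<lambda>x. D x * of_real (cos (2 * pi * x) ^ k) * unit_exp (of_int l * of_real x)) = 0" for k and l :: int
  proof (induction k arbitrary: l)
    case 0 then show ?case using coeff by simp
  next
    case (Suc k)
    have "D x * of_real (cos (2 * pi * x) ^ Suc k) * unit_exp (of_int l * of_real x) =
        (D x * of_real (cos (2 * pi * x) ^ k) * unit_exp (of_int (l + 1) * of_real x) +
         D x * of_real (cos (2 * pi * x) ^ k) * unit_exp (of_int (l - 1) * of_real x)) / 2" for x
    proof -
      have "unit_exp (of_int (l + 1) * of_real x) = unit_exp (of_int l * of_real x) * unit_exp (of_real x)"
        "unit_exp (of_int (l - 1) * of_real x) = unit_exp (of_int l * of_real x) * unit_exp (- of_real x)"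
        by (simp_all only: flip: unit_exp_add) (simp_all add: algebra_simps)
      then show ?thesis unfolding power_Suc of_real_mult cos_eq_unit_exp(2) by (simp add: field_simps)
    qed
    then have "integral {0..1} (\<lambda>x. D x * of_real (cos (2 * pi * x) ^ Suc k) * unit_exp (of_int l * of_real x)) =
       integral {0..1} (\<lambda>x. (D x * of_real (cos (2 * pi * x) ^ k) * unit_exp (of_int (l + 1) * of_real x) +
         D x * of_real (cos (2 * pi * x) ^ k) * unit_exp (of_int (l - 1) * of_real x)) / 2)"
      by presburger
    also have "\<dots> = (integral {0..1} (\<lambda>x. D x * of_real (cos (2 * pi * x) ^ k) * unit_exp (of_int (l + 1) * of_real x)) +
         integral {0..1} (\<lambda>x. D x * of_real (cos (2 * pi * x) ^ k) * unit_exp (of_int (l - 1) * of_real x))) / 2"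
      by (subst integral_divide, subst Henstock_Kurzweil_Integration.integral_add)
        (auto intro!: integrable_continuous_real continuous_intros)
    also have "\<dots> = 0" unfolding Suc.IH by simp
    finally show ?case .
  qed
  \<comment> \<open>The real part of \<open>D\<close> as a function of the cosine.\<close>
  define \<phi> where "\<phi> y = Re (D (arccos y / (2 * pi)))" for y
  have \<phi>: "\<phi> (cos (2 * pi * x)) = Re (D x)" if "x \<in> {0..1}" for x
  proof (cases "x \<le> 1/2")
    case True
    then have "arccos (cos (2 * pi * x)) = 2 * pi * x" using that by (intro arccos_cos) auto
    then show ?thesis by (simp add: \<phi>_def)
  next
    case False
    have "cos (2 * pi * x) = cos (2 * pi * (1 - x))"
      using cos_2pi_minus[of "2 * pi * x"] by (simp add: algebra_simps)
    moreover have "arccos (cos (2 * pi * (1 - x))) = 2 * pi * (1 - x)"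
      using that False by (intro arccos_cos) (auto simp: mult_le_cancel_left1)
    moreover have "D (1 - x) = D x" using even[of x] per[of "- x"] by (simp add: add.commute)
    ultimately show ?thesis by (simp add: \<phi>_def)
  qed
  have cont_\<phi>: "continuous_on {-1..1} \<phi>"
    unfolding \<phi>_def by (intro continuous_intros continuous_on_compose2[of UNIV D] cont) auto
  have "compact (D ` {0..1})" by (intro compact_continuous_image continuous_intros) auto
  then obtain B where B: "\<And>x. x \<in> {0..1} \<Longrightarrow> norm (D x) \<le> B" and "B > 0"
    using compact_imp_bounded bounded_pos by (metis imageI)
  let ?I = "integral {0..1} (\<lambda>x. D x * of_real (Re (D x)))"
  have small: "norm ?I \<le> B * e" if "e > 0" for e
  proof -
    obtain g where g: "real_polynomial_function g" "\<And>y. y \<in> {-1..1} \<Longrightarrow> \<bar>\<phi> y - g y\<bar> < e"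
      using Stone_Weierstrass_real_polynomial_function[OF compact_Icc cont_\<phi> \<open>e > 0\<close>] by blast
    obtain a n where gs: "g = (\<lambda>y. \<Sum>i\<le>n. a i * y ^ i)" using g(1) real_polynomial_function_iff_sum by auto
    have contg: "continuous_on S (\<lambda>x. g (cos (2 * pi * x)))" for S
      unfolding gs by (intro continuous_intros)
    have "integral {0..1} (\<lambda>x. D x * of_real (g (cos (2 * pi * x)))) =
        integral {0..1} (\<lambda>x. \<Sum>i\<le>n. of_real (a i) * (D x * of_real (cos (2 * pi * x) ^ i) * unit_exp (of_int 0 * of_real x)))"
      by (intro integral_cong) (simp add: gs sum_distrib_left mult_ac unit_exp_def)
    also have "\<dots> = (\<Sum>i\<le>n. of_real (a i) * integral {0..1} (\<lambda>x. D x * of_real (cos (2 * pi * x) ^ i) * unit_exp (of_int 0 * of_real x)))"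
      by (subst integral_sum) (auto intro!: integrable_continuous_real continuous_intros simp del: of_int_0)
    also have "\<dots> = 0" unfolding cosk by simp
    finally have 0: "integral {0..1} (\<lambda>x. D x * of_real (g (cos (2 * pi * x)))) = 0" .
    have "?I = integral {0..1} (\<lambda>x. D x * of_real (Re (D x) - g (cos (2 * pi * x))))"
      unfolding of_real_diff right_diff_distrib
      by (subst Henstock_Kurzweil_Integration.integral_diff) (auto intro!: integrable_continuous_real continuous_intros contg simp: 0)
    also have "norm \<dots> \<le> B * e * (1 - 0)"
    proof (rule integral_bound)
      show "continuous_on {0..1} (\<lambda>x. D x * of_real (Re (D x) - g (cos (2 * pi * x))))"
        by (intro continuous_intros contg)
      fix x :: real assume x: "x \<in> {0..1}"
      have "\<bar>Re (D x) - g (cos (2 * pi * x))\<bar> \<le> e"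
        using g(2)[of "cos (2 * pi * x)"] \<phi>[OF x] by simp
      then show "norm (D x * of_real (Re (D x) - g (cos (2 * pi * x)))) \<le> B * e"
        unfolding norm_mult norm_of_real using B[OF x] \<open>B > 0\<close> by (intro mult_mono) auto
    qed simp
    finally show ?thesis by simp
  qed
  have "norm ?I \<le> 0"
  proof (rule field_le_epsilon)
    fix e :: real assume "e > 0"
    then show "norm ?I \<le> 0 + e" using small[of "e / B"] \<open>B > 0\<close> by simp
  qed
  then have "?I = 0" by simp
  then have "integral {0..1} (\<lambda>x. Re (D x) ^ 2) = 0"
  proof -
    have "(\<lambda>x. D x * of_real (Re (D x))) integrable_on {0..1}"
      by (intro integrable_continuous_real continuous_intros)
    from integral_linear[OF this bounded_linear_Re] show ?thesis
      using \<open>?I = 0\<close> by (simp add: o_def power2_eq_square)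
  qed
  then have "\<forall>x\<in>{0..1}. Re (D x) ^ 2 = 0"
    by (subst (asm) integral_eq_0_iff) (auto intro!: continuous_intros)
  then have "Re (D (frac x)) = 0" using frac_lt_1[of x] by (simp add: frac_ge_0 less_imp_le)
  moreover have "D x = D (frac x)"
    using periodic_of_int[of D "frac x" "\<lfloor>x\<rfloor>"] per by (simp add: frac_def)
  ultimately show ?thesis by simp
qed

lemma even_periodic_zero_coeffs:
  fixes D :: "real \<Rightarrow> complex"
  assumes "continuous_on UNIV D" and "\<And>x. D (- x) = D x" and "\<And>x. D (x + 1) = D x"
    and "\<And>l::int. integral {0..1} (\<lambda>x. D x * unit_exp (of_int l * of_real x)) = 0"
  shows "D x = 0"
proof -
  have "Re (D x) = 0" by (rule even_periodic_zero_coeffs_Re[of D]) (use assms in auto)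
  moreover have "Re (\<i> * D x) = 0"
  proof (rule even_periodic_zero_coeffs_Re[of "\<lambda>x. \<i> * D x"])
    fix l :: int
    show "integral {0..1} (\<lambda>x. \<i> * D x * unit_exp (of_int l * of_real x)) = 0"
      using assms(4)[of l] by (simp add: mult.assoc)
  qed (use assms in \<open>auto intro!: continuous_intros\<close>)
  ultimately show ?thesis by (simp add: complex_eq_iff)
qed

text \<open>The characteristic function of the standard normal distribution, rescaled.\<close>
lemma gaussian_fourier_transform:
  fixes A l :: real
  assumes "A > 0"
  shows "(LINT x|lborel. of_real (exp (- pi * A * x^2)) * unit_exp (of_real (l * x))) = of_real (1 / sqrt A * exp (- pi * l^2 / A))"
    and "integrable lborel (\<lambda>x. complex_of_real (exp (- pi * A * x^2)) * unit_exp (of_real (l * x)))"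
proof -
  define c where "c = sqrt (2 * pi * A)"
  have c: "c > 0" "c^2 = 2 * pi * A" using assms by (auto simp: c_def)
  define t where "t = 2 * pi * l / c"
  have "exp (- (t^2) / 2) = exp (- pi * l^2 / A)"
    using assms unfolding t_def power_divide c(2) power_mult_distrib by (simp add: power2_eq_square)
  then have "of_real (exp (- pi * l^2 / A)) = char std_normal_distribution t"
    by (simp add: char_std_normal_distribution)
  also have "\<dots> = (LINT x|lborel. std_normal_density x *\<^sub>R iexp (t * x))"
    unfolding char_def by (subst integral_density) (auto simp: normal_density_nonneg)
  also have "\<dots> = \<bar>c\<bar> *\<^sub>R (LINT x|lborel. std_normal_density (0 + c * x) *\<^sub>R iexp (t * (0 + c * x)))"
    using c by (intro lborel_integral_real_affine) auto
  also have "(\<lambda>x. std_normal_density (0 + c * x) *\<^sub>R iexp (t * (0 + c * x))) =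
     (\<lambda>x. of_real (1 / sqrt (2 * pi)) * (of_real (exp (- pi * A * x^2)) * unit_exp (of_real (l * x))))"
    using c by (auto simp: fun_eq_iff std_normal_density_def power_mult_distrib t_def unit_exp_def scaleR_conv_of_real field_simps)
  also have "(LINT x|lborel. of_real (1 / sqrt (2 * pi)) * (of_real (exp (- pi * A * x^2)) * unit_exp (of_real (l * x)))) =
      of_real (1 / sqrt (2 * pi)) * (LINT x|lborel. complex_of_real (exp (- pi * A * x^2)) * unit_exp (of_real (l * x)))"
    by (rule integral_mult_right_zero)
  finally have "of_real (exp (- pi * l^2 / A)) = of_real (c / sqrt (2 * pi)) * (LINT x|lborel. complex_of_real (exp (- pi * A * x^2)) * unit_exp (of_real (l * x)))"
    using c by (simp add: scaleR_conv_of_real)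
  moreover have "c / sqrt (2 * pi) = sqrt A" using assms by (simp add: c_def real_sqrt_mult)
  ultimately show "(LINT x|lborel. of_real (exp (- pi * A * x^2)) * unit_exp (of_real (l * x))) = of_real (1 / sqrt A * exp (- pi * l^2 / A))"
    using assms by (simp add: field_simps)
  have "integrable lborel (\<lambda>x. sqrt (2 * pi * (1 / c)^2) * normal_density 0 (1 / c) x)"
    using c by (intro integrable_mult_right integrable_normal_density) auto
  also have "(\<lambda>x. sqrt (2 * pi * (1 / c)^2) * normal_density 0 (1 / c) x) = (\<lambda>x. exp (- pi * A * x^2))"
    using c by (auto simp: normal_density_def fun_eq_iff power_divide)
  finally have "integrable lborel (\<lambda>x. exp (- pi * A * x^2))" .
  then show "integrable lborel (\<lambda>x. complex_of_real (exp (- pi * A * x^2)) * unit_exp (of_real (l * x)))"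
    by (rule Bochner_Integration.integrable_bound) (auto simp: norm_mult unit_exp_def)
qed

lemma gauss_lin_zsummable:
  assumes "Re a < 0"
  shows "zsummable (\<lambda>n. exp (a * of_int n ^ 2 + b * of_int n))"
proof (rule gauss_dominated_summable[where \<epsilon> = "- Re a" and B = "norm b" and C = 1])
  fix n :: int
  have "Re (b * of_int n) \<le> norm b * \<bar>real_of_int n\<bar>"
    by (metis complex_Re_le_cmod norm_mult norm_of_int of_int_abs)
  moreover have "Re (a * of_int n ^ 2) = Re a * real_of_int n ^ 2"
    by (simp add: power2_eq_square)
  ultimately show "norm (exp (a * of_int n ^ 2 + b * of_int n)) \<le> 1 * exp (norm b * \<bar>real_of_int n\<bar> - - Re a * real_of_int n ^ 2)"
    unfolding norm_exp_eq_Re plus_complex.sel by simp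
qed (use assms in simp)

lemma gauss_shift_zsummable:
  fixes A z :: complex
  assumes "Re A > 0"
  shows "zsummable (\<lambda>n. exp (- of_real pi * A * (of_int n + z) ^ 2))"
proof -
  have "zsummable (\<lambda>n. exp (- of_real pi * A * z ^ 2) * exp ((- of_real pi * A) * of_int n ^ 2 + (- 2 * of_real pi * A * z) * of_int n))"
    unfolding norm_mult
    by (intro summable_on_cmult_right gauss_lin_zsummable) (use assms in simp)
  also have "(\<lambda>n. exp (- of_real pi * A * z ^ 2) * exp ((- of_real pi * A) * of_int n ^ 2 + (- 2 * of_real pi * A * z) * of_int n)) =
      (\<lambda>n. exp (- of_real pi * A * (of_int n + z) ^ 2))"
    unfolding mult_exp_exp by (simp add: fun_eq_iff power2_eq_square algebra_simps)
  finally show ?thesis .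
qed

lemma unit_exp_has_integral:
  "((\<lambda>b. unit_exp (of_int j * of_real b)) has_integral (if j = 0 then 1 else 0)) {0..1}"
proof (cases "j = 0")
  case True then show ?thesis using has_integral_const_real[of "1::complex" 0 1] by (simp add: unit_exp_def)
next
  case False
  let ?F = "\<lambda>z. unit_exp (of_int j * z) / (2 * of_real pi * \<i> * of_int j)"
  have "((\<lambda>b. unit_exp (of_int j * of_real b)) has_integral (?F (of_real 1) - ?F (of_real 0))) {0..1}"
  proof (rule fundamental_theorem_of_calculus)
    fix x :: real
    have "(?F has_field_derivative unit_exp (of_int j * of_real x)) (at (of_real x))"
      unfolding unit_exp_def using False by (auto intro!: derivative_eq_intros simp: field_simps)
    then show "((\<lambda>x. ?F (of_real x)) has_vector_derivative unit_exp (of_int j * of_real x)) (at x within {0..1})"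
      by (rule has_vector_derivative_real_field)
  qed simp
  moreover have "unit_exp 0 = 1" "unit_exp (of_int j) = 1" by (simp_all add: unit_exp_def[of 0])
  ultimately show ?thesis using False by simp
qed

lemma lborel_integral_unit_interval:
  fixes f :: "real \<Rightarrow> complex"
  assumes "set_integrable lborel {0..<1} f"
  shows "(LINT x:{0..<1}|lborel. f x) = integral {0..1} f"
proof -
  have "(LINT x:{0..<1}|lborel. f x) = integral {0..<1} f"
    by (rule set_borel_integral_eq_integral(2)[OF assms])
  also have "\<dots> = integral {0..1} f"
  proof (rule integral_spike_set)
    show "negligible {x \<in> {0..<1} - {0..1}. f x \<noteq> 0}" by (rule negligible_subset[of "{}"]) auto
    show "negligible {x \<in> {0..1} - {0..<1}. f x \<noteq> 0}" by (rule negligible_subset[of "{1}"]) auto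
  qed
  finally show ?thesis .
qed

lemma continuous_unit_integrable:
  fixes f :: "real \<Rightarrow> complex"
  assumes "continuous_on {0..1} f"
  shows "set_integrable lborel {0..<1} f"
  by (rule set_integrable_subset[OF borel_integrable_atLeastAtMost'[OF assms]]) auto

text \<open>The Lebesgue integrals run over a half-open period because its integer translates tile the line; the
  dominating family \<open>K\<close> allows to integrate termwise.\<close>
lemma period_integral_series:
  fixes f :: "int \<Rightarrow> real \<Rightarrow> complex"
  assumes "\<And>n. continuous_on {0..1} (f n)"
    and bound: "\<And>n b. b \<in> {0..1} \<Longrightarrow> norm (f n b) \<le> K n" and K: "K summable_on UNIV"
  shows "(\<lambda>k. LINT b:{0..<1}|lborel. f (int_decode k) b) sums integral {0..1} (\<lambda>b. \<Sum>\<^sub>\<infinity>n. f n b)"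
proof -
  have K': "summable (\<lambda>k. K (int_decode k))"
    using K summable_on_reindex_bij_betw[OF bij_int_decode, of K] summable_on_imp_summable by simp
  have int: "set_integrable lborel {0..<1} (f n)" for n by (rule continuous_unit_integrable[OF assms(1)])
  have le: "(LINT b:{0..<1}|lborel. norm (f n b)) \<le> K n" for n
  proof -
    have "(LINT b:{0..<1}|lborel. norm (f n b)) \<le> (LINT b:{0..<1::real}|lborel. K n)"
      using bound by (intro set_integral_mono set_integrable_norm int) (auto simp: set_integrable_def)
    also have "\<dots> = K n" by (simp add: set_lebesgue_integral_def)
    finally show ?thesis .
  qed
  have zs: "zsummable (\<lambda>n. f n b)" if "b \<in> {0..1}" for b
    by (rule summable_on_comparison_test[OF K bound[OF that]]) auto
  have s2: "summable (\<lambda>k. norm (f (int_decode k) b))" if "b \<in> {0..<1}" for b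
    using int_abs_summable_sums(1)[OF zs] that by auto
  have s3: "summable (\<lambda>k. LINT b:{0..<1}|lborel. norm (f (int_decode k) b))"
  proof (rule summable_comparison_test'[where N = 0, OF K'])
    fix k
    have "0 \<le> (LINT b:{0..<1}|lborel. norm (f (int_decode k) b))"
      unfolding set_lebesgue_integral_def by (intro Bochner_Integration.integral_nonneg) (auto simp: indicator_def)
    then show "norm (LINT b:{0..<1}|lborel. norm (f (int_decode k) b)) \<le> K (int_decode k)"
      using le[of "int_decode k"] by simp
  qed
  note r = set_integral_series[where f = "\<lambda>k. f (int_decode k)", OF int s2 s3]
  have "(LINT b:{0..<1}|lborel. \<Sum>k. f (int_decode k) b) = integral {0..1} (\<lambda>b. \<Sum>k. f (int_decode k) b)"
    by (rule lborel_integral_unit_interval[OF r(1)])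
  also have "\<dots> = integral {0..1} (\<lambda>b. \<Sum>\<^sub>\<infinity>n. f n b)"
    using int_abs_summable_sums(2)[OF zs] by (intro integral_cong) (simp add: sums_iff)
  finally show ?thesis using r(2) by simp
qed

text \<open>The translates of the period by integers tile the line, so that the coefficient of the periodized Gaussian
  is a value of the Fourier transform of the Gaussian itself.\<close>
lemma periodized_gaussian_coeff:
  fixes A :: real and l :: int
  assumes "A > 0"
  shows "integral {0..1} (\<lambda>b. (\<Sum>\<^sub>\<infinity>n. of_real (exp (- pi * A * (of_int n + b)^2))) * unit_exp (of_int l * of_real b))
      = of_real (1 / sqrt A * exp (- pi * of_int l ^ 2 / A))"
proof -
  define g where "g x = complex_of_real (exp (- pi * A * x^2)) * unit_exp (of_real (of_int l * x))" for x
  have g_int: "integrable lborel g" and g_val: "(LINT x|lborel. g x) = of_real (1 / sqrt A * exp (- pi * of_int l ^ 2 / A))"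
    using gaussian_fourier_transform[OF assms, of "of_int l"] unfolding g_def by blast+
  have cont: "continuous_on S g" for S unfolding g_def unit_exp_def by (intro continuous_intros)
  have gs: "of_real (exp (- pi * A * (of_int n + b)^2)) * unit_exp (of_int l * of_real b) = g (of_int n + b)" for n :: int and b
  proof -
    have "of_real (of_int l * (of_int n + b)) = complex_of_int (l * n) + of_int l * of_real b"
      by (simp add: algebra_simps)
    then show ?thesis unfolding g_def by (simp only: unit_exp_add unit_exp_int mult_1)
  qed
  have "(\<lambda>k. LINT b:{0..<1}|lborel. g (of_int (int_decode k) + b)) sums integral {0..1} (\<lambda>b. \<Sum>\<^sub>\<infinity>n. g (of_int n + b))"
  proof (rule period_integral_series[where f = "\<lambda>n b. g (of_int n + b)" and K = "\<lambda>n. exp (2 * pi * A * \<bar>of_int n\<bar> - pi * A * of_int n ^ 2)"])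
    show "continuous_on {0..1} (\<lambda>b. g (of_int n + b))" for n
      by (rule continuous_on_compose2[OF cont[of UNIV]]) (auto intro!: continuous_intros)
    show "norm (g (of_int n + b)) \<le> exp (2 * pi * A * \<bar>of_int n\<bar> - pi * A * of_int n ^ 2)" if "b \<in> {0..1}" for n b
    proof -
      have "\<bar>b * of_int n\<bar> \<le> 1 * \<bar>of_int n\<bar>" unfolding abs_mult using that by (intro mult_right_mono) auto
      then have "- \<bar>of_int n\<bar> \<le> b * of_int n" by (simp add: abs_le_iff)
      moreover have "(of_int n + b) ^ 2 = of_int n ^ 2 + b ^ 2 + 2 * (b * of_int n)"
        by (simp add: power2_sum)
      ultimately have "of_int n ^ 2 - 2 * \<bar>of_int n\<bar> \<le> (of_int n + b) ^ 2"
        using zero_le_power2[of b] by linarith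
      then have "pi * A * (of_int n ^ 2 - 2 * \<bar>of_int n\<bar>) \<le> pi * A * (of_int n + b) ^ 2"
        using assms by (intro mult_left_mono) auto
      then show ?thesis unfolding g_def norm_mult norm_unit_exp_of_real by (simp add: algebra_simps)
    qed
    show "(\<lambda>n::int. exp (2 * pi * A * \<bar>of_int n\<bar> - pi * A * of_int n ^ 2)) summable_on UNIV"
      using gauss_dominated_summable[of "pi * A" "\<lambda>n. of_real (exp (2 * pi * A * \<bar>of_int n\<bar> - pi * A * of_int n ^ 2))" 1 "2 * pi * A"] assms
      by simp
  qed
  also have "(\<lambda>b. \<Sum>\<^sub>\<infinity>n. g (of_int n + b)) = (\<lambda>b. (\<Sum>\<^sub>\<infinity>n. of_real (exp (- pi * A * (of_int n + b)^2))) * unit_exp (of_int l * of_real b))"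
    by (simp only: infsum_cmult_left' flip: gs)
  also have "(\<lambda>k. LINT b:{0..<1}|lborel. g (of_int (int_decode k) + b)) = (\<lambda>k. LINT x:{of_int (int_decode k)..<of_int (int_decode k) + 1}|lborel. g x)"
  proof
    fix k
    show "(LINT b:{0..<1}|lborel. g (of_int (int_decode k) + b)) = (LINT x:{of_int (int_decode k)..<of_int (int_decode k) + 1}|lborel. g x)"
      unfolding set_lebesgue_integral_def
      by (subst (2) lborel_integral_real_affine[of 1 _ "of_int (int_decode k)"])
        (auto intro!: Bochner_Integration.integral_cong simp: indicator_def)
  qed
  finally have sums: "(\<lambda>k. LINT x:{of_int (int_decode k)..<of_int (int_decode k) + 1}|lborel. g x) sums
      integral {0..1} (\<lambda>b. (\<Sum>\<^sub>\<infinity>n. of_real (exp (- pi * A * (of_int n + b)^2))) * unit_exp (of_int l * of_real b))" .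
  have un: "(\<Union>k. {real_of_int (int_decode k)..<of_int (int_decode k) + 1}) = UNIV"
  proof -
    have "\<exists>k. x \<in> {real_of_int (int_decode k)..<of_int (int_decode k) + 1}" for x
      by (rule exI[of _ "int_encode \<lfloor>x\<rfloor>"]) auto
    then show ?thesis by blast
  qed
  have "(LINT x:(\<Union>k. {real_of_int (int_decode k)..<of_int (int_decode k) + 1})|lborel. g x) =
      (\<Sum>k. LINT x:{of_int (int_decode k)..<of_int (int_decode k) + 1}|lborel. g x)"
  proof (rule lebesgue_integral_countable_add)
    fix i j :: nat assume "i \<noteq> j"
    then have "int_decode i \<noteq> int_decode j" by (simp add: int_decode_eq)
    then show "{real_of_int (int_decode i)..<of_int (int_decode i) + 1} \<inter> {of_int (int_decode j)..<of_int (int_decode j) + 1} = {}"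
      by (cases "int_decode i < int_decode j") (fastforce simp: less_le_not_le)+
  qed (use g_int in \<open>auto simp: un set_integrable_def\<close>)
  then have "(\<Sum>k. LINT x:{of_int (int_decode k)..<of_int (int_decode k) + 1}|lborel. g x) = (LINT x|lborel. g x)"
    unfolding un by (simp add: set_lebesgue_integral_def)
  then show ?thesis using sums g_val by (simp add: sums_iff)
qed

text \<open>Orthogonality of the characters of the circle leaves the term with index \<open>- l\<close>.\<close>
lemma dual_gaussian_coeff:
  fixes A :: real and l :: int
  assumes "A > 0"
  shows "integral {0..1} (\<lambda>b. (\<Sum>\<^sub>\<infinity>n. of_real (exp (- pi * of_int n ^ 2 / A)) * unit_exp (of_int n * of_real b)) * unit_exp (of_int l * of_real b))
      = of_real (exp (- pi * of_int l ^ 2 / A))"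
proof -
  let ?f = "\<lambda>n b. complex_of_real (exp (- pi * of_int n ^ 2 / A)) * unit_exp (of_int (n + l) * of_real b)"
  have cont: "continuous_on {0..1} (?f n)" for n unfolding unit_exp_def by (intro continuous_intros)
  have "(\<lambda>k. LINT b:{0..<1}|lborel. ?f (int_decode k) b) sums integral {0..1} (\<lambda>b. \<Sum>\<^sub>\<infinity>n. ?f n b)"
  proof (rule period_integral_series[where K = "\<lambda>n. exp (- pi * of_int n ^ 2 / A)", OF cont])
    show "norm (?f n b) \<le> exp (- pi * of_int n ^ 2 / A)" for n b
      using norm_unit_exp_of_real[of "of_int (n + l) * b"] by (simp add: norm_mult)
    show "(\<lambda>n::int. exp (- pi * of_int n ^ 2 / A)) summable_on UNIV"
      using gauss_dominated_summable[of "pi / A" "\<lambda>n. of_real (exp (- pi * of_int n ^ 2 / A))" 1 0] assms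
      by simp
  qed
  moreover have "(LINT b:{0..<1}|lborel. ?f n b) = (if n = - l then of_real (exp (- pi * of_int l ^ 2 / A)) else 0)" for n
  proof -
    have "(LINT b:{0..<1}|lborel. ?f n b) = integral {0..1} (?f n)"
      by (rule lborel_integral_unit_interval[OF continuous_unit_integrable[OF cont]])
    also have "\<dots> = of_real (exp (- pi * of_int n ^ 2 / A)) * (if n + l = 0 then 1 else 0)"
      by (rule integral_unique[OF has_integral_mult_right[OF unit_exp_has_integral]])
    finally show ?thesis by (auto simp: add_eq_0_iff2)
  qed
  ultimately have "(\<lambda>k. if int_decode k = - l then of_real (exp (- pi * of_int l ^ 2 / A)) else 0) sums integral {0..1} (\<lambda>b. \<Sum>\<^sub>\<infinity>n. ?f n b)"
    by simp
  moreover have "(\<lambda>k. if int_decode k = - l then of_real (exp (- pi * of_int l ^ 2 / A)) else (0::complex)) =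
      (\<lambda>k. if k = int_encode (- l) then of_real (exp (- pi * of_int l ^ 2 / A)) else 0)"
    by (metis int_decode_inverse int_encode_inverse)
  ultimately have "(\<lambda>k. if k = int_encode (- l) then of_real (exp (- pi * of_int l ^ 2 / A)) else 0) sums integral {0..1} (\<lambda>b. \<Sum>\<^sub>\<infinity>n. ?f n b)"
    by (simp only:)
  then have "integral {0..1} (\<lambda>b. \<Sum>\<^sub>\<infinity>n. ?f n b) = of_real (exp (- pi * of_int l ^ 2 / A))"
    using sums_single[of "int_encode (- l)" "\<lambda>_. complex_of_real (exp (- pi * of_int l ^ 2 / A))"]
    by (rule sums_unique2)
  moreover have "(\<lambda>b::real. \<Sum>\<^sub>\<infinity>n. ?f n b) = (\<lambda>b. (\<Sum>\<^sub>\<infinity>n. of_real (exp (- pi * of_int n ^ 2 / A)) * unit_exp (of_int n * of_real b)) * unit_exp (of_int l * of_real b))"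
    by (simp only: of_int_add unit_exp_add distrib_right mult.assoc infsum_cmult_left'[symmetric])
  ultimately show ?thesis by simp
qed

section \<open>Poisson summation for Gaussians\<close>

definition shifted_gaussian_sum :: "complex \<Rightarrow> complex \<Rightarrow> complex"
  where "shifted_gaussian_sum A z = (\<Sum>\<^sub>\<infinity>n::int. exp (- of_real pi * A * (of_int n + z) ^ 2))"

definition dual_gaussian_sum :: "complex \<Rightarrow> complex \<Rightarrow> complex"
  where "dual_gaussian_sum A z = (\<Sum>\<^sub>\<infinity>n::int. exp (- of_real pi * of_int n ^ 2 / A) * unit_exp (of_int n * z))"

lemma exp_zsum_has_derivative:
  fixes a b :: complex
  assumes "Re a < 0"
  shows "((\<lambda>z. \<Sum>\<^sub>\<infinity>n. exp (a * of_int n ^ 2) * exp ((b * of_int n) * z)) has_field_derivative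
           (\<Sum>\<^sub>\<infinity>n. exp (a * of_int n ^ 2) * (b * of_int n) * exp ((b * of_int n) * z))) (at z)"
    and "zsummable (\<lambda>n. exp (a * of_int n ^ 2) * exp ((b * of_int n) * z))"
    and "zsummable (\<lambda>n. exp (a * of_int n ^ 2) * (b * of_int n) * exp ((b * of_int n) * z))"
proof -
  have "zsummable (\<lambda>n. of_real (norm (exp (a * of_int n ^ 2)) * exp (Re (b * of_int n * z) + 1 * norm (b * of_int n))))"
  proof (rule gauss_dominated_summable[where \<epsilon> = "- Re a" and B = "norm (b * z) + norm b" and C = 1])
    fix n :: int
    have "Re (b * of_int n * z) \<le> norm (b * z) * \<bar>of_int n\<bar>"
      using complex_Re_le_cmod[of "b * of_int n * z"] by (simp add: norm_mult mult_ac)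
    moreover have "Re (a * of_int n ^ 2) = Re a * real_of_int n ^ 2" by (simp add: power2_eq_square)
    ultimately show "norm (complex_of_real (norm (exp (a * of_int n ^ 2)) * exp (Re (b * of_int n * z) + 1 * norm (b * of_int n))))
        \<le> 1 * exp ((norm (b * z) + norm b) * \<bar>of_int n\<bar> - - Re a * of_int n ^ 2)"
      unfolding norm_of_real norm_exp_eq_Re mult_exp_exp by (simp add: norm_mult algebra_simps)
  qed (use assms in simp)
  then have "(\<lambda>n. norm (exp (a * of_int n ^ 2)) * exp (Re (b * of_int n * z) + 1 * norm (b * of_int n))) summable_on UNIV"
    by (simp only: norm_of_real abs_mult abs_norm_cancel abs_exp_cancel)
  note * = exp_sum_has_derivative[OF zero_less_one this]
  show "((\<lambda>z. \<Sum>\<^sub>\<infinity>n. exp (a * of_int n ^ 2) * exp ((b * of_int n) * z)) has_field_derivative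
           (\<Sum>\<^sub>\<infinity>n. exp (a * of_int n ^ 2) * (b * of_int n) * exp ((b * of_int n) * z))) (at z)"
    "zsummable (\<lambda>n. exp (a * of_int n ^ 2) * exp ((b * of_int n) * z))"
    "zsummable (\<lambda>n. exp (a * of_int n ^ 2) * (b * of_int n) * exp ((b * of_int n) * z))"
    by (fact *)+
qed

lemma shifted_gaussian_sum_alt:
  "shifted_gaussian_sum A z = exp (- of_real pi * A * z ^ 2) *
     (\<Sum>\<^sub>\<infinity>n. exp ((- of_real pi * A) * of_int n ^ 2) * exp (((- 2 * of_real pi * A) * of_int n) * z))"
  unfolding shifted_gaussian_sum_def
  by (subst infsum_cmult_right'[symmetric], rule infsum_cong)
    (simp add: mult_exp_exp power2_eq_square algebra_simps)

lemma dual_gaussian_sum_alt: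
  "dual_gaussian_sum A z =
     (\<Sum>\<^sub>\<infinity>n. exp ((- of_real pi / A) * of_int n ^ 2) * exp (((2 * of_real pi * \<i>) * of_int n) * z))"
  by (simp add: dual_gaussian_sum_def unit_exp_def mult_ac)

lemma shifted_gaussian_sum_zsummable_weighted:
  fixes A z :: complex
  assumes "Re A > 0"
  shows "zsummable (\<lambda>n. (of_int n + z) * exp (- of_real pi * A * (of_int n + z) ^ 2))"
proof -
  let ?e = "\<lambda>n::int. exp (- of_real pi * A * (of_int n + z) ^ 2)"
  have A0: "A \<noteq> 0" using assms by auto
  have "zsummable (\<lambda>n. exp (- of_real pi * A * z ^ 2) / (- 2 * of_real pi * A) *
      (exp ((- of_real pi * A) * of_int n ^ 2) * ((- 2 * of_real pi * A) * of_int n) * exp (((- 2 * of_real pi * A) * of_int n) * z)))"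
    by (subst norm_mult, rule summable_on_cmult_right, rule exp_zsum_has_derivative(3)) (use assms in simp)
  also have "(\<lambda>n. exp (- of_real pi * A * z ^ 2) / (- 2 * of_real pi * A) *
      (exp ((- of_real pi * A) * of_int n ^ 2) * ((- 2 * of_real pi * A) * of_int n) * exp (((- 2 * of_real pi * A) * of_int n) * z)))
      = (\<lambda>n. of_int n * ?e n)"
  proof
    fix n :: int
    have "exp (- of_real pi * A * z ^ 2) * exp ((- of_real pi * A) * of_int n ^ 2) * exp (((- 2 * of_real pi * A) * of_int n) * z) = ?e n"
      by (simp add: mult_exp_exp power2_eq_square algebra_simps)
    then show "exp (- of_real pi * A * z ^ 2) / (- 2 * of_real pi * A) *
      (exp ((- of_real pi * A) * of_int n ^ 2) * ((- 2 * of_real pi * A) * of_int n) * exp (((- 2 * of_real pi * A) * of_int n) * z))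
      = of_int n * ?e n"
      using A0 by (simp add: field_simps)
  qed
  finally have 1: "zsummable (\<lambda>n. of_int n * ?e n)" .
  have 2: "zsummable (\<lambda>n. z * ?e n)"
    unfolding norm_mult by (rule summable_on_cmult_right[OF gauss_shift_zsummable[OF assms]])
  show ?thesis
    by (rule summable_on_comparison_test[OF summable_on_add[OF 1 2]])
      (auto simp: distrib_right intro: norm_triangle_ineq)
qed

lemma shifted_gaussian_sum_has_derivative:
  fixes A z :: complex
  assumes "Re A > 0"
  shows "(shifted_gaussian_sum A has_field_derivative
     - 2 * of_real pi * A * (\<Sum>\<^sub>\<infinity>n. (of_int n + z) * exp (- of_real pi * A * (of_int n + z) ^ 2))) (at z)"
proof -
  let ?S = "\<lambda>z. \<Sum>\<^sub>\<infinity>n. exp ((- of_real pi * A) * of_int n ^ 2) * exp (((- 2 * of_real pi * A) * of_int n) * z)"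
  let ?T = "\<Sum>\<^sub>\<infinity>n. exp ((- of_real pi * A) * of_int n ^ 2) * ((- 2 * of_real pi * A) * of_int n) * exp (((- 2 * of_real pi * A) * of_int n) * z)"
  let ?e = "exp (- of_real pi * A * z ^ 2)"
  have a: "Re (- of_real pi * A) < 0" using assms by simp
  have "((\<lambda>z. exp (- of_real pi * A * z ^ 2) * ?S z) has_field_derivative
      ?e * (- 2 * of_real pi * A * z) * ?S z + ?T * ?e) (at z)"
    by (rule derivative_eq_intros exp_zsum_has_derivative(1)[OF a] refl | simp)+
  also have "?e * (- 2 * of_real pi * A * z) * ?S z + ?T * ?e =
     (\<Sum>\<^sub>\<infinity>n. ?e * (- 2 * of_real pi * A * z) * (exp ((- of_real pi * A) * of_int n ^ 2) * exp (((- 2 * of_real pi * A) * of_int n) * z))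
       + exp ((- of_real pi * A) * of_int n ^ 2) * ((- 2 * of_real pi * A) * of_int n) * exp (((- 2 * of_real pi * A) * of_int n) * z) * ?e)"
  proof (subst infsum_add)
    show "(\<lambda>n. ?e * (- 2 * of_real pi * A * z) * (exp ((- of_real pi * A) * of_int n ^ 2) * exp (((- 2 * of_real pi * A) * of_int n) * z))) summable_on UNIV"
      by (rule summable_on_cmult_right[OF Infinite_Sum.abs_summable_summable[OF exp_zsum_has_derivative(2)[OF a]]])
    show "(\<lambda>n. exp ((- of_real pi * A) * of_int n ^ 2) * ((- 2 * of_real pi * A) * of_int n) * exp (((- 2 * of_real pi * A) * of_int n) * z) * ?e) summable_on UNIV"
      by (rule summable_on_cmult_left[OF Infinite_Sum.abs_summable_summable[OF exp_zsum_has_derivative(3)[OF a]]])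
  qed (simp only: infsum_cmult_right' infsum_cmult_left')
  also have "\<dots> = (\<Sum>\<^sub>\<infinity>n. - 2 * of_real pi * A * ((of_int n + z) * exp (- of_real pi * A * (of_int n + z) ^ 2)))"
  proof (rule infsum_cong)
    fix n :: int
    have "exp (- of_real pi * A * (of_int n + z) ^ 2) = ?e * exp ((- of_real pi * A) * of_int n ^ 2) * exp (((- 2 * of_real pi * A) * of_int n) * z)"
      by (simp add: mult_exp_exp power2_eq_square algebra_simps)
    then show "?e * (- 2 * of_real pi * A * z) * (exp ((- of_real pi * A) * of_int n ^ 2) * exp (((- 2 * of_real pi * A) * of_int n) * z))
       + exp ((- of_real pi * A) * of_int n ^ 2) * ((- 2 * of_real pi * A) * of_int n) * exp (((- 2 * of_real pi * A) * of_int n) * z) * ?e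
       = - 2 * of_real pi * A * ((of_int n + z) * exp (- of_real pi * A * (of_int n + z) ^ 2))"
      by (simp add: algebra_simps)
  qed
  also have "\<dots> = - 2 * of_real pi * A * (\<Sum>\<^sub>\<infinity>n. (of_int n + z) * exp (- of_real pi * A * (of_int n + z) ^ 2))"
    by (rule infsum_cmult_right')
  finally show ?thesis by (simp only: shifted_gaussian_sum_alt[abs_def])
qed

lemma dual_gaussian_sum_has_derivative:
  fixes A z :: complex
  assumes "Re (1 / A) > 0"
  shows "(dual_gaussian_sum A has_field_derivative
     2 * of_real pi * \<i> * (\<Sum>\<^sub>\<infinity>n. of_int n * exp (- of_real pi * of_int n ^ 2 / A) * unit_exp (of_int n * z))) (at z)"
    and "zsummable (\<lambda>n. of_int n * exp (- of_real pi * of_int n ^ 2 / A) * unit_exp (of_int n * z))"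
    and "zsummable (\<lambda>n. exp (- of_real pi * of_int n ^ 2 / A) * unit_exp (of_int n * z))"
proof -
  have "Re (- of_real pi / A) = - pi * Re (1 / A)" by (simp add: Re_divide)
  then have a: "Re (- of_real pi / A) < 0" using assms by (simp add: mult_pos_pos)
  note d = exp_zsum_has_derivative[OF a, of "2 * of_real pi * \<i>" z]
  have eq: "exp ((- of_real pi / A) * of_int n ^ 2) * ((2 * of_real pi * \<i>) * of_int n) * exp (((2 * of_real pi * \<i>) * of_int n) * z)
     = 2 * of_real pi * \<i> * (of_int n * exp (- of_real pi * of_int n ^ 2 / A) * unit_exp (of_int n * z))" for n :: int
    by (simp add: unit_exp_def mult_ac)
  show "(dual_gaussian_sum A has_field_derivative
     2 * of_real pi * \<i> * (\<Sum>\<^sub>\<infinity>n. of_int n * exp (- of_real pi * of_int n ^ 2 / A) * unit_exp (of_int n * z))) (at z)"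
    using d(1) unfolding eq infsum_cmult_right' by (simp only: dual_gaussian_sum_alt[abs_def])
  have c: "1 / (2 * of_real pi * \<i>) * (2 * of_real pi * \<i> * X) = X" for X :: complex by simp
  have "zsummable (\<lambda>n. 1 / (2 * of_real pi * \<i>) * (2 * of_real pi * \<i> * (of_int n * exp (- of_real pi * of_int n ^ 2 / A) * unit_exp (of_int n * z))))"
    using d(3) unfolding eq by (subst norm_mult) (rule summable_on_cmult_right)
  then show "zsummable (\<lambda>n. of_int n * exp (- of_real pi * of_int n ^ 2 / A) * unit_exp (of_int n * z))"
    by (simp only: c)
  show "zsummable (\<lambda>n. exp (- of_real pi * of_int n ^ 2 / A) * unit_exp (of_int n * z))"
    using d(2) by (simp add: unit_exp_def mult_ac)
qed

text \<open>Both sides are continuous, even and periodic functions of \<open>b\<close> with the same Fourier coefficients.\<close>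
lemma gaussian_poisson_real:
  fixes A b :: real
  assumes "A > 0"
  shows "shifted_gaussian_sum (of_real A) (of_real b) = of_real (1 / sqrt A) * dual_gaussian_sum (of_real A) (of_real b)"
proof -
  let ?L = "\<lambda>b::real. shifted_gaussian_sum (of_real A) (of_real b)"
  let ?R = "\<lambda>b::real. dual_gaussian_sum (of_real A) (of_real b)"
  have Re: "Re (complex_of_real A) > 0" "Re (1 / complex_of_real A) > 0" using assms by (auto simp: Re_divide)
  have contL: "continuous_on S ?L" for S
    by (rule continuous_on_compose2[of UNIV "shifted_gaussian_sum (of_real A)"])
      (auto intro!: continuous_intros DERIV_continuous_on shifted_gaussian_sum_has_derivative[OF Re(1), THEN has_field_derivative_at_within])
  have contR: "continuous_on S ?R" for S
    by (rule continuous_on_compose2[of UNIV "dual_gaussian_sum (of_real A)"])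
      (auto intro!: continuous_intros DERIV_continuous_on dual_gaussian_sum_has_derivative(1)[OF Re(2), THEN has_field_derivative_at_within])
  have neg: "bij (uminus :: int \<Rightarrow> int)" by (rule bij_uminus)
  have shift: "bij (\<lambda>n::int. n + 1)" by (rule bij_plus_right)
  have "?L b - of_real (1 / sqrt A) * ?R b = 0"
  proof (rule even_periodic_zero_coeffs[of "\<lambda>b. ?L b - of_real (1 / sqrt A) * ?R b"])
    show "continuous_on UNIV (\<lambda>b. ?L b - of_real (1 / sqrt A) * ?R b)"
      by (intro continuous_intros contL contR)
    fix x :: real
    have "?L (- x) = ?L x"
    proof -
      have "?L (- x) = (\<Sum>\<^sub>\<infinity>n::int. exp (- of_real pi * of_real A * (of_int (- n) + of_real (- x)) ^ 2))"
        unfolding shifted_gaussian_sum_def by (rule infsum_reindex_bij_betw[OF neg, symmetric])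
      also have "\<dots> = ?L x" unfolding shifted_gaussian_sum_def
        by (rule infsum_cong) (simp add: power2_eq_square algebra_simps)
      finally show ?thesis .
    qed
    moreover have "?R (- x) = ?R x"
    proof -
      have "?R (- x) = (\<Sum>\<^sub>\<infinity>n::int. exp (- of_real pi * of_int (- n) ^ 2 / of_real A) * unit_exp (of_int (- n) * of_real (- x)))"
        unfolding dual_gaussian_sum_def by (rule infsum_reindex_bij_betw[OF neg, symmetric])
      also have "\<dots> = ?R x" unfolding dual_gaussian_sum_def
        by (rule infsum_cong) (simp add: power2_eq_square algebra_simps)
      finally show ?thesis .
    qed
    ultimately show "?L (- x) - of_real (1 / sqrt A) * ?R (- x) = ?L x - of_real (1 / sqrt A) * ?R x" by simp
    have "?L x = (\<Sum>\<^sub>\<infinity>n::int. exp (- of_real pi * of_real A * (of_int (n + 1) + of_real x) ^ 2))"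
      unfolding shifted_gaussian_sum_def by (rule infsum_reindex_bij_betw[OF shift, symmetric])
    also have "\<dots> = ?L (x + 1)" unfolding shifted_gaussian_sum_def by (rule infsum_cong) (simp add: add_ac)
    finally have "?L (x + 1) = ?L x" by simp
    moreover have "?R (x + 1) = ?R x"
      unfolding dual_gaussian_sum_def by (rule infsum_cong) (simp add: distrib_left unit_exp_add)
    ultimately show "?L (x + 1) - of_real (1 / sqrt A) * ?R (x + 1) = ?L x - of_real (1 / sqrt A) * ?R x" by simp
  next
    fix l :: int
    have ue: "continuous_on S (\<lambda>x::real. unit_exp (of_int l * of_real x))" for S
      unfolding unit_exp_def by (intro continuous_intros)
    have L: "integral {0..1} (\<lambda>x. ?L x * unit_exp (of_int l * of_real x)) = of_real (1 / sqrt A * exp (- pi * of_int l ^ 2 / A))"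
      using periodized_gaussian_coeff[OF assms, of l] by (simp add: shifted_gaussian_sum_def exp_of_real[symmetric])
    have R: "integral {0..1} (\<lambda>x. ?R x * unit_exp (of_int l * of_real x)) = of_real (exp (- pi * of_int l ^ 2 / A))"
      using dual_gaussian_coeff[OF assms, of l] by (simp add: dual_gaussian_sum_def exp_of_real[symmetric])
    have "integral {0..1} (\<lambda>x. (?L x - of_real (1 / sqrt A) * ?R x) * unit_exp (of_int l * of_real x)) =
        integral {0..1} (\<lambda>x. ?L x * unit_exp (of_int l * of_real x)) -
        integral {0..1} (\<lambda>x. of_real (1 / sqrt A) * (?R x * unit_exp (of_int l * of_real x)))"
      unfolding left_diff_distrib mult.assoc
      by (intro Henstock_Kurzweil_Integration.integral_diff integrable_continuous_real continuous_intros contL contR ue)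
    also have "\<dots> = 0" unfolding integral_mult_right L R by simp
    finally show "integral {0..1} (\<lambda>x. (?L x - of_real (1 / sqrt A) * ?R x) * unit_exp (of_int l * of_real x)) = 0" .
  qed
  then show ?thesis by simp
qed

text \<open>Both sides are holomorphic in \<open>A\<close> on the right half plane, and they agree for positive \<open>A\<close>.\<close>
theorem gaussian_poisson:
  fixes A :: complex and b :: real
  assumes "Re A > 0"
  shows "shifted_gaussian_sum A (of_real b) = dual_gaussian_sum A (of_real b) / csqrt A"
proof -
  define S where "S = {A::complex. Re A > 0}"
  have "open S" unfolding S_def by (rule open_halfspace_Re_gt)
  have "connected S" unfolding S_def by (intro convex_connected convex_halfspace_Re_gt)
  have quad: "(\<lambda>n. norm (c n) * exp (Re ((- of_real pi * of_real (q n ^ 2)) * z) + Re z / 2 * norm (- of_real pi * complex_of_real (q n ^ 2)))) summable_on UNIV"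
    if "Re z > 0" "\<And>n. norm (c n) = 1" "\<And>n. q n = of_int n + \<beta>" for c :: "int \<Rightarrow> complex" and q :: "int \<Rightarrow> real" and \<beta> :: real and z :: complex
  proof -
    have "zsummable (\<lambda>n. exp (- of_real pi * of_real (Re z / 2) * (of_int n + of_real \<beta>) ^ 2))"
      by (rule gauss_shift_zsummable) (use that in simp)
    also have "(\<lambda>n. norm (exp (- of_real pi * of_real (Re z / 2) * (of_int n + complex_of_real \<beta>) ^ 2))) =
       (\<lambda>n. norm (c n) * exp (Re ((- of_real pi * of_real (q n ^ 2)) * z) + Re z / 2 * norm (- of_real pi * complex_of_real (q n ^ 2))))"
    proof
      fix n
      have "Re ((- of_real pi * of_real (q n ^ 2)) * z) = - pi * q n ^ 2 * Re z"
        by (simp del: of_real_power)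
      moreover have "norm (- of_real pi * complex_of_real (q n ^ 2)) = pi * q n ^ 2"
        unfolding norm_mult norm_minus_cancel norm_of_real by simp
      moreover have "- of_real pi * of_real (Re z / 2) * (of_int n + complex_of_real \<beta>) ^ 2 = of_real (- pi * (Re z / 2) * q n ^ 2)"
        by (simp add: that)
      ultimately show "norm (exp (- of_real pi * of_real (Re z / 2) * (of_int n + complex_of_real \<beta>) ^ 2)) =
        norm (c n) * exp (Re ((- of_real pi * of_real (q n ^ 2)) * z) + Re z / 2 * norm (- of_real pi * complex_of_real (q n ^ 2)))"
        unfolding that(2) norm_exp_eq_Re by (simp only: Re_complex_of_real) (simp add: field_simps)
    qed
    finally show ?thesis .
  qed
  have hol: "(\<lambda>z. \<Sum>\<^sub>\<infinity>n. c n * exp ((- of_real pi * of_real (q n ^ 2)) * z)) holomorphic_on S"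
    if "\<And>n. norm (c n) = 1" "\<And>n. q n = of_int n + \<beta>" for c :: "int \<Rightarrow> complex" and q :: "int \<Rightarrow> real" and \<beta> :: real
  proof (rule holomorphic_onI)
    fix z assume "z \<in> S"
    then have z: "Re z > 0" "Re z / 2 > 0" by (auto simp: S_def)
    show "(\<lambda>z. \<Sum>\<^sub>\<infinity>n. c n * exp ((- of_real pi * of_real (q n ^ 2)) * z)) field_differentiable at z within S"
      by (rule field_differentiable_at_within, unfold field_differentiable_def, rule exI)
        (rule exp_sum_has_derivative(1)[OF z(2) quad[OF z(1) that]])
  qed
  have holL: "(\<lambda>A. shifted_gaussian_sum A (of_real b)) holomorphic_on S"
  proof -
    have eq: "shifted_gaussian_sum A (of_real b) = (\<Sum>\<^sub>\<infinity>n::int. 1 * exp ((- of_real pi * of_real ((of_int n + b) ^ 2)) * A))" for A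
      unfolding shifted_gaussian_sum_def by (rule infsum_cong) (simp add: mult_ac)
    show ?thesis unfolding eq by (rule hol) auto
  qed
  have holR': "(\<lambda>z. \<Sum>\<^sub>\<infinity>n::int. unit_exp (of_int n * of_real b) * exp ((- of_real pi * of_real ((of_int n + 0) ^ 2)) * z)) holomorphic_on S"
  proof (rule hol)
    fix n :: int
    show "norm (unit_exp (of_int n * complex_of_real b)) = 1"
      using norm_unit_exp_of_real[of "of_int n * b"] by simp
  qed auto
  have holR: "(\<lambda>A. dual_gaussian_sum A (of_real b)) holomorphic_on S"
  proof -
    have eq: "dual_gaussian_sum A (of_real b) = (\<Sum>\<^sub>\<infinity>n::int. unit_exp (of_int n * of_real b) * exp ((- of_real pi * of_real ((of_int n + 0) ^ 2)) * (1 / A)))" for A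
      unfolding dual_gaussian_sum_def by (rule infsum_cong) (simp add: mult_ac)
    have "(\<lambda>A. 1 / A) holomorphic_on S" unfolding S_def by (intro holomorphic_intros) auto
    moreover have "(\<lambda>A::complex. 1 / A) ` S \<subseteq> S"
      by (auto simp: S_def Re_divide intro!: divide_pos_pos add_pos_nonneg)
    ultimately show ?thesis unfolding eq by (rule holomorphic_on_compose_gen[OF _ holR', unfolded o_def])
  qed
  have "shifted_gaussian_sum A (of_real b) - dual_gaussian_sum A (of_real b) / csqrt A = 0"
  proof (rule analytic_continuation[of "\<lambda>A. shifted_gaussian_sum A (of_real b) - dual_gaussian_sum A (of_real b) / csqrt A" S "of_real ` {0<..}" 1])
    show "(\<lambda>A. shifted_gaussian_sum A (of_real b) - dual_gaussian_sum A (of_real b) / csqrt A) holomorphic_on S"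
      by (intro holomorphic_intros holL holR) (auto simp: S_def complex_nonpos_Reals_iff)
    show "complex_of_real ` {0<..} \<subseteq> S" by (auto simp: S_def)
    show "1 islimpt (complex_of_real ` {0<..})"
    proof -
      have "(\<lambda>n. complex_of_real (1 + 1 / real (Suc n))) \<longlonglongrightarrow> of_real (1 + 0)"
        by (intro tendsto_intros LIMSEQ_Suc lim_1_over_n)
      moreover have "complex_of_real (1 + 1 / real (Suc n)) \<in> complex_of_real ` {0<..} - {1}" for n
      proof (intro DiffI imageI)
        show "1 + 1 / real (Suc n) \<in> {0<..}" by (simp add: add_pos_nonneg)
        show "complex_of_real (1 + 1 / real (Suc n)) \<notin> {1}"
          unfolding singleton_iff of_real_eq_1_iff by simp
      qed
      ultimately show ?thesis unfolding islimpt_sequential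
        by (intro exI[of _ "\<lambda>n. complex_of_real (1 + 1 / real (Suc n))"] conjI allI) simp_all
    qed
    fix z assume "z \<in> complex_of_real ` {0<..}"
    then obtain a where "a > 0" "z = of_real a" by auto
    then show "shifted_gaussian_sum z (of_real b) - dual_gaussian_sum z (of_real b) / csqrt z = 0"
      using gaussian_poisson_real[of a b] by (simp add: field_simps)
  qed (use assms \<open>open S\<close> \<open>connected S\<close> in \<open>auto simp: S_def\<close>)
  then show ?thesis by simp
qed

text \<open>Differentiation of the real Poisson formula in \<open>b\<close>. The dual sum has no term for \<open>n = 0\<close>, so the odd
  sum is exponentially small as \<open>A\<close> tends to zero.\<close>
theorem gaussian_poisson_weighted:
  fixes A b :: real
  assumes "A > 0"
  shows "(\<Sum>\<^sub>\<infinity>n::int. (of_int n + of_real b) * exp (- of_real pi * of_real A * (of_int n + of_real b) ^ 2)) =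
    - \<i> / of_real (A * sqrt A) * (\<Sum>\<^sub>\<infinity>n::int. of_int n * exp (- of_real pi * of_int n ^ 2 / of_real A) * unit_exp (of_int n * of_real b))"
    (is "?L = _ * ?R")
proof -
  have Re: "Re (complex_of_real A) > 0" "Re (1 / complex_of_real A) > 0" using assms by (auto simp: Re_divide)
  have "((\<lambda>x. shifted_gaussian_sum (of_real A) (of_real x)) has_vector_derivative - 2 * of_real pi * of_real A * ?L) (at b)"
    by (rule has_vector_derivative_real_field[OF shifted_gaussian_sum_has_derivative[OF Re(1)]])
  moreover have "((\<lambda>x. of_real (1 / sqrt A) * dual_gaussian_sum (of_real A) (of_real x)) has_vector_derivative
      of_real (1 / sqrt A) * (2 * of_real pi * \<i> * ?R)) (at b)"
    by (intro has_vector_derivative_mult_right has_vector_derivative_real_field dual_gaussian_sum_has_derivative(1) Re)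
  ultimately have "- 2 * of_real pi * of_real A * ?L = of_real (1 / sqrt A) * (2 * of_real pi * \<i> * ?R)"
    unfolding gaussian_poisson_real[OF assms] by (rule vector_derivative_unique_at)
  moreover have "L = - \<i> / of_real (A * sqrt A) * R"
    if "- 2 * of_real pi * of_real A * L = of_real (1 / sqrt A) * (2 * of_real pi * \<i> * R)" for L R :: complex
  proof -
    have "2 * of_real pi * (of_real A * L) = 2 * of_real pi * (- \<i> / of_real (sqrt A) * R)"
    proof -
      have "2 * of_real pi * (of_real A * L) = - (- 2 * of_real pi * of_real A * L)" by simp
      also have "\<dots> = - (of_real (1 / sqrt A) * (2 * of_real pi * \<i> * R))" by (simp only: that)
      also have "\<dots> = 2 * of_real pi * (- \<i> / of_real (sqrt A) * R)" by simp
      finally show ?thesis .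
    qed
    then have "of_real A * L = - \<i> / of_real (sqrt A) * R"
      unfolding mult_cancel_left by simp
    then show ?thesis using assms by (simp add: field_simps)
  qed
  ultimately show ?thesis by blast
qed

section \<open>Quadratic Gauss sums\<close>

lemma periodic_sum_reindex:
  fixes f :: "int \<Rightarrow> complex" and g :: "'a \<Rightarrow> int"
  assumes "d > 0" and per: "\<And>j k. [j = k] (mod d) \<Longrightarrow> f j = f k"
    and "finite A" and inj: "\<And>x y. x \<in> A \<Longrightarrow> y \<in> A \<Longrightarrow> [g x = g y] (mod d) \<Longrightarrow> x = y"
    and "int (card A) = d"
  shows "(\<Sum>x\<in>A. f (g x)) = (\<Sum>j\<in>{0..<d}. f j)"
proof -
  have inj': "inj_on (\<lambda>x. g x mod d) A"
    by (intro inj_onI inj) (auto simp: cong_def)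
  have "(\<lambda>x. g x mod d) ` A = {0..<d}"
  proof (rule card_subset_eq)
    show "card ((\<lambda>x. g x mod d) ` A) = card {0..<d}"
      using assms(5) by (simp add: card_image[OF inj'] flip: nat_eq_iff2)
  qed (use assms(1) in auto)
  moreover have "(\<Sum>x\<in>A. f (g x)) = (\<Sum>x\<in>A. f (g x mod d))"
    by (intro sum.cong per) (auto simp: cong_def)
  ultimately show ?thesis
    using sum.reindex[OF inj', of f] by (simp add: o_def)
qed

text \<open>The shift by \<open>K\<close> permutes the residues and multiplies the sum by \<open>\<omega>\<close>.\<close>
lemma periodic_sum_shift_zero:
  fixes f :: "int \<Rightarrow> complex"
  assumes "d > 0" and "\<And>j k. [j = k] (mod d) \<Longrightarrow> f j = f k"
    and "\<And>j. f (j + K) = \<omega> * f j" and "\<omega> \<noteq> 1"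
  shows "(\<Sum>j\<in>{0..<d}. f j) = 0"
proof -
  have "(\<Sum>j\<in>{0..<d}. f (j + K)) = (\<Sum>j\<in>{0..<d}. f j)"
  proof (rule periodic_sum_reindex)
    fix x y assume *: "x \<in> {0..<d}" "y \<in> {0..<d}" "[x + K = y + K] (mod d)"
    then have "[x = y] (mod d)" by (simp add: cong_add_rcancel)
    with * show "x = y" by (auto simp: cong_def)
  qed (use assms in auto)
  then have "\<omega> * (\<Sum>j\<in>{0..<d}. f j) = (\<Sum>j\<in>{0..<d}. f j)"
    by (simp add: assms(3) sum_distrib_left)
  then show ?thesis using assms(4) by simp
qed

lemma unit_exp_eq_1_iff: "unit_exp (of_real x) = 1 \<longleftrightarrow> x \<in> \<int>"
proof -
  have "unit_exp (of_real x) = 1 \<longleftrightarrow> (\<exists>n::int. 2 * pi * x = of_int (2 * n) * pi)"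
    by (simp add: unit_exp_def exp_eq_1)
  also have "\<dots> \<longleftrightarrow> (\<exists>n::int. x = of_int n)"
    by (rule ex_cong1) (auto simp: field_simps)
  finally show ?thesis by (auto simp: Ints_def)
qed

lemma unit_exp_frac_eq_1_iff:
  fixes m d :: int
  assumes "d \<noteq> 0"
  shows "unit_exp (of_int m / of_int d) = 1 \<longleftrightarrow> d dvd m"
proof -
  have "unit_exp (of_int m / of_int d) = unit_exp (of_real (of_int m / of_int d))" by simp
  also have "\<dots> = 1 \<longleftrightarrow> (of_int m / of_int d :: real) \<in> \<int>" by (rule unit_exp_eq_1_iff)
  also have "\<dots> \<longleftrightarrow> d dvd m"
  proof
    assume "(of_int m / of_int d :: real) \<in> \<int>"
    then obtain n where "of_int m / of_int d = (of_int n :: real)" by (auto elim: Ints_cases)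
    then have "of_int m = (of_int (n * d) :: real)" using assms by (simp add: field_simps)
    then show "d dvd m" by (simp only: of_int_eq_iff) simp
  qed (use assms in auto)
  finally show ?thesis .
qed

lemma unit_exp_frac_cong:
  fixes m n d :: int
  assumes "[m = n] (mod d)"
  shows "unit_exp (of_int m / of_int d) = unit_exp (of_int n / of_int d)"
proof (cases "d = 0")
  case False
  obtain k where "m = n + d * k" using assms by (metis cong_iff_lin cong_sym)
  then have "of_int m / of_int d = of_int n / of_int d + complex_of_int k"
    using False by (simp add: field_simps)
  then show ?thesis by (simp add: unit_exp_add)
qed simp

lemma unit_exp_character_sum:
  fixes k d :: int
  assumes "d > 0"
  shows "(\<Sum>v\<in>{0..<d}. unit_exp (of_int (k * v) / of_int d)) = (if d dvd k then of_int d else 0)"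
proof (cases "d dvd k")
  case True
  then have "unit_exp (of_int (k * v) / of_int d) = 1" for v
    using assms unit_exp_frac_eq_1_iff[of d "k * v"] by (simp add: dvd_mult2)
  then show ?thesis using True assms by simp
next
  case False
  have "(\<Sum>v\<in>{0..<d}. unit_exp (of_int (k * v) / of_int d)) = 0"
  proof (rule periodic_sum_shift_zero[where K = 1 and \<omega> = "unit_exp (of_int k / of_int d)"])
    show "unit_exp (of_int (k * (v + 1)) / of_int d) = unit_exp (of_int k / of_int d) * unit_exp (of_int (k * v) / of_int d)" for v
      by (simp add: algebra_simps add_divide_distrib flip: unit_exp_add)
    show "unit_exp (of_int (k * i) / of_int d) = unit_exp (of_int (k * j) / of_int d)" if "[i = j] (mod d)" for i j
      by (intro unit_exp_frac_cong cong_mult that cong_refl)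
  qed (use assms False unit_exp_frac_eq_1_iff[of d k] in auto)
  then show ?thesis using False by simp
qed

definition gauss_sum :: "int \<Rightarrow> int \<Rightarrow> complex"
  where "gauss_sum a d = (\<Sum>j\<in>{0..<d}. unit_exp (of_int (a * j ^ 2) / of_int d))"

lemma gauss_sum_periodic: "[j = k] (mod d) \<Longrightarrow> unit_exp (of_int (a * j ^ 2) / of_int d) = unit_exp (of_int (a * k ^ 2) / of_int d)"
  by (intro unit_exp_frac_cong cong_mult cong_pow cong_refl)

lemma gauss_sum_cong: "[a = b] (mod d) \<Longrightarrow> gauss_sum a d = gauss_sum b d"
  unfolding gauss_sum_def by (intro sum.cong refl unit_exp_frac_cong cong_mult cong_refl)

lemma gauss_sum_one [simp]: "gauss_sum a 1 = 1"
proof -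
  have "{0..<1::int} = {0}" by auto
  then show ?thesis by (simp add: gauss_sum_def unit_exp_def)
qed

lemma gauss_sum_reindex:
  fixes g :: "'a \<Rightarrow> int"
  assumes "d > 0" "finite A" "\<And>x y. x \<in> A \<Longrightarrow> y \<in> A \<Longrightarrow> [g x = g y] (mod d) \<Longrightarrow> x = y" "int (card A) = d"
  shows "gauss_sum a d = (\<Sum>x\<in>A. unit_exp (of_int (a * g x ^ 2) / of_int d))"
  unfolding gauss_sum_def
  by (rule periodic_sum_reindex[OF assms(1) gauss_sum_periodic assms(2-4), symmetric])

lemma gauss_sum_uminus: "gauss_sum (- a) d = cnj (gauss_sum a d)"
  by (simp add: gauss_sum_def unit_exp_def exp_cnj)

lemma gauss_sum_mult_square:
  assumes "d > 0" "coprime x d"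
  shows "gauss_sum (a * x ^ 2) d = gauss_sum a d"
proof -
  have "gauss_sum a d = (\<Sum>j\<in>{0..<d}. unit_exp (of_int (a * (x * j) ^ 2) / of_int d))"
  proof (rule gauss_sum_reindex)
    fix i j assume *: "i \<in> {0..<d}" "j \<in> {0..<d}" "[x * i = x * j] (mod d)"
    then have "[i = j] (mod d)" using assms(2) by (simp add: cong_mult_lcancel)
    with * show "i = j" by (auto simp: cong_def)
  qed (use assms in auto)
  then show ?thesis by (simp add: gauss_sum_def power_mult_distrib mult_ac)
qed

text \<open>By the Chinese remainder theorem every residue modulo \<open>m * p\<close> is \<open>p * u + m * v\<close> for a unique pair of
  residues, and the mixed term of the square is a multiple of \<open>m * p\<close>.\<close>
lemma gauss_sum_mult_coprime:
  assumes "m > 0" "p > 0" "coprime m p"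
  shows "gauss_sum a (m * p) = gauss_sum (a * p) m * gauss_sum (a * m) p"
proof -
  have "gauss_sum a (m * p) = (\<Sum>x\<in>{0..<m} \<times> {0..<p}. unit_exp (of_int (a * (p * fst x + m * snd x) ^ 2) / of_int (m * p)))"
  proof (rule gauss_sum_reindex)
    fix x y assume x: "x \<in> {0..<m} \<times> {0..<p}" and y: "y \<in> {0..<m} \<times> {0..<p}"
      and c: "[p * fst x + m * snd x = p * fst y + m * snd y] (mod (m * p))"
    have "[p * fst x + m * snd x = p * fst y + m * snd y] (mod m)" by (rule cong_modulus_mult[OF c])
    then have "[p * fst x = p * fst y] (mod m)" by (simp add: cong_def)
    then have "[fst x = fst y] (mod m)" using assms(3) by (simp add: cong_mult_lcancel coprime_commute)
    moreover have "[p * fst x + m * snd x = p * fst y + m * snd y] (mod p)"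
      using cong_modulus_mult[of _ _ p m] c by (simp add: mult.commute)
    then have "[m * snd x = m * snd y] (mod p)" by (simp add: cong_def)
    then have "[snd x = snd y] (mod p)" using assms(3) by (simp add: cong_mult_lcancel)
    ultimately show "x = y" using x y by (auto simp: cong_def prod_eq_iff)
  qed (use assms in \<open>auto simp: card_cartesian_product\<close>)
  also have "\<dots> = (\<Sum>x\<in>{0..<m} \<times> {0..<p}. unit_exp (of_int (a * p * fst x ^ 2) / of_int m) * unit_exp (of_int (a * m * snd x ^ 2) / of_int p))"
  proof (rule sum.cong)
    fix x :: "int \<times> int"
    have "complex_of_int (a * (p * fst x + m * snd x) ^ 2) / of_int (m * p) =
      of_int (a * p * fst x ^ 2) / of_int m + of_int (a * m * snd x ^ 2) / of_int p + of_int (2 * a * fst x * snd x)"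
      using assms(1,2) by (simp add: field_simps power2_eq_square)
    then show "unit_exp (of_int (a * (p * fst x + m * snd x) ^ 2) / of_int (m * p)) =
      unit_exp (of_int (a * p * fst x ^ 2) / of_int m) * unit_exp (of_int (a * m * snd x ^ 2) / of_int p)"
      by (simp only: unit_exp_add unit_exp_int mult_1_right)
  qed simp
  also have "\<dots> = gauss_sum (a * p) m * gauss_sum (a * m) p"
    by (simp add: gauss_sum_def sum_product sum.cartesian_product case_prod_beta)
  finally show ?thesis .
qed

text \<open>In \<open>j = u + p * m * v\<close> the square is linear in \<open>v\<close> modulo \<open>p ^ 2 * m\<close>; the character sum over \<open>v\<close>
  keeps only the multiples \<open>u\<close> of \<open>p\<close>.\<close>
lemma gauss_sum_prime_square:
  assumes "p > 0" "m > 0" "coprime (2 * a) p"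
  shows "gauss_sum a (p ^ 2 * m) = of_int p * gauss_sum a m"
proof -
  have "gauss_sum a (p ^ 2 * m) = (\<Sum>x\<in>{0..<p * m} \<times> {0..<p}. unit_exp (of_int (a * (fst x + p * m * snd x) ^ 2) / of_int (p ^ 2 * m)))"
  proof (rule gauss_sum_reindex)
    fix x y assume x: "x \<in> {0..<p * m} \<times> {0..<p}" and y: "y \<in> {0..<p * m} \<times> {0..<p}"
      and c: "[fst x + p * m * snd x = fst y + p * m * snd y] (mod (p ^ 2 * m))"
    have c': "[fst x + p * m * snd x = fst y + p * m * snd y] (mod (p * m * p))"
      using c by (simp add: power2_eq_square mult_ac)
    have "[fst x + p * m * snd x = fst y + p * m * snd y] (mod (p * m))" by (rule cong_modulus_mult[OF c'])
    then have "[fst x = fst y] (mod (p * m))" by (simp add: cong_def)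
    then have 1: "fst x = fst y" using x y by (auto simp: cong_def)
    then have "[p * m * snd x = p * m * snd y] (mod (p * m * p))" using c' by (simp add: cong_add_lcancel)
    then have "[snd x = snd y] (mod p)" using assms(1,2) by (simp add: cong_iff_dvd_diff flip: right_diff_distrib)
    then show "x = y" using 1 x y by (auto simp: cong_def prod_eq_iff)
  qed (use assms in \<open>auto simp: card_cartesian_product nat_mult_distrib power2_eq_square\<close>)
  also have "\<dots> = (\<Sum>x\<in>{0..<p * m} \<times> {0..<p}. unit_exp (of_int (a * fst x ^ 2) / of_int (p ^ 2 * m)) * unit_exp (of_int (2 * a * fst x * snd x) / of_int p))"
  proof (rule sum.cong)
    fix x :: "int \<times> int"
    have "complex_of_int (a * (fst x + p * m * snd x) ^ 2) / of_int (p ^ 2 * m) =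
      of_int (a * fst x ^ 2) / of_int (p ^ 2 * m) + of_int (2 * a * fst x * snd x) / of_int p + of_int (a * m * snd x ^ 2)"
      using assms(1,2) by (simp add: field_simps power2_eq_square)
    then show "unit_exp (of_int (a * (fst x + p * m * snd x) ^ 2) / of_int (p ^ 2 * m)) =
      unit_exp (of_int (a * fst x ^ 2) / of_int (p ^ 2 * m)) * unit_exp (of_int (2 * a * fst x * snd x) / of_int p)"
      by (simp only: unit_exp_add unit_exp_int mult_1_right)
  qed simp
  also have "\<dots> = (\<Sum>u\<in>{0..<p * m}. unit_exp (of_int (a * u ^ 2) / of_int (p ^ 2 * m)) * (\<Sum>v\<in>{0..<p}. unit_exp (of_int ((2 * a * u) * v) / of_int p)))"
    by (simp add: sum_distrib_left sum.cartesian_product case_prod_beta)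
  also have "\<dots> = (\<Sum>u\<in>{0..<p * m}. if p dvd u then unit_exp (of_int (a * u ^ 2) / of_int (p ^ 2 * m)) * of_int p else 0)"
    unfolding unit_exp_character_sum[OF assms(1)]
    using assms(3) by (intro sum.cong refl) (auto simp: coprime_dvd_mult_right_iff coprime_commute)
  also have "\<dots> = (\<Sum>u | u \<in> {0..<p * m} \<and> p dvd u. unit_exp (of_int (a * u ^ 2) / of_int (p ^ 2 * m)) * of_int p)"
    by (subst sum.inter_filter[symmetric]) auto
  also have "\<dots> = (\<Sum>j\<in>{0..<m}. unit_exp (of_int (a * j ^ 2) / of_int m) * of_int p)"
  proof (rule sum.reindex_bij_witness[where i = "\<lambda>j. p * j" and j = "\<lambda>u. u div p"])
    fix u assume "u \<in> {u. u \<in> {0..<p * m} \<and> p dvd u}"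
    then obtain j where j: "u = p * j" "0 \<le> p * j" "p * j < p * m" by auto
    then have "0 \<le> j" "j < m" using assms(1) by (auto simp: zero_le_mult_iff)
    then show "p * (u div p) = u" "u div p \<in> {0..<m}" using j assms(1) by auto
    show "unit_exp (of_int (a * (u div p) ^ 2) / of_int m) * of_int p = unit_exp (of_int (a * u ^ 2) / of_int (p ^ 2 * m)) * of_int p"
      using j assms(1) by (simp add: power_mult_distrib)
  qed (use assms(1) in auto)
  finally show ?thesis by (simp add: gauss_sum_def sum_distrib_left mult.commute)
qed

lemma gauss_sum_half:
  assumes "p = 2 * h + 1" "h \<ge> (0::int)"
  shows "gauss_sum b p = 2 * (\<Sum>j\<in>{1..h}. unit_exp (of_int (b * j ^ 2) / of_int p)) + 1"
proof -
  let ?F = "\<lambda>j. unit_exp (of_int (b * j ^ 2) / of_int p)"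
  have "{0..<p} = {0} \<union> {1..h} \<union> {h+1..<p}" using assms by auto
  then have "gauss_sum b p = ?F 0 + sum ?F {1..h} + sum ?F {h+1..<p}"
    unfolding gauss_sum_def by (simp only:, subst sum.union_disjoint; (subst sum.union_disjoint)?) (use assms in auto)
  also have "sum ?F {h+1..<p} = sum ?F {1..h}"
  proof (rule sum.reindex_bij_witness[where i = "\<lambda>j. p - j" and j = "\<lambda>j. p - j"])
    fix j assume "j \<in> {h + 1..<p}"
    have "[(p - j) ^ 2 = (- j) ^ 2] (mod p)" by (intro cong_pow) (simp add: cong_iff_dvd_diff)
    then show "?F (p - j) = ?F j" by (intro unit_exp_frac_cong cong_mult) auto
  qed (use assms in auto)
  also have "?F 0 = 1" by (simp add: unit_exp_def)
  finally show ?thesis by simp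
qed

text \<open>If \<open>a\<close> is a square modulo \<open>p\<close>, it can be absorbed in the summation variable. If not, then \<open>0\<close>, the nonzero
  values of \<open>b * j ^ 2\<close> and those of \<open>a * b * j ^ 2\<close> run through all residues exactly once. The corresponding
  exponentials sum to zero, so the two Gauss sums are opposite to each other.\<close>
lemma gauss_sum_prime:
  fixes p a b :: int
  assumes p: "prime p" "odd p" and a: "coprime a p" and b: "coprime b p"
  shows "gauss_sum (a * b) p = of_int (Legendre a p) * gauss_sum b p"
proof -
  have "p > 0" using p(1) by (simp add: prime_gt_0_int)
  have nz: "\<not> [a = 0] (mod p)"
    using a p(1) by (metis cong_0_iff coprime_absorb_right not_prime_unit)
  show ?thesis
  proof (cases "QuadRes p a")
    case True
    then obtain y where y: "[y ^ 2 = a] (mod p)" by (auto simp: QuadRes_def)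
    then have "coprime (y ^ 2) p" using a cong_imp_coprime cong_sym by blast
    then have "coprime y p" by simp
    then have "gauss_sum (b * y ^ 2) p = gauss_sum b p" using \<open>p > 0\<close> by (intro gauss_sum_mult_square)
    moreover have "gauss_sum (b * y ^ 2) p = gauss_sum (a * b) p"
      by (rule gauss_sum_cong) (use y cong_scalar_left in \<open>metis mult.commute\<close>)
    ultimately show ?thesis using True nz by (simp add: Legendre_def)
  next
    case False
    define h where "h = p div 2"
    have h: "p = 2 * h + 1" "h \<ge> 0" using p(2) \<open>p > 0\<close> by (auto simp: h_def)
    \<comment> \<open>Representatives of all residues: the values \<open>b * j ^ 2\<close>, and those of \<open>a * b * j ^ 2\<close> for \<open>j \<noteq> 0\<close>.\<close>
    let ?A = "{0..h} \<times> {False} \<union> {1..h} \<times> {True}"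
    let ?g = "\<lambda>x. if snd x then a * b * fst x ^ 2 else b * fst x ^ 2"
    have sq: "i = j" if "0 \<le> i" "i \<le> h" "0 \<le> j" "j \<le> h" "[i ^ 2 = j ^ 2] (mod p)" for i j
    proof -
      have "p dvd (i - j) * (i + j)"
        using that(5) by (simp add: cong_iff_dvd_diff power2_eq_square algebra_simps)
      then have "p dvd i - j \<or> p dvd i + j" using p(1) by (simp add: prime_dvd_mult_iff)
      then show ?thesis
      proof
        assume "p dvd i - j"
        then show ?thesis using that h by (auto dest!: dvd_imp_le_int[rotated])
      next
        assume "p dvd i + j"
        then have "i + j = 0" using that h zdvd_not_zless[of "i + j" p] by linarith
        then show ?thesis using that by linarith
      qed
    qed
    have cross: False if "1 \<le> j" "j \<le> h" "[a * b * j ^ 2 = b * i ^ 2] (mod p)" for i j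
    proof -
      have "[b * (a * j ^ 2) = b * i ^ 2] (mod p)" using that(3) by (simp add: mult_ac)
      then have 1: "[a * j ^ 2 = i ^ 2] (mod p)" using b by (simp add: cong_mult_lcancel)
      have "\<not> p dvd j" using that h zdvd_not_zless by auto
      then have "coprime j p" using p(1) by (metis coprime_commute prime_imp_coprime)
      then obtain k where k: "[j * k = 1] (mod p)" using cong_solve_coprime_int by blast
      have "[a * (j * k) ^ 2 = a * 1 ^ 2] (mod p)" by (intro cong_mult cong_pow k cong_refl)
      moreover have "[(a * j ^ 2) * k ^ 2 = i ^ 2 * k ^ 2] (mod p)" by (intro cong_mult 1 cong_refl)
      ultimately have "[(i * k) ^ 2 = a] (mod p)"
        by (simp add: power_mult_distrib mult_ac) (metis cong_sym cong_trans)
      then show False using False by (auto simp: QuadRes_def)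
    qed
    have "(\<Sum>x\<in>?A. unit_exp (of_int (?g x) / of_int p)) = (\<Sum>j\<in>{0..<p}. unit_exp (of_int j / of_int p))"
    proof (rule periodic_sum_reindex)
      show "unit_exp (of_int j / of_int p) = unit_exp (of_int k / of_int p)" if "[j = k] (mod p)" for j k
        by (rule unit_exp_frac_cong[OF that])
      show "int (card ?A) = p"
        using h by (subst card_Un_disjoint) (auto simp: card_cartesian_product)
      fix x y assume x: "x \<in> ?A" and y: "y \<in> ?A" and c: "[?g x = ?g y] (mod p)"
      obtain i s where xs: "x = (i, s)" by force
      obtain j t where yt: "y = (j, t)" by force
      show "x = y"
      proof (cases "s = t")
        case True
        have "[b * i ^ 2 = b * j ^ 2] (mod p)"
        proof (cases t)
          case True
          then have "[a * (b * i ^ 2) = a * (b * j ^ 2)] (mod p)" using c xs yt \<open>s = t\<close> by (simp add: mult_ac)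
          then show ?thesis using a by (simp add: cong_mult_lcancel)
        qed (use c xs yt True in auto)
        then have "[i ^ 2 = j ^ 2] (mod p)" using b by (simp add: cong_mult_lcancel)
        moreover have "0 \<le> i" "i \<le> h" "0 \<le> j" "j \<le> h" using x y xs yt by auto
        ultimately show ?thesis using sq True xs yt by simp
      next
        case False
        then consider "s" "\<not> t" | "\<not> s" "t" by blast
        then show ?thesis
        proof cases
          case 1 then show ?thesis using cross[of i j] x c xs yt by auto
        next
          case 2 then show ?thesis using cross[of j i] y cong_sym[OF c] xs yt by auto
        qed
      qed
    qed (use \<open>p > 0\<close> in auto)
    also have "\<dots> = 0"
      using unit_exp_character_sum[of p 1] \<open>p > 0\<close> p(1) by (auto simp: not_prime_unit)
    finally have "(\<Sum>x\<in>?A. unit_exp (of_int (?g x) / of_int p)) = 0" .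
    also have "(\<Sum>x\<in>?A. unit_exp (of_int (?g x) / of_int p)) =
      (\<Sum>x\<in>{0..h} \<times> {False}. unit_exp (of_int (?g x) / of_int p)) + (\<Sum>x\<in>{1..h} \<times> {True}. unit_exp (of_int (?g x) / of_int p))"
      by (rule sum.union_disjoint) auto
    also have "(\<Sum>x\<in>{0..h} \<times> {False}. unit_exp (of_int (?g x) / of_int p)) = (\<Sum>j\<in>{0..h}. unit_exp (of_int (b * j ^ 2) / of_int p))"
      by (rule sum.reindex_bij_witness[where i = "\<lambda>j. (j, False)" and j = fst]) auto
    also have "(\<Sum>x\<in>{1..h} \<times> {True}. unit_exp (of_int (?g x) / of_int p)) = (\<Sum>j\<in>{1..h}. unit_exp (of_int (a * b * j ^ 2) / of_int p))"
      by (rule sum.reindex_bij_witness[where i = "\<lambda>j. (j, True)" and j = fst]) auto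
    also have "(\<Sum>j\<in>{0..h}. unit_exp (of_int (b * j ^ 2) / of_int p)) = 1 + (\<Sum>j\<in>{1..h}. unit_exp (of_int (b * j ^ 2) / of_int p))"
    proof -
      have "{0..h} = insert 0 {1..h}" using h by auto
      then show ?thesis by (simp add: unit_exp_def)
    qed
    finally have 0: "1 + (\<Sum>j\<in>{1..h}. unit_exp (of_int (b * j ^ 2) / of_int p)) + (\<Sum>j\<in>{1..h}. unit_exp (of_int (a * b * j ^ 2) / of_int p)) = 0" .
    have double: "(2 * S + 1) + (2 * T + 1) = 0" if "1 + S + T = 0" for S T :: complex
    proof -
      have "(2 * S + 1) + (2 * T + 1) = 2 * (1 + S + T)" by simp
      then show ?thesis using that by simp
    qed
    have "gauss_sum b p + gauss_sum (a * b) p = 0"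
      unfolding gauss_sum_half[OF h] by (rule double[OF 0])
    then show ?thesis using False nz by (simp add: Legendre_def add_eq_0_iff)
  qed
qed

text \<open>Induction on \<open>d\<close>: a prime whose square divides \<open>d\<close> contributes its Legendre symbol twice and can be
  split off with its square; a simple prime factor is split off as a coprime factor.\<close>
theorem gauss_sum_jacobi:
  fixes a b d :: int
  assumes "d > 0" "odd d" "coprime a d" "coprime b d"
  shows "gauss_sum (a * b) d = of_int (\<Prod>p\<in>#prime_factorization d. Legendre a p) * gauss_sum b d"
  using assms
proof (induction "nat d" arbitrary: a b d rule: less_induct)
  case less
  show ?case
  proof (cases "d = 1")
    case False
    then have "\<not> is_unit d" using less.prems(1) by simp
    then obtain p where p: "prime p" "p dvd d"
      using less.prems(1) prime_divisorE[of d] by (metis less_irrefl)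
    then obtain m where d: "d = p * m" by auto
    have p1: "p > 1" using p(1) by (simp add: prime_gt_1_int)
    have m: "m > 0" "m \<noteq> 0" using less.prems(1) d p1 by (auto simp: zero_less_mult_iff)
    have odd: "odd p" "odd m" using less.prems(2) d by auto
    have cop: "coprime a p" "coprime a m" "coprime b p" "coprime b m" using less.prems(3,4) d by auto
    have pf: "prime_factorization d = {#p#} + prime_factorization m"
      using d m p(1) by (simp add: prime_factorization_mult prime_factorization_prime)
    have "1 * m < p * m" using p1 m by (intro mult_strict_right_mono) auto
    then have lt: "nat m < nat d" using d m by simp
    show ?thesis
    proof (cases "p dvd m")
      case True
      then obtain k where k: "m = p * k" by auto
      have k0: "k > 0" using m k p1 by (auto simp: zero_less_mult_iff)
      have dk: "d = p ^ 2 * k" by (simp add: d k power2_eq_square)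
      have "1 * k < p * k" using p1 k0 by (intro mult_strict_right_mono) auto
      then have lt': "nat k < nat d" using lt k by simp
      have pf': "prime_factorization d = {#p, p#} + prime_factorization k"
        using pf k k0 p(1) by (simp add: prime_factorization_mult prime_factorization_prime)
      have cop': "coprime a k" "coprime b k" "odd k" using cop odd k by auto
      have L: "Legendre a p * Legendre a p = 1"
      proof -
        have "\<not> [a = 0] (mod p)"
          using cop(1) p(1) by (metis cong_0_iff coprime_absorb_right not_prime_unit)
        then show ?thesis by (simp add: Legendre_def)
      qed
      have c2: "coprime (2 * x) p" if "coprime x p" for x :: int
        using that odd(1) by simp
      have "gauss_sum (a * b) d = of_int p * gauss_sum (a * b) k"
        unfolding dk using p1 k0 cop by (intro gauss_sum_prime_square c2) auto
      also have "\<dots> = of_int p * (of_int (\<Prod>p\<in>#prime_factorization k. Legendre a p) * gauss_sum b k)"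
        using less.hyps[OF lt' k0 cop'(3,1,2)] by simp
      also have "\<dots> = of_int (\<Prod>p\<in>#prime_factorization k. Legendre a p) * gauss_sum b d"
        unfolding dk using p1 k0 cop by (subst gauss_sum_prime_square[OF _ _ c2]) auto
      also have "(\<Prod>p\<in>#prime_factorization k. Legendre a p) = (\<Prod>p\<in>#prime_factorization d. Legendre a p)"
        unfolding pf' using L by (simp add: mult.assoc[symmetric])
      finally show ?thesis .
    next
      case False
      then have cpm: "coprime m p" using p(1) by (metis coprime_commute prime_imp_coprime)
      have d': "d = m * p" by (simp add: d)
      have "gauss_sum (a * b) d = gauss_sum (a * (b * p)) m * gauss_sum (a * (b * m)) p"
        unfolding d' using gauss_sum_mult_coprime[OF m(1) _ cpm, of "a * b"] p1 by (simp add: mult.assoc)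
      also have "gauss_sum (a * (b * p)) m = of_int (\<Prod>p\<in>#prime_factorization m. Legendre a p) * gauss_sum (b * p) m"
        by (rule less.hyps[OF lt m(1) odd(2) cop(2)]) (use cop cpm in \<open>simp add: coprime_commute\<close>)
      also have "gauss_sum (a * (b * m)) p = of_int (Legendre a p) * gauss_sum (b * m) p"
        by (rule gauss_sum_prime) (use p odd cop cpm in auto)
      also have "of_int (\<Prod>p\<in>#prime_factorization m. Legendre a p) * gauss_sum (b * p) m * (of_int (Legendre a p) * gauss_sum (b * m) p)
        = of_int (\<Prod>p\<in>#prime_factorization d. Legendre a p) * (gauss_sum (b * p) m * gauss_sum (b * m) p)"
        unfolding pf by simp
      also have "gauss_sum (b * p) m * gauss_sum (b * m) p = gauss_sum b d"
        unfolding d' using gauss_sum_mult_coprime[OF m(1) _ cpm, of b] p1 by simp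
      finally show ?thesis .
    qed
  qed simp
qed

section \<open>Binomial series and real Taylor expansions\<close>

text \<open>Two solutions of the same linear equation of first order have a constant quotient.\<close>
lemma fps_ODE_eq:
  fixes y z :: "complex fps"
  assumes "z $ 0 \<noteq> 0" and "fps_deriv y * z = y * fps_deriv z" and "y $ 0 = z $ 0"
  shows "y = z"
proof -
  have inv: "z * inverse z = 1" using assms(1) by (rule inverse_mult_eq_1')
  have "fps_deriv (y * inverse z) = (fps_deriv y * z - y * fps_deriv z) * inverse z ^ 2"
    using inv by (simp add: fps_inverse_deriv[OF assms(1)] power2_eq_square algebra_simps)
  then have "fps_deriv (y * inverse z) = 0" using assms(2) by simp
  then have "y * inverse z = fps_const ((y * inverse z) $ 0)" by (simp only: fps_deriv_eq_0_iff)
  also have "(y * inverse z) $ 0 = 1" using assms(1,3) by simp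
  finally have "y * inverse z = 1" by simp
  then have "y * (z * inverse z) = z" by (simp add: mult.left_commute)
  then show ?thesis using inv by simp
qed

lemma fps_binomial_compose_deriv:
  fixes s :: complex and P :: "complex fps"
  assumes "P $ 0 = 0"
  shows "(1 + P) * fps_deriv (fps_binomial s oo P) = fps_const s * (fps_binomial s oo P) * fps_deriv P"
proof -
  have "(1 + fps_X) * fps_deriv (fps_binomial s) = fps_const s * fps_binomial s"
    unfolding fps_binomial_deriv
    by (subst fps_divide_unit) (simp_all add: mult.left_commute[of "1 + fps_X"] inverse_mult_eq_1')
  then have "((1 + fps_X) * fps_deriv (fps_binomial s)) oo P = (fps_const s * fps_binomial s) oo P" by simp
  then have "(1 + P) * (fps_deriv (fps_binomial s) oo P) = fps_const s * (fps_binomial s oo P)"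
    by (simp add: fps_compose_mult_distrib[OF assms] fps_compose_add_distrib assms)
  then have "(1 + P) * (fps_deriv (fps_binomial s) oo P) * fps_deriv P = fps_const s * (fps_binomial s oo P) * fps_deriv P"
    by simp
  then show ?thesis by (simp add: fps_compose_deriv[OF assms] mult.assoc)
qed

text \<open>The identity \<open>(1 + P)\<^sup>s (1 + Q)\<^sup>s = ((1 + P) (1 + Q))\<^sup>s\<close> of formal power series: both sides have the same
  logarithmic derivative.\<close>
lemma fps_binomial_compose_mult:
  fixes s :: complex and P Q :: "complex fps"
  assumes "P $ 0 = 0" "Q $ 0 = 0"
  shows "(fps_binomial s oo P) * (fps_binomial s oo Q) = fps_binomial s oo (P + Q + P * Q)"
proof (rule fps_ODE_eq)
  let ?R = "P + Q + P * Q"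
  let ?B = "\<lambda>P. fps_binomial s oo P"
  have R0: "?R $ 0 = 0" using assms by simp
  show "(fps_binomial s oo ?R) $ 0 \<noteq> 0" "(?B P * ?B Q) $ 0 = (?B ?R) $ 0" by simp_all
  have 1: "(1 + P) * (1 + Q) * fps_deriv (?B P * ?B Q) = fps_const s * (?B P * ?B Q) * fps_deriv ?R"
  proof -
    have "(1 + P) * (1 + Q) * fps_deriv (?B P * ?B Q) =
        ((1 + P) * fps_deriv (?B P)) * (1 + Q) * ?B Q + (1 + P) * ?B P * ((1 + Q) * fps_deriv (?B Q))"
      by (simp add: algebra_simps)
    also have "\<dots> = fps_const s * (?B P * ?B Q) * fps_deriv ?R"
      unfolding fps_binomial_compose_deriv[OF assms(1)] fps_binomial_compose_deriv[OF assms(2)]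
      by (simp add: algebra_simps)
    finally show ?thesis .
  qed
  have "1 + ?R = (1 + P) * (1 + Q)" by (simp add: algebra_simps)
  then have 2: "(1 + P) * (1 + Q) * fps_deriv (?B ?R) = fps_const s * ?B ?R * fps_deriv ?R"
    using fps_binomial_compose_deriv[OF R0, of s] by simp
  have "(1 + P) * (1 + Q) * (fps_deriv (?B P * ?B Q) * ?B ?R) =
      (1 + P) * (1 + Q) * fps_deriv (?B P * ?B Q) * ?B ?R" by (simp only: mult.assoc)
  also have "\<dots> = (1 + P) * (1 + Q) * fps_deriv (?B ?R) * (?B P * ?B Q)"
    unfolding 1 2 by (simp only: mult_ac)
  finally have "(1 + P) * (1 + Q) * (fps_deriv (?B P * ?B Q) * ?B ?R) =
     (1 + P) * (1 + Q) * (?B P * ?B Q * fps_deriv (?B ?R))" by (simp only: mult_ac)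
  moreover have "(1 + P) * (1 + Q) \<noteq> 0"
  proof -
    have "(1 + P) $ 0 = 1" "(1 + Q) $ 0 = 1" using assms by simp_all
    then have "1 + P \<noteq> 0" "1 + Q \<noteq> 0" by (metis fps_zero_nth zero_neq_one)+
    then show ?thesis by simp
  qed
  ultimately show "fps_deriv (?B P * ?B Q) * ?B ?R = ?B P * ?B Q * fps_deriv (?B ?R)" by simp
qed

text \<open>Both \<open>real_analytic_on\<close> and \<open>taylor_series\<close> speak of functions of a real variable, so the expansion is
  required on a real interval only; \<open>F\<close> still has complex coefficients and a complex disc of convergence.\<close>
definition real_fps_expansion :: "(real \<Rightarrow> complex) \<Rightarrow> real \<Rightarrow> complex fps \<Rightarrow> bool"
  where "real_fps_expansion h x F \<longleftrightarrow>
    (\<exists>\<delta>>0. \<forall>y. \<bar>y - x\<bar> < \<delta> \<longrightarrow> (\<lambda>n. F $ n * of_real (y - x) ^ n) sums h y)"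

lemma real_analytic_onI:
  assumes "\<And>x. x \<in> S \<Longrightarrow> \<exists>F. real_fps_expansion h x F"
  shows "real_analytic_on h S"
  unfolding real_analytic_on_def
proof
  fix x assume "x \<in> S"
  then obtain F where "real_fps_expansion h x F" using assms by blast
  then show "\<exists>a. \<exists>\<delta>>0. \<forall>y. \<bar>y - x\<bar> < \<delta> \<longrightarrow> (\<lambda>n. a n * of_real (y - x) ^ n) sums h y"
    unfolding real_fps_expansion_def by (intro exI[of _ "fps_nth F"]) simp
qed

text \<open>On the interval the function is the restriction of a convergent complex power series, which is
  differentiated termwise.\<close>
lemma real_fps_expansion_deriv:
  assumes "real_fps_expansion h x F"
  shows "real_fps_expansion (\<lambda>y. vector_derivative h (at y)) x (fps_deriv F)"
proof -
  obtain \<delta> where \<delta>: "\<delta> > 0" and sums: "\<And>y. \<bar>y - x\<bar> < \<delta> \<Longrightarrow> (\<lambda>n. F $ n * of_real (y - x) ^ n) sums h y"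
    using assms unfolding real_fps_expansion_def by blast
  have rad: "norm (complex_of_real (y - x)) < fps_conv_radius F" if "\<bar>y - x\<bar> < \<delta>" for y
  proof -
    \<comment> \<open>A point of convergence beyond \<open>y\<close>.\<close>
    let ?r = "(\<bar>y - x\<bar> + \<delta>) / 2"
    have "summable (\<lambda>n. F $ n * of_real ?r ^ n)"
      using sums[of "x + ?r"] that \<delta> by (auto simp: sums_iff field_simps abs_if)
    then have "norm (complex_of_real ?r) \<le> fps_conv_radius F"
      unfolding fps_conv_radius_def by (rule conv_radius_geI)
    moreover have "norm (complex_of_real (y - x)) < norm (complex_of_real ?r)"
      using that \<delta> unfolding norm_of_real by simp
    ultimately show ?thesis by (metis ereal_less(3) less_ereal.simps(1) order_less_le_trans)
  qed
  have h: "h y = eval_fps F (of_real (y - x))" if "\<bar>y - x\<bar> < \<delta>" for y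
    using sums[OF that] by (simp add: eval_fps_def sums_iff)
  have "(\<lambda>n. fps_deriv F $ n * of_real (y - x) ^ n) sums vector_derivative h (at y)" if y: "\<bar>y - x\<bar> < \<delta>" for y
  proof -
    have "((\<lambda>z. eval_fps F (z - of_real x)) has_field_derivative eval_fps (fps_deriv F) (of_real y - of_real x) * 1) (at (of_real y))"
      using rad[OF y] by (intro DERIV_chain2[OF has_field_derivative_eval_fps]) (auto intro!: derivative_eq_intros)
    then have "((\<lambda>t. eval_fps F (of_real t - of_real x)) has_vector_derivative eval_fps (fps_deriv F) (of_real (y - x))) (at y)"
      using has_vector_derivative_real_field by fastforce
    then have "(h has_vector_derivative eval_fps (fps_deriv F) (of_real (y - x))) (at y)"
      by (rule has_vector_derivative_transform_within_open[where S = "{y. \<bar>y - x\<bar> < \<delta>}"])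
        (use h y in \<open>auto intro!: open_Collect_less continuous_intros\<close>)
    then have "vector_derivative h (at y) = eval_fps (fps_deriv F) (of_real (y - x))"
      by (rule vector_derivative_at)
    moreover have "norm (complex_of_real (y - x)) < fps_conv_radius (fps_deriv F)"
      using rad[OF y] fps_conv_radius_deriv[of F] by (metis order_less_le_trans)
    ultimately show ?thesis using sums_eval_fps by metis
  qed
  then show ?thesis unfolding real_fps_expansion_def using \<delta> by blast
qed

lemma taylor_series_eqI:
  assumes "real_fps_expansion h x F"
  shows "taylor_series h x = F"
proof -
  have at_x: "h x = F $ 0" if "real_fps_expansion h x F" for h and F :: "complex fps"
  proof -
    have "(\<lambda>n. F $ n * of_real (x - x) ^ n) sums h x"
      using that unfolding real_fps_expansion_def by (metis abs_zero diff_self)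
    then have "(\<lambda>n. F $ n * 0 ^ n) sums h x" by simp
    then show ?thesis using powser_sums_zero[of "fps_nth F"] sums_unique2 by blast
  qed
  have "((\<lambda>g y. vector_derivative g (at y)) ^^ n) h x = fact n * F $ n" if "real_fps_expansion h x F" for n h and F :: "complex fps"
    using that
  proof (induction n arbitrary: h F)
    case 0 then show ?case using at_x by simp
  next
    case (Suc n)
    show ?case
      using Suc.IH[OF real_fps_expansion_deriv[OF Suc.prems]] by (simp add: funpow_Suc_right algebra_simps del: funpow.simps)
  qed
  from this[OF assms] show ?thesis
    by (simp add: taylor_series_def fps_eq_iff)
qed

lemma real_fps_expansion_diff:
  assumes "real_fps_expansion f x F" "real_fps_expansion g x G"
  shows "real_fps_expansion (\<lambda>y. f y - g y) x (F - G)"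
proof -
  obtain d1 d2 where "d1 > 0" "d2 > 0"
    "\<And>y. \<bar>y - x\<bar> < d1 \<Longrightarrow> (\<lambda>n. F $ n * of_real (y - x) ^ n) sums f y"
    "\<And>y. \<bar>y - x\<bar> < d2 \<Longrightarrow> (\<lambda>n. G $ n * of_real (y - x) ^ n) sums g y"
    using assms unfolding real_fps_expansion_def by metis
  then show ?thesis
    unfolding real_fps_expansion_def
    by (intro exI[of _ "min d1 d2"]) (auto intro!: sums_diff simp: algebra_simps)
qed

lemma real_fps_expansion_add:
  assumes "real_fps_expansion f x F" "real_fps_expansion g x G"
  shows "real_fps_expansion (\<lambda>y. f y + g y) x (F + G)"
proof -
  obtain d1 d2 where "d1 > 0" "d2 > 0"
    "\<And>y. \<bar>y - x\<bar> < d1 \<Longrightarrow> (\<lambda>n. F $ n * of_real (y - x) ^ n) sums f y"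
    "\<And>y. \<bar>y - x\<bar> < d2 \<Longrightarrow> (\<lambda>n. G $ n * of_real (y - x) ^ n) sums g y"
    using assms unfolding real_fps_expansion_def by metis
  then show ?thesis
    unfolding real_fps_expansion_def
    by (intro exI[of _ "min d1 d2"]) (auto intro!: sums_add simp: distrib_right)
qed

lemma has_fps_expansion_imp_real:
  assumes F: "H has_fps_expansion F" and h: "\<forall>\<^sub>F y in nhds x. h y = H (of_real (y - x))"
  shows "real_fps_expansion h x F"
proof -
  have rad: "fps_conv_radius F > 0" and ev: "\<forall>\<^sub>F z in nhds 0. eval_fps F z = H z"
    using F by (auto simp: has_fps_expansion_def)
  have "\<forall>\<^sub>F z in nhds (0::complex). z \<in> eball 0 (fps_conv_radius F)"
    using rad by (intro eventually_nhds_in_open) (auto simp: zero_ereal_def)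
  with ev have "\<forall>\<^sub>F z in nhds 0. eval_fps F z = H z \<and> norm z < fps_conv_radius F"
    by eventually_elim auto
  moreover have "filterlim (\<lambda>y. complex_of_real (y - x)) (nhds 0) (nhds x)"
  proof -
    have "filterlim (\<lambda>y. complex_of_real (y - x)) (nhds (of_real (x - x))) (nhds x)"
      by (intro tendsto_intros filterlim_ident)
    then show ?thesis by simp
  qed
  ultimately have "\<forall>\<^sub>F y in nhds x. eval_fps F (of_real (y - x)) = H (of_real (y - x)) \<and> norm (complex_of_real (y - x)) < fps_conv_radius F"
    unfolding filterlim_iff by fast
  with h have "\<forall>\<^sub>F y in nhds x. (\<lambda>n. F $ n * of_real (y - x) ^ n) sums h y"
  proof eventually_elim
    case (elim y) then show ?case using sums_eval_fps[of "complex_of_real (y - x)" F] by simp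
  qed
  then show ?thesis
    unfolding real_fps_expansion_def eventually_nhds_metric by (auto simp: dist_real_def)
qed

section \<open>The theta series of weight one half\<close>

definition theta :: "nat \<Rightarrow> int \<Rightarrow> complex \<Rightarrow> complex"
  where "theta N r \<tau> = (\<Sum>\<^sub>\<infinity>n::int. unit_exp (of_nat N / 2 * (of_int n + of_int r / of_nat N) ^ 2 * \<tau>))"

lemma infsum_residue_classes:
  fixes F :: "int \<Rightarrow> complex"
  assumes "zsummable F" "d > 0"
  shows "(\<Sum>\<^sub>\<infinity>n. F n) = (\<Sum>j\<in>{0..<d}. \<Sum>\<^sub>\<infinity>m. F (j + d * m))"
proof -
  have bij: "bij_betw (\<lambda>x. fst x + d * snd x) ({0..<d} \<times> UNIV) (UNIV :: int set)"
    by (rule bij_betw_byWitness[where f' = "\<lambda>n. (n mod d, n div d)"]) (use assms(2) in auto)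
  have "F summable_on UNIV" by (rule Infinite_Sum.abs_summable_summable[OF assms(1)])
  then have s: "(\<lambda>x. F (fst x + d * snd x)) summable_on {0..<d} \<times> UNIV"
    using summable_on_reindex_bij_betw[OF bij, of F] by simp
  have "(\<Sum>\<^sub>\<infinity>n. F n) = (\<Sum>\<^sub>\<infinity>x\<in>{0..<d} \<times> UNIV. F (fst x + d * snd x))"
    by (rule infsum_reindex_bij_betw[OF bij, symmetric])
  also have "\<dots> = (\<Sum>\<^sub>\<infinity>j\<in>{0..<d}. \<Sum>\<^sub>\<infinity>m. F (fst (j, m) + d * snd (j, m)))"
    by (rule infsum_Sigma_banach[symmetric]) (rule s)
  also have "\<dots> = (\<Sum>j\<in>{0..<d}. \<Sum>\<^sub>\<infinity>m. F (j + d * m))" by simp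
  finally show ?thesis .
qed

lemma infsum_finite_sum:
  fixes F :: "'b \<Rightarrow> int \<Rightarrow> complex"
  assumes "finite J" "\<And>j. j \<in> J \<Longrightarrow> zsummable (F j)"
  shows "(\<Sum>j\<in>J. \<Sum>\<^sub>\<infinity>l. F j l) = (\<Sum>\<^sub>\<infinity>l. \<Sum>j\<in>J. F j l)"
proof -
  have "((\<lambda>l. \<Sum>j\<in>J. F j l) has_sum (\<Sum>j\<in>J. \<Sum>\<^sub>\<infinity>l. F j l)) UNIV"
    using assms
  proof (induction J rule: finite_induct)
    case (insert x J)
    have "zsummable (F x)" by (rule insert.prems) simp
    then have x: "(F x has_sum (\<Sum>\<^sub>\<infinity>l. F x l)) UNIV"
      by (rule has_sum_infsum[OF Infinite_Sum.abs_summable_summable])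
    have "((\<lambda>l. \<Sum>j\<in>J. F j l) has_sum (\<Sum>j\<in>J. \<Sum>\<^sub>\<infinity>l. F j l)) UNIV"
      by (rule insert.IH) (rule insert.prems, simp)
    from has_sum_add[OF x this] insert.hyps show ?case by simp
  qed simp
  then show ?thesis by (rule infsumI[symmetric])
qed

lemma theta_eq_shifted_gaussian_sum:
  assumes "N > 0"
  shows "theta N r \<tau> = shifted_gaussian_sum (- \<i> * of_nat N * \<tau>) (of_real (of_int r / of_nat N))"
  unfolding theta_def shifted_gaussian_sum_def
  by (rule infsum_cong) (simp add: unit_exp_def algebra_simps)

lemma theta_zsummable:
  assumes "N > 0" "Im \<tau> > 0"
  shows "zsummable (\<lambda>n. unit_exp (of_nat N / 2 * (of_int n + of_int r / of_nat N) ^ 2 * \<tau>))"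
proof -
  have "zsummable (\<lambda>n. exp (- of_real pi * (- \<i> * of_nat N * \<tau>) * (of_int n + of_real (of_int r / of_nat N)) ^ 2))"
    by (rule gauss_shift_zsummable) (use assms in simp)
  then show ?thesis by (simp add: unit_exp_def algebra_simps)
qed

text \<open>For even \<open>N\<close> the part of the exponent that is not constant in \<open>n\<close> has integral coefficients, which makes
  the term at \<open>h / k\<close> periodic in \<open>n\<close> with period \<open>k\<close>.\<close>
lemma theta_coeff_eq:
  fixes h k r n :: int
  assumes "N = 2 * M" "M > 0" "k > 0"
  shows "unit_exp (of_nat N / 2 * (of_int n + of_int r / of_nat N) ^ 2 * (of_int h / of_int k)) =
    unit_exp (of_int (h * (int M * n ^ 2 + r * n)) / of_int k) * unit_exp (of_int (h * r ^ 2) / of_int (4 * int M * k))"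
proof -
  have "of_nat N / 2 * (of_int n + of_int r / of_nat N) ^ 2 * (of_int h / of_int k) =
     of_int (h * (int M * n ^ 2 + r * n)) / of_int k + (of_int (h * r ^ 2) / of_int (4 * int M * k) :: complex)"
    using assms by (simp add: field_simps power2_eq_square)
  then show ?thesis by (simp only: unit_exp_add)
qed

lemma theta_coeff_cong:
  fixes h k r n :: int
  assumes "even N" "N > 0" "k > 0" "[n = n'] (mod k)"
  shows "unit_exp (of_nat N / 2 * (of_int n + of_int r / of_nat N) ^ 2 * (of_int h / of_int k)) =
    unit_exp (of_nat N / 2 * (of_int n' + of_int r / of_nat N) ^ 2 * (of_int h / of_int k))"
proof -
  obtain M where M: "N = 2 * M" "M > 0" using assms(1,2) by auto
  have "unit_exp (of_int (h * (int M * n ^ 2 + r * n)) / of_int k) = unit_exp (of_int (h * (int M * n' ^ 2 + r * n')) / of_int k)"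
    by (intro unit_exp_frac_cong cong_mult cong_add cong_pow assms(4) cong_refl)
  then show ?thesis unfolding theta_coeff_eq[OF M assms(3)] by simp
qed

lemma theta_summand_split:
  fixes h k r j m :: int
  assumes "even N" "N > 0" "k > 0"
  shows "unit_exp (of_nat N / 2 * (of_int (j + k * m) + of_int r / of_nat N) ^ 2 * (of_int h / of_int k + \<i> * w)) =
    unit_exp (of_nat N / 2 * (of_int j + of_int r / of_nat N) ^ 2 * (of_int h / of_int k)) *
    exp (- of_real pi * (of_nat N * of_int k ^ 2 * w) * (of_int m + of_real ((of_int j + of_int r / of_nat N) / of_int k)) ^ 2)"
proof -
  define \<beta> where "\<beta> = (of_int j + of_int r / of_nat N) / (of_int k :: real)"
  have "unit_exp (of_nat N / 2 * (of_int (j + k * m) + of_int r / of_nat N) ^ 2 * (of_int h / of_int k)) =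
      unit_exp (of_nat N / 2 * (of_int j + of_int r / of_nat N) ^ 2 * (of_int h / of_int k))"
    by (rule theta_coeff_cong) (use assms in \<open>auto simp: cong_def\<close>)
  moreover have "unit_exp (of_nat N / 2 * (of_int (j + k * m) + of_int r / of_nat N) ^ 2 * (\<i> * w)) =
      exp (- of_real pi * (of_nat N * of_int k ^ 2 * w) * (of_int m + of_real \<beta>) ^ 2)"
  proof -
    have "complex_of_int (j + k * m) + of_int r / of_nat N = of_int k * (of_int m + of_real \<beta>)"
      using assms(3) by (simp add: \<beta>_def field_simps)
    then have "(of_int (j + k * m) + of_int r / of_nat N) ^ 2 = of_int k ^ 2 * (of_int m + complex_of_real \<beta>) ^ 2"
      by (simp only: power_mult_distrib)
    then show ?thesis by (simp add: unit_exp_def algebra_simps)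
  qed
  ultimately show ?thesis unfolding \<beta>_def by (simp only: distrib_left unit_exp_add)
qed

text \<open>Sorting the summation index modulo \<open>k\<close> freezes the oscillating factor, and Poisson summation applies to each
  residue class. As \<open>w\<close> tends to zero only the term with \<open>l = 0\<close> survives; its coefficient is a quadratic
  exponential sum modulo \<open>k\<close>.\<close>
theorem theta_at_rational:
  fixes h k r :: int
  assumes "even N" "N > 0" "k > 0" "Re w > 0"
  defines "A \<equiv> of_nat N * of_int k ^ 2 * w"
  defines "g \<equiv> (\<lambda>l::int. \<Sum>j\<in>{0..<k}. unit_exp (of_nat N / 2 * (of_int j + of_int r / of_nat N) ^ 2 * (of_int h / of_int k)) *
      unit_exp (of_int l * ((of_int j + of_int r / of_nat N) / of_int k)))"
  shows "theta N r (of_int h / of_int k + \<i> * w) = (\<Sum>\<^sub>\<infinity>l. exp (- of_real pi * of_int l ^ 2 / A) * g l) / csqrt A"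
proof -
  define c where "c j = unit_exp (of_nat N / 2 * (of_int j + of_int r / of_nat N) ^ 2 * (of_int h / of_int k))" for j :: int
  define \<beta> where "\<beta> j = (of_int j + of_int r / of_nat N) / (of_int k :: real)" for j :: int
  have A: "Re A > 0" using assms(2-4) unfolding A_def
    by (simp add: mult_pos_pos flip: of_nat_mult of_int_power of_int_mult)
  have Ai: "Re (1 / A) > 0" using A by (auto simp: Re_divide intro!: divide_pos_pos add_pos_nonneg)
  have zs: "zsummable (\<lambda>n. unit_exp (of_nat N / 2 * (of_int n + of_int r / of_nat N) ^ 2 * (of_int h / of_int k + \<i> * w)))"
    by (rule theta_zsummable) (use assms in auto)
  have summand: "unit_exp (of_nat N / 2 * (of_int (j + k * m) + of_int r / of_nat N) ^ 2 * (of_int h / of_int k + \<i> * w)) =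
      c j * exp (- of_real pi * A * (of_int m + of_real (\<beta> j)) ^ 2)" for j m
    unfolding c_def \<beta>_def A_def by (rule theta_summand_split[OF assms(1-3)])
  have "theta N r (of_int h / of_int k + \<i> * w) =
      (\<Sum>j\<in>{0..<k}. \<Sum>\<^sub>\<infinity>m. c j * exp (- of_real pi * A * (of_int m + of_real (\<beta> j)) ^ 2))"
    unfolding theta_def by (subst infsum_residue_classes[OF zs assms(3)]) (simp only: summand)
  also have "\<dots> = (\<Sum>j\<in>{0..<k}. c j * (dual_gaussian_sum A (of_real (\<beta> j)) / csqrt A))"
    by (simp only: infsum_cmult_right' shifted_gaussian_sum_def[symmetric] gaussian_poisson[OF A])
  also have "\<dots> = (\<Sum>j\<in>{0..<k}. \<Sum>\<^sub>\<infinity>l. c j * (exp (- of_real pi * of_int l ^ 2 / A) * unit_exp (of_int l * of_real (\<beta> j)))) / csqrt A"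
    by (simp add: dual_gaussian_sum_def infsum_cmult_right' sum_divide_distrib)
  also have "(\<Sum>j\<in>{0..<k}. \<Sum>\<^sub>\<infinity>l. c j * (exp (- of_real pi * of_int l ^ 2 / A) * unit_exp (of_int l * of_real (\<beta> j)))) =
      (\<Sum>\<^sub>\<infinity>l. \<Sum>j\<in>{0..<k}. c j * (exp (- of_real pi * of_int l ^ 2 / A) * unit_exp (of_int l * of_real (\<beta> j))))"
    by (rule infsum_finite_sum)
      (simp, subst norm_mult, rule summable_on_cmult_right, rule dual_gaussian_sum_has_derivative(3)[OF Ai])
  also have "\<dots> = (\<Sum>\<^sub>\<infinity>l. exp (- of_real pi * of_int l ^ 2 / A) * g l)"
    by (rule infsum_cong) (simp add: g_def c_def \<beta>_def sum_distrib_left mult_ac)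
  finally show ?thesis .
qed

text \<open>The difference of two arguments in \<open>(- pi / 2, pi / 2)\<close> is again a principal argument.\<close>
lemma Ln_quotient_halfplane:
  assumes "Re A > 0" "Re B > 0" "A = B * v"
  shows "Ln v = Ln A - Ln B"
proof -
  have nz: "A \<noteq> 0" "B \<noteq> 0" using assms by auto
  have "\<bar>Im (Ln A)\<bar> < pi / 2" "\<bar>Im (Ln B)\<bar> < pi / 2"
    using Re_Ln_pos_lt[OF nz(1)] Re_Ln_pos_lt[OF nz(2)] assms(1,2) by blast+
  then show ?thesis
    using assms(3) nz by (intro Ln_unique) (auto simp: exp_diff)
qed

lemma csqrt_quotient_halfplane:
  assumes "Re A > 0" "Re B > 0" "A = B * v"
  shows "csqrt A = csqrt B * csqrt v"
proof -
  have nz: "A \<noteq> 0" "B \<noteq> 0" "v \<noteq> 0" using assms by auto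
  have "Ln v = Ln A - Ln B" by (rule Ln_quotient_halfplane[OF assms])
  then show ?thesis using nz by (simp add: csqrt_exp_Ln exp_add[symmetric] add_divide_distrib[symmetric])
qed

lemma csqrt_divide_of_real:
  assumes "s > 0"
  shows "csqrt (w / of_real s) = csqrt w / of_real (sqrt s)"
proof (rule csqrt_unique)
  show "(csqrt w / of_real (sqrt s)) ^ 2 = w / of_real s"
    using assms by (simp add: power_divide flip: of_real_power)
  show "0 < Re (csqrt w / of_real (sqrt s)) \<or> Re (csqrt w / of_real (sqrt s)) = 0 \<and> 0 \<le> Im (csqrt w / of_real (sqrt s))"
    using csqrt_principal[of w] assms by (auto simp: Re_divide_of_real Im_divide_of_real simp del: csqrt.sel)
qed

lemma dual_gaussian_sum_uminus: "dual_gaussian_sum A (- z) = dual_gaussian_sum A z"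
proof -
  have "dual_gaussian_sum A (- z) = (\<Sum>\<^sub>\<infinity>n::int. exp (- of_real pi * of_int (- n) ^ 2 / A) * unit_exp (of_int (- n) * - z))"
    unfolding dual_gaussian_sum_def
    by (rule infsum_reindex_bij_betw[symmetric]) (rule bij_uminus)
  then show ?thesis by (simp add: dual_gaussian_sum_def)
qed

lemma moebius_Im_pos:
  fixes a b c d :: real
  assumes "a * d - b * c = 1" "Im \<tau> > 0"
  shows "Im ((of_real a * \<tau> + of_real b) / (of_real c * \<tau> + of_real d)) = Im \<tau> / norm (of_real c * \<tau> + of_real d) ^ 2"
    and "of_real c * \<tau> + of_real d \<noteq> 0"
proof -
  show "of_real c * \<tau> + of_real d \<noteq> 0"
  proof
    assume 0: "of_real c * \<tau> + of_real d = 0"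
    then have "c * Im \<tau> = 0" by (simp add: complex_eq_iff)
    then have "c = 0" using assms(2) by simp
    with 0 have "d = 0" by simp
    with \<open>c = 0\<close> assms(1) show False by simp
  qed
  have "Im ((of_real a * \<tau> + of_real b) / (of_real c * \<tau> + of_real d)) = (a * d - b * c) * Im \<tau> / norm (of_real c * \<tau> + of_real d) ^ 2"
    unfolding Im_divide' by (simp add: algebra_simps)
  then show "Im ((of_real a * \<tau> + of_real b) / (of_real c * \<tau> + of_real d)) = Im \<tau> / norm (of_real c * \<tau> + of_real d) ^ 2"
    using assms(1) by simp
qed

text \<open>The point \<open>\<gamma>\<tau>\<close> is \<open>b / d + \<i> * w\<close> with \<open>w = - \<i> * \<tau> / (d * (c * \<tau> + d))\<close>, so Poisson summation modulo \<open>d\<close>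
  applies. In the dual sum, \<open>ad - bc = 1\<close> allows to complete a square, and because of the congruences modulo
  \<open>2N\<close> this amounts to a shift of the residue \<open>j\<close>: the sum over \<open>j\<close> splits off as a Gauss sum. What remains is the
  dual sum at \<open>\<tau>\<close>, and Poisson summation modulo 1 leads back to \<open>theta N r \<tau>\<close>. The case \<open>s = - 1\<close> serves the
  matrices with negative \<open>d\<close>, after a change of sign of all entries.\<close>
theorem theta_transform_gauss_sum:
  fixes a b c d r s :: int
  assumes N: "N = 2 * M" "M > 0" and det: "a * d - b * c = 1" and d: "d > 0"
    and s: "s = 1 \<or> s = - 1" and a_cong: "[a = s] (mod 2 * int N)" and d_cong: "[d = s] (mod 2 * int N)"
    and c_cong: "[c = 0] (mod 2 * int N)" and \<tau>: "Im \<tau> > 0"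
  shows "theta N r ((of_int a * \<tau> + of_int b) / (of_int c * \<tau> + of_int d)) =
    unit_exp (of_int (s * b * r ^ 2) / of_int (2 * int N)) * gauss_sum (b * int M) d / of_real (sqrt (of_int d)) *
      csqrt (of_int c * \<tau> + of_int d) * theta N r \<tau>"
proof -
  define u where "u = of_int c * \<tau> + of_int d"
  have rdet: "real_of_int a * of_int d - of_int b * of_int c = 1"
    using det by (simp flip: of_int_mult of_int_diff)
  have cdet: "complex_of_int a * of_int d - of_int b * of_int c = 1"
    using det by (simp flip: of_int_mult of_int_diff)
  have u0: "u \<noteq> 0" using moebius_Im_pos(2)[OF rdet \<tau>] by (simp add: u_def)
  have \<tau>0: "\<tau> \<noteq> 0" using \<tau> by auto
  have N0: "N > 0" "even N" using N by auto
  define w where "w = - \<i> * \<tau> / (of_int d * u)"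
  have arg: "(of_int a * \<tau> + of_int b) / u = of_int b / of_int d + \<i> * w"
  proof -
    have "of_int d * (of_int a * \<tau> + of_int b) = of_int b * u + \<tau> * (complex_of_int a * of_int d - of_int b * of_int c)"
      by (simp add: u_def algebra_simps)
    then show ?thesis using u0 d cdet by (simp add: w_def field_simps)
  qed
  have "Re w = Im (of_int b / of_int d + \<i> * w)" by simp
  also have "\<dots> = Im \<tau> / norm u ^ 2"
    using moebius_Im_pos(1)[OF rdet \<tau>] by (simp add: u_def arg[unfolded u_def, symmetric])
  finally have w: "Re w > 0" using \<tau> u0 by simp
  define A where "A = of_nat N * of_int d ^ 2 * w"
  define A0 where "A0 = - \<i> * of_nat N * \<tau>"
  have A: "Re A > 0" using w N0 d unfolding A_def
    by (simp add: mult_pos_pos flip: of_nat_mult of_int_power of_int_mult)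
  have A0: "Re A0 > 0" using \<tau> N0 by (simp add: A0_def)
  have AA: "A0 = A * (u / of_int d)" using u0 d by (simp add: A_def A0_def w_def field_simps power2_eq_square)
  \<comment> \<open>The coefficient of the residue \<open>j\<close> in the decomposition of theta modulo \<open>d\<close>.\<close>
  define phase where "phase j = unit_exp (of_int (b * (r + int N * j) ^ 2) / of_int (2 * int N * d))" for j
  have phase_cong: "phase i = phase j" if "[i = j] (mod d)" for i j
  proof -
    have "phase j = unit_exp (of_nat N / 2 * (of_int j + of_int r / of_nat N) ^ 2 * (of_int b / of_int d))" for j
      unfolding phase_def using N0 d by (intro arg_cong[of _ _ unit_exp]) (simp add: field_simps power2_eq_square)
    then show ?thesis using theta_coeff_cong[OF N0(2,1) d that, of r b] by simp
  qed
  have phase_shift: "(\<Sum>j\<in>{0..<d}. phase (j + t)) = (\<Sum>j\<in>{0..<d}. phase j)" for t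
  proof (rule periodic_sum_reindex[OF d])
    fix x y assume *: "x \<in> {0..<d}" "y \<in> {0..<d}" "[x + t = y + t] (mod d)"
    then have "[x = y] (mod d)" by (simp add: cong_add_rcancel)
    with * show "x = y" by (auto simp: cong_def)
  qed (use phase_cong d in auto)
  obtain a' where a': "a = s + 2 * int N * a'" using a_cong by (metis cong_iff_lin cong_sym)
  obtain d' where d': "d = s + 2 * int N * d'" using d_cong by (metis cong_iff_lin cong_sym)
  obtain c' where c': "c = 2 * int N * c'" using c_cong by (auto simp: cong_0_iff)
  have G: "(\<Sum>j\<in>{0..<d}. phase j) = unit_exp (of_int (s * b * r ^ 2) / of_int (2 * int N)) * gauss_sum (b * int M) d"
  proof -
    have ss: "s * s = 1" using s by auto
    have sd: "s * d = 1 + 2 * int N * (s * d')" unfolding d' using ss by (simp add: algebra_simps)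
    \<comment> \<open>This shift of \<open>j\<close> makes \<open>r + N * j\<close> congruent to \<open>N * j\<close> modulo \<open>d\<close>, so that the linear term disappears.\<close>
    have "phase (j + 2 * r * s * d') = unit_exp (of_int (s * b * r ^ 2) / of_int (2 * int N)) * unit_exp (of_int (b * int M * j ^ 2) / of_int d)" for j
    proof -
      have eq: "r + int N * (j + 2 * r * s * d') = r * (s * d) + int N * j"
        unfolding sd by (simp add: algebra_simps)
      have "b * (r * (s * d) + int N * j) ^ 2 = b * r ^ 2 * d ^ 2 * (s * s) + 2 * int N * d * (b * r * s * j) + int N ^ 2 * b * j ^ 2"
        by (simp add: power2_eq_square algebra_simps)
      then have sq: "b * (r * (s * d) + int N * j) ^ 2 = b * r ^ 2 * d ^ 2 + 2 * int N * d * (b * r * s * j) + int N ^ 2 * b * j ^ 2"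
        by (simp only: ss mult_1_right)
      have "complex_of_int (b * (r * (s * d) + int N * j) ^ 2) / of_int (2 * int N * d) =
          of_int (b * r ^ 2 * d) / of_int (2 * int N) + of_int (b * r * s * j) + of_int (int N * b * j ^ 2) / of_int (2 * d)"
        unfolding sq using d N0 by (simp add: field_simps power2_eq_square)
      also have "complex_of_int (int N * b * j ^ 2) / of_int (2 * d) = of_int (b * int M * j ^ 2) / of_int d"
        using d N by (simp add: field_simps)
      also have "complex_of_int (b * r ^ 2 * d) / of_int (2 * int N) = of_int (s * b * r ^ 2) / of_int (2 * int N) + of_int (b * r ^ 2 * d')"
        unfolding d' using N0 by (simp add: field_simps)
      finally show ?thesis unfolding phase_def eq by (simp only: unit_exp_add unit_exp_int mult_1_right)
    qed
    then have "(\<Sum>j\<in>{0..<d}. phase (j + 2 * r * s * d')) = unit_exp (of_int (s * b * r ^ 2) / of_int (2 * int N)) * gauss_sum (b * int M) d"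
      by (simp add: gauss_sum_def sum_distrib_left)
    then show ?thesis unfolding phase_shift .
  qed
  have dual: "exp (- of_real pi * of_int l ^ 2 / A) *
      (\<Sum>j\<in>{0..<d}. unit_exp (of_nat N / 2 * (of_int j + of_int r / of_nat N) ^ 2 * (of_int b / of_int d)) *
         unit_exp (of_int l * ((of_int j + of_int r / of_nat N) / of_int d))) =
      (\<Sum>j\<in>{0..<d}. phase j) * (exp (- of_real pi * of_int l ^ 2 / A0) * unit_exp (of_int l * of_real (of_int (s * r) / of_nat N)))" for l
  proof -
    have "1 / A = 1 / A0 + \<i> * of_int c / (of_nat N * of_int d)"
    proof -
      have "1 / A = u / (of_int d * A0)" unfolding AA using A u0 d by (auto simp: field_simps)
      also have "u / (of_int d * A0) = 1 / A0 + \<i> * of_int c / (of_nat N * of_int d)"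
        using \<tau>0 N0 d by (simp add: A0_def u_def field_simps)
      finally show ?thesis .
    qed
    then have "- of_real pi * of_int l ^ 2 / A = - of_real pi * of_int l ^ 2 * (1 / A0 + \<i> * of_int c / (of_nat N * of_int d))"
      by (metis divide_inverse inverse_eq_divide)
    also have "\<dots> = - of_real pi * of_int l ^ 2 / A0 + 2 * of_real pi * \<i> * (of_int (- c * l ^ 2) / of_int (2 * int N * d))"
      using N0 d by (simp add: distrib_left)
    finally have "- of_real pi * of_int l ^ 2 / A = - of_real pi * of_int l ^ 2 / A0 + 2 * of_real pi * \<i> * (of_int (- c * l ^ 2) / of_int (2 * int N * d))" .
    then have e: "exp (- of_real pi * of_int l ^ 2 / A) = exp (- of_real pi * of_int l ^ 2 / A0) * unit_exp (of_int (- c * l ^ 2) / of_int (2 * int N * d))"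
      by (simp only: exp_add unit_exp_def)
    have j: "unit_exp (of_int (- c * l ^ 2) / of_int (2 * int N * d)) *
        (unit_exp (of_nat N / 2 * (of_int j + of_int r / of_nat N) ^ 2 * (of_int b / of_int d)) *
         unit_exp (of_int l * ((of_int j + of_int r / of_nat N) / of_int d))) =
        unit_exp (of_int l * of_real (of_int (s * r) / of_nat N)) * phase (j + (- 2 * c' * l))" for j
    proof -
      define m where "m = r + int N * j"
      have m: "complex_of_int j + of_int r / of_nat N = of_int m / of_nat N" using N0 by (simp add: m_def field_simps)
      have "complex_of_int (- c * l ^ 2) / of_int (2 * int N * d) + (of_nat N / 2 * (of_int m / of_nat N) ^ 2 * (of_int b / of_int d) +
          of_int l * ((of_int m / of_nat N) / of_int d)) = of_int (b * m ^ 2 + 2 * l * m - c * l ^ 2) / of_int (2 * int N * d)"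
        using N0 d by (simp add: field_simps power2_eq_square)
      \<comment> \<open>Completing the square in \<open>m\<close>, up to multiples of \<open>d\<close>.\<close>
      also have "b * m ^ 2 + 2 * l * m - c * l ^ 2 = b * (m - c * l) ^ 2 + 2 * a * d * l * m - a * c * d * l ^ 2"
      proof -
        have "b * (m - c * l) ^ 2 + 2 * a * d * l * m - a * c * d * l ^ 2 =
          b * m ^ 2 + (a * d - b * c) * (2 * l * m) - (a * d - b * c) * c * l ^ 2"
          by (simp add: power2_eq_square algebra_simps)
        then show ?thesis unfolding det by simp
      qed
      also have "complex_of_int (b * (m - c * l) ^ 2 + 2 * a * d * l * m - a * c * d * l ^ 2) / of_int (2 * int N * d) =
          of_int (b * (m - c * l) ^ 2) / of_int (2 * int N * d) + of_int (a * l * m) / of_nat N - of_int (a * c * l ^ 2) / of_int (2 * int N)"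
        using N0 d by (simp add: field_simps)
      also have "complex_of_int (a * c * l ^ 2) / of_int (2 * int N) = of_int (a * c' * l ^ 2)"
        unfolding c' using N0 by simp
      also have "complex_of_int (a * l * m) / of_nat N = of_int l * of_real (of_int (s * r) / of_nat N) + of_int (s * l * j + 2 * a' * l * m)"
        unfolding a' m_def using N0 by (simp add: field_simps)
      finally have "complex_of_int (- c * l ^ 2) / of_int (2 * int N * d) + (of_nat N / 2 * (of_int m / of_nat N) ^ 2 * (of_int b / of_int d) +
          of_int l * ((of_int m / of_nat N) / of_int d)) =
          of_int l * of_real (of_int (s * r) / of_nat N) + of_int (b * (m - c * l) ^ 2) / of_int (2 * int N * d) + of_int (s * l * j + 2 * a' * l * m - a * c' * l ^ 2)"
        by simp
      moreover have "m - c * l = r + int N * (j + (- 2 * c' * l))" by (simp add: m_def c' algebra_simps)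
      ultimately show ?thesis unfolding phase_def m unit_exp_add[symmetric] by (simp only: unit_exp_add unit_exp_int mult_1_right)
    qed
    have "unit_exp (of_int (- c * l ^ 2) / of_int (2 * int N * d)) *
        (\<Sum>j\<in>{0..<d}. unit_exp (of_nat N / 2 * (of_int j + of_int r / of_nat N) ^ 2 * (of_int b / of_int d)) *
         unit_exp (of_int l * ((of_int j + of_int r / of_nat N) / of_int d))) =
        (\<Sum>j\<in>{0..<d}. unit_exp (of_int l * of_real (of_int (s * r) / of_nat N)) * phase (j + (- 2 * c' * l)))"
      unfolding sum_distrib_left by (rule sum.cong[OF refl j])
    also have "\<dots> = unit_exp (of_int l * of_real (of_int (s * r) / of_nat N)) * (\<Sum>j\<in>{0..<d}. phase j)"
      by (simp only: sum_distrib_left[symmetric] phase_shift)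
    finally show ?thesis unfolding e by (simp only: mult.assoc) (simp only: mult_ac)
  qed
  have "theta N r ((of_int a * \<tau> + of_int b) / u) = (\<Sum>\<^sub>\<infinity>l. exp (- of_real pi * of_int l ^ 2 / A) *
      (\<Sum>j\<in>{0..<d}. unit_exp (of_nat N / 2 * (of_int j + of_int r / of_nat N) ^ 2 * (of_int b / of_int d)) *
         unit_exp (of_int l * ((of_int j + of_int r / of_nat N) / of_int d)))) / csqrt A"
    unfolding arg A_def by (rule theta_at_rational[OF N0(2,1) d w])
  also have "\<dots> = (\<Sum>j\<in>{0..<d}. phase j) * dual_gaussian_sum A0 (of_real (of_int (s * r) / of_nat N)) / csqrt A"
    unfolding dual by (simp only: infsum_cmult_right' dual_gaussian_sum_def)
  also have "dual_gaussian_sum A0 (of_real (of_int (s * r) / of_nat N)) = dual_gaussian_sum A0 (of_real (of_int r / of_nat N))"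
    using s dual_gaussian_sum_uminus[of A0 "of_real (of_int r / of_nat N)"] by auto
  also have "\<dots> = theta N r \<tau> * csqrt A0"
    unfolding theta_eq_shifted_gaussian_sum[OF N0(1)] A0_def[symmetric] gaussian_poisson[OF A0] using A0 by auto
  also have "csqrt A0 = csqrt A * (csqrt u / of_real (sqrt (of_int d)))"
    using csqrt_quotient_halfplane[OF A0 A AA] csqrt_divide_of_real[of "of_int d" u] d by simp
  also have "(\<Sum>j\<in>{0..<d}. phase j) * (theta N r \<tau> * (csqrt A * (csqrt u / of_real (sqrt (of_int d))))) / csqrt A =
      (\<Sum>j\<in>{0..<d}. phase j) / of_real (sqrt (of_int d)) * csqrt u * theta N r \<tau>"
    using A by auto
  finally show ?thesis unfolding G u_def by simp
qed

text \<open>All terms of the series are positive at \<open>\<i>\<close>; the value is cancelled in the next two proofs.\<close>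
lemma theta_2_0_nonzero: "theta 2 0 \<i> \<noteq> 0"
proof -
  let ?f = "\<lambda>n::int. exp (- 2 * pi * of_int n ^ 2)"
  have eq: "unit_exp (of_nat 2 / 2 * (of_int n + of_int 0 / of_nat 2) ^ 2 * \<i>) = of_real (?f n)" for n :: int
    by (simp add: unit_exp_def exp_of_real[symmetric] mult_ac)
  have "zsummable (\<lambda>n. of_real (?f n))"
    using theta_zsummable[of 2 \<i> 0] unfolding eq by simp
  then have s: "?f summable_on UNIV" by simp
  then have "theta 2 0 \<i> = of_real (\<Sum>\<^sub>\<infinity>n. ?f n)"
    unfolding theta_def eq by (metis has_sum_infsum has_sum_of_real infsumI)
  moreover have "sum ?f {0} \<le> (\<Sum>\<^sub>\<infinity>n. ?f n)"
    by (rule finite_sum_le_infsum[OF s]) auto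
  ultimately show ?thesis by auto
qed

text \<open>The factorization of the matrix with rows \<open>(1, 1)\<close> and \<open>(4k, d)\<close>, \<open>d = 4k + 1\<close>, into the lower triangular matrix
  with lower row \<open>(4k, 1)\<close> and the translation by 1 gives the theta value at the image of \<open>\<i>\<close> without a
  Gauss sum. Comparison with the direct transformation determines the Gauss sum, including its sign.\<close>
lemma gauss_sum_1_pos:
  assumes "d > 0" "[d = 1] (mod 4)"
  shows "gauss_sum 1 d = of_real (sqrt (of_int d))"
proof -
  obtain k where k: "d = 1 + 4 * k" using assms(2) by (metis cong_iff_lin cong_sym)
  let ?w = "of_int (4 * k) * \<i> + of_int d :: complex"
  have T: "theta 2 0 (\<i> + 1) = theta 2 0 \<i>"
    using theta_transform_gauss_sum[of 2 1 1 1 1 0 1 \<i> 0] by (simp add: unit_exp_def)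
  have arg: "(of_int 1 * (\<i> + 1) + of_int 0) / ?w = (of_int 1 * \<i> + of_int 1) / ?w"
    by simp
  have "theta 2 0 ((of_int 1 * (\<i> + 1) + of_int 0) / (of_int (4 * k) * (\<i> + 1) + of_int 1)) = csqrt (of_int (4 * k) * (\<i> + 1) + of_int 1) * theta 2 0 (\<i> + 1)"
    using theta_transform_gauss_sum[of 2 1 1 1 0 "4 * k" 1 "\<i> + 1" 0] by (simp add: unit_exp_def cong_def)
  also have "of_int (4 * k) * (\<i> + 1) + of_int 1 = ?w" by (simp add: k algebra_simps)
  finally have 1: "theta 2 0 ((of_int 1 * \<i> + of_int 1) / ?w) = csqrt ?w * theta 2 0 \<i>"
    unfolding arg T .
  have 2: "theta 2 0 ((of_int 1 * \<i> + of_int 1) / ?w) = gauss_sum 1 d / of_real (sqrt (of_int d)) * csqrt ?w * theta 2 0 \<i>"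
    using theta_transform_gauss_sum[of 2 1 1 d 1 "4 * k" 1 \<i> 0] assms by (simp add: unit_exp_def k cong_def)
  have "?w \<noteq> 0" using assms by (auto simp: complex_eq_iff)
  then have "csqrt ?w \<noteq> 0" by (simp del: csqrt.simps)
  moreover have "1 * csqrt ?w * theta 2 0 \<i> = gauss_sum 1 d / of_real (sqrt (of_int d)) * csqrt ?w * theta 2 0 \<i>"
    using trans[OF 1[symmetric] 2] by (simp only: mult_1)
  ultimately have "1 = gauss_sum 1 d / of_real (sqrt (of_int d))"
    using theta_2_0_nonzero by (simp only: mult_cancel_right simp_thms)
  then show ?thesis using assms by (simp add: field_simps)
qed

text \<open>The same comparison for the rows \<open>(- 1, - 1)\<close> and \<open>(4k, d)\<close>, \<open>d = 4k - 1\<close>. The two matrices now differ by a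
  sign, and \<open>csqrt (- w) = - \<i> * csqrt w\<close> for \<open>w = 4k * \<i> + d\<close>.\<close>
lemma gauss_sum_1_neg:
  assumes "d > 0" "[d = - 1] (mod 4)"
  shows "gauss_sum 1 d = \<i> * of_real (sqrt (of_int d))"
proof -
  obtain k where k: "d = - 1 + 4 * k" using assms(2) by (metis cong_iff_lin cong_sym)
  have "k > 0" using assms k by linarith
  let ?w = "of_int (4 * k) * \<i> + of_int d :: complex"
  have Im: "Im ?w > 0" using \<open>k > 0\<close> by simp
  have T: "theta 2 0 (\<i> + 1) = theta 2 0 \<i>"
    using theta_transform_gauss_sum[of 2 1 1 1 1 0 1 \<i> 0] by (simp add: unit_exp_def)
  have w: "of_int (- 4 * k) * (\<i> + 1) + of_int 1 = - ?w" by (simp add: k algebra_simps)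
  have arg: "(of_int 1 * (\<i> + 1) + of_int 0) / - ?w = (of_int (- 1) * \<i> + of_int (- 1)) / ?w"
  proof -
    have "of_int (- 1) * \<i> + of_int (- 1) = - (of_int 1 * (\<i> + 1) + of_int 0)" by simp
    then show ?thesis by (simp only: minus_divide_left[symmetric] minus_divide_right[symmetric])
  qed
  have "theta 2 0 ((of_int 1 * (\<i> + 1) + of_int 0) / (of_int (- 4 * k) * (\<i> + 1) + of_int 1)) = csqrt (of_int (- 4 * k) * (\<i> + 1) + of_int 1) * theta 2 0 (\<i> + 1)"
    using theta_transform_gauss_sum[of 2 1 1 1 0 "- 4 * k" 1 "\<i> + 1" 0] by (simp add: unit_exp_def cong_def)
  then have 1: "theta 2 0 ((of_int (- 1) * \<i> + of_int (- 1)) / ?w) = csqrt (- ?w) * theta 2 0 \<i>"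
    unfolding w arg T .
  have 2: "theta 2 0 ((of_int (- 1) * \<i> + of_int (- 1)) / ?w) = gauss_sum (- 1) d / of_real (sqrt (of_int d)) * csqrt ?w * theta 2 0 \<i>"
    using theta_transform_gauss_sum[of 2 1 "- 1" d "- 1" "4 * k" "- 1" \<i> 0] assms by (simp add: unit_exp_def k cong_def)
  have "csqrt (- (- ?w)) = \<i> * csqrt (- ?w)"
    by (rule csqrt_minus) (use Im in simp)
  then have "- \<i> * csqrt ?w = - \<i> * (\<i> * csqrt (- ?w))" by (simp only: minus_minus)
  also have "\<dots> = csqrt (- ?w)" by (simp add: mult.assoc[symmetric] del: csqrt.simps)
  finally have 3: "csqrt (- ?w) = - \<i> * csqrt ?w" by (rule sym)
  have "?w \<noteq> 0" using Im by (metis less_irrefl zero_complex.sel(2))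
  then have "csqrt ?w \<noteq> 0" by (simp del: csqrt.simps)
  moreover have "- \<i> * csqrt ?w * theta 2 0 \<i> = gauss_sum (- 1) d / of_real (sqrt (of_int d)) * csqrt ?w * theta 2 0 \<i>"
    using trans[OF 1[symmetric] 2] by (simp only: 3)
  ultimately have "gauss_sum (- 1) d / of_real (sqrt (of_int d)) = - \<i>"
    using theta_2_0_nonzero by (simp only: mult_cancel_right simp_thms)
  then have "cnj (gauss_sum 1 d) = - \<i> * of_real (sqrt (of_int d))"
    using assms by (simp add: field_simps flip: gauss_sum_uminus)
  then have "cnj (cnj (gauss_sum 1 d)) = cnj (- \<i> * of_real (sqrt (of_int d)))" by (rule arg_cong)
  then show ?thesis by simp
qed

lemma Gamma1_entries:
  fixes \<gamma> :: "int ^ 2 ^ 2"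
  assumes "\<gamma> \<in> Gamma1 (2 * N)"
  shows "\<gamma>$1$1 * \<gamma>$2$2 - \<gamma>$1$2 * \<gamma>$2$1 = 1" "[\<gamma>$1$1 = 1] (mod 2 * int N)" "[\<gamma>$2$1 = 0] (mod 2 * int N)"
    "[\<gamma>$2$2 = 1] (mod 2 * int N)"
  using assms by (auto simp: Gamma1_def det_2)

text \<open>Modulo \<open>d\<close>, \<open>- b * M * (2 * c) ^ 2\<close> is congruent to \<open>2 * N * c\<close>, so the conjugate of the Gauss sum of
  \<open>theta_transform_gauss_sum\<close> is the Jacobi symbol of \<open>2Nc\<close> times the sum with \<open>a = 1\<close>. For negative \<open>d\<close> all
  entries change sign. Then \<open>- d\<close> is 3 modulo 4, and the factor \<open>\<i>\<close> of its Gauss sum turns \<open>csqrt (- (c * \<tau> + d))\<close>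
  into \<open>csqrt (c * \<tau> + d)\<close>, up to a sign that depends on the sign of \<open>c\<close>. This is the sign in Shimura's symbol.\<close>
theorem theta_transform:
  fixes \<gamma> :: "int ^ 2 ^ 2"
  assumes N: "N > 0" "even N" and \<gamma>: "\<gamma> \<in> Gamma1 (2 * N)" and \<tau>: "Im \<tau> > 0"
  shows "theta N r ((of_int (\<gamma>$1$1) * \<tau> + of_int (\<gamma>$1$2)) / (of_int (\<gamma>$2$1) * \<tau> + of_int (\<gamma>$2$2))) =
    theta_multiplier N r \<gamma> * csqrt (of_int (\<gamma>$2$1) * \<tau> + of_int (\<gamma>$2$2)) * theta N r \<tau>"
proof -
  obtain M where M: "N = 2 * M" "M > 0" using N by auto
  define a b c d where "a = \<gamma>$1$1" "b = \<gamma>$1$2" "c = \<gamma>$2$1" "d = \<gamma>$2$2"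
  note abcd = a_b_c_d_def
  have det: "a * d - b * c = 1" and ac: "[a = 1] (mod 2 * int N)" and cc: "[c = 0] (mod 2 * int N)" and dc: "[d = 1] (mod 2 * int N)"
    using Gamma1_entries[OF \<gamma>] by (simp_all add: abcd)
  obtain d' where d': "d = 1 + 2 * int N * d'" using dc by (metis cong_iff_lin cong_sym)
  have d4: "d = 1 + 4 * (int M * d')" using d' M by simp
  have odd: "odd d" using d4 by simp
  have d0: "d \<noteq> 0" using odd by auto
  have cop_cd: "coprime c d"
  proof (rule coprimeI)
    fix e assume "e dvd c" "e dvd d"
    then have "e dvd a * d - b * c" by (intro dvd_diff dvd_mult)
    then show "is_unit e" by (simp add: det)
  qed
  have cop_Nd: "coprime (2 * int N) d"
  proof (rule coprimeI)
    fix e assume e: "e dvd 2 * int N" "e dvd d"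
    have "e dvd d - 2 * int N * d'" by (rule dvd_diff[OF e(2) dvd_mult2[OF e(1)]])
    moreover have one: "d - 2 * int N * d' = 1" using d' by linarith
    ultimately show "is_unit e" by (simp only: one)
  qed
  have cop: "coprime (2 * int N * c) d" using cop_cd cop_Nd by simp
  have gs: "gauss_sum (- (b * int M)) \<bar>d\<bar> = of_int (\<Prod>p\<in>#prime_factorization \<bar>d\<bar>. Legendre (2 * int N * c) p) * gauss_sum 1 \<bar>d\<bar>"
  proof -
    have "gauss_sum (- (b * int M)) \<bar>d\<bar> = gauss_sum (- (b * int M) * (2 * c) ^ 2) \<bar>d\<bar>"
      using odd cop_cd d0 by (intro gauss_sum_mult_square[symmetric]) auto
    also have "\<dots> = gauss_sum (2 * int N * c * 1) \<bar>d\<bar>"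
    proof (rule gauss_sum_cong)
      have "- (b * int M) * (2 * c) ^ 2 = 2 * int N * c * (1 - a * d)"
      proof -
        have "1 - a * d = - (b * c)" using det by simp
        then show ?thesis by (simp only: M) (simp add: power2_eq_square)
      qed
      moreover have "[2 * int N * c * (1 - a * d) = 2 * int N * c * 1] (mod d)"
        by (rule cong_mult[OF cong_refl]) (simp add: cong_iff_dvd_diff)
      ultimately have "[- (b * int M) * (2 * c) ^ 2 = 2 * int N * c * 1] (mod d)" by (simp only:)
      then show "[- (b * int M) * (2 * c) ^ 2 = 2 * int N * c * 1] (mod \<bar>d\<bar>)"
        by (simp only: cong_iff_dvd_diff abs_dvd_iff)
    qed
    also have "\<dots> = of_int (\<Prod>p\<in>#prime_factorization \<bar>d\<bar>. Legendre (2 * int N * c) p) * gauss_sum 1 \<bar>d\<bar>"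
      by (rule gauss_sum_jacobi) (use d0 odd cop in auto)
    finally show ?thesis .
  qed
  define w where "w = of_int c * \<tau> + of_int d"
  have mult: "theta_multiplier N r \<gamma> = unit_exp (of_int (b * r ^ 2) / of_int (2 * int N)) *
      (if c = 0 then 1 else of_int (shimura_symbol (2 * int N * c) d))"
    by (simp add: theta_multiplier_def Let_def abcd)
  have key: "theta N r ((of_int a * \<tau> + of_int b) / w) = theta_multiplier N r \<gamma> * csqrt w * theta N r \<tau>"
  proof (cases "d > 0")
    case True
    have g1: "gauss_sum 1 d = of_real (sqrt (of_int d))"
      by (rule gauss_sum_1_pos[OF True]) (simp add: d4 cong_iff_dvd_diff)
    have "cnj (gauss_sum (b * int M) d) = cnj (of_int (\<Prod>p\<in>#prime_factorization d. Legendre (2 * int N * c) p) * of_real (sqrt (of_int d)))"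
      using gs True g1 by (simp add: gauss_sum_uminus)
    then have "gauss_sum (b * int M) d = of_int (\<Prod>p\<in>#prime_factorization d. Legendre (2 * int N * c) p) * of_real (sqrt (of_int d))"
      by (simp only: complex_cnj_cancel_iff)
    then have G: "gauss_sum (b * int M) d / of_real (sqrt (of_int d)) = of_int (\<Prod>p\<in>#prime_factorization d. Legendre (2 * int N * c) p)"
      using True by simp
    have S: "(\<Prod>p\<in>#prime_factorization d. Legendre (2 * int N * c) p) = (if c = 0 then 1 else shimura_symbol (2 * int N * c) d)"
    proof (cases "c = 0")
      case c0: True
      then have "a * d = 1" using det by simp
      then have "d = 1" using True by (metis pos_zmult_eq_1_iff mult.commute)
      then show ?thesis using c0 by simp
    qed (use True in \<open>simp add: shimura_symbol_def\<close>)
    have "theta N r ((of_int a * \<tau> + of_int b) / w) =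
      unit_exp (of_int (1 * b * r ^ 2) / of_int (2 * int N)) * gauss_sum (b * int M) d / of_real (sqrt (of_int d)) * csqrt w * theta N r \<tau>"
      unfolding w_def by (rule theta_transform_gauss_sum[OF M det True _ ac dc cc \<tau>]) simp
    also have "\<dots> = unit_exp (of_int (1 * b * r ^ 2) / of_int (2 * int N)) * (gauss_sum (b * int M) d / of_real (sqrt (of_int d))) * csqrt w * theta N r \<tau>"
      by simp
    also have "\<dots> = theta_multiplier N r \<gamma> * csqrt w * theta N r \<tau>"
      unfolding G S mult by (simp split: if_splits)
    finally show ?thesis .
  next
    case False
    then have dneg: "d < 0" using d0 by simp
    then have abs: "\<bar>d\<bar> = - d" by simp
    have c0: "c \<noteq> 0"
    proof
      assume "c = 0"
      then have "a * d = 1" using det by simp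
      then have "d = -1" using dneg by (metis zmult_eq_1_iff less_irrefl zero_less_one order_less_trans)
      then have "4 * (int M * d') = - 2" using d4 by linarith
      then show False by presburger
    qed
    have g1: "gauss_sum 1 (- d) = \<i> * of_real (sqrt (of_int (- d)))"
      by (rule gauss_sum_1_neg) (use dneg in \<open>simp_all add: d4 cong_iff_dvd_diff\<close>)
    define L where "L = (\<Prod>p\<in>#prime_factorization (- d). Legendre (2 * int N * c) p)"
    have G: "gauss_sum (- b * int M) (- d) / of_real (sqrt (of_int (- d))) = of_int L * \<i>"
      using gs[unfolded abs g1] dneg by (simp add: L_def)
    have S: "shimura_symbol (2 * int N * c) d = (if c < 0 then - L else L)"
      using dneg N by (simp add: shimura_symbol_def L_def abs mult_less_0_iff)
    \<comment> \<open>The principal root of \<open>- w\<close> depends on the half plane of \<open>w\<close>, that is, on the sign of \<open>c\<close>.\<close>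
    have csq: "\<i> * csqrt (- w) = (if c < 0 then - 1 else 1) * csqrt w"
    proof (cases "c < 0")
      case True
      then have "Im w < 0" using \<tau> by (simp add: w_def mult_neg_pos)
      then show ?thesis using True by (simp del: csqrt.simps)
    next
      case False
      then have "Im (- w) < 0" using \<tau> c0 by (simp add: w_def)
      then have "csqrt (- (- w)) = \<i> * csqrt (- w)" by (intro csqrt_minus) simp
      then show ?thesis using False by simp
    qed
    have "theta N r ((of_int (- a) * \<tau> + of_int (- b)) / (of_int (- c) * \<tau> + of_int (- d))) =
      unit_exp (of_int (- 1 * - b * r ^ 2) / of_int (2 * int N)) * gauss_sum (- b * int M) (- d) / of_real (sqrt (of_int (- d))) *
        csqrt (of_int (- c) * \<tau> + of_int (- d)) * theta N r \<tau>"
    proof (rule theta_transform_gauss_sum[OF M _ _ _ _ _ _ \<tau>])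
      show "[- a = - 1] (mod 2 * int N)" "[- d = - 1] (mod 2 * int N)" "[- c = 0] (mod 2 * int N)"
        using ac dc cc cong_minus_minus_iff[of c 0] by (auto simp: cong_minus_minus_iff)
    qed (use det dneg in auto)
    also have "of_int (- c) * \<tau> + of_int (- d) = - w" by (simp add: w_def)
    also have "(of_int (- a) * \<tau> + of_int (- b)) / - w = (of_int a * \<tau> + of_int b) / w"
    proof -
      have "of_int (- a) * \<tau> + of_int (- b) = - (of_int a * \<tau> + of_int b)" by simp
      then show ?thesis by (simp only: minus_divide_divide)
    qed
    also have "unit_exp (of_int (- 1 * - b * r ^ 2) / of_int (2 * int N)) * gauss_sum (- b * int M) (- d) / of_real (sqrt (of_int (- d))) * csqrt (- w) * theta N r \<tau>
      = unit_exp (of_int (b * r ^ 2) / of_int (2 * int N)) * (gauss_sum (- b * int M) (- d) / of_real (sqrt (of_int (- d)))) * csqrt (- w) * theta N r \<tau>"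
      by simp
    also have "\<dots> = unit_exp (of_int (b * r ^ 2) / of_int (2 * int N)) * of_int L * (\<i> * csqrt (- w)) * theta N r \<tau>"
      unfolding G by (simp only: mult.assoc)
    also have "\<dots> = theta_multiplier N r \<gamma> * csqrt w * theta N r \<tau>"
      unfolding csq mult S using c0 by simp
    finally show ?thesis .
  qed
  then show ?thesis unfolding w_def abcd .
qed

section \<open>The quantum set\<close>

lemma ord2_gt_iff: "k \<noteq> 0 \<Longrightarrow> ord2 k > n \<longleftrightarrow> 2 ^ Suc n dvd k"
  unfolding ord2_def by (subst power_dvd_iff_le_multiplicity) auto

lemma ord2_eq_iff: "k \<noteq> 0 \<Longrightarrow> ord2 k = n \<longleftrightarrow> 2 ^ n dvd k \<and> \<not> 2 ^ Suc n dvd k"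
  unfolding ord2_def by (subst (1 2) power_dvd_iff_le_multiplicity) auto

lemma ord2_decompose:
  assumes "k \<noteq> 0"
  obtains k' where "k = 2 ^ ord2 k * k'" "odd k'"
  using multiplicity_decompose'[of k 2] assms unfolding ord2_def by auto

text \<open>The denominator of \<open>\<gamma>x\<close> is the absolute value of \<open>c * h + d * k\<close>, which is congruent to \<open>k\<close> modulo \<open>2N\<close>, and
  membership in the quantum set depends only on which divisors of \<open>2N\<close> divide the denominator.\<close>
lemma quantum_set_moebius:
  fixes \<gamma> :: "int ^ 2 ^ 2"
  assumes N: "N > 0" "even N" and \<gamma>: "\<gamma> \<in> Gamma1 (2 * N)" and x: "x \<in> quantum_set N r"
    and nz: "of_int (\<gamma>$2$1) * x + of_int (\<gamma>$2$2) \<noteq> 0"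
  shows "moebius_rat \<gamma> x \<in> quantum_set N r"
proof -
  obtain M where M: "N = 2 * M" "M > 0" using N by auto
  define a b c d where "a = \<gamma>$1$1" "b = \<gamma>$1$2" "c = \<gamma>$2$1" "d = \<gamma>$2$2"
  note abcd = a_b_c_d_def
  have det: "a * d - b * c = 1" and cc: "[c = 0] (mod 2 * int N)" and dc: "[d = 1] (mod 2 * int N)"
    using Gamma1_entries[OF \<gamma>] by (simp_all add: abcd)
  obtain h k where hk: "quotient_of x = (h, k)" by force
  obtain p q where pq: "quotient_of (moebius_rat \<gamma> x) = (p, q)" by force
  have k: "k > 0" "coprime h k" "x = of_int h / of_int k"
    using hk quotient_of_denom_pos quotient_of_coprime quotient_of_div by blast+
  have q: "q > 0" "coprime p q" "moebius_rat \<gamma> x = of_int p / of_int q"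
    using pq quotient_of_denom_pos quotient_of_coprime quotient_of_div by blast+
  define k' where "k' = c * h + d * k"
  define h' where "h' = a * h + b * k"
  have "of_int k' = (of_int c * x + of_int d) * of_int k" using k by (simp add: k'_def field_simps)
  then have "of_int k' \<noteq> (0::rat)" using nz k by (simp add: abcd)
  then have k'0: "k' \<noteq> 0" by simp
  have "moebius_rat \<gamma> x = of_int h' / of_int k'"
  proof -
    have "of_int h' = (of_int a * x + of_int b) * of_int k" "of_int k' = (of_int c * x + of_int d) * of_int k"
      using k by (simp_all add: k'_def h'_def field_simps)
    then show ?thesis using k unfolding moebius_rat_def abcd by simp
  qed
  then have "of_int (p * k') = (of_int (h' * q) :: rat)"
    using q k'0 by (simp add: field_simps)
  then have eq: "p * k' = h' * q" by (simp only: of_int_eq_iff)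
  have "coprime h' k'"
  proof (rule coprimeI)
    fix e assume e: "e dvd h'" "e dvd k'"
    have "d * h' - b * k' = (a * d - b * c) * h" "a * k' - c * h' = (a * d - b * c) * k"
      by (simp_all add: h'_def k'_def algebra_simps)
    then have "d * h' - b * k' = h" "a * k' - c * h' = k" using det by simp_all
    then have "e dvd h" "e dvd k" using e by (metis dvd_diff dvd_mult)+
    then show "is_unit e" using k(2) by (meson coprime_def)
  qed
  then have "k' dvd q" using eq by (metis coprime_commute coprime_dvd_mult_right_iff dvd_triv_right)
  moreover have "q dvd k'" using eq q(2) by (metis coprime_commute coprime_dvd_mult_right_iff dvd_triv_right)
  ultimately have qk': "q = \<bar>k'\<bar>" using q(1) by (metis abs_of_pos zdvd_antisym_abs)
  have dvd_iff: "m dvd q \<longleftrightarrow> m dvd k" if "m dvd 2 * int N" for m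
  proof -
    have "m dvd c" "m dvd d - 1" using that cc dc by (meson cong_0_iff cong_iff_dvd_diff dvd_trans)+
    then have "m dvd c * h + (d - 1) * k" by simp
    moreover have "k' = c * h + (d - 1) * k + k" by (simp add: k'_def algebra_simps)
    ultimately show ?thesis unfolding qk' by (simp add: dvd_add_right_iff)
  qed
  have N2: "2 ^ Suc (ord2 (int N)) dvd 2 * int N"
    using multiplicity_dvd[of 2 "int N"] by (simp add: ord2_def mult_dvd_mono)
  then have N1: "2 ^ ord2 (int N) dvd 2 * int N" by (metis dvd_mult_right power_Suc)
  have q0: "q \<noteq> 0" "k \<noteq> 0" using q k by auto
  have gt: "ord2 q > ord2 (int N) \<longleftrightarrow> ord2 k > ord2 (int N)"
    by (simp only: ord2_gt_iff[OF q0(1)] ord2_gt_iff[OF q0(2)] dvd_iff[OF N2])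
  have eq: "ord2 q = ord2 (int N) \<longleftrightarrow> ord2 k = ord2 (int N)"
    by (simp only: ord2_eq_iff[OF q0(1)] ord2_eq_iff[OF q0(2)] dvd_iff[OF N2] dvd_iff[OF N1])
  have "ord2 (int N) > 0" using ord2_gt_iff[of "int N" 0] N by simp
  then obtain e where e: "ord2 (int N) = Suc e" using gr0_implies_Suc by blast
  have "2 ^ e dvd 2 * int N" using N1 e by (metis dvd_mult_right power_Suc)
  then have pred: "ord2 q = e \<longleftrightarrow> ord2 k = e"
    using N1 by (simp only: ord2_eq_iff[OF q0(1)] ord2_eq_iff[OF q0(2)] e dvd_iff)
  have "int N div 2 dvd 2 * int N" using M by simp
  note half = dvd_iff[OF this]
  have "rat_denom x = k" "rat_denom (moebius_rat \<gamma> x) = q" by (simp_all add: rat_denom_def hk pq)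
  then show ?thesis using x half gt eq pred unfolding quantum_set_def e by (auto split: if_splits)
qed

text \<open>A shift of \<open>j\<close> multiplies every term by the same root of unity different from 1. If \<open>N / 2\<close> does not divide \<open>r\<close>,
  the shift is by \<open>k / (N / 2)\<close> and the root of unity is that of \<open>h * r / (N / 2)\<close>. Otherwise the shift is by
  \<open>k\<close> divided by the 2-part of \<open>N\<close>, and the conditions on the 2-adic valuation of \<open>k\<close> say precisely that the
  root of unity is \<open>- 1\<close>.\<close>
theorem quantum_set_gauss_sum_zero:
  assumes N: "N = 2 * M" "M > 0" and x: "x \<in> quantum_set N r" and hk: "quotient_of x = (h, k)"
  shows "(\<Sum>j\<in>{0..<k}. unit_exp (of_int (h * (int M * j ^ 2 + r * j)) / of_int k)) = 0"
proof -
  have k: "k > 0" "coprime h k" using hk quotient_of_denom_pos quotient_of_coprime by blast+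
  have den: "rat_denom x = k" by (simp add: rat_denom_def hk)
  have half: "int N div 2 = int M" using N by simp
  have per: "unit_exp (of_int (h * (int M * i ^ 2 + r * i)) / of_int k) = unit_exp (of_int (h * (int M * j ^ 2 + r * j)) / of_int k)"
    if "[i = j] (mod k)" for i j
    by (intro unit_exp_frac_cong cong_mult cong_add cong_pow that cong_refl)
  show ?thesis
  proof (cases "int M dvd r")
    case False
    then have "int M dvd k" using x den unfolding quantum_set_def half by auto
    then obtain K where K: "k = int M * K" by auto
    show ?thesis
    proof (rule periodic_sum_shift_zero[OF k(1) per, where K = K and \<omega> = "unit_exp (of_int (h * r) / of_int (int M))"])
      fix j
      have "h * (int M * (j + K) ^ 2 + r * (j + K)) = h * (int M * j ^ 2 + r * j) + h * r * K + k * (2 * h * j + h * K)"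
        by (simp add: K power2_eq_square algebra_simps)
      moreover have "complex_of_int (A + p * K + k * B) / of_int k = of_int p / of_int (int M) + of_int A / of_int k + of_int B" for A p B
        using k(1) N(2) unfolding K by (auto simp: field_simps zero_less_mult_iff)
      ultimately have "complex_of_int (h * (int M * (j + K) ^ 2 + r * (j + K))) / of_int k =
          of_int (h * r) / of_int (int M) + of_int (h * (int M * j ^ 2 + r * j)) / of_int k + of_int (2 * h * j + h * K)"
        by metis
      then show "unit_exp (of_int (h * (int M * (j + K) ^ 2 + r * (j + K))) / of_int k) =
          unit_exp (of_int (h * r) / of_int (int M)) * unit_exp (of_int (h * (int M * j ^ 2 + r * j)) / of_int k)"
        by (simp only: unit_exp_add unit_exp_int mult_1_right)
    next
      have "coprime (int M) h" using k(2) K by (simp add: coprime_commute)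
      then have "\<not> int M dvd h * r" using False by (simp add: coprime_dvd_mult_right_iff)
      then show "unit_exp (of_int (h * r) / of_int (int M)) \<noteq> 1"
        using unit_exp_frac_eq_1_iff[of "int M" "h * r"] N(2) by simp
    qed
  next
    case True
    then obtain s where s: "r = int M * s" by auto
    define e where "e = ord2 (int M)"
    obtain M' where M': "int M = 2 ^ e * M'" "odd M'"
      using ord2_decompose[of "int M"] N(2) unfolding e_def by auto
    have ordN: "ord2 (int N) = Suc e"
    proof -
      have "int N = 2 ^ Suc e * M'" using N(1) M'(1) by simp
      then have "2 ^ Suc e dvd int N \<and> \<not> 2 ^ Suc (Suc e) dvd int N" using M'(2) by auto
      then show ?thesis by (rule iffD2[OF ord2_eq_iff, rotated]) (use N in simp)
    qed
    have odd_s: "[r = int M] (mod int N) \<longleftrightarrow> odd s"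
    proof -
      have "[r = int M] (mod int N) \<longleftrightarrow> int M * 2 dvd int M * (s - 1)"
        unfolding cong_iff_dvd_diff s N(1) by (simp add: algebra_simps)
      also have "\<dots> \<longleftrightarrow> odd s" using N(2) by (subst dvd_mult_cancel_left) auto
      finally show ?thesis .
    qed
    obtain K where K: "k = 2 ^ Suc e * K" and parity: "odd (K + s)"
    proof (cases "odd s")
      case True
      then have "ord2 k > Suc e"
        using x den \<open>int M dvd r\<close> odd_s unfolding quantum_set_def half ordN by auto
      then have "2 ^ Suc (Suc e) dvd k" using ord2_gt_iff[of k] k(1) by simp
      then obtain K where "k = 2 ^ Suc (Suc e) * K" by auto
      then show ?thesis using that[of "2 * K"] True by simp
    next
      case False
      then have "ord2 k = Suc e"
        using x den \<open>int M dvd r\<close> odd_s unfolding quantum_set_def half ordN by auto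
      then obtain K where "k = 2 ^ Suc e * K" "odd K" using ord2_decompose[of k] k(1) by auto
      then show ?thesis using that[of K] False by simp
    qed
    have odd_h: "odd h"
    proof
      assume "even h"
      moreover have "even k" using K by simp
      ultimately show False using k(2) by (meson coprime_common_divisor odd_one)
    qed
    show ?thesis
    proof (rule periodic_sum_shift_zero[OF k(1) per, where K = K and \<omega> = "unit_exp (of_int (h * M' * (K + s)) / of_int 2)"])
      fix j
      have "2 * (h * (int M * (j + K) ^ 2 + r * (j + K))) = 2 * (h * (int M * j ^ 2 + r * j)) + k * (h * M' * (K + s)) + 2 * k * (h * j * M')"
        by (simp add: K s M'(1) power2_eq_square algebra_simps)
      then have "2 * complex_of_int (h * (int M * (j + K) ^ 2 + r * (j + K))) = 2 * of_int (h * (int M * j ^ 2 + r * j)) + of_int k * of_int (h * M' * (K + s)) + 2 * of_int k * of_int (h * j * M')"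
        by (metis of_int_add of_int_mult of_int_numeral)
      then have "complex_of_int (h * (int M * (j + K) ^ 2 + r * (j + K))) / of_int k =
          of_int (h * M' * (K + s)) / of_int 2 + of_int (h * (int M * j ^ 2 + r * j)) / of_int k + of_int (h * j * M')"
        using k(1) by (simp add: field_simps del: of_int_mult of_int_add of_int_power)
      then show "unit_exp (of_int (h * (int M * (j + K) ^ 2 + r * (j + K))) / of_int k) =
          unit_exp (of_int (h * M' * (K + s)) / of_int 2) * unit_exp (of_int (h * (int M * j ^ 2 + r * j)) / of_int k)"
        by (simp only: unit_exp_add unit_exp_int mult_1_right)
    next
      have "\<not> 2 dvd h * M' * (K + s)" using odd_h M'(2) parity by simp
      then show "unit_exp (of_int (h * M' * (K + s)) / of_int 2) \<noteq> 1"
        using unit_exp_frac_eq_1_iff[of 2 "h * M' * (K + s)"] by simp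
    qed
  qed
qed

section \<open>Size of the theta series\<close>

text \<open>The series \<open>theta\<close> has the terms \<open>exp (\<i> * theta_exponent N r n * \<tau>)\<close>.\<close>
definition theta_exponent :: "nat \<Rightarrow> int \<Rightarrow> int \<Rightarrow> real"
  where "theta_exponent N r n = pi * of_nat N * (of_int n + of_int r / of_nat N) ^ 2"

lemma theta_exponent_nonneg [simp]: "theta_exponent N r n \<ge> 0"
  by (simp add: theta_exponent_def)

lemma theta_term:
  "unit_exp (of_nat N / 2 * (of_int n + of_int r / of_nat N) ^ 2 * \<tau>) = exp (\<i> * of_real (theta_exponent N r n) * \<tau>)"
  by (simp add: unit_exp_def theta_exponent_def mult_ac)

lemma theta_altdef: "theta N r \<tau> = (\<Sum>\<^sub>\<infinity>n. exp (\<i> * of_real (theta_exponent N r n) * \<tau>))"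
  unfolding theta_def theta_term ..

lemma norm_exp_theta_exponent: "norm (exp (\<i> * of_real (theta_exponent N r n) * \<tau>)) = exp (- theta_exponent N r n * Im \<tau>)"
  by simp

lemma theta_exponent_summable:
  assumes "N > 0" "y > 0"
  shows "(\<lambda>n. exp (- theta_exponent N r n * y)) summable_on UNIV"
  using theta_zsummable[of N "\<i> * of_real y" r] assms unfolding theta_term norm_exp_theta_exponent by simp

lemma theta_has_derivative:
  assumes "N > 0" "Im \<tau> > 0"
  shows "(theta N r has_field_derivative
      (\<Sum>\<^sub>\<infinity>n. \<i> * of_real (theta_exponent N r n) * exp (\<i> * of_real (theta_exponent N r n) * \<tau>))) (at \<tau>)"
    and "zsummable (\<lambda>n. \<i> * of_real (theta_exponent N r n) * exp (\<i> * of_real (theta_exponent N r n) * \<tau>))"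
proof -
  have "(\<lambda>n. norm (1::complex) * exp (Re (\<i> * of_real (theta_exponent N r n) * \<tau>) + Im \<tau> / 2 * norm (\<i> * complex_of_real (theta_exponent N r n)))) summable_on UNIV"
    using theta_exponent_summable[of N "Im \<tau> / 2" r] assms by (simp add: norm_mult algebra_simps)
  note d = exp_sum_has_derivative[OF half_gt_zero[OF assms(2)] this]
  show "(theta N r has_field_derivative
      (\<Sum>\<^sub>\<infinity>n. \<i> * of_real (theta_exponent N r n) * exp (\<i> * of_real (theta_exponent N r n) * \<tau>))) (at \<tau>)"
    using d(1) by (simp add: theta_altdef[abs_def])
  show "zsummable (\<lambda>n. \<i> * of_real (theta_exponent N r n) * exp (\<i> * of_real (theta_exponent N r n) * \<tau>))"
    using d(3) by simp
qed

lemma theta_holomorphic: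
  assumes "N > 0"
  shows "theta N r holomorphic_on {\<tau>. Im \<tau> > 0}"
  by (rule holomorphic_onI, rule field_differentiable_at_within, unfold field_differentiable_def, rule exI,
      rule theta_has_derivative(1)[OF assms]) simp

lemma norm_zsum_le:
  assumes "g summable_on UNIV" "\<And>n::int. norm (f n :: complex) \<le> g n"
  shows "norm (\<Sum>\<^sub>\<infinity>n. f n) \<le> (\<Sum>\<^sub>\<infinity>n. g n)"
proof -
  have s: "zsummable f" by (rule summable_on_comparison_test[OF assms]) auto
  have "norm (\<Sum>\<^sub>\<infinity>n. f n) \<le> (\<Sum>\<^sub>\<infinity>n. norm (f n))" by (rule norm_infsum_bound[OF s])
  also have "\<dots> \<le> (\<Sum>\<^sub>\<infinity>n. g n)" by (rule infsum_mono[OF s assms])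
  finally show ?thesis .
qed

text \<open>High up the sum of the absolute values is bounded by its value at a fixed height; low down Poisson summation
  shows how fast it grows.\<close>
lemma theta_bound:
  assumes "N > 0"
  obtains C where "C > 0" "\<And>\<tau>. Im \<tau> > 0 \<Longrightarrow> norm (theta N r \<tau>) \<le> C * (1 + 1 / sqrt (Im \<tau>))"
proof -
  let ?\<alpha> = "of_int r / of_nat N :: real"
  let ?T = "\<lambda>y. \<Sum>\<^sub>\<infinity>n. exp (- theta_exponent N r n * y)"
  define C1 where "C1 = ?T (1 / of_nat N)"
  define C2 where "C2 = (\<Sum>\<^sub>\<infinity>n::int. exp (- pi * of_int n ^ 2))"
  have s2: "(\<lambda>n::int. exp (- pi * of_int n ^ 2)) summable_on UNIV"
    using gauss_dominated_summable[of pi "\<lambda>n. of_real (exp (- pi * of_int n ^ 2))" 1 0] by simp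
  have nn: "C1 \<ge> 0" "C2 \<ge> 0" unfolding C1_def C2_def by (auto intro!: infsum_nonneg)
  have le: "norm (theta N r \<tau>) \<le> C1 + C2 / sqrt (Im \<tau>)" if \<tau>: "Im \<tau> > 0" for \<tau>
  proof -
    define y where "y = Im \<tau>"
    have y: "y > 0" using \<tau> by (simp add: y_def)
    have T: "norm (theta N r \<tau>) \<le> ?T y"
      unfolding theta_altdef
      by (rule norm_zsum_le[OF theta_exponent_summable[OF assms y]]) (simp add: y_def)
    show ?thesis
    proof (cases "y \<ge> 1 / of_nat N")
      case True
      have "?T y \<le> C1" unfolding C1_def
      proof (intro infsum_mono theta_exponent_summable y)
        fix n
        have "theta_exponent N r n * (1 / of_nat N) \<le> theta_exponent N r n * y"
          using True by (intro mult_left_mono) auto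
        then show "exp (- theta_exponent N r n * y) \<le> exp (- theta_exponent N r n * (1 / of_nat N))" by simp
      qed (use assms in auto)
      moreover have "0 \<le> C2 / sqrt (Im \<tau>)" using nn \<tau> by simp
      ultimately show ?thesis using T by linarith
    next
      case False
      define A where "A = of_nat N * y"
      have A: "A > 0" "A \<le> 1" using False assms y by (auto simp: A_def field_simps)
      have "complex_of_real (?T y) = (\<Sum>\<^sub>\<infinity>n. of_real (exp (- theta_exponent N r n * y)))"
        using theta_exponent_summable[OF assms y, of r] by (metis has_sum_infsum has_sum_of_real infsumI)
      also have "\<dots> = shifted_gaussian_sum (of_real A) (of_real ?\<alpha>)"
        unfolding shifted_gaussian_sum_def theta_exponent_def A_def
        by (rule infsum_cong) (simp add: exp_of_real[symmetric] mult_ac)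
      also have "\<dots> = of_real (1 / sqrt A) * dual_gaussian_sum (of_real A) (of_real ?\<alpha>)"
        by (rule gaussian_poisson_real[OF A(1)])
      finally have "norm (complex_of_real (?T y)) = 1 / sqrt A * norm (dual_gaussian_sum (of_real A) (of_real ?\<alpha>))"
        using A by (simp add: norm_mult norm_divide)
      also have "norm (dual_gaussian_sum (of_real A) (of_real ?\<alpha>)) \<le> C2"
        unfolding dual_gaussian_sum_def C2_def
      proof (rule norm_zsum_le[OF s2])
        fix n :: int
        have "norm (unit_exp (of_int n * complex_of_real ?\<alpha>)) = 1"
          using norm_unit_exp_of_real[of "of_int n * ?\<alpha>"] by simp
        moreover have "pi * of_int n ^ 2 * 1 \<le> pi * of_int n ^ 2 * (1 / A)"
          using A by (intro mult_left_mono) auto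
        then have "norm (exp (- of_real pi * of_int n ^ 2 / complex_of_real A)) \<le> exp (- pi * of_int n ^ 2)"
          by (simp add: Re_divide_of_real)
        ultimately show "norm (exp (- of_real pi * of_int n ^ 2 / complex_of_real A) * unit_exp (of_int n * complex_of_real ?\<alpha>)) \<le> exp (- pi * of_int n ^ 2)"
          unfolding norm_mult by simp
      qed
      also have "1 / sqrt A * C2 \<le> 1 / sqrt y * C2"
      proof (intro mult_right_mono nn divide_left_mono)
        have "1 * y \<le> of_nat N * y" using assms y by (intro mult_right_mono) auto
        then show "sqrt y \<le> sqrt A" by (simp add: A_def)
      qed (use y A in auto)
      finally have "\<bar>?T y\<bar> \<le> 1 / sqrt y * C2"
        using A unfolding norm_of_real by (simp add: divide_right_mono)
      then have "?T y \<le> 1 / sqrt y * C2" by (rule order_trans[OF abs_ge_self])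
      then show ?thesis using T nn by (simp add: y_def)
    qed
  qed
  show ?thesis
  proof (rule that[of "C1 + C2 + 1"])
    fix \<tau> :: complex assume \<tau>: "Im \<tau> > 0"
    have "C1 + C2 / sqrt (Im \<tau>) \<le> (C1 + C2 + 1) * (1 + 1 / sqrt (Im \<tau>))"
    proof -
      define v where "v = 1 / sqrt (Im \<tau>)"
      have v: "v \<ge> 0" "C1 * v \<ge> 0" using nn \<tau> by (auto simp: v_def)
      have "(C1 + C2 + 1) * (1 + v) = C1 + C2 + 1 + C1 * v + C2 * v + v" by (simp add: algebra_simps)
      moreover have "C2 / sqrt (Im \<tau>) = C2 * v" by (simp add: v_def)
      ultimately show ?thesis using v nn unfolding v_def[symmetric] by linarith
    qed
    then show "norm (theta N r \<tau>) \<le> (C1 + C2 + 1) * (1 + 1 / sqrt (Im \<tau>))" using le[OF \<tau>] by linarith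
  qed (use nn in linarith)
qed

lemma power_div_fact_le_exp:
  fixes z :: real
  assumes "z \<ge> 0"
  shows "z ^ n / fact n \<le> exp z"
proof -
  have "sum (\<lambda>n. z ^ n /\<^sub>R fact n) {n} \<le> (\<Sum>n. z ^ n /\<^sub>R fact n)"
    by (rule sum_le_suminf[OF summable_exp_generic]) (use assms in auto)
  then show ?thesis by (simp add: exp_def field_simps)
qed

text \<open>The exponential series exceeds each of its terms.\<close>
lemma exp_decay_le_power:
  fixes \<delta> :: real
  assumes "\<delta> > 0"
  obtains C where "C > 0" "\<And>t. t > 0 \<Longrightarrow> exp (- \<delta> / t) \<le> C * t ^ n"
proof (rule that[of "fact n / \<delta> ^ n"])
  show "fact n / \<delta> ^ n > 0" using assms by simp
  fix t :: real assume t: "t > 0"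
  have "(\<delta> / t) ^ n / fact n \<le> exp (\<delta> / t)" using assms t by (intro power_div_fact_le_exp) auto
  then have "exp (- (\<delta> / t)) \<le> inverse ((\<delta> / t) ^ n / fact n)"
    unfolding exp_minus using assms t by (intro le_imp_inverse_le) auto
  then show "exp (- \<delta> / t) \<le> fact n / \<delta> ^ n * t ^ n" by (simp add: field_simps power_divide)
qed

text \<open>One half of the exponent provides decay in \<open>\<rho>\<close>, the other half convergence of the sum over \<open>l\<close>.\<close>
lemma nonzero_gauss_term_bound:
  fixes \<rho> :: real and l :: int
  assumes "l \<noteq> 0" "\<rho> \<ge> \<rho>0" "\<rho>0 > 0"
  shows "exp (- pi * of_int l ^ 2 * \<rho>) \<le> exp (- pi * \<rho> / 2) * exp (- pi * \<rho>0 / 2 * of_int l ^ 2)"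
proof -
  have "1 \<le> l ^ 2" using assms(1) by (simp add: int_one_le_iff_zero_less)
  then have l: "1 \<le> real_of_int l ^ 2" by (metis of_int_1 of_int_le_iff of_int_power)
  have "\<rho> * 1 \<le> \<rho> * of_int l ^ 2" using assms l by (intro mult_left_mono) auto
  moreover have "\<rho>0 * of_int l ^ 2 \<le> \<rho> * of_int l ^ 2" using assms by (intro mult_right_mono) auto
  ultimately have "pi / 2 * (\<rho> + \<rho>0 * of_int l ^ 2) \<le> pi / 2 * (2 * (\<rho> * of_int l ^ 2))"
    by (intro mult_left_mono) auto
  moreover have "pi / 2 * (2 * (\<rho> * of_int l ^ 2)) = pi * of_int l ^ 2 * \<rho>" by simp
  moreover have "pi / 2 * (\<rho> + \<rho>0 * of_int l ^ 2) = pi * \<rho> / 2 + pi * \<rho>0 / 2 * of_int l ^ 2"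
    by (simp add: distrib_left)
  ultimately have "- pi * of_int l ^ 2 * \<rho> \<le> - pi * \<rho> / 2 + - pi * \<rho>0 / 2 * of_int l ^ 2" by linarith
  then show ?thesis unfolding mult_exp_exp by (simp only: exp_le_cancel_iff)
qed

text \<open>The constant term of the dual sum at \<open>x\<close> vanishes by \<open>quantum_set_gauss_sum_zero\<close>; the other terms are
  exponentially small in \<open>1 / norm w\<close>. The sector is wide enough to contain the discs for Cauchy's inequality around
  points of the vertical line, and the horizontal segments at the vertex of the ideal triangle.\<close>
theorem theta_cusp_decay:
  assumes N: "N > 0" "even N" and x: "x \<in> quantum_set N r"
  obtains C where "C > 0" "\<And>w. w \<noteq> 0 \<Longrightarrow> norm w \<le> 1/4 \<Longrightarrow> norm w \<le> 4 * Re w \<Longrightarrow> norm (theta N r (of_rat x + \<i> * w)) \<le> C * norm w ^ m"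
proof -
  obtain M where M: "N = 2 * M" "M > 0" using N by auto
  obtain h k where hk: "quotient_of x = (h, k)" by force
  have k: "k > 0" and x_eq: "x = of_int h / of_int k"
    using hk quotient_of_denom_pos quotient_of_div by blast+
  define \<rho>0 where "\<rho>0 = 1 / (of_nat N * of_int k ^ 2 :: real)"
  have \<rho>0: "\<rho>0 > 0" using N k by (simp add: \<rho>0_def)
  define S where "S = (\<Sum>\<^sub>\<infinity>l::int. exp (- pi * \<rho>0 / 2 * of_int l ^ 2))"
  have s: "(\<lambda>l::int. exp (- pi * \<rho>0 / 2 * of_int l ^ 2)) summable_on UNIV"
    using gauss_dominated_summable[of "pi * \<rho>0 / 2" "\<lambda>n. of_real (exp (- pi * \<rho>0 / 2 * of_int n ^ 2))" 1 0] \<rho>0 by simp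
  have S: "S \<ge> 0" unfolding S_def by (auto intro!: infsum_nonneg)
  define g where "g = (\<lambda>l::int. \<Sum>j\<in>{0..<k}. unit_exp (of_nat N / 2 * (of_int j + of_int r / of_nat N) ^ 2 * (of_int h / of_int k)) *
      unit_exp (of_int l * ((of_int j + of_int r / of_nat N) / of_int k)))"
  have g0: "g 0 = 0"
  proof -
    have "g 0 = (\<Sum>j\<in>{0..<k}. unit_exp (of_int (h * (int M * j ^ 2 + r * j)) / of_int k)) * unit_exp (of_int (h * r ^ 2) / of_int (4 * int M * k))"
      unfolding g_def theta_coeff_eq[OF M k] by (simp add: sum_distrib_right unit_exp_def[of 0])
    then show ?thesis using quantum_set_gauss_sum_zero[OF M x hk] by simp
  qed
  have g: "norm (g l) \<le> of_int k" for l
  proof -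
    have "norm (unit_exp (of_nat N / 2 * (of_int j + of_int r / of_nat N) ^ 2 * (of_int h / of_int k)) *
      unit_exp (of_int l * ((of_int j + of_int r / of_nat N) / of_int k))) = 1" for j :: int
      using norm_unit_exp_of_real[of "of_nat N / 2 * (of_int j + of_int r / of_nat N) ^ 2 * (of_int h / of_int k)"]
        norm_unit_exp_of_real[of "of_int l * ((of_int j + of_int r / of_nat N) / of_int k)"]
      by (simp add: norm_mult)
    then have "norm (g l) \<le> (\<Sum>j\<in>{0..<k}. 1)" unfolding g_def by (intro order_trans[OF norm_sum sum_mono]) simp
    then show ?thesis using k by simp
  qed
  obtain C0 where C0: "C0 > 0" "\<And>t. t > 0 \<Longrightarrow> exp (- (pi * \<rho>0 / 8) / t) \<le> C0 * t ^ Suc m"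
    using exp_decay_le_power[of "pi * \<rho>0 / 8" "Suc m"] \<rho>0 by auto
  show ?thesis
  proof (rule that[of "of_int k * S * C0 + 1"])
    show "of_int k * S * C0 + 1 > 0" using k S C0 by (simp add: add_nonneg_pos)
    fix w :: complex assume w: "w \<noteq> 0" "norm w \<le> 1/4" "norm w \<le> 4 * Re w"
    define t where "t = norm w"
    have t: "t > 0" "t \<le> 1/4" using w by (auto simp: t_def)
    have Rew: "Re w > 0" using w(3) t(1) unfolding t_def by linarith
    define A where "A = of_nat N * of_int k ^ 2 * w"
    have "Re (1 / w) = Re w / t ^ 2" by (simp add: Re_divide' t_def)
    then have inv: "Re (1 / w) \<ge> 1 / (4 * t)"
    proof -
      have "1 / (4 * t) = t / 4 / t ^ 2" using t by (simp add: power2_eq_square)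
      also have "\<dots> \<le> Re w / t ^ 2" using w(3) by (intro divide_right_mono) (simp_all add: t_def)
      finally show ?thesis using \<open>Re (1 / w) = Re w / t ^ 2\<close> by simp
    qed
    moreover have "1 / (4 * t) \<ge> 1" using t by simp
    ultimately have inv1: "Re (1 / w) \<ge> 1" by linarith
    have "1 / A = of_real \<rho>0 * (1 / w)" by (simp add: A_def \<rho>0_def)
    then have ReA: "Re (1 / A) = \<rho>0 * Re (1 / w)" by (simp only: times_complex.sel Re_complex_of_real Im_complex_of_real mult_zero_left diff_zero)
    have \<rho>: "Re (1 / A) \<ge> \<rho>0" unfolding ReA using inv1 \<rho>0 by simp
    have "theta N r (of_rat x + \<i> * w) = (\<Sum>\<^sub>\<infinity>l. exp (- of_real pi * of_int l ^ 2 / A) * g l) / csqrt A"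
      using theta_at_rational[OF N(2,1) k Rew, of r h] by (simp add: x_eq of_rat_divide A_def g_def)
    then have "norm (theta N r (of_rat x + \<i> * w)) = norm (\<Sum>\<^sub>\<infinity>l. exp (- of_real pi * of_int l ^ 2 / A) * g l) / sqrt (norm A)"
      by (simp add: norm_divide del: csqrt.simps)
    also have "norm (\<Sum>\<^sub>\<infinity>l. exp (- of_real pi * of_int l ^ 2 / A) * g l) \<le> (\<Sum>\<^sub>\<infinity>l::int. of_int k * exp (- pi * Re (1 / A) / 2) * exp (- pi * \<rho>0 / 2 * of_int l ^ 2))"
    proof (rule norm_zsum_le)
      show "(\<lambda>l::int. of_int k * exp (- pi * Re (1 / A) / 2) * exp (- pi * \<rho>0 / 2 * of_int l ^ 2)) summable_on UNIV"
        by (rule summable_on_cmult_right[OF s])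
      fix l :: int
      show "norm (exp (- of_real pi * of_int l ^ 2 / A) * g l) \<le> of_int k * exp (- pi * Re (1 / A) / 2) * exp (- pi * \<rho>0 / 2 * of_int l ^ 2)"
      proof (cases "l = 0")
        case False
        have "- of_real pi * of_int l ^ 2 / A = of_real (- pi * of_int l ^ 2) * (1 / A)" by simp
        then have "Re (- of_real pi * of_int l ^ 2 / A) = - pi * of_int l ^ 2 * Re (1 / A)"
          by (metis Im_complex_of_real Re_complex_of_real diff_zero mult_zero_left times_complex.sel(1))
        then have "norm (exp (- of_real pi * of_int l ^ 2 / A) * g l) \<le> exp (- pi * of_int l ^ 2 * Re (1 / A)) * of_int k"
          unfolding norm_mult norm_exp_eq_Re by (intro mult_mono g) auto
        also have "\<dots> \<le> exp (- pi * Re (1 / A) / 2) * exp (- pi * \<rho>0 / 2 * of_int l ^ 2) * of_int k"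
          using k by (intro mult_right_mono nonzero_gauss_term_bound[OF False \<rho> \<rho>0]) auto
        finally show ?thesis by (simp add: mult_ac)
      qed (use g0 k in simp)
    qed
    also have "\<dots> = of_int k * exp (- pi * Re (1 / A) / 2) * S" by (simp add: S_def infsum_cmult_right')
    also have "\<dots> / sqrt (norm A) \<le> of_int k * exp (- pi * Re (1 / A) / 2) * S / sqrt t"
    proof (rule divide_left_mono)
      have "1 * t \<le> (of_nat N * of_int k ^ 2) * t"
      proof (intro mult_right_mono)
        have "1 \<le> int N * k ^ 2" using N k by (simp add: int_one_le_iff_zero_less)
        then have "real_of_int 1 \<le> real_of_int (int N * k ^ 2)" by (simp only: of_int_le_iff)
        then show "1 \<le> real N * of_int k ^ 2" by simp
      qed (use t in auto)
      then show le: "sqrt t \<le> sqrt (norm A)" by (simp add: A_def norm_mult norm_power t_def)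
      have "0 < sqrt t" using t by simp
      then show "0 < sqrt (norm A) * sqrt t" using le by (intro mult_pos_pos) linarith+
      show "0 \<le> of_int k * exp (- pi * Re (1 / A) / 2) * S" using k S by simp
    qed
    also have "exp (- pi * Re (1 / A) / 2) \<le> exp (- (pi * \<rho>0 / 8) / t)"
    proof -
      have "\<rho>0 * (1 / (4 * t)) \<le> Re (1 / A)" unfolding ReA using inv \<rho>0 by (intro mult_left_mono) auto
      then have "pi / 2 * (\<rho>0 * (1 / (4 * t))) \<le> pi / 2 * Re (1 / A)" by (intro mult_left_mono) auto
      then show ?thesis by (simp add: mult_ac)
    qed
    also have "\<dots> \<le> C0 * t ^ Suc m" by (rule C0(2)[OF t(1)])
    also have "of_int k * (C0 * t ^ Suc m) * S / sqrt t = of_int k * S * C0 * t ^ m * (t / sqrt t)"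
      by simp
    also have "\<dots> \<le> of_int k * S * C0 * t ^ m * 1"
    proof (intro mult_left_mono)
      have "t / sqrt t = sqrt t" using t by (simp add: real_div_sqrt)
      then show "t / sqrt t \<le> 1" using t by simp
    qed (use k S C0 t in auto)
    also have "\<dots> \<le> (of_int k * S * C0 + 1) * t ^ m" using t by (simp add: distrib_right)
    finally show "norm (theta N r (of_rat x + \<i> * w)) \<le> (of_int k * S * C0 + 1) * norm w ^ m"
      using k S t by (simp add: t_def divide_right_mono mult_right_mono mult_left_mono)
  qed
qed

section \<open>Integrals over the half line\<close>

lemma improper_FTC_seq:
  fixes f G :: "real \<Rightarrow> complex"
  assumes int: "set_integrable lborel {0<..} f"
    and deriv: "\<And>u. u > 0 \<Longrightarrow> (G has_vector_derivative f u) (at u)"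
    and a: "\<And>k. a k > 0" "a \<longlonglongrightarrow> 0" and b: "filterlim b at_top sequentially"
  shows "(\<lambda>k. G (b k) - G (a k)) \<longlonglongrightarrow> (LINT u:{0<..}|lborel. f u)"
proof -
  have lim: "(\<lambda>k. LINT u|lborel. indicator {a k..b k} u *\<^sub>R f u) \<longlonglongrightarrow> (LINT u|lborel. indicator {0<..} u *\<^sub>R f u)"
  proof (rule integral_dominated_convergence[where w = "\<lambda>u. norm (indicator {0<..} u *\<^sub>R f u)"])
    show "(\<lambda>u. indicator {0<..} u *\<^sub>R f u) \<in> borel_measurable lborel"
      using int unfolding set_integrable_def by (rule borel_measurable_integrable)
    show "integrable lborel (\<lambda>u. norm (indicator {0<..} u *\<^sub>R f u))"
      using int unfolding set_integrable_def by (rule integrable_norm)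
    have sub: "{a k..b k} \<subseteq> {0<..}" for k using a(1)[of k] by auto
    show "(\<lambda>u. indicator {a k..b k} u *\<^sub>R f u) \<in> borel_measurable lborel" for k
      using set_integrable_subset[OF int _ sub] unfolding set_integrable_def by (simp add: borel_measurable_integrable)
    show "AE u in lborel. norm (indicator {a k..b k} u *\<^sub>R f u) \<le> norm (indicator {0<..} u *\<^sub>R f u)" for k
      using a(1)[of k] by (intro AE_I2) (auto simp: indicator_def)
    show "AE u in lborel. (\<lambda>k. indicator {a k..b k} u *\<^sub>R f u) \<longlonglongrightarrow> indicator {0<..} u *\<^sub>R f u"
    proof (rule AE_I2)
      fix u :: real
      show "(\<lambda>k. indicator {a k..b k} u *\<^sub>R f u) \<longlonglongrightarrow> indicator {0<..} u *\<^sub>R f u"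
      proof (cases "u > 0")
        case True
        then have "\<forall>\<^sub>F k in sequentially. a k < u" using a(2) by (rule order_tendstoD(2)[rotated])
        moreover have "\<forall>\<^sub>F k in sequentially. b k \<ge> u" using b unfolding filterlim_at_top by blast
        ultimately have "\<forall>\<^sub>F k in sequentially. indicator {a k..b k} u *\<^sub>R f u = indicator {0<..} u *\<^sub>R f u"
          by eventually_elim (use True in auto)
        then show ?thesis by (rule tendsto_eventually)
      next
        case False
        then have "indicator {a k..b k} u *\<^sub>R f u = indicator {0<..} u *\<^sub>R f u" for k
          using a(1)[of k] by (auto simp: indicator_def)
        then show ?thesis by (simp only: tendsto_const)
      qed
    qed
  qed
  have "\<forall>\<^sub>F k in sequentially. b k \<ge> 1" using b unfolding filterlim_at_top by blast
  moreover have "\<forall>\<^sub>F k in sequentially. a k < 1" using a(2) by (rule order_tendstoD) simp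
  ultimately have "\<forall>\<^sub>F k in sequentially. (LINT u|lborel. indicator {a k..b k} u *\<^sub>R f u) = G (b k) - G (a k)"
  proof eventually_elim
    case (elim k)
    have sub: "{a k..b k} \<subseteq> {0<..}" using a(1)[of k] by auto
    have "set_integrable lborel {a k..b k} f" by (rule set_integrable_subset[OF int _ sub]) simp
    then have "(LINT u:{a k..b k}|lborel. f u) = integral {a k..b k} f"
      by (rule set_borel_integral_eq_integral(2))
    also have "\<dots> = G (b k) - G (a k)"
    proof (rule integral_unique[OF fundamental_theorem_of_calculus])
      show "a k \<le> b k" using elim by linarith
      show "(G has_vector_derivative f u) (at u within {a k..b k})" if "u \<in> {a k..b k}" for u
        by (rule has_vector_derivative_at_within[OF deriv]) (use that a(1)[of k] in simp)
    qed
    finally show ?case by (simp add: set_lebesgue_integral_def)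
  qed
  with lim have "(\<lambda>k. G (b k) - G (a k)) \<longlonglongrightarrow> (LINT u|lborel. indicator {0<..} u *\<^sub>R f u)"
    by (rule Lim_transform_eventually)
  then show ?thesis by (simp add: set_lebesgue_integral_def)
qed

text \<open>The theta series grows at most like \<open>u powr (- 1/2)\<close> at zero, and the kernel of weight \<open>3/2\<close> decays like
  \<open>u powr (- 3/2)\<close> at infinity.\<close>
definition half_line_majorant :: "real \<Rightarrow> real"
  where "half_line_majorant u = u powr (- 1/2) * min 1 (1 / u)"

lemma half_line_majorant_nonneg: "u > 0 \<Longrightarrow> half_line_majorant u \<ge> 0"
  by (simp add: half_line_majorant_def)

lemma half_line_majorant_le1: "0 < u \<Longrightarrow> u \<le> 1 \<Longrightarrow> half_line_majorant u = u powr (- 1/2)"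
  by (simp add: half_line_majorant_def min_def field_simps)

lemma half_line_majorant_ge1: "u \<ge> 1 \<Longrightarrow> half_line_majorant u = u powr (- 3/2)"
proof -
  assume u: "u \<ge> 1"
  have "u powr (- 3/2) = u powr (- 1/2 + - 1)" by simp
  also have "\<dots> = u powr (- 1/2) * (1 / u)" using u by (simp only: powr_add) (simp add: powr_minus_divide)
  finally show ?thesis using u by (simp add: half_line_majorant_def min_def field_simps)
qed

lemma half_line_majorant_integrable: "set_integrable lborel {0<..} half_line_majorant"
proof -
  have "(\<lambda>u::real. u powr (- 1/2)) integrable_on {0..1}"
    using has_integral_powr_from_0[of "- 1/2" 1] by (auto simp: integrable_on_def)
  then have i1: "half_line_majorant integrable_on {0..1}"
    by (rule integrable_spike[where S = "{0}"]) (auto simp: half_line_majorant_le1)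
  have "(\<lambda>u::real. u powr (- 3/2)) integrable_on {1..}"
    using has_integral_powr_to_inf[where a = 1 and e = "- 3/2"] by (auto simp: integrable_on_def)
  then have i2: "half_line_majorant integrable_on {1..}"
    by (rule integrable_eq) (auto simp: half_line_majorant_ge1)
  have "half_line_majorant integrable_on {0..1} \<union> {1..}"
  proof (rule integrable_Un[OF _ i1 i2])
    have "{0..1} \<inter> {1..} = {1::real}" by auto
    then show "negligible ({0..1} \<inter> {1..} :: real set)" by simp
  qed
  moreover have "{0..1} \<union> {1..} = {0::real..}" by auto
  ultimately have i: "half_line_majorant integrable_on {0..}" by simp
  have "half_line_majorant integrable_on {0<..}"
    by (rule integrable_spike_set[OF i]; rule negligible_subset[of "{0}"]) auto
  then have "half_line_majorant absolutely_integrable_on {0<..}"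
    by (rule nonnegative_absolutely_integrable_1) (auto simp: half_line_majorant_def)
  moreover have "(\<lambda>u. indicator {0<..} u *\<^sub>R half_line_majorant u) \<in> borel_measurable lborel"
    unfolding half_line_majorant_def by measurable
  ultimately show ?thesis
    unfolding set_integrable_def by (subst (asm) integrable_completion) auto
qed

lemma half_line_integrableI:
  fixes f :: "real \<Rightarrow> complex"
  assumes "continuous_on {0<..} f" "\<And>u. u > 0 \<Longrightarrow> norm (f u) \<le> C * half_line_majorant u"
  shows "set_integrable lborel {0<..} f"
  unfolding set_integrable_def
proof (rule Bochner_Integration.integrable_bound)
  show "integrable lborel (\<lambda>u. C * (indicator {0<..} u *\<^sub>R half_line_majorant u))"
    using half_line_majorant_integrable unfolding set_integrable_def by (rule integrable_mult_right)
  show "(\<lambda>u. indicator {0<..} u *\<^sub>R f u) \<in> borel_measurable lborel"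
    using borel_measurable_continuous_on_indicator[OF _ assms(1)] by simp
  show "AE u in lborel. norm (indicator {0<..} u *\<^sub>R f u) \<le> norm (C * (indicator {0<..} u *\<^sub>R half_line_majorant u))"
  proof (rule AE_I2)
    fix u :: real
    show "norm (indicator {0<..} u *\<^sub>R f u) \<le> norm (C * (indicator {0<..} u *\<^sub>R half_line_majorant u))"
      using assms(2)[of u] by (cases "u > 0") auto
  qed
qed

text \<open>The remainder is \<open>z ^ K\<close> times a power series that converges absolutely at \<open>1/2\<close>.\<close>
lemma binomial_remainder:
  fixes a :: real
  obtains C where "C \<ge> 0" "\<And>z. 0 \<le> z \<Longrightarrow> z \<le> 1/2 \<Longrightarrow> \<bar>(1 - z) powr a - (\<Sum>n<K. (a gchoose n) * (- z) ^ n)\<bar> \<le> C * z ^ K"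
proof -
  have sums: "(\<lambda>n. (a gchoose n) * z ^ n) sums (1 + z) powr a" if "\<bar>z\<bar> < 1" for z
    by (rule gen_binomial_real[OF that])
  have "summable (\<lambda>n. norm ((a gchoose n) * (1/2) ^ n))"
    by (rule powser_insidea[OF sums_summable[OF sums[of "3/4"]]]) auto
  then have "summable (\<lambda>n. 2 ^ K * norm ((a gchoose (n + K)) * (1/2) ^ (n + K)))"
    by (intro summable_mult) (subst summable_iff_shift, assumption)
  then have s: "summable (\<lambda>n. \<bar>a gchoose (n + K)\<bar> * (1/2) ^ n)"
    by (simp add: abs_mult power_add power_one_over field_simps)
  show ?thesis
  proof (rule that[of "\<Sum>n. \<bar>a gchoose (n + K)\<bar> * (1/2) ^ n"])
    show "0 \<le> (\<Sum>n. \<bar>a gchoose (n + K)\<bar> * (1/2) ^ n)" by (rule suminf_nonneg[OF s]) auto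
    fix z :: real assume z: "0 \<le> z" "z \<le> 1/2"
    have sz: "(\<lambda>n. (a gchoose n) * (- z) ^ n) sums (1 - z) powr a" using sums[of "- z"] z by simp
    have "(1 - z) powr a - (\<Sum>n<K. (a gchoose n) * (- z) ^ n) = (\<Sum>n. (a gchoose (n + K)) * (- z) ^ (n + K))"
      using suminf_minus_initial_segment[OF sums_summable[OF sz], of K] sums_unique[OF sz] by simp
    also have "\<bar>\<dots>\<bar> \<le> (\<Sum>n. z ^ K * (\<bar>a gchoose (n + K)\<bar> * (1/2) ^ n))"
    proof -
      have le: "norm ((a gchoose (n + K)) * (- z) ^ (n + K)) \<le> z ^ K * (\<bar>a gchoose (n + K)\<bar> * (1/2) ^ n)" for n
      proof -
        have "norm ((a gchoose (n + K)) * (- z) ^ (n + K)) = z ^ K * (\<bar>a gchoose (n + K)\<bar> * z ^ n)"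
          using z by (simp add: abs_mult power_abs power_add)
        also have "\<dots> \<le> z ^ K * (\<bar>a gchoose (n + K)\<bar> * (1/2) ^ n)"
          using z by (intro mult_left_mono power_mono) auto
        finally show ?thesis .
      qed
      have s': "summable (\<lambda>n. z ^ K * (\<bar>a gchoose (n + K)\<bar> * (1/2) ^ n))" by (rule summable_mult[OF s])
      show ?thesis
        using norm_suminf_le[OF le s'] by simp
    qed
    also have "\<dots> = (\<Sum>n. \<bar>a gchoose (n + K)\<bar> * (1/2) ^ n) * z ^ K"
      by (subst suminf_mult[OF s]) simp
    finally show "\<bar>(1 - z) powr a - (\<Sum>n<K. (a gchoose n) * (- z) ^ n)\<bar> \<le> (\<Sum>n. \<bar>a gchoose (n + K)\<bar> * (1/2) ^ n) * z ^ K" .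
  qed
qed

lemma moment_integrable:
  fixes \<phi> :: "real \<Rightarrow> complex"
  assumes cont: "continuous_on {0<..} \<phi>"
    and C: "\<And>u. u > 0 \<Longrightarrow> norm (\<phi> u) \<le> C * min (u ^ Suc n) 1"
  shows "set_integrable lborel {0<..} (\<lambda>u. \<phi> u * of_real (u powr (- 3/2 - real n)))"
proof (rule half_line_integrableI)
  show "continuous_on {0<..} (\<lambda>u. \<phi> u * of_real (u powr (- 3/2 - real n)))"
    by (intro continuous_intros cont) auto
  fix u :: real assume u: "u > 0"
  have c0: "0 \<le> C * min (u ^ Suc n) 1" using C[OF u] norm_ge_zero by (rule order_trans[rotated])
  moreover have "min (u ^ Suc n) 1 > 0" using u by simp
  ultimately have C0: "C \<ge> 0" by (meson mult_neg_pos not_le)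
  have "min (u ^ Suc n) 1 * u powr (- 3/2 - real n) \<le> half_line_majorant u"
  proof (cases "u \<le> 1")
    case True
    have "min (u ^ Suc n) 1 * u powr (- 3/2 - real n) \<le> u ^ Suc n * u powr (- 3/2 - real n)"
      using u by (intro mult_right_mono) auto
    also have "\<dots> = u powr (real (Suc n) + (- 3/2 - real n))"
      using u by (simp only: powr_realpow[symmetric] powr_add)
    also have "\<dots> = half_line_majorant u" using u True by (simp add: half_line_majorant_le1)
    finally show ?thesis .
  next
    case False
    then have "min (u ^ Suc n) 1 * u powr (- 3/2 - real n) \<le> 1 * u powr (- 3/2)"
      by (intro mult_mono powr_mono) auto
    then show ?thesis using False by (simp add: half_line_majorant_ge1)
  qed
  then have "C * (min (u ^ Suc n) 1 * u powr (- 3/2 - real n)) \<le> C * half_line_majorant u"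
    using C0 by (rule mult_left_mono)
  moreover have "norm (\<phi> u * of_real (u powr (- 3/2 - real n))) \<le> C * min (u ^ Suc n) 1 * u powr (- 3/2 - real n)"
    unfolding norm_mult norm_of_real by (rule mult_mono[OF C[OF u] _ c0]) auto
  ultimately show "norm (\<phi> u * of_real (u powr (- 3/2 - real n))) \<le> C * half_line_majorant u" by simp
qed

lemma moment_integrable_half:
  fixes \<phi> :: "real \<Rightarrow> complex"
  assumes cont: "continuous_on {0<..} \<phi>"
    and C: "\<And>u. u > 0 \<Longrightarrow> norm (\<phi> u) \<le> C * min (u ^ n) (1 / u)"
  shows "set_integrable lborel {0<..} (\<lambda>u. \<phi> u * of_real (u powr (- 1/2 - real n)))"
proof -
  have "set_integrable lborel {0<..} (\<lambda>u. (of_real u * \<phi> u) * of_real (u powr (- 3/2 - real n)))"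
  proof (rule moment_integrable)
    fix u :: real assume u: "u > 0"
    have "norm (of_real u * \<phi> u) \<le> u * (C * min (u ^ n) (1 / u))"
      using C[OF u] u by (simp add: norm_mult)
    also have "\<dots> = C * (u * min (u ^ n) (1 / u))" by simp
    also have "u * min (u ^ n) (1 / u) = min (u ^ Suc n) 1"
      using u by (subst mult_min_right) auto
    finally show "norm (of_real u * \<phi> u) \<le> C * min (u ^ Suc n) 1" .
  qed (intro continuous_intros cont)
  moreover have "(of_real u * \<phi> u) * of_real (u powr (- 3/2 - real n)) = \<phi> u * of_real (u powr (- 1/2 - real n))" if "u > 0" for u
  proof -
    have "u powr (- 1/2 - real n) = u powr (1 + (- 3/2 - real n))" by simp
    also have "\<dots> = u * u powr (- 3/2 - real n)" using that by (simp only: powr_add) simp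
    finally show ?thesis by simp
  qed
  ultimately show ?thesis by (subst (asm) set_integrable_cong[OF refl refl]) auto
qed

text \<open>With \<open>u = t + s\<close> the kernel is \<open>(u - t) powr (- 1/2)\<close>. For \<open>u \<ge> 2 * t\<close> its binomial expansion in \<open>t / u\<close> has a
  uniform remainder. For \<open>u \<le> 2 * t\<close> the function is so small that both the integral and the
  truncated expansion are \<open>O(t ^ K)\<close>: here the decay of all orders is used.\<close>
theorem half_integral_asymptotics:
  fixes \<phi> :: "real \<Rightarrow> complex"
  assumes cont: "continuous_on {0<..} \<phi>"
    and rapid: "\<And>m. \<exists>C. \<forall>u>0. norm (\<phi> u) \<le> C * min (u ^ m) (1 / u)"
  shows "(\<lambda>t. (LINT s:{0<..}|lborel. \<phi> (t + s) * of_real (s powr (- 1/2))) -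
      (\<Sum>n<K. of_real (((- 1/2) gchoose n) * (- t) ^ n) * (LINT u:{0<..}|lborel. \<phi> u * of_real (u powr (- 1/2 - real n)))))
    \<in> O[at_right 0](\<lambda>t. of_real t ^ K)"
proof -
  let ?b = "\<lambda>n. ((- 1/2 :: real) gchoose n)"
  let ?J = "\<lambda>n u. \<phi> u * of_real (u powr (- 1/2 - real n))"
  have mom: "set_integrable lborel {0<..} (?J n)" for n
  proof -
    obtain C where "\<And>u. u > 0 \<Longrightarrow> norm (\<phi> u) \<le> C * min (u ^ n) (1 / u)" using rapid[of n] by blast
    then show ?thesis by (rule moment_integrable_half[OF cont])
  qed
  obtain C0 where C0: "C0 \<ge> 0" "\<And>z. 0 \<le> z \<Longrightarrow> z \<le> 1/2 \<Longrightarrow> \<bar>(1 - z) powr (- 1/2) - (\<Sum>n<K. ?b n * (- z) ^ n)\<bar> \<le> C0 * z ^ K"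
    using binomial_remainder[of "- 1/2" K] by blast
  \<comment> \<open>The second summand bounds the truncated expansion on \<open>u \<le> 2 * t\<close>, where \<open>1 \<le> 2 * t / u\<close>.\<close>
  define C1 where "C1 = C0 + 2 ^ K * (\<Sum>n<K. \<bar>?b n\<bar>)"
  have C1: "C0 \<le> C1" "C1 \<ge> 0" using C0 by (auto simp: C1_def intro!: sum_nonneg add_nonneg_nonneg)
  obtain C2 where C2: "\<And>u. u > 0 \<Longrightarrow> norm (\<phi> u) \<le> C2 * min (u ^ K) (1 / u)" using rapid[of K] by blast
  obtain C3 where C3: "\<And>u. u > 0 \<Longrightarrow> norm (\<phi> u) \<le> C3 * min (u ^ 0) (1 / u)" using rapid[of 0] by blast
  have C2_nn: "C2 \<ge> 0" "C3 \<ge> 0" using order_trans[OF norm_ge_zero C2[of 1]] order_trans[OF norm_ge_zero C3[of 1]] by simp_all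
  let ?D = half_line_majorant
  define ID where "ID = (LINT s:{0<..}|lborel. ?D s)"
  define J where "J = (LINT u:{0<..}|lborel. norm (?J K u))"
  have main: "norm ((LINT s:{0<..}|lborel. \<phi> (t + s) * of_real (s powr (- 1/2))) -
      (\<Sum>n<K. of_real (?b n * (- t) ^ n) * (LINT u:{0<..}|lborel. ?J n u))) \<le> (C1 * J + C2 * 2 ^ K * ID) * t ^ K"
    if t: "0 < t" "t \<le> 1" for t
  proof -
    define F where "F u = indicator {0<..} (u - t) *\<^sub>R (\<phi> u * complex_of_real ((u - t) powr (- 1/2)))" for u
    have intF0: "set_integrable lborel {0<..} (\<lambda>s. \<phi> (t + s) * complex_of_real (s powr (- 1/2)))"
    proof (rule half_line_integrableI)
      show "continuous_on {0<..} (\<lambda>s. \<phi> (t + s) * of_real (s powr (- 1/2)))"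
        using t by (intro continuous_intros continuous_on_compose2[OF cont]) auto
      fix s :: real assume s: "s > 0"
      have "norm (\<phi> (t + s)) \<le> C3 * min 1 (1 / s)"
      proof -
        have "norm (\<phi> (t + s)) \<le> C3 * min ((t + s) ^ 0) (1 / (t + s))" by (rule C3) (use s t in simp)
        also have "\<dots> \<le> C3 * min 1 (1 / s)"
        proof (rule mult_left_mono[OF _ C2_nn(2)])
          have "1 / (t + s) \<le> 1 / s" using s t by (simp add: frac_le)
          then show "min ((t + s) ^ 0) (1 / (t + s)) \<le> min 1 (1 / s)" by simp
        qed
        finally show ?thesis .
      qed
      then have "norm (\<phi> (t + s)) * s powr (- 1/2) \<le> C3 * min 1 (1 / s) * s powr (- 1/2)"
        by (rule mult_right_mono) simp
      then show "norm (\<phi> (t + s) * of_real (s powr (- 1/2))) \<le> C3 * ?D s"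
        by (simp add: norm_mult half_line_majorant_def mult_ac)
    qed
    have F_shift: "indicator {0<..} s *\<^sub>R (\<phi> (t + s) * complex_of_real (s powr (- 1/2))) = F (t + 1 * s)" for s
      by (simp add: F_def)
    have intF: "integrable lborel F"
      using intF0 unfolding set_integrable_def F_shift by (simp only: lborel_integrable_real_affine_iff[OF one_neq_zero])
    have valF: "(LINT s:{0<..}|lborel. \<phi> (t + s) * of_real (s powr (- 1/2))) = (LINT u|lborel. F u)"
      unfolding set_lebesgue_integral_def F_shift using lborel_integral_real_affine[OF one_neq_zero, of F t] by simp
    define j where "j n u = indicator {0<..} u *\<^sub>R ?J n u" for n u
    have ij: "integrable lborel (j n)" for n
      using mom[of n] unfolding set_integrable_def j_def .
    define G where "G u = (\<Sum>n<K. of_real (?b n * (- t) ^ n) * j n u)" for u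
    have intG: "integrable lborel G"
      unfolding G_def by (intro Bochner_Integration.integrable_sum integrable_mult_right ij)
    have valG: "(\<Sum>n<K. of_real (?b n * (- t) ^ n) * (LINT u:{0<..}|lborel. ?J n u)) = (LINT u|lborel. G u)"
      unfolding G_def set_lebesgue_integral_def j_def[symmetric]
      by (subst Bochner_Integration.integral_sum, rule integrable_mult_right[OF ij]) (simp only: integral_mult_right_zero)
    \<comment> \<open>A majorant of the difference of the integrands whose integral is a multiple of \<open>t ^ K\<close>.\<close>
    define B where "B u = C1 * t ^ K * (indicator {0<..} u *\<^sub>R norm (?J K u)) + C2 * (2 * t) ^ K * (indicator {0<..} (u - t) *\<^sub>R ?D (u - t))" for u
    have iD: "integrable lborel (\<lambda>u. indicator {0<..} (u - t) *\<^sub>R ?D (u - t))"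
      using lborel_integrable_real_affine[OF half_line_majorant_integrable[unfolded set_integrable_def], of 1 "- t"]
      by (simp add: add.commute)
    have iJ: "integrable lborel (\<lambda>u. indicator {0<..} u *\<^sub>R norm (?J K u))"
      using set_integrable_norm[OF mom[of K]] unfolding set_integrable_def .
    have intB: "integrable lborel B"
      unfolding B_def by (intro Bochner_Integration.integrable_add integrable_mult_right iD iJ)
    have vD: "(LINT u|lborel. indicator {0<..} (u - t) *\<^sub>R ?D (u - t)) = ID"
      unfolding ID_def set_lebesgue_integral_def
      by (subst (2) lborel_integral_real_affine[of 1 _ "- t"]) (auto simp: add.commute)
    have valB: "(LINT u|lborel. B u) = (C1 * J + C2 * 2 ^ K * ID) * t ^ K"
    proof -
      have "(LINT u|lborel. B u) = C1 * t ^ K * J + C2 * (2 * t) ^ K * ID"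
        unfolding B_def J_def set_lebesgue_integral_def vD[symmetric]
        by (subst Bochner_Integration.integral_add[OF integrable_mult_right[OF iJ] integrable_mult_right[OF iD]])
          (simp only: integral_mult_right_zero)
      then show ?thesis by (simp only: power_mult_distrib) (simp add: algebra_simps)
    qed
    have pw: "norm (F u - G u) \<le> B u" for u
    proof (cases "u > 0")
      case False
      then show ?thesis using t by (auto simp: F_def G_def j_def B_def)
    next
      case u: True
      let ?S = "\<Sum>n<K. ?b n * (- t) ^ n * u powr (- 1/2 - real n)"
      have G: "G u = \<phi> u * of_real ?S"
        using u by (simp add: G_def j_def sum_distrib_left mult_ac)
      have nJ: "norm (?J K u) = norm (\<phi> u) * u powr (- 1/2 - real K)" by (simp add: norm_mult)
      have split: "u powr (- 1/2 - real n) = u powr (- 1/2) * (1 / u) ^ n" for n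
      proof -
        have "u powr (- 1/2 - real n) = u powr (- 1/2) / u powr real n" by (rule powr_diff)
        also have "\<dots> = u powr (- 1/2) * (1 / u) ^ n"
          by (subst powr_realpow[OF u]) (simp add: power_one_over)
        finally show ?thesis .
      qed
      have tS: "?S = u powr (- 1/2) * (\<Sum>n<K. ?b n * (- (t / u)) ^ n)"
      proof -
        have "(- (t / u)) ^ n = (- t) ^ n * (1 / u) ^ n" for n
          by (simp flip: power_mult_distrib)
        then show ?thesis unfolding split sum_distrib_left by (simp only: mult_ac)
      qed
      have tK: "t ^ K * u powr (- 1/2 - real K) = u powr (- 1/2) * (t / u) ^ K"
        unfolding split by (simp add: power_divide)
      have D0: "0 \<le> C2 * (2 * t) ^ K * (indicator {0<..} (u - t) *\<^sub>R ?D (u - t))"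
        using C2_nn t by (auto simp: indicator_def intro!: mult_nonneg_nonneg half_line_majorant_nonneg)
      show ?thesis
      proof (cases "u \<ge> 2 * t")
        case True
        have z: "0 \<le> t / u" "t / u \<le> 1/2" using u t True by (auto simp: field_simps)
        have "u - t = u * (1 - t / u)" using u by (simp add: right_diff_distrib)
        then have "(u - t) powr (- 1/2) = (u * (1 - t / u)) powr (- 1/2)" by simp
        also have "\<dots> = u powr (- 1/2) * (1 - t / u) powr (- 1/2)" by (rule powr_mult)
        finally have "F u - G u = \<phi> u * of_real (u powr (- 1/2) * ((1 - t / u) powr (- 1/2) - (\<Sum>n<K. ?b n * (- (t / u)) ^ n)))"
          unfolding G tS using True t by (simp add: F_def algebra_simps)
        then have "norm (F u - G u) = norm (\<phi> u) * (u powr (- 1/2) * \<bar>(1 - t / u) powr (- 1/2) - (\<Sum>n<K. ?b n * (- (t / u)) ^ n)\<bar>)"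
          by (simp only: norm_mult norm_of_real abs_mult) simp
        also have "\<dots> \<le> norm (\<phi> u) * (u powr (- 1/2) * (C0 * (t / u) ^ K))"
          by (intro mult_left_mono C0(2) z) auto
        also have "\<dots> = C0 * (t ^ K * norm (?J K u))" unfolding nJ using tK by (simp add: mult_ac)
        also have "\<dots> \<le> C1 * (t ^ K * norm (?J K u))" using C1 t by (intro mult_right_mono) auto
        also have "\<dots> \<le> B u" using D0 u by (simp add: B_def mult_ac)
        finally show ?thesis .
      next
        case False
        have q: "1 \<le> 2 * (t / u)" using u False by (simp add: field_simps)
        have "\<bar>?S\<bar> \<le> u powr (- 1/2) * (\<Sum>n<K. \<bar>?b n\<bar> * (2 ^ K * (t / u) ^ K))"
          unfolding tS abs_mult
        proof (intro mult_mono order_trans[OF sum_abs sum_mono])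
          fix n assume "n \<in> {..<K}"
          then have n: "n \<le> K" by simp
          have tu0: "0 \<le> t / u" using t u by simp
          then have "(t / u) ^ n \<le> (2 * (t / u)) ^ n" by (intro power_mono) linarith+
          also have "\<dots> \<le> (2 * (t / u)) ^ K" by (rule power_increasing[OF n q])
          finally have "(t / u) ^ n \<le> 2 ^ K * (t / u) ^ K" by (simp only: power_mult_distrib)
          moreover have "\<bar>(- (t / u)) ^ n\<bar> = (t / u) ^ n" using t u by (simp add: power_abs)
          ultimately show "\<bar>?b n * (- (t / u)) ^ n\<bar> \<le> \<bar>?b n\<bar> * (2 ^ K * (t / u) ^ K)"
            unfolding abs_mult by (simp add: mult_left_mono)
        qed (auto intro!: sum_nonneg)
        also have "\<dots> = (2 ^ K * (\<Sum>n<K. \<bar>?b n\<bar>)) * (u powr (- 1/2) * (t / u) ^ K)"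
          by (simp only: sum_distrib_right[symmetric]) (simp only: mult_ac)
        also have "\<dots> \<le> C1 * (u powr (- 1/2) * (t / u) ^ K)"
          using C0 t u by (intro mult_right_mono) (auto simp: C1_def)
        finally have "norm (\<phi> u) * \<bar>?S\<bar> \<le> norm (\<phi> u) * (C1 * (t ^ K * u powr (- 1/2 - real K)))"
          unfolding tK by (rule mult_left_mono) simp
        then have "norm (G u) \<le> C1 * t ^ K * norm (?J K u)"
          unfolding G nJ norm_mult norm_of_real by (simp add: mult_ac)
        moreover have "norm (F u) \<le> C2 * (2 * t) ^ K * (indicator {0<..} (u - t) *\<^sub>R ?D (u - t))"
        proof (cases "u > t")
          case True
          have "norm (\<phi> u) \<le> C2 * min (u ^ K) (1 / u)" by (rule C2[OF u])
          also have "\<dots> \<le> C2 * (2 * t) ^ K"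
            using u False C2_nn by (intro mult_left_mono min.coboundedI1 power_mono) auto
          finally have "norm (\<phi> u) * (u - t) powr (- 1/2) \<le> C2 * (2 * t) ^ K * (u - t) powr (- 1/2)"
            by (rule mult_right_mono) simp
          then show ?thesis using True False t
            by (simp add: F_def norm_mult half_line_majorant_le1)
        qed (use D0 in \<open>simp add: F_def\<close>)
        moreover have "norm (F u - G u) \<le> norm (G u) + norm (F u)"
          using norm_triangle_ineq4[of "F u" "G u"] by simp
        ultimately show ?thesis using u unfolding B_def by simp
      qed
    qed
    have "norm ((LINT u|lborel. F u) - (LINT u|lborel. G u)) = norm (LINT u|lborel. F u - G u)"
      using intF intG by simp
    also have "\<dots> \<le> (LINT u|lborel. B u)"
      by (rule Bochner_Integration.integral_norm_bound_integral[OF Bochner_Integration.integrable_diff[OF intF intG] intB pw])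
    finally show ?thesis unfolding valF valG valB .
  qed
  show ?thesis
  proof (rule bigoI)
    have "\<forall>\<^sub>F t in at_right (0::real). 0 < t \<and> t \<le> 1"
      by (intro eventually_at_rightI[of 0 1]) auto
    then show "\<forall>\<^sub>F t in at_right 0. norm ((LINT s:{0<..}|lborel. \<phi> (t + s) * of_real (s powr (- 1/2))) -
      (\<Sum>n<K. of_real (((- 1/2) gchoose n) * (- t) ^ n) * (LINT u:{0<..}|lborel. ?J n u))) \<le> (C1 * J + C2 * 2 ^ K * ID) * norm (of_real t ^ K :: complex)"
    proof eventually_elim
      case (elim t) then show ?case using main[of t] by (simp add: norm_power)
    qed
  qed
qed

section \<open>Expansions at the quantum set\<close>

text \<open>An asymptotic expansion in \<open>\<epsilon> = \<i> * t\<close>. Compared with \<open>has_asymptotic_expansion\<close>, the coefficients belong to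
  the same variable as those of the formal series and of the Taylor series of the period function.\<close>
definition eps_expansion :: "(complex \<Rightarrow> complex) \<Rightarrow> rat \<Rightarrow> complex fps \<Rightarrow> bool"
  where "eps_expansion f x F \<longleftrightarrow> (\<forall>K. (\<lambda>t::real. f (of_rat x + \<i> * of_real t) - (\<Sum>n<K. F $ n * (\<i> * of_real t) ^ n))
    \<in> O[at_right 0](\<lambda>t. of_real t ^ K))"

lemma eps_expansion_imp_asymptotic:
  assumes "eps_expansion f x F"
  obtains a where "has_asymptotic_expansion f x a" "eps_series a = F"
proof
  \<comment> \<open>The variable \<open>t\<close> of \<open>has_asymptotic_expansion\<close> is \<open>- 2 * pi * \<i> * \<epsilon>\<close>.\<close>
  let ?a = "\<lambda>n. F $ n * inverse ((- 2 * of_real pi * \<i>) ^ n)"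
  show "eps_series ?a = F"
    by (simp add: eps_series_def fps_eq_iff)
  show "has_asymptotic_expansion f x ?a"
    unfolding has_asymptotic_expansion_def
  proof
    fix K
    have lim: "filterlim (\<lambda>t::real. t / (2 * pi)) (at_right 0) (at_right 0)"
      by real_asymp
    have "(\<lambda>t::real. f (of_rat x + \<i> * of_real (t / (2 * pi))) - (\<Sum>n<K. F $ n * (\<i> * of_real (t / (2 * pi))) ^ n))
      \<in> O[at_right 0](\<lambda>t. of_real (t / (2 * pi)) ^ K)"
      using assms[unfolded eps_expansion_def, rule_format, of K] by (rule landau_o.big.compose[OF _ lim])
    also have "(\<lambda>t::real. complex_of_real (t / (2 * pi)) ^ K) = (\<lambda>t. (1 / (2 * of_real pi)) ^ K * of_real t ^ K)"
      by (simp add: fun_eq_iff power_divide)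
    also have "O[at_right 0](\<lambda>t::real. (1 / (2 * complex_of_real pi)) ^ K * of_real t ^ K) = O[at_right 0](\<lambda>t. of_real t ^ K)"
      by (rule landau_o.big.cmult) simp
    also have "(\<lambda>t::real. f (of_rat x + \<i> * of_real (t / (2 * pi))) - (\<Sum>n<K. F $ n * (\<i> * of_real (t / (2 * pi))) ^ n)) =
        (\<lambda>t. f (of_rat x + \<i> * of_real t / (2 * of_real pi)) - (\<Sum>n<K. ?a n * of_real t ^ n))"
    proof
      fix t :: real
      have "F $ n * (\<i> * of_real (t / (2 * pi))) ^ n = ?a n * of_real t ^ n" for n
      proof -
        have "\<i> * complex_of_real (t / (2 * pi)) = inverse (- 2 * of_real pi * \<i>) * of_real t"
          by (simp add: field_simps)
        then have "(\<i> * complex_of_real (t / (2 * pi))) ^ n = inverse ((- 2 * of_real pi * \<i>) ^ n) * of_real t ^ n"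
          by (simp only: power_mult_distrib power_inverse)
        then show ?thesis by (simp only: mult.assoc)
      qed
      then have sums: "(\<Sum>n<K. F $ n * (\<i> * of_real (t / (2 * pi))) ^ n) = (\<Sum>n<K. ?a n * of_real t ^ n)"
        by (simp only:)
      have arg: "\<i> * complex_of_real (t / (2 * pi)) = \<i> * of_real t / (2 * of_real pi)" by simp
      show "f (of_rat x + \<i> * of_real (t / (2 * pi))) - (\<Sum>n<K. F $ n * (\<i> * of_real (t / (2 * pi))) ^ n) =
        f (of_rat x + \<i> * of_real t / (2 * of_real pi)) - (\<Sum>n<K. ?a n * of_real t ^ n)"
        unfolding sums unfolding arg ..
    qed
    finally show "(\<lambda>t. f (of_rat x + \<i> * of_real t / (2 * of_real pi)) - (\<Sum>n<K. ?a n * of_real t ^ n)) \<in> O[at_right 0](\<lambda>t. of_real t ^ K)" .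
  qed
qed

lemma eps_expansion_add:
  assumes "eps_expansion f x F" "eps_expansion g x G"
  shows "eps_expansion (\<lambda>z. f z + g z) x (F + G)"
  unfolding eps_expansion_def
proof
  fix K
  have "(\<lambda>t::real. (f (of_rat x + \<i> * of_real t) - (\<Sum>n<K. F $ n * (\<i> * of_real t) ^ n)) +
      (g (of_rat x + \<i> * of_real t) - (\<Sum>n<K. G $ n * (\<i> * of_real t) ^ n))) \<in> O[at_right 0](\<lambda>t. of_real t ^ K)"
    by (rule sum_in_bigo(1)[OF assms[unfolded eps_expansion_def, rule_format]])
  then show "(\<lambda>t::real. f (of_rat x + \<i> * of_real t) + g (of_rat x + \<i> * of_real t) - (\<Sum>n<K. (F + G) $ n * (\<i> * of_real t) ^ n)) \<in> O[at_right 0](\<lambda>t. of_real t ^ K)"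
    by (simp add: algebra_simps sum.distrib)
qed

lemma eps_expansion_cmult:
  assumes "eps_expansion f x F"
  shows "eps_expansion (\<lambda>z. c * f z) x (fps_const c * F)"
  unfolding eps_expansion_def
proof
  fix K
  have "(\<lambda>t::real. c * (f (of_rat x + \<i> * of_real t) - (\<Sum>n<K. F $ n * (\<i> * of_real t) ^ n))) \<in> O[at_right 0](\<lambda>t. of_real t ^ K)"
    using assms unfolding eps_expansion_def by (cases "c = 0") auto
  then show "(\<lambda>t::real. c * f (of_rat x + \<i> * of_real t) - (\<Sum>n<K. (fps_const c * F) $ n * (\<i> * of_real t) ^ n)) \<in> O[at_right 0](\<lambda>t. of_real t ^ K)"
    by (simp add: algebra_simps sum_distrib_left)
qed

lemma eps_expansion_cong:
  assumes "eps_expansion f x F" "\<And>t. t > 0 \<Longrightarrow> f (of_rat x + \<i> * of_real t) = g (of_rat x + \<i> * of_real t)"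
  shows "eps_expansion g x F"
  unfolding eps_expansion_def
proof
  fix K
  have "\<forall>\<^sub>F t in at_right (0::real). f (of_rat x + \<i> * of_real t) - (\<Sum>n<K. F $ n * (\<i> * of_real t) ^ n) = g (of_rat x + \<i> * of_real t) - (\<Sum>n<K. F $ n * (\<i> * of_real t) ^ n)"
    using assms(2) by (intro eventually_at_rightI[of 0 1]) auto
  then show "(\<lambda>t::real. g (of_rat x + \<i> * of_real t) - (\<Sum>n<K. F $ n * (\<i> * of_real t) ^ n)) \<in> O[at_right 0](\<lambda>t. of_real t ^ K)"
    using assms(1)[unfolded eps_expansion_def, rule_format, of K] by (subst (asm) landau_o.big.in_cong) auto
qed

lemma complex_of_rat_eq: "complex_of_rat x = of_real (of_rat x)"
proof (cases x)
  case (Fract a b)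
  then show ?thesis by (simp add: of_rat_rat)
qed

lemma Im_of_rat [simp]: "Im (of_rat x) = 0"
  by (simp add: complex_of_rat_eq)

lemma theta_vertical_rapid:
  assumes N: "N > 0" "even N" and x: "x \<in> quantum_set N r"
  shows "\<exists>C. \<forall>u>0. norm (theta N r (of_rat x + \<i> * of_real u)) \<le> C * min (u ^ m) 1"
proof -
  obtain C1 where C1: "C1 > 0" "\<And>w. w \<noteq> 0 \<Longrightarrow> norm w \<le> 1/4 \<Longrightarrow> norm w \<le> 4 * Re w \<Longrightarrow> norm (theta N r (of_rat x + \<i> * w)) \<le> C1 * norm w ^ m"
    using theta_cusp_decay[OF N x] by metis
  obtain C2 where C2: "C2 > 0" "\<And>\<tau>. Im \<tau> > 0 \<Longrightarrow> norm (theta N r \<tau>) \<le> C2 * (1 + 1 / sqrt (Im \<tau>))"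
    using theta_bound[OF N(1)] by metis
  show ?thesis
  proof (intro exI allI impI)
    fix u :: real assume u: "u > 0"
    show "norm (theta N r (of_rat x + \<i> * of_real u)) \<le> (C1 + 3 * C2 * 4 ^ m) * min (u ^ m) 1"
    proof (cases "u \<le> 1/4")
      case True
      have "norm (theta N r (of_rat x + \<i> * of_real u)) \<le> C1 * u ^ m"
        using C1(2)[of "of_real u"] u True by simp
      also have "\<dots> \<le> (C1 + 3 * C2 * 4 ^ m) * u ^ m" using C1 C2 u by (intro mult_right_mono) auto
      also have "u ^ m = min (u ^ m) 1" using u True by (simp add: power_le_one)
      finally show ?thesis .
    next
      case False
      have "sqrt (1/4) \<le> sqrt u" using False by (intro real_sqrt_le_mono) simp
      then have "1 / sqrt u \<le> 1 / (1 / 2)" using u by (intro divide_left_mono) (auto simp: real_sqrt_divide)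
      then have "C2 * (1 + 1 / sqrt u) \<le> C2 * 3" using C2 by (intro mult_left_mono) auto
      then have "norm (theta N r (of_rat x + \<i> * of_real u)) \<le> 3 * C2"
        using C2(2)[of "of_rat x + \<i> * of_real u"] u by simp
      also have "\<dots> = 3 * C2 * 4 ^ m * (1/4) ^ m" by (simp add: power_divide)
      also have "\<dots> \<le> (C1 + 3 * C2 * 4 ^ m) * min (u ^ m) 1"
        using C1 C2 False by (intro mult_mono) (auto intro!: power_mono simp: power_le_one)
      finally show ?thesis .
    qed
  qed
qed

text \<open>The derivative of \<open>theta\<close> along a vertical line, as a series in order to integrate it termwise.\<close>
definition theta_vertical_deriv :: "nat \<Rightarrow> int \<Rightarrow> rat \<Rightarrow> real \<Rightarrow> complex"
  where "theta_vertical_deriv N r x u =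
    (\<Sum>\<^sub>\<infinity>n. - of_real (theta_exponent N r n) * exp (\<i> * of_real (theta_exponent N r n) * (of_rat x + \<i> * of_real u)))"

lemma theta_vertical_deriv_eq:
  assumes "N > 0" "u > 0"
  shows "theta_vertical_deriv N r x u = \<i> * deriv (theta N r) (of_rat x + \<i> * of_real u)"
proof -
  have "deriv (theta N r) (of_rat x + \<i> * of_real u) =
      (\<Sum>\<^sub>\<infinity>n. \<i> * of_real (theta_exponent N r n) * exp (\<i> * of_real (theta_exponent N r n) * (of_rat x + \<i> * of_real u)))"
    by (rule DERIV_imp_deriv[OF theta_has_derivative(1)]) (use assms in auto)
  then show ?thesis
    unfolding theta_vertical_deriv_def by (simp add: infsum_cmult_right'[symmetric] mult.assoc[symmetric])
qed

lemma theta_vertical_has_vector_derivative: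
  assumes "N > 0" "u > 0"
  shows "((\<lambda>u. theta N r (of_rat x + \<i> * of_real u)) has_vector_derivative theta_vertical_deriv N r x u) (at u)"
proof -
  have "(theta N r has_field_derivative deriv (theta N r) (of_rat x + \<i> * of_real u)) (at (of_rat x + \<i> * of_real u))"
    by (rule holomorphic_derivI[OF theta_holomorphic[OF assms(1)]]) (use assms in \<open>auto simp: open_halfspace_Im_gt\<close>)
  then have "((\<lambda>z. theta N r (of_rat x + \<i> * z)) has_field_derivative deriv (theta N r) (of_rat x + \<i> * of_real u) * \<i>) (at (of_real u))"
    by (rule DERIV_chain2) (auto intro!: derivative_eq_intros)
  then show ?thesis
    unfolding theta_vertical_deriv_eq[OF assms] mult.commute[of \<i> "deriv _ _"]
    by (rule has_vector_derivative_real_field)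
qed

lemma theta_vertical_continuous:
  assumes "N > 0" "Im z = 0"
  shows "continuous_on {0<..} (\<lambda>u. theta N r (z + \<i> * of_real u))"
  by (rule continuous_on_compose2[OF holomorphic_on_imp_continuous_on[OF theta_holomorphic[OF assms(1)]]])
    (auto intro!: continuous_intros simp: assms(2))

lemma theta_vertical_deriv_continuous:
  assumes "N > 0"
  shows "continuous_on {0<..} (theta_vertical_deriv N r x)"
proof -
  have "deriv (theta N r) holomorphic_on {\<tau>. Im \<tau> > 0}"
    by (rule holomorphic_deriv[OF theta_holomorphic[OF assms]]) (simp add: open_halfspace_Im_gt)
  then have "continuous_on {\<tau>. Im \<tau> > 0} (deriv (theta N r))"
    by (rule holomorphic_on_imp_continuous_on)
  then have "continuous_on {0<..} (\<lambda>u. deriv (theta N r) (of_rat x + \<i> * of_real u))"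
    by (rule continuous_on_compose2) (auto intro!: continuous_intros)
  then have "continuous_on {0<..} (\<lambda>u. \<i> * deriv (theta N r) (of_rat x + \<i> * of_real u))"
    by (rule continuous_on_mult_left)
  then show ?thesis
    by (rule continuous_on_eq) (simp add: theta_vertical_deriv_eq[OF assms])
qed

text \<open>Cauchy's inequality on the disc of radius \<open>u / 2\<close> costs a factor \<open>1 / u\<close>: near zero it is compensated by one
  more order of decay, far up it is the asserted decay.\<close>
lemma theta_vertical_deriv_rapid:
  assumes N: "N > 0" "even N" and x: "x \<in> quantum_set N r"
  shows "\<exists>C. \<forall>u>0. norm (theta_vertical_deriv N r x u) \<le> C * min (u ^ m) (1 / u)"
proof -
  obtain C1 where C1: "C1 > 0" "\<And>w. w \<noteq> 0 \<Longrightarrow> norm w \<le> 1/4 \<Longrightarrow> norm w \<le> 4 * Re w \<Longrightarrow> norm (theta N r (of_rat x + \<i> * w)) \<le> C1 * norm w ^ Suc m"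
    using theta_cusp_decay[OF N x] by metis
  obtain C2 where C2: "C2 > 0" "\<And>\<tau>. Im \<tau> > 0 \<Longrightarrow> norm (theta N r \<tau>) \<le> C2 * (1 + 1 / sqrt (Im \<tau>))"
    using theta_bound[OF N(1)] by metis
  have cauchy: "norm (theta_vertical_deriv N r x u) \<le> B / (u / 2)"
    if u: "u > 0" and B: "\<And>z. norm (of_rat x + \<i> * of_real u - z) = u / 2 \<Longrightarrow> norm (theta N r z) \<le> B" for u B
  proof -
    have sub: "cball (of_rat x + \<i> * of_real u) (u / 2) \<subseteq> {\<tau>. Im \<tau> > 0}"
    proof
      fix z assume "z \<in> cball (of_rat x + \<i> * of_real u) (u / 2)"
      then have "\<bar>Im (of_rat x + \<i> * of_real u - z)\<bar> \<le> u / 2"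
        by (metis abs_Im_le_cmod dist_norm mem_cball order_trans)
      then have "\<bar>u - Im z\<bar> \<le> u / 2" by simp
      then have "Im z > 0" using u by linarith
      then show "z \<in> {\<tau>. Im \<tau> > 0}" by simp
    qed
    have hol: "theta N r holomorphic_on cball (of_rat x + \<i> * of_real u) (u / 2)"
      using theta_holomorphic[OF N(1)] sub by (rule holomorphic_on_subset)
    have "norm ((deriv ^^ 1) (theta N r) (of_rat x + \<i> * of_real u)) \<le> fact 1 * B / (u / 2) ^ 1"
      by (rule Cauchy_inequality[OF holomorphic_on_subset[OF hol ball_subset_cball] holomorphic_on_imp_continuous_on[OF hol]])
        (use u B in auto)
    then show ?thesis by (simp add: theta_vertical_deriv_eq[OF N(1) u] norm_mult)
  qed
  let ?C = "2 * C1 * (3/2) ^ Suc m + 80 * C2 * 8 ^ m"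
  show ?thesis
  proof (intro exI allI impI)
    fix u :: real assume u: "u > 0"
    show "norm (theta_vertical_deriv N r x u) \<le> ?C * min (u ^ m) (1 / u)"
    proof (cases "u \<le> 1/8")
      case True
      have "norm (theta_vertical_deriv N r x u) \<le> C1 * (3/2 * u) ^ Suc m / (u / 2)"
      proof (rule cauchy[OF u])
        fix z assume z: "norm (of_rat x + \<i> * of_real u - z) = u / 2"
        define w where "w = - \<i> * (z - of_rat x)"
        have zw: "z = of_rat x + \<i> * w" by (simp add: w_def algebra_simps)
        have "of_rat x + \<i> * of_real u - z = \<i> * (of_real u - w)" by (simp add: zw algebra_simps)
        then have d: "norm (of_real u - w) = u / 2" using z by (simp add: norm_mult)
        have "norm w \<le> norm (of_real u :: complex) + norm (of_real u - w)"
          using norm_triangle_ineq4[of "of_real u" "of_real u - w"] by simp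
        then have w1: "norm w \<le> 3/2 * u" using d u by simp
        have "Re (of_real u - w) \<le> u / 2" using complex_Re_le_cmod[of "of_real u - w"] d by simp
        then have w2: "Re w \<ge> u / 2" by simp
        have "norm (theta N r z) \<le> C1 * norm w ^ Suc m"
          unfolding zw by (rule C1(2)) (use w1 w2 u True in auto)
        also have "\<dots> \<le> C1 * (3/2 * u) ^ Suc m" using w1 C1 by (intro mult_left_mono power_mono) auto
        finally show "norm (theta N r z) \<le> C1 * (3/2 * u) ^ Suc m" .
      qed
      also have "\<dots> = 2 * C1 * (3/2) ^ Suc m * u ^ m" using u by (simp add: power_mult_distrib field_simps)
      also have "\<dots> \<le> ?C * u ^ m" using C2 u by (intro mult_right_mono) auto
      also have "u ^ m = min (u ^ m) (1 / u)"
      proof -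
        have "u ^ m \<le> 1" using u True by (simp add: power_le_one)
        also have "1 \<le> 1 / u" using u True by simp
        finally show ?thesis by simp
      qed
      finally show ?thesis .
    next
      case False
      have "norm (theta_vertical_deriv N r x u) \<le> 5 * C2 / (u / 2)"
      proof (rule cauchy[OF u])
        fix z assume "norm (of_rat x + \<i> * of_real u - z) = u / 2"
        then have "\<bar>Im (of_rat x + \<i> * of_real u - z)\<bar> \<le> u / 2" by (metis abs_Im_le_cmod)
        then have "\<bar>u - Im z\<bar> \<le> u / 2" by simp
        then have z: "Im z > 1/16" using False by linarith
        then have "sqrt (1/16) \<le> sqrt (Im z)" by (intro real_sqrt_le_mono) simp
        then have "1 / sqrt (Im z) \<le> 1 / (1 / 4)" using z by (intro divide_left_mono) (auto simp: real_sqrt_divide)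
        then have "C2 * (1 + 1 / sqrt (Im z)) \<le> C2 * 5" using C2 by (intro mult_left_mono) auto
        then show "norm (theta N r z) \<le> 5 * C2" using C2(2)[of z] z by simp
      qed
      also have "\<dots> = 10 * C2 * (1 / u)" by simp
      also have "\<dots> \<le> ?C * min (u ^ m) (1 / u)"
      proof (cases "u \<le> 1")
        case True
        have "1 ^ m \<le> (8 * u) ^ m" using False by (intro power_mono) auto
        then have one: "1 \<le> 8 ^ m * u ^ m" by (simp only: power_mult_distrib power_one)
        have "1 / u \<le> 8" using False u unfolding pos_divide_le_eq[OF u] by linarith
        then have "10 * C2 * (1 / u) \<le> 10 * C2 * 8" using C2(1) by (intro mult_left_mono) auto
        also have "\<dots> = 80 * C2 * 1" by simp
        also have "\<dots> \<le> 80 * C2 * (8 ^ m * u ^ m)" using one C2(1) by (intro mult_left_mono) auto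
        also have "\<dots> = 80 * C2 * 8 ^ m * u ^ m" by (simp only: mult.assoc)
        also have "\<dots> \<le> ?C * u ^ m" using C1(1) u by (intro mult_right_mono) auto
        also have "u ^ m = min (u ^ m) (1 / u)"
        proof -
          have "u ^ m \<le> 1" using u True by (simp add: power_le_one)
          also have "1 \<le> 1 / u" using u True by simp
          finally show ?thesis by simp
        qed
        finally show ?thesis .
      next
        case big: False
        have "1 / u \<le> 1" using big by simp
        also have "1 \<le> u ^ m" using big by simp
        finally have m: "min (u ^ m) (1 / u) = 1 / u" by simp
        have "10 * C2 * 1 \<le> 80 * C2 * 8 ^ m" using C2 by (intro mult_mono) auto
        moreover have "0 \<le> 2 * C1 * (3/2) ^ Suc m" using C1 by simp
        ultimately have "10 * C2 \<le> ?C" by linarith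
        then show ?thesis unfolding m using u by (intro mult_right_mono) auto
      qed
      finally show ?thesis .
    qed
  qed
qed

text \<open>The value of the Gamma function at \<open>1/2\<close>, rescaled.\<close>
lemma exp_half_integral:
  fixes \<beta> :: real
  assumes "\<beta> > 0"
  shows "set_integrable lborel {0<..} (\<lambda>s. complex_of_real (exp (- \<beta> * s) * s powr (- 1/2)))"
    and "(LINT s:{0<..}|lborel. complex_of_real (exp (- \<beta> * s) * s powr (- 1/2))) = of_real (sqrt (pi / \<beta>))"
proof -
  define g where "g s = indicator {0<..} s *\<^sub>R complex_of_real (exp (- s) * s powr (- 1/2))" for s :: real
  have i1: "set_integrable lborel {0<..} (\<lambda>s. complex_of_real (exp (- s) * s powr (- 1/2)))"
  proof (rule half_line_integrableI[where C = 1])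
    show "continuous_on {0<..} (\<lambda>s. complex_of_real (exp (- s) * s powr (- 1/2)))" by (intro continuous_intros) auto
    fix s :: real assume s: "s > 0"
    have "exp s \<ge> s" using exp_ge_add_one_self[of s] by linarith
    then have "exp (- s) \<le> min 1 (1 / s)" using s by (simp add: exp_minus field_simps)
    then have "exp (- s) * s powr (- 1/2) \<le> min 1 (1 / s) * s powr (- 1/2)" by (rule mult_right_mono) simp
    moreover have "norm (complex_of_real (exp (- s) * s powr (- 1/2))) = exp (- s) * s powr (- 1/2)"
      unfolding norm_of_real by simp
    ultimately show "norm (complex_of_real (exp (- s) * s powr (- 1/2))) \<le> 1 * half_line_majorant s"
      by (simp only: half_line_majorant_def mult_1 mult.commute)
  qed
  then have ig: "integrable lborel g" unfolding set_integrable_def g_def[symmetric] .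
  have "((\<lambda>t. t powr (1/2 - 1) / exp t) has_integral Gamma (1/2)) {0::real..}" by (rule Gamma_integral_real) simp
  then have "((\<lambda>t. exp (- t) * t powr (- 1/2)) has_integral sqrt pi) {0::real..}"
    by (simp add: Gamma_one_half_real exp_minus field_simps)
  then have "((\<lambda>t. complex_of_real (exp (- t) * t powr (- 1/2))) has_integral of_real (sqrt pi)) {0..}"
    by (rule has_integral_of_real)
  then have "integral {0..} (\<lambda>t. complex_of_real (exp (- t) * t powr (- 1/2))) = of_real (sqrt pi)"
    by (rule integral_unique)
  moreover have "integral {0<..} (\<lambda>t. complex_of_real (exp (- t) * t powr (- 1/2))) = integral {0..} (\<lambda>t. complex_of_real (exp (- t) * t powr (- 1/2)))"
    by (rule integral_spike_set; rule negligible_subset[of "{0}"]) auto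
  ultimately have vg: "(LINT s|lborel. g s) = of_real (sqrt pi)"
    using set_borel_integral_eq_integral(2)[OF i1] unfolding g_def set_lebesgue_integral_def by simp
  have eq: "indicator {0<..} s *\<^sub>R complex_of_real (exp (- \<beta> * s) * s powr (- 1/2)) = of_real (sqrt \<beta>) * g (0 + \<beta> * s)" for s
  proof (cases "s > 0")
    case True
    have "(\<beta> * s) powr (- 1/2) = \<beta> powr (- 1/2) * s powr (- 1/2)" by (rule powr_mult)
    moreover have "\<beta> powr (- 1/2) = 1 / sqrt \<beta>" using assms by (simp add: powr_minus_divide powr_half_sqrt)
    ultimately show ?thesis using True assms by (simp add: g_def)
  next
    case False
    then show ?thesis using assms by (simp add: g_def zero_less_mult_iff)
  qed
  show "set_integrable lborel {0<..} (\<lambda>s. complex_of_real (exp (- \<beta> * s) * s powr (- 1/2)))"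
    unfolding set_integrable_def eq by (intro integrable_mult_right lborel_integrable_real_affine ig) (use assms in simp)
  have "(LINT s|lborel. g (0 + \<beta> * s)) = of_real (sqrt pi) / of_real \<beta>"
    using lborel_integral_real_affine[of \<beta> g 0] assms vg by (simp add: scaleR_conv_of_real field_simps)
  then have "(LINT s:{0<..}|lborel. complex_of_real (exp (- \<beta> * s) * s powr (- 1/2))) = of_real (sqrt \<beta> * (sqrt pi / \<beta>))"
    unfolding set_lebesgue_integral_def eq by simp
  also have "sqrt \<beta> * (sqrt pi / \<beta>) = sqrt (pi / \<beta>)"
    using assms real_sqrt_mult_self[of \<beta>] by (simp add: real_sqrt_divide field_simps)
  finally show "(LINT s:{0<..}|lborel. complex_of_real (exp (- \<beta> * s) * s powr (- 1/2))) = of_real (sqrt (pi / \<beta>))" .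
qed

section \<open>The Eichler integral of the theta series\<close>

text \<open>The \<open>n\<close>th Taylor coefficient in \<open>\<epsilon>\<close> of the kernel \<open>(W + \<i> * \<epsilon>) powr (- 3/2)\<close>. For
  \<open>W = - \<i> * (w - x)\<close> this is the kernel of weight \<open>3/2\<close> with singularity at \<open>w = x + \<epsilon>\<close>.\<close>
definition kern :: "nat \<Rightarrow> complex \<Rightarrow> complex"
  where "kern n W = ((- 3/2) gchoose n) * (\<i> / W) ^ n * W powr (- 3/2)"

lemma of_real_gchoose: "complex_of_real (a gchoose n) = of_real a gchoose n"
  by (simp add: gbinomial_prod_rev)

lemma kern_of_real:
  assumes "s > 0"
  shows "kern n (of_real s) = of_real ((- 3/2) gchoose n) * \<i> ^ n * of_real (s powr (- 3/2 - real n))"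
proof -
  have "s powr (- 3/2 - real n) = s powr (- 3/2) / s powr real n" by (rule powr_diff)
  also have "\<dots> = s powr (- 3/2) / s ^ n" by (subst powr_realpow[OF assms]) simp
  finally have p: "s powr (- 3/2 - real n) = s powr (- 3/2) / s ^ n" .
  have "complex_of_real s powr (- 3/2) = of_real (s powr (- 3/2))"
    using powr_of_real[of s "- 3/2"] assms by simp
  then show ?thesis unfolding kern_def p by (simp add: of_real_gchoose power_divide)
qed

text \<open>The Taylor series at \<open>\<epsilon> = 0\<close>, as a formal series, of the Eichler integral of \<open>theta\<close> from \<open>x\<close> to \<open>\<i>\<infinity>\<close> with
  singularity at \<open>x + \<epsilon>\<close>. It need not converge; its coefficients are absolutely convergent integrals if \<open>x\<close> is in the
  quantum set, where \<open>theta\<close> decays rapidly.\<close>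
definition eichler_series :: "nat \<Rightarrow> int \<Rightarrow> rat \<Rightarrow> complex fps"
  where "eichler_series N r x = Abs_fps (\<lambda>n. LINT s:{0<..}|lborel. theta N r (of_rat x + \<i> * of_real s) * kern n (of_real s))"

definition theta_abs :: "nat \<Rightarrow> int \<Rightarrow> complex \<Rightarrow> complex"
  where "theta_abs N r \<tau> = (\<Sum>\<^sub>\<infinity>n::int. of_real \<bar>of_int n + of_int r / of_nat N\<bar> * exp (\<i> * of_real (theta_exponent N r n) * \<tau>))"

definition theta_odd :: "nat \<Rightarrow> int \<Rightarrow> complex \<Rightarrow> complex"
  where "theta_odd N r \<tau> = (\<Sum>\<^sub>\<infinity>n::int. of_real (of_int n + of_int r / of_nat N) * exp (\<i> * of_real (theta_exponent N r n) * \<tau>))"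

lemma theta_odd_zsummable:
  assumes "N > 0" "Im \<tau> > 0"
  shows "zsummable (\<lambda>n. of_real (of_int n + of_int r / of_nat N) * exp (\<i> * of_real (theta_exponent N r n) * \<tau>))"
    and "zsummable (\<lambda>n. of_real \<bar>of_int n + of_int r / of_nat N\<bar> * exp (\<i> * of_real (theta_exponent N r n) * \<tau>))"
proof -
  have "zsummable (\<lambda>n. (of_int n + of_real (of_int r / of_nat N)) * exp (- of_real pi * (- \<i> * of_nat N * \<tau>) * (of_int n + of_real (of_int r / of_nat N)) ^ 2))"
    by (rule shifted_gaussian_sum_zsummable_weighted) (use assms in simp)
  also have "(\<lambda>n::int. (of_int n + of_real (of_int r / of_nat N)) * exp (- of_real pi * (- \<i> * of_nat N * \<tau>) * (of_int n + of_real (of_int r / of_nat N)) ^ 2))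
    = (\<lambda>n. of_real (of_int n + of_int r / of_nat N) * exp (\<i> * of_real (theta_exponent N r n) * \<tau>))"
    by (simp add: theta_exponent_def fun_eq_iff algebra_simps)
  finally show "zsummable (\<lambda>n. of_real (of_int n + of_int r / of_nat N) * exp (\<i> * of_real (theta_exponent N r n) * \<tau>))" .
  then show "zsummable (\<lambda>n. of_real \<bar>of_int n + of_int r / of_nat N\<bar> * exp (\<i> * of_real (theta_exponent N r n) * \<tau>))"
    unfolding norm_mult norm_of_real abs_idempotent .
qed

lemma theta_exponent_sqrt:
  assumes "N > 0"
  shows "theta_exponent N r n * sqrt (pi / theta_exponent N r n) = pi * sqrt (of_nat N) * \<bar>of_int n + of_int r / of_nat N\<bar>"
proof (cases "theta_exponent N r n = 0")
  case True
  then have "real_of_int n + of_int r / of_nat N = 0" using assms by (simp add: theta_exponent_def)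
  then show ?thesis using True by simp
next
  case False
  then have pos: "theta_exponent N r n > 0" using theta_exponent_nonneg[of N r n] by linarith
  have "theta_exponent N r n * sqrt (pi / theta_exponent N r n) = sqrt pi * (theta_exponent N r n / sqrt (theta_exponent N r n))"
    by (simp add: real_sqrt_divide)
  also have "\<dots> = sqrt pi * sqrt (theta_exponent N r n)" using pos by (simp add: real_div_sqrt)
  also have "\<dots> = (sqrt pi * sqrt pi) * sqrt (of_nat N) * \<bar>of_int n + of_int r / of_nat N\<bar>"
    by (simp add: theta_exponent_def real_sqrt_mult)
  finally show ?thesis by simp
qed

text \<open>The half-order integral multiplies an exponential of frequency \<open>\<beta>\<close> by \<open>sqrt (pi / \<beta>)\<close>. The frequencies of
  \<open>theta\<close> are squares up to a constant, so the root produces the absolute value of \<open>n + r / N\<close>.\<close>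
theorem theta_half_integral:
  assumes N: "N > 0" and t: "t > 0"
  shows "(LINT s:{0<..}|lborel. theta_vertical_deriv N r x (t + s) * of_real (s powr (- 1/2))) =
    - of_real (pi * sqrt (of_nat N)) * theta_abs N r (of_rat x + \<i> * of_real t)"
proof -
  define \<beta> where "\<beta> = theta_exponent N r"
  define q where "q n = \<bar>real_of_int n + of_int r / of_nat N\<bar>" for n
  define e where "e n = exp (\<i> * of_real (\<beta> n) * (of_rat x + \<i> * of_real t))" for n
  define g where "g b s = exp (- b * s) * s powr (- 1/2)" for b s :: real
  define f where "f n s = - of_real (\<beta> n) * e n * of_real (g (\<beta> n) s)" for n s
  have nn: "\<beta> n \<ge> 0" for n by (simp add: \<beta>_def)
  have root: "\<beta> n * sqrt (pi / \<beta> n) = pi * sqrt (of_nat N) * q n" for n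
    unfolding \<beta>_def q_def by (rule theta_exponent_sqrt[OF N])
  have fi: "set_integrable lborel {0<..} (f n)" and fv: "(LINT s:{0<..}|lborel. f n s) = - of_real (pi * sqrt (of_nat N)) * (of_real (q n) * e n)"
    and fn: "(LINT s:{0<..}|lborel. norm (f n s)) = pi * sqrt (of_nat N) * norm (of_real (q n) * e n)" for n
  proof -
    have *: "set_integrable lborel {0<..} (f n) \<and> (LINT s:{0<..}|lborel. f n s) = - e n * of_real (\<beta> n * sqrt (pi / \<beta> n)) \<and>
      (LINT s:{0<..}|lborel. norm (f n s)) = norm (e n) * (\<beta> n * sqrt (pi / \<beta> n))"
    proof (cases "\<beta> n = 0")
      case True
      then show ?thesis by (simp add: f_def[abs_def] set_integrable_def set_lebesgue_integral_def)
    next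
      case False
      then have b: "\<beta> n > 0" using nn[of n] by linarith
      note I = exp_half_integral[OF b, folded g_def]
      have Ir: "(LINT s:{0<..}|lborel. g (\<beta> n) s) = sqrt (pi / \<beta> n)"
        using I(2) unfolding set_integral_complex_of_real by (simp only: of_real_eq_iff)
      have 1: "set_integrable lborel {0<..} (f n)"
        unfolding f_def by (rule set_integrable_mult_right) (rule I(1))
      have 2: "(LINT s:{0<..}|lborel. f n s) = - e n * of_real (\<beta> n * sqrt (pi / \<beta> n))"
        unfolding f_def set_integral_mult_right I(2) by simp
      have "norm (f n s) = \<beta> n * norm (e n) * g (\<beta> n) s" for s
        unfolding f_def norm_mult norm_minus_cancel norm_of_real using nn[of n] by (simp add: g_def)
      then have 3: "(LINT s:{0<..}|lborel. norm (f n s)) = norm (e n) * (\<beta> n * sqrt (pi / \<beta> n))"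
        by (simp only: set_integral_mult_right Ir) simp
      show ?thesis using 1 2 3 by blast
    qed
    show "set_integrable lborel {0<..} (f n)" using * by blast
    show "(LINT s:{0<..}|lborel. f n s) = - of_real (pi * sqrt (of_nat N)) * (of_real (q n) * e n)"
      using * unfolding root by simp
    have "q n \<ge> 0" by (simp add: q_def)
    then show "(LINT s:{0<..}|lborel. norm (f n s)) = pi * sqrt (of_nat N) * norm (of_real (q n) * e n)"
      using * unfolding root by (simp add: norm_mult)
  qed
  have zq: "zsummable (\<lambda>n. of_real (q n) * e n)"
    unfolding q_def e_def \<beta>_def by (rule theta_odd_zsummable(2)) (use N t in auto)
  have abs: "theta_abs N r (of_rat x + \<i> * of_real t) = (\<Sum>\<^sub>\<infinity>n. of_real (q n) * e n)"
    by (simp add: theta_abs_def q_def e_def \<beta>_def)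
  have pw: "f n s = (\<i> * (\<i> * of_real (\<beta> n) * exp (\<i> * of_real (\<beta> n) * (of_rat x + \<i> * of_real (t + s))))) * of_real (s powr (- 1/2))" for n s
    unfolding f_def e_def g_def by (simp add: exp_of_real[symmetric] mult_exp_exp algebra_simps)
  have zf: "zsummable (\<lambda>n. f n s)" if "s > 0" for s
    unfolding pw norm_mult
    by (intro summable_on_cmult_left summable_on_cmult_right)
      (use theta_has_derivative(2)[of N "of_rat x + \<i> * of_real (t + s)" r] N t that in \<open>simp add: \<beta>_def norm_mult\<close>)
  have pws: "(\<Sum>k. f (int_decode k) s) = theta_vertical_deriv N r x (t + s) * of_real (s powr (- 1/2))" if "s > 0" for s
  proof -
    have "(\<Sum>k. f (int_decode k) s) = (\<Sum>\<^sub>\<infinity>n. f n s)"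
      using int_abs_summable_sums(2)[OF zf[OF that]] by (simp add: sums_iff)
    also have "\<dots> = theta_vertical_deriv N r x (t + s) * of_real (s powr (- 1/2))"
      unfolding pw theta_vertical_deriv_def infsum_cmult_left'[symmetric]
      by (rule infsum_cong) (simp add: \<beta>_def mult.assoc[symmetric])
    finally show ?thesis .
  qed
  have "(\<lambda>k. LINT s:{0<..}|lborel. f (int_decode k) s) sums (LINT s:{0<..}|lborel. \<Sum>k. f (int_decode k) s)"
  proof (rule set_integral_series(2)[OF fi])
    show "summable (\<lambda>k. norm (f (int_decode k) s))" if "s \<in> {0<..}" for s
      using int_abs_summable_sums(1)[OF zf] that by simp
    show "summable (\<lambda>k. LINT s:{0<..}|lborel. norm (f (int_decode k) s))"
      unfolding fn by (rule summable_mult[OF int_abs_summable_sums(1)[OF zq]])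
  qed
  moreover have "(\<lambda>k. LINT s:{0<..}|lborel. f (int_decode k) s) sums (- of_real (pi * sqrt (of_nat N)) * (\<Sum>\<^sub>\<infinity>n. of_real (q n) * e n))"
    unfolding fv by (rule sums_mult[OF int_abs_summable_sums(2)[OF zq]])
  moreover have "(LINT s:{0<..}|lborel. \<Sum>k. f (int_decode k) s) = (LINT s:{0<..}|lborel. theta_vertical_deriv N r x (t + s) * of_real (s powr (- 1/2)))"
    by (rule set_lebesgue_integral_cong) (auto simp: pws)
  ultimately show ?thesis unfolding abs using sums_unique2 by metis
qed

text \<open>Integration by parts; the boundary terms vanish, at zero because of the rapid decay of \<open>theta\<close>.\<close>
lemma theta_moment_by_parts:
  assumes N: "N > 0" "even N" and x: "x \<in> quantum_set N r"
  shows "(LINT u:{0<..}|lborel. theta_vertical_deriv N r x u * of_real (u powr (- 1/2 - real n))) =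
    of_real (1/2 + real n) * (LINT u:{0<..}|lborel. theta N r (of_rat x + \<i> * of_real u) * of_real (u powr (- 3/2 - real n)))"
proof -
  define V where "V u = theta N r (of_rat x + \<i> * of_real u)" for u
  define V' where "V' = theta_vertical_deriv N r x"
  obtain C where C: "\<And>u. u > 0 \<Longrightarrow> norm (V u) \<le> C * min (u ^ Suc n) 1"
    using theta_vertical_rapid[OF N x, of "Suc n"] unfolding V_def by blast
  obtain C' where C': "\<And>u. u > 0 \<Longrightarrow> norm (V' u) \<le> C' * min (u ^ n) (1 / u)"
    using theta_vertical_deriv_rapid[OF N x, of n] unfolding V'_def by blast
  have i1: "set_integrable lborel {0<..} (\<lambda>u. V u * of_real (u powr (- 3/2 - real n)))"
    by (rule moment_integrable[OF _ C]) (auto simp: V_def intro: theta_vertical_continuous N)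
  have i2: "set_integrable lborel {0<..} (\<lambda>u. V' u * of_real (u powr (- 1/2 - real n)))"
    by (rule moment_integrable_half[OF _ C']) (auto simp: V'_def intro: theta_vertical_deriv_continuous N)
  have i3: "set_integrable lborel {0<..} (\<lambda>u. of_real (1/2 + real n) * (V u * of_real (u powr (- 3/2 - real n))))"
    by (rule set_integrable_mult_right) (rule i1)
  let ?G = "\<lambda>u. V u * of_real (u powr (- 1/2 - real n))"
  let ?f = "\<lambda>u. V' u * of_real (u powr (- 1/2 - real n)) - of_real (1/2 + real n) * (V u * of_real (u powr (- 3/2 - real n)))"
  have "(\<lambda>k. ?G (real (Suc k)) - ?G (1 / real (Suc k))) \<longlonglongrightarrow> (LINT u:{0<..}|lborel. ?f u)"
  proof (rule improper_FTC_seq)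
    show "set_integrable lborel {0<..} ?f" by (rule set_integral_diff(1)[OF i2 i3])
    fix u :: real assume u: "u > 0"
    have "((\<lambda>u. u powr (- 1/2 - real n)) has_real_derivative (- 1/2 - real n) * u powr (- 1/2 - real n - 1)) (at u)"
      using u by (rule has_real_derivative_powr)
    moreover have "- 1/2 - real n - 1 = - 3/2 - real n" by simp
    ultimately have "((\<lambda>u. u powr (- 1/2 - real n)) has_real_derivative (- 1/2 - real n) * u powr (- 3/2 - real n)) (at u)" by simp
    then have d: "((\<lambda>u. complex_of_real (u powr (- 1/2 - real n))) has_vector_derivative of_real ((- 1/2 - real n) * u powr (- 3/2 - real n))) (at u)"
      by (intro has_vector_derivative_of_real) (simp add: has_real_derivative_iff_has_vector_derivative)
    have "(V has_vector_derivative V' u) (at u)"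
      unfolding V_def V'_def by (rule theta_vertical_has_vector_derivative[OF N(1) u])
    from has_vector_derivative_mult[OF this d]
    show "(?G has_vector_derivative ?f u) (at u)"
      by (rule has_vector_derivative_eq_rhs) (simp add: algebra_simps)
  next
    show "(\<lambda>k. 1 / real (Suc k)) \<longlonglongrightarrow> 0" by (rule LIMSEQ_Suc[OF lim_1_over_n])
    show "filterlim (\<lambda>k. real (Suc k)) at_top sequentially"
      by (rule filterlim_compose[OF filterlim_real_sequentially filterlim_Suc])
  qed simp
  moreover have "(\<lambda>k. ?G (real (Suc k)) - ?G (1 / real (Suc k))) \<longlonglongrightarrow> 0 - 0"
  proof (rule tendsto_diff)
    have C0: "C \<ge> 0" using order_trans[OF norm_ge_zero C[of 1]] by simp
    have lim: "((\<lambda>k. C * real (Suc k) powr (- 1/2)) \<longlonglongrightarrow> 0)"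
      by real_asymp
    show "(\<lambda>k. ?G (real (Suc k))) \<longlonglongrightarrow> 0"
    proof (rule Lim_null_comparison[OF always_eventually lim], rule allI)
      fix k
      have "norm (V (real (Suc k))) \<le> C * min (real (Suc k) ^ Suc n) 1" by (rule C) simp
      also have "\<dots> \<le> C * 1" using C0 by (intro mult_left_mono) auto
      finally have "norm (V (real (Suc k))) \<le> C" by simp
      then have "norm (V (real (Suc k))) * real (Suc k) powr (- 1/2 - real n) \<le> C * real (Suc k) powr (- 1/2)"
        using C0 by (intro mult_mono powr_mono) auto
      then show "norm (?G (real (Suc k))) \<le> C * real (Suc k) powr (- 1/2)" by (simp add: norm_mult)
    qed
    show "(\<lambda>k. ?G (1 / real (Suc k))) \<longlonglongrightarrow> 0"
    proof (rule Lim_null_comparison[OF always_eventually lim], rule allI)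
      fix k
      define a where "a = 1 / real (Suc k)"
      have a: "a > 0" "a \<le> 1" by (auto simp: a_def)
      have "norm (V a) \<le> C * a ^ Suc n" by (rule order_trans[OF C[OF a(1)] mult_left_mono[OF min.cobounded1 C0]])
      then have "norm (V a) * a powr (- 1/2 - real n) \<le> C * a ^ Suc n * a powr (- 1/2 - real n)"
        by (rule mult_right_mono) simp
      also have "\<dots> = C * (a powr real (Suc n) * a powr (- 1/2 - real n))"
        by (subst powr_realpow[OF a(1)]) simp
      also have "a powr real (Suc n) * a powr (- 1/2 - real n) = a powr (1/2)"
        by (subst powr_add[symmetric]) simp
      also have "a powr (1/2) = real (Suc k) powr (- 1/2)"
        unfolding a_def by (simp add: powr_divide powr_minus_divide)
      finally show "norm (?G (1 / real (Suc k))) \<le> C * real (Suc k) powr (- 1/2)"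
        unfolding a_def[symmetric] by (simp add: norm_mult)
    qed
  qed
  ultimately have "(LINT u:{0<..}|lborel. ?f u) = 0" using LIMSEQ_unique by fastforce
  then have "(LINT u:{0<..}|lborel. V' u * of_real (u powr (- 1/2 - real n))) =
      (LINT u:{0<..}|lborel. of_real (1/2 + real n) * (V u * of_real (u powr (- 3/2 - real n))))"
    unfolding set_integral_diff(2)[OF i2 i3] by simp
  then show ?thesis unfolding set_integral_mult_right V_def V'_def .
qed

text \<open>The series is a half-order integral of \<open>theta_vertical_deriv\<close>, whose asymptotic coefficients are moments. After
  integration by parts these are the moments of \<open>theta\<close> that occur in the Eichler integral; the binomial coefficients
  of \<open>- 1/2\<close> become those of \<open>- 3/2\<close>.\<close>
theorem theta_abs_eps_expansion:
  assumes N: "N > 0" "even N" and x: "x \<in> quantum_set N r"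
  shows "eps_expansion (theta_abs N r) x (fps_const (- 1 / (2 * of_real pi * of_real (sqrt (of_nat N)))) * eichler_series N r x)"
  unfolding eps_expansion_def
proof
  fix K
  let ?m = "\<lambda>n. LINT u:{0<..}|lborel. theta N r (of_rat x + \<i> * of_real u) * of_real (u powr (- 3/2 - real n))"
  let ?c = "- 1 / (2 * of_real pi * of_real (sqrt (of_nat N))) :: complex"
  have E: "eichler_series N r x $ n = of_real ((- 3/2) gchoose n) * \<i> ^ n * ?m n" for n
  proof -
    have "eichler_series N r x $ n = (LINT s:{0<..}|lborel. (of_real ((- 3/2) gchoose n) * \<i> ^ n) * (theta N r (of_rat x + \<i> * of_real s) * of_real (s powr (- 3/2 - real n))))"
      unfolding eichler_series_def fps_nth_Abs_fps by (rule set_lebesgue_integral_cong) (auto simp: kern_of_real)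
    then show ?thesis by (simp only: set_integral_mult_right)
  qed
  \<comment> \<open>The factor \<open>1/2 + n\<close> comes from the integration by parts.\<close>
  have binom: "((- 1/2) gchoose n) * (1/2 + real n) = ((- 3/2) gchoose n) / 2" for n
    using gbinomial_absorb_comp[of "- 1/2 :: real" n] by (simp add: algebra_simps)
  let ?D = "\<lambda>t. (LINT s:{0<..}|lborel. theta_vertical_deriv N r x (t + s) * of_real (s powr (- 1/2))) -
      (\<Sum>n<K. of_real (((- 1/2) gchoose n) * (- t) ^ n) * (LINT u:{0<..}|lborel. theta_vertical_deriv N r x u * of_real (u powr (- 1/2 - real n))))"
  have D: "?D \<in> O[at_right 0](\<lambda>t. of_real t ^ K)"
    by (rule half_integral_asymptotics[OF theta_vertical_deriv_continuous[OF N(1)] theta_vertical_deriv_rapid[OF N x]])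
  have sN: "complex_of_real (sqrt (of_nat N)) \<noteq> 0" using N by simp
  have eq: "theta_abs N r (of_rat x + \<i> * of_real t) - (\<Sum>n<K. (fps_const ?c * eichler_series N r x) $ n * (\<i> * of_real t) ^ n) = (2 * ?c) * ?D t"
    if t: "t > 0" for t
  proof -
    have 1: "theta_abs N r (of_rat x + \<i> * of_real t) = (2 * ?c) * (LINT s:{0<..}|lborel. theta_vertical_deriv N r x (t + s) * of_real (s powr (- 1/2)))"
      unfolding theta_half_integral[OF N(1) t] using sN by simp
    have 2: "(fps_const ?c * eichler_series N r x) $ n * (\<i> * of_real t) ^ n =
        (2 * ?c) * (of_real (((- 1/2) gchoose n) * (- t) ^ n) * (LINT u:{0<..}|lborel. theta_vertical_deriv N r x u * of_real (u powr (- 1/2 - real n))))" for n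
    proof -
      have "\<i> ^ n * (\<i> * of_real t) ^ n = of_real ((- t) ^ n)"
        by (simp flip: power_mult_distrib)
      then have "(fps_const ?c * eichler_series N r x) $ n * (\<i> * of_real t) ^ n = ?c * (of_real ((- 3/2) gchoose n) * of_real ((- t) ^ n) * ?m n)"
      proof -
        have "(c * (b * p * m)) * z = c * (b * (p * z) * m)" for b c m p z :: complex
          by (simp only: mult_ac)
        then show ?thesis unfolding fps_mult_left_const_nth E
          using \<open>\<i> ^ n * (\<i> * of_real t) ^ n = of_real ((- t) ^ n)\<close> by (simp only:)
      qed
      also have "\<dots> = (2 * ?c) * (of_real (((- 3/2) gchoose n) / 2 * (- t) ^ n) * ?m n)"
        by simp
      also have "\<dots> = (2 * ?c) * (of_real (((- 1/2) gchoose n) * (- t) ^ n) * (of_real (1/2 + real n) * ?m n))"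
        unfolding binom[symmetric] by (simp only: of_real_mult mult_ac)
      finally show ?thesis unfolding theta_moment_by_parts[OF N x] .
    qed
    show ?thesis unfolding 1 2 right_diff_distrib sum_distrib_left ..
  qed
  have "(\<lambda>t. (2 * ?c) * ?D t) \<in> O[at_right 0](\<lambda>t. of_real t ^ K)"
    using D by (subst landau_o.big.cmult_in_iff) (use sN in auto)
  note mem = this
  have ev: "\<forall>\<^sub>F t in at_right 0. theta_abs N r (of_rat x + \<i> * of_real t) - (\<Sum>n<K. (fps_const ?c * eichler_series N r x) $ n * (\<i> * of_real t) ^ n) = (2 * ?c) * ?D t"
    using eq by (intro eventually_at_rightI[of 0 1]) auto
  show "(\<lambda>t. theta_abs N r (of_rat x + \<i> * of_real t) - (\<Sum>n<K. (fps_const ?c * eichler_series N r x) $ n * (\<i> * of_real t) ^ n)) \<in> O[at_right 0](\<lambda>t. of_real t ^ K)"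
    by (rule landau_o.big.in_cong[OF ev, THEN iffD2, OF mem])
qed

section \<open>The expansion of the partial theta function\<close>

text \<open>On each residue class modulo the denominator of \<open>x\<close> the series is an odd Gaussian sum, whose dual has no
  constant term. Hence the series decays faster than any power, at every rational point.\<close>
theorem theta_odd_eps_expansion:
  assumes N: "N > 0" "even N"
  shows "eps_expansion (theta_odd N r) x 0"
  unfolding eps_expansion_def
proof
  fix K
  obtain h k where hk: "quotient_of x = (h, k)" by force
  have k: "k > 0" and x_eq: "x = of_int h / of_int k"
    using hk quotient_of_denom_pos quotient_of_div by blast+
  define B where "B = real N * of_int k ^ 2"
  have B: "B > 0" using N k by (simp add: B_def)
  define S where "S = (\<Sum>\<^sub>\<infinity>l::int. \<bar>of_int l\<bar> * exp (- pi / 2 * of_int l ^ 2))"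
  have s: "(\<lambda>l::int. \<bar>of_int l\<bar> * exp (- pi / 2 * of_int l ^ 2)) summable_on UNIV"
  proof -
    have "zsummable (\<lambda>l. of_real (\<bar>of_int l\<bar> * exp (- pi / 2 * of_int l ^ 2)))"
    proof (rule gauss_dominated_summable[where \<epsilon> = "pi / 2" and B = 1 and C = 1])
      fix l :: int
      have "\<bar>of_int l\<bar> \<le> exp \<bar>real_of_int l\<bar>" using exp_ge_add_one_self[of "\<bar>real_of_int l\<bar>"] by linarith
      then have "\<bar>of_int l\<bar> * exp (- pi / 2 * of_int l ^ 2) \<le> exp \<bar>real_of_int l\<bar> * exp (- pi / 2 * of_int l ^ 2)"
        by (rule mult_right_mono) simp
      also have "\<dots> = exp (1 * \<bar>of_int l\<bar> - pi / 2 * of_int l ^ 2)" by (simp add: mult_exp_exp)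
      finally show "norm (complex_of_real (\<bar>of_int l\<bar> * exp (- pi / 2 * of_int l ^ 2))) \<le> 1 * exp (1 * \<bar>of_int l\<bar> - pi / 2 * of_int l ^ 2)"
        unfolding norm_of_real by (simp add: abs_mult)
    qed simp
    then show ?thesis unfolding norm_of_real by (simp add: abs_mult)
  qed
  have S: "S \<ge> 0" unfolding S_def by (auto intro!: infsum_nonneg)
  obtain C where C: "C > 0" "\<And>t. t > 0 \<Longrightarrow> exp (- (pi / 2) / t) \<le> C * t ^ (K + 2)"
    using exp_decay_le_power[of "pi / 2" "K + 2"] by auto
  have dual: "norm (\<Sum>\<^sub>\<infinity>n::int. (of_int n + complex_of_real b) * exp (- of_real pi * of_real A * (of_int n + complex_of_real b) ^ 2)) \<le> S * C * A ^ K"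
    if A: "0 < A" "A \<le> 1" for A b :: real
  proof -
    have "norm (\<Sum>\<^sub>\<infinity>n::int. (of_int n + complex_of_real b) * exp (- of_real pi * of_real A * (of_int n + complex_of_real b) ^ 2)) =
      1 / (A * sqrt A) * norm (\<Sum>\<^sub>\<infinity>n::int. of_int n * exp (- of_real pi * of_int n ^ 2 / of_real A) * unit_exp (of_int n * of_real b))"
      unfolding gaussian_poisson_weighted[OF A(1)] using A by (simp add: norm_mult norm_divide)
    also have "norm (\<Sum>\<^sub>\<infinity>n::int. of_int n * exp (- of_real pi * of_int n ^ 2 / of_real A) * unit_exp (of_int n * of_real b)) \<le>
        (\<Sum>\<^sub>\<infinity>l::int. exp (- pi * (1 / A) / 2) * (\<bar>of_int l\<bar> * exp (- pi / 2 * of_int l ^ 2)))"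
    proof (rule norm_zsum_le[OF summable_on_cmult_right[OF s]])
      fix l :: int
      have u: "norm (unit_exp (of_int l * complex_of_real b)) = 1"
        using norm_unit_exp_of_real[of "of_int l * b"] by simp
      have e: "norm (exp (- of_real pi * of_int l ^ 2 / complex_of_real A)) = exp (- pi * of_int l ^ 2 * (1 / A))"
        by (simp add: Re_divide_of_real)
      show "norm (of_int l * exp (- of_real pi * of_int l ^ 2 / complex_of_real A) * unit_exp (of_int l * of_real b)) \<le>
          exp (- pi * (1 / A) / 2) * (\<bar>of_int l\<bar> * exp (- pi / 2 * of_int l ^ 2))"
      proof (cases "l = 0")
        case False
        have "exp (- pi * of_int l ^ 2 * (1 / A)) \<le> exp (- pi * (1 / A) / 2) * exp (- pi * 1 / 2 * of_int l ^ 2)"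
          by (rule nonzero_gauss_term_bound[OF False]) (use A in auto)
        then have "\<bar>of_int l\<bar> * exp (- pi * of_int l ^ 2 * (1 / A)) \<le> \<bar>of_int l\<bar> * (exp (- pi * (1 / A) / 2) * exp (- pi * 1 / 2 * of_int l ^ 2))"
          by (rule mult_left_mono) simp
        then show ?thesis unfolding norm_mult u e norm_of_int by (simp add: mult_ac)
      qed simp
    qed
    also have "\<dots> = exp (- (pi / 2) / A) * S" unfolding S_def by (simp add: infsum_cmult_right')
    also have "exp (- (pi / 2) / A) * S \<le> C * A ^ (K + 2) * S"
      using C(2)[OF A(1)] S by (rule mult_right_mono)
    also have "1 / (A * sqrt A) * (C * A ^ (K + 2) * S) = S * C * A ^ K * (A / sqrt A)"
      using A by (simp add: power_add power2_eq_square)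
    also have "\<dots> \<le> S * C * A ^ K * 1"
    proof (rule mult_left_mono)
      show "A / sqrt A \<le> 1" using A by (simp add: real_div_sqrt)
      show "0 \<le> S * C * A ^ K" using S C(1) A by simp
    qed
    finally show ?thesis using A by (simp add: divide_right_mono)
  qed
  have main: "norm (theta_odd N r (of_rat x + \<i> * of_real t)) \<le> (of_int k ^ 2 * S * C * B ^ K) * t ^ K" if t: "0 < t" "t \<le> 1 / B" for t
  proof -
    define A where "A = B * t"
    have A: "0 < A" "A \<le> 1" using B t by (auto simp: A_def field_simps)
    define c where "c j = unit_exp (of_nat N / 2 * (of_int j + of_int r / of_nat N) ^ 2 * (of_int h / of_int k))" for j :: int
    define \<beta> where "\<beta> j = (of_int j + of_int r / of_nat N) / (of_int k :: real)" for j :: int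
    have c1: "norm (c j) = 1" for j
      using norm_unit_exp_of_real[of "of_nat N / 2 * (of_int j + of_int r / of_nat N) ^ 2 * (of_int h / of_int k)"] by (simp add: c_def)
    have arg: "of_rat x + \<i> * of_real t = of_int h / of_int k + \<i> * complex_of_real t" by (simp add: x_eq of_rat_divide)
    have zs: "zsummable (\<lambda>n. of_real (of_int n + of_int r / of_nat N) * exp (\<i> * of_real (theta_exponent N r n) * (of_int h / of_int k + \<i> * of_real t)))"
      by (rule theta_odd_zsummable(1)[OF N(1)]) (use t in simp)
    have term1: "of_real (of_int (j + k * m) + of_int r / of_nat N) * exp (\<i> * of_real (theta_exponent N r (j + k * m)) * (of_int h / of_int k + \<i> * of_real t)) =
        of_int k * c j * ((of_int m + of_real (\<beta> j)) * exp (- of_real pi * of_real A * (of_int m + of_real (\<beta> j)) ^ 2))" for j m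
    proof -
      have "of_int (j + k * m) + of_int r / of_nat N = of_int k * (of_int m + \<beta> j)" using k by (simp add: \<beta>_def field_simps)
      moreover have "of_nat N * of_int k ^ 2 * complex_of_real t = of_real A" by (simp add: A_def B_def)
      ultimately show ?thesis
        unfolding theta_term[symmetric] theta_summand_split[OF N(2,1) k] c_def[symmetric] \<beta>_def[symmetric] by simp
    qed
    have "theta_odd N r (of_rat x + \<i> * of_real t) = (\<Sum>j\<in>{0..<k}. of_int k * c j * (\<Sum>\<^sub>\<infinity>m. (of_int m + of_real (\<beta> j)) * exp (- of_real pi * of_real A * (of_int m + of_real (\<beta> j)) ^ 2)))"
      unfolding theta_odd_def arg by (subst infsum_residue_classes[OF zs k]) (simp only: term1 infsum_cmult_right')
    also have "norm \<dots> \<le> (\<Sum>j\<in>{0..<k}. of_int k * (S * C * A ^ K))"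
    proof (rule order_trans[OF norm_sum sum_mono])
      fix j
      show "norm (of_int k * c j * (\<Sum>\<^sub>\<infinity>m. (of_int m + of_real (\<beta> j)) * exp (- of_real pi * of_real A * (of_int m + of_real (\<beta> j)) ^ 2))) \<le> of_int k * (S * C * A ^ K)"
        unfolding norm_mult c1 using k dual[OF A] by (simp add: mult_left_mono)
    qed
    also have "\<dots> = (of_int k ^ 2 * S * C * B ^ K) * t ^ K" using k by (simp add: A_def power_mult_distrib power2_eq_square)
    finally show ?thesis .
  qed
  show "(\<lambda>t. theta_odd N r (of_rat x + \<i> * of_real t) - (\<Sum>n<K. 0 $ n * (\<i> * of_real t) ^ n)) \<in> O[at_right 0](\<lambda>t. of_real t ^ K)"
  proof (rule bigoI)
    have "\<forall>\<^sub>F t in at_right (0::real). 0 < t \<and> t \<le> 1 / B"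
      using B by (intro eventually_at_rightI[of 0 "1 / B"]) auto
    then show "\<forall>\<^sub>F t in at_right 0. norm (theta_odd N r (of_rat x + \<i> * of_real t) - (\<Sum>n<K. 0 $ n * (\<i> * of_real t) ^ n)) \<le> (of_int k ^ 2 * S * C * B ^ K) * norm (of_real t ^ K :: complex)"
    proof eventually_elim
      case (elim t) then show ?case using main[of t] by (simp add: norm_power)
    qed
  qed
qed

text \<open>The remainder after \<open>K\<close> terms is \<open>z ^ K\<close> times the value of the shifted series, which is continuous at zero.\<close>
lemma has_fps_expansion_imp_eps_expansion:
  assumes "(\<lambda>\<epsilon>. f (of_rat x + \<epsilon>)) has_fps_expansion F"
  shows "eps_expansion f x F"
  unfolding eps_expansion_def
proof
  fix K
  have rad: "fps_conv_radius F > 0" and ev: "\<forall>\<^sub>F z in nhds 0. eval_fps F z = f (of_rat x + z)"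
    using assms by (auto simp: has_fps_expansion_def)
  have "\<forall>\<^sub>F z in nhds (0::complex). z \<in> eball 0 (fps_conv_radius F)"
    using rad by (intro eventually_nhds_in_open) (auto simp: zero_ereal_def)
  moreover define G where "G = eval_fps (fps_shift K F)"
  have "isCont G 0" unfolding G_def
    using rad by (intro continuous_eval_fps) (auto simp: zero_ereal_def)
  then have "(G \<longlongrightarrow> G 0) (nhds 0)" by (simp add: continuous_within tendsto_at_iff_tendsto_nhds)
  then have "\<forall>\<^sub>F z in nhds 0. dist (G z) (G 0) < 1" by (rule tendstoD) simp
  ultimately have "\<forall>\<^sub>F z in nhds 0. norm (f (of_rat x + z) - (\<Sum>n<K. F $ n * z ^ n)) \<le> (norm (G 0) + 1) * norm z ^ K"
    using ev
  proof eventually_elim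
    case (elim z)
    then have "norm z < fps_conv_radius F" by simp
    then have sF: "(\<lambda>n. F $ n * z ^ n) sums eval_fps F z" by (rule sums_eval_fps)
    have "norm z < fps_conv_radius (fps_shift K F)" using \<open>norm z < fps_conv_radius F\<close> by simp
    then have sG: "(\<lambda>n. fps_shift K F $ n * z ^ n) sums G z" unfolding G_def by (rule sums_eval_fps)
    have "(\<lambda>n. z ^ K * (fps_shift K F $ n * z ^ n)) sums (z ^ K * G z)" by (rule sums_mult[OF sG])
    moreover have "(\<lambda>n. z ^ K * (fps_shift K F $ n * z ^ n)) = (\<lambda>n. F $ (n + K) * z ^ (n + K))"
      by (simp add: power_add mult_ac fun_eq_iff)
    ultimately have "(\<lambda>n. F $ (n + K) * z ^ (n + K)) sums (z ^ K * G z)" by simp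
    moreover have "(\<lambda>n. F $ (n + K) * z ^ (n + K)) sums (eval_fps F z - (\<Sum>n<K. F $ n * z ^ n))"
      using sF by (rule sums_split_initial_segment)
    ultimately have "eval_fps F z - (\<Sum>n<K. F $ n * z ^ n) = z ^ K * G z" by (rule sums_unique2[rotated])
    then have "norm (f (of_rat x + z) - (\<Sum>n<K. F $ n * z ^ n)) = norm (G z) * norm z ^ K"
      using elim by (simp add: norm_mult norm_power)
    also have "norm (G z) \<le> norm (G 0) + 1"
      using elim norm_triangle_ineq2[of "G z" "G 0"] by (simp add: dist_norm)
    finally show ?case by (simp add: mult_right_mono)
  qed
  moreover have "filterlim (\<lambda>t::real. \<i> * of_real t) (nhds 0) (at_right 0)"
  proof -
    have "((\<lambda>t::real. \<i> * of_real t) \<longlongrightarrow> \<i> * of_real 0) (at_right 0)" by (intro tendsto_intros)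
    then show ?thesis by simp
  qed
  ultimately have "\<forall>\<^sub>F t in at_right (0::real). norm (f (of_rat x + \<i> * of_real t) - (\<Sum>n<K. F $ n * (\<i> * of_real t) ^ n)) \<le> (norm (G 0) + 1) * norm (\<i> * complex_of_real t) ^ K"
    unfolding filterlim_iff by fast
  then show "(\<lambda>t. f (of_rat x + \<i> * of_real t) - (\<Sum>n<K. F $ n * (\<i> * of_real t) ^ n)) \<in> O[at_right 0](\<lambda>t. of_real t ^ K)"
    by (intro bigoI[where c = "norm (G 0) + 1"]) (simp add: norm_mult norm_power)
qed

text \<open>The truncation to \<open>n \<ge> 0\<close> and the truncation to positive \<open>q = n + r / N\<close> differ in the terms for which \<open>n\<close> and
  \<open>q\<close> have different signs; this is the difference of the coefficients.\<close>
definition defect_coeff :: "nat \<Rightarrow> int \<Rightarrow> int \<Rightarrow> real"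
  where "defect_coeff N r n = (let q = of_int n + of_int r / of_nat N in (if n \<ge> 0 then q else 0) - (\<bar>q\<bar> + q) / 2)"

text \<open>For \<open>\<bar>n\<bar> > \<bar>r\<bar>\<close> the sign of \<open>n + r / N\<close> is that of \<open>n\<close>, so the range contains all nonzero coefficients.\<close>
definition theta_defect :: "nat \<Rightarrow> int \<Rightarrow> complex \<Rightarrow> complex"
  where "theta_defect N r \<tau> = (\<Sum>n\<in>{-\<bar>r\<bar>..\<bar>r\<bar>}. of_real (defect_coeff N r n) * exp (\<i> * of_real (theta_exponent N r n) * \<tau>))"

text \<open>The Taylor series of \<open>theta_defect\<close> at \<open>z\<close>.\<close>
definition defect_series :: "nat \<Rightarrow> int \<Rightarrow> complex \<Rightarrow> complex fps"
  where "defect_series N r z = (\<Sum>n\<in>{-\<bar>r\<bar>..\<bar>r\<bar>}. fps_const (of_real (defect_coeff N r n) * exp (\<i> * of_real (theta_exponent N r n) * z)) * fps_exp (\<i> * of_real (theta_exponent N r n)))"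

lemma defect_has_fps_expansion:
  "(\<lambda>\<epsilon>. theta_defect N r (z + \<epsilon>)) has_fps_expansion defect_series N r z"
proof -
  have eq: "theta_defect N r (z + \<epsilon>) = (\<Sum>n\<in>{-\<bar>r\<bar>..\<bar>r\<bar>}. (of_real (defect_coeff N r n) * exp (\<i> * of_real (theta_exponent N r n) * z)) * exp (\<i> * of_real (theta_exponent N r n) * \<epsilon>))" for \<epsilon>
    unfolding theta_defect_def by (simp add: distrib_left exp_add mult.assoc)
  show ?thesis unfolding eq defect_series_def
    by (intro has_fps_expansion_sum has_fps_expansion_cmult_left has_fps_expansion_exp)
qed

lemma defect_coeff_zero:
  assumes "N > 0" "n \<notin> {-\<bar>r\<bar>..\<bar>r\<bar>}"
  shows "defect_coeff N r n = 0"
proof -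
  have "\<bar>real_of_int r / of_nat N\<bar> \<le> \<bar>real_of_int r\<bar> / 1"
    unfolding abs_divide using assms(1) by (intro divide_left_mono) auto
  then have q: "\<bar>real_of_int r / of_nat N\<bar> \<le> of_int \<bar>r\<bar>" by simp
  consider "n > \<bar>r\<bar>" | "n < - \<bar>r\<bar>" using assms(2) by fastforce
  then show ?thesis
  proof cases
    case 1
    then have "real_of_int n > of_int \<bar>r\<bar>" by (simp only: of_int_less_iff)
    then have "real_of_int n + of_int r / of_nat N \<ge> 0" using q by linarith
    then show ?thesis using 1 by (simp add: defect_coeff_def Let_def)
  next
    case 2
    then have "real_of_int n < of_int (- \<bar>r\<bar>)" by (simp only: of_int_less_iff)
    then have "real_of_int n < - of_int \<bar>r\<bar>" by (simp only: of_int_minus)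
    then have "real_of_int n + of_int r / of_nat N \<le> 0" using abs_le_D1[OF q] by linarith
    moreover have "n < 0" using 2 by linarith
    ultimately show ?thesis by (simp add: defect_coeff_def Let_def)
  qed
qed

text \<open>The coefficient \<open>q\<close> restricted to \<open>q > 0\<close> is \<open>(q + \<bar>q\<bar>) / 2\<close>.\<close>
lemma partial_theta_decomposition:
  assumes N: "N > 0" and \<tau>: "Im \<tau> > 0"
  shows "partial_theta N r \<tau> = 1/2 * theta_odd N r \<tau> + 1/2 * theta_abs N r \<tau> + theta_defect N r \<tau>"
proof -
  define q where "q n = real_of_int n + of_int r / of_nat N" for n
  define e where "e n = exp (\<i> * of_real (theta_exponent N r n) * \<tau>)" for n
  have z1: "zsummable (\<lambda>n. of_real (q n) * e n)" and z2: "zsummable (\<lambda>n. of_real \<bar>q n\<bar> * e n)"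
    unfolding q_def e_def using theta_odd_zsummable[OF N \<tau>] by blast+
  note s1 = Infinite_Sum.abs_summable_summable[OF z1] and s2 = Infinite_Sum.abs_summable_summable[OF z2]
  let ?h = "\<lambda>n. (if n \<ge> 0 then of_real (q n) * e n else 0)"
  have bij: "bij_betw int UNIV {0..}"
    by (rule bij_betw_byWitness[where f' = nat]) auto
  have "(?h has_sum (1/2 * (\<Sum>\<^sub>\<infinity>n. of_real (q n) * e n) + 1/2 * (\<Sum>\<^sub>\<infinity>n. of_real \<bar>q n\<bar> * e n) + theta_defect N r \<tau>)) UNIV"
  proof -
    have "((\<lambda>n. of_real (defect_coeff N r n) * e n) has_sum theta_defect N r \<tau>) UNIV"
      unfolding theta_defect_def
      by (rule has_sum_finite_neutralI) (auto simp: e_def defect_coeff_zero[OF N])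
    then have "((\<lambda>n. 1/2 * (of_real (q n) * e n) + 1/2 * (of_real \<bar>q n\<bar> * e n) + of_real (defect_coeff N r n) * e n) has_sum
        (1/2 * (\<Sum>\<^sub>\<infinity>n. of_real (q n) * e n) + 1/2 * (\<Sum>\<^sub>\<infinity>n. of_real \<bar>q n\<bar> * e n) + theta_defect N r \<tau>)) UNIV"
      by (intro has_sum_add has_sum_cmult_right has_sum_infsum s1 s2)
    moreover have "1/2 * (of_real (q n) * e n) + 1/2 * (of_real \<bar>q n\<bar> * e n) + of_real (defect_coeff N r n) * e n = ?h n" for n
    proof -
      have "1/2 * (of_real (q n) * e n) + 1/2 * (of_real \<bar>q n\<bar> * e n) + of_real (defect_coeff N r n) * e n =
        of_real (q n / 2 + \<bar>q n\<bar> / 2 + defect_coeff N r n) * e n"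
        by (simp add: algebra_simps)
      also have "q n / 2 + \<bar>q n\<bar> / 2 + defect_coeff N r n = (if n \<ge> 0 then q n else 0)"
        by (simp add: defect_coeff_def q_def Let_def add_divide_distrib)
      finally show ?thesis by simp
    qed
    ultimately show ?thesis by (simp only:)
  qed
  then have "((\<lambda>n. of_real (q n) * e n) has_sum (1/2 * (\<Sum>\<^sub>\<infinity>n. of_real (q n) * e n) + 1/2 * (\<Sum>\<^sub>\<infinity>n. of_real \<bar>q n\<bar> * e n) + theta_defect N r \<tau>)) {0..}"
    by (subst (asm) has_sum_cong_neutral[where T = "{0..}" and g = "\<lambda>n. of_real (q n) * e n"]) auto
  then have "((\<lambda>k. of_real (q (int k)) * e (int k)) has_sum (1/2 * (\<Sum>\<^sub>\<infinity>n. of_real (q n) * e n) + 1/2 * (\<Sum>\<^sub>\<infinity>n. of_real \<bar>q n\<bar> * e n) + theta_defect N r \<tau>)) UNIV"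
    using has_sum_reindex_bij_betw[OF bij, of "\<lambda>n. of_real (q n) * e n"] by simp
  then have sums: "(\<lambda>k. of_real (q (int k)) * e (int k)) sums (1/2 * (\<Sum>\<^sub>\<infinity>n. of_real (q n) * e n) + 1/2 * (\<Sum>\<^sub>\<infinity>n. of_real \<bar>q n\<bar> * e n) + theta_defect N r \<tau>)"
    by (rule has_sum_imp_sums)
  have "partial_theta N r \<tau> = (\<Sum>k. of_real (q (int k)) * e (int k))"
    unfolding partial_theta_def q_def e_def theta_term[symmetric] by simp
  also have "\<dots> = 1/2 * (\<Sum>\<^sub>\<infinity>n. of_real (q n) * e n) + 1/2 * (\<Sum>\<^sub>\<infinity>n. of_real \<bar>q n\<bar> * e n) + theta_defect N r \<tau>"
    using sums by (rule sums_unique[symmetric])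
  finally show ?thesis by (simp add: theta_odd_def theta_abs_def q_def e_def)
qed

definition eichler_const :: "nat \<Rightarrow> complex"
  where "eichler_const N = - 1 / (4 * of_real pi * of_real (sqrt (of_nat N)))"

theorem partial_theta_eps_expansion:
  assumes N: "N > 0" "even N" and x: "x \<in> quantum_set N r"
  shows "eps_expansion (partial_theta N r) x (fps_const (eichler_const N) * eichler_series N r x + defect_series N r (of_rat x))"
proof -
  have "eps_expansion (\<lambda>\<tau>. 1/2 * theta_odd N r \<tau> + 1/2 * theta_abs N r \<tau> + theta_defect N r \<tau>) x
    (fps_const (1/2) * 0 + fps_const (1/2) * (fps_const (- 1 / (2 * of_real pi * of_real (sqrt (of_nat N)))) * eichler_series N r x) + defect_series N r (of_rat x))"
    by (intro eps_expansion_add eps_expansion_cmult theta_odd_eps_expansion theta_abs_eps_expansion N x has_fps_expansion_imp_eps_expansion defect_has_fps_expansion)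
  moreover have "fps_const (1/2) * 0 + fps_const (1/2) * (fps_const (- 1 / (2 * of_real pi * of_real (sqrt (of_nat N)))) * eichler_series N r x) =
      fps_const (eichler_const N) * eichler_series N r x"
    by (simp add: eichler_const_def mult.assoc[symmetric])
  ultimately have "eps_expansion (\<lambda>\<tau>. 1/2 * theta_odd N r \<tau> + 1/2 * theta_abs N r \<tau> + theta_defect N r \<tau>) x
    (fps_const (eichler_const N) * eichler_series N r x + defect_series N r (of_rat x))" by (simp only:)
  then show ?thesis
    by (rule eps_expansion_cong) (use partial_theta_decomposition[OF N(1)] in simp)
qed

section \<open>The formal Moebius substitution\<close>

text \<open>The formal series of \<open>(V + \<i> * \<epsilon>) powr (- 3/2)\<close> in \<open>\<epsilon>\<close>.\<close>
definition kern_series :: "complex \<Rightarrow> complex fps"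
  where "kern_series V = fps_const (V powr (- 3/2)) * (fps_binomial (- 3/2) oo (fps_const (\<i> / V) * fps_X))"

lemma kern_series_nth: "fps_nth (kern_series V) n = kern n V"
  unfolding kern_series_def fps_compose_linear by (simp add: kern_def mult_ac)

text \<open>The series \<open>moebius_shift\<close> at an arbitrary base point: the analyticity of the finite part has to be proved at
  irrational points as well.\<close>
definition moebius_shift_at :: "int \<Rightarrow> int \<Rightarrow> int \<Rightarrow> int \<Rightarrow> complex \<Rightarrow> complex fps"
  where "moebius_shift_at a b c d z =
    (fps_const (of_int a) * (fps_const z + fps_X) + fps_const (of_int b))
    * inverse (fps_const (of_int c) * (fps_const z + fps_X) + fps_const (of_int d))
    - fps_const ((of_int a * z + of_int b) / (of_int c * z + of_int d))"

lemma moebius_shift_eq: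
  fixes \<gamma> :: "int ^ 2 ^ 2"
  assumes "a = \<gamma>$1$1" "b = \<gamma>$1$2" "c = \<gamma>$2$1" "d = \<gamma>$2$2"
  shows "moebius_shift \<gamma> x = moebius_shift_at a b c d (of_rat x)"
  by (simp add: moebius_shift_def moebius_shift_at_def moebius_rat_def of_rat_divide of_rat_add of_rat_mult assms)

lemma moebius_shift_at_0:
  assumes "of_int c * z + of_int d \<noteq> 0"
  shows "fps_nth (moebius_shift_at a b c d z) 0 = 0"
  using assms by (simp add: moebius_shift_at_def divide_inverse)

text \<open>With \<open>u = cz + d\<close> this is the identity \<open>(u + c\<epsilon>) (\<gamma>(z + \<epsilon>) - \<gamma>z) = \<epsilon> / u\<close>.\<close>
lemma moebius_shift_at_mult:
  assumes det: "a' * d' - b' * c' = (1::int)"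
    and u: "u = of_int c' * z + of_int d'" "u \<noteq> 0"
  shows "(1 + fps_const (of_int c' / u) * fps_X) * moebius_shift_at a' b' c' d' z = fps_const (1 / u ^ 2) * fps_X"
proof -
  define a b c d where "a = complex_of_int a'" "b = complex_of_int b'" "c = complex_of_int c'" "d = complex_of_int d'"
  note abcd = a_b_c_d_def
  have cdet: "a * d - b * c = 1" using det by (simp add: abcd flip: of_int_mult of_int_diff)
  define m where "m = (a * z + b) / (c * z + d)"
  have u': "u = c * z + d" by (simp add: u abcd)
  define D where "D = fps_const c * (fps_const z + fps_X) + fps_const d"
  have D1: "D = fps_const u + fps_const c * fps_X"
  proof -
    have "fps_const u = fps_const c * fps_const z + fps_const d" by (simp add: u')
    then show ?thesis by (simp only: D_def distrib_left add_ac)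
  qed
  have D: "D = fps_const u * (1 + fps_const (c / u) * fps_X)"
  proof -
    have "fps_const u * (1 + fps_const (c / u) * fps_X) = fps_const u + fps_const (u * (c / u)) * fps_X"
      by (simp only: distrib_left mult_1_right mult.assoc[symmetric] fps_const_mult)
    then show ?thesis using u(2) by (simp add: D1)
  qed
  have D0: "fps_nth D 0 \<noteq> 0" using u by (simp add: D_def abcd)
  have "D * moebius_shift_at a' b' c' d' z = (fps_const a * (fps_const z + fps_X) + fps_const b) * (D * inverse D) - fps_const m * D"
    by (simp add: moebius_shift_at_def D_def m_def abcd algebra_simps)
  also have "D * inverse D = 1" by (rule inverse_mult_eq_1'[OF D0])
  also have "(fps_const a * (fps_const z + fps_X) + fps_const b) * 1 - fps_const m * D = fps_const (a * z + b - m * u) + fps_const (a - m * c) * fps_X"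
  proof -
    have "(A * (Z + X) + B) * 1 - E * (U + C * X) = (A * Z + B - E * U) + (A - E * C) * X" for A B C E U X Z :: "complex fps"
      by (simp add: algebra_simps)
    then show ?thesis unfolding D1 by simp
  qed
  also have "a * z + b - m * u = 0" using u(2) by (simp add: m_def u')
  also have "a - m * c = 1 / u"
  proof -
    have mu: "m * u = a * z + b" using u(2) by (simp add: m_def u')
    have "(a - m * c) * u = a * u - (m * u) * c" by (simp add: algebra_simps)
    also have "\<dots> = 1" unfolding mu using cdet by (simp add: u' algebra_simps)
    finally show ?thesis using u(2) by (simp add: eq_divide_eq)
  qed
  finally have "fps_const u * ((1 + fps_const (c / u) * fps_X) * moebius_shift_at a' b' c' d' z) = fps_const (1 / u) * fps_X"
    by (simp add: D mult.assoc)
  then have "fps_const (1 / u) * (fps_const u * ((1 + fps_const (c / u) * fps_X) * moebius_shift_at a' b' c' d' z)) = fps_const (1 / u) * (fps_const (1 / u) * fps_X)"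
    by simp
  then show ?thesis using u(2) by (simp add: mult.assoc[symmetric] abcd power2_eq_square)
qed

lemma fps_compose_const_mult:
  fixes M :: "complex fps"
  assumes "fps_nth M 0 = 0"
  shows "(fps_binomial s oo (fps_const a * fps_X)) oo M = fps_binomial s oo (fps_const a * M)"
proof -
  have "(fps_binomial s oo (fps_const a * fps_X)) oo M = fps_binomial s oo ((fps_const a * fps_X) oo M)"
    by (rule fps_compose_assoc[symmetric]) (use assms in auto)
  then show ?thesis by (simp add: fps_compose_mult_distrib[OF assms] assms)
qed

text \<open>The point \<open>x + \<i> * W\<close> is the preimage under \<open>\<gamma>\<close> of \<open>\<gamma>x + \<i> * s\<close>. The automorphy factor is a power of
  \<open>1 + c\<epsilon> / u\<close> and the transformed kernel is a power of \<open>1 + \<i> / s * (\<gamma>(x + \<epsilon>) - \<gamma>x)\<close>. The product of the two bases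
  is \<open>1 + \<i>\<epsilon> / W\<close>, the base of the kernel at \<open>W\<close>.\<close>
theorem kern_series_moebius:
  fixes \<gamma> :: "int ^ 2 ^ 2"
  assumes entries: "a = \<gamma>$1$1" "b = \<gamma>$1$2" "c = \<gamma>$2$1" "d = \<gamma>$2$2"
    and det: "a * d - b * c = 1"
    and u: "u = of_int c * of_rat x + of_int d" "u \<noteq> (0::real)"
    and s: "s > 0" and W: "W = of_real (u ^ 2 * s) / (1 - \<i> * of_real (of_int c * u * s))"
  shows "automorphy_series (- 3/2) \<gamma> x * (kern_series (of_real s) oo moebius_shift \<gamma> x) =
    fps_const (lower_power u c (- 3/2) * of_real s powr (- 3/2)) * (fps_binomial (- 3/2) oo (fps_const (\<i> / W) * fps_X))"
proof -
  define z where "z = complex_of_rat x"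
  define M where "M = moebius_shift \<gamma> x"
  define U where "U = complex_of_real u"
  have U: "U = of_int c * z + of_int d" "U \<noteq> 0"
  proof -
    show "U \<noteq> 0" unfolding U_def of_real_eq_0_iff by (rule u(2))
    show "U = of_int c * z + of_int d" unfolding U_def u(1) z_def complex_of_rat_eq by simp
  qed
  have M: "M = moebius_shift_at a b c d z" by (simp add: M_def z_def moebius_shift_eq[OF entries])
  have M0: "fps_nth M 0 = 0" unfolding M by (rule moebius_shift_at_0) (use U in simp)
  have mult: "(1 + fps_const (of_int c / U) * fps_X) * M = fps_const (1 / U ^ 2) * fps_X"
    unfolding M by (rule moebius_shift_at_mult[OF det U])
  \<comment> \<open>The product of \<open>1 + ?P\<close> and \<open>1 + ?Q\<close> is \<open>1 + \<i> * \<epsilon> / W\<close>.\<close>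
  let ?P = "fps_const (of_int c / U) * fps_X" and ?Q = "fps_const (\<i> / of_real s) * M"
  have sum: "?P + ?Q + ?P * ?Q = fps_const (\<i> / W) * fps_X"
  proof -
    have "?P + ?Q + ?P * ?Q = ?P + fps_const (\<i> / of_real s) * ((1 + ?P) * M)" by (simp add: algebra_simps)
    also have "\<dots> = fps_const (of_int c / U + \<i> / of_real s * (1 / U ^ 2)) * fps_X"
      unfolding mult by (simp add: distrib_right mult.assoc[symmetric] fps_const_add[symmetric] del: fps_const_add)
    also have "of_int c / U + \<i> / of_real s * (1 / U ^ 2) = \<i> / W"
    proof -
      have "\<i> / W = \<i> * (1 - \<i> * of_real (of_int c * u * s)) / of_real (u ^ 2 * s)" unfolding W by simp
      also have "\<dots> = of_int c / U + \<i> / of_real s * (1 / U ^ 2)"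
        using u(2) s by (simp add: U_def field_simps power2_eq_square)
      finally show ?thesis by simp
    qed
    finally show ?thesis .
  qed
  have A: "automorphy_series (- 3/2) \<gamma> x = fps_const (lower_power u c (- 3/2)) * (fps_binomial (- 3/2) oo ?P)"
    by (simp add: automorphy_series_def Let_def entries U_def u(1))
  have "kern_series (of_real s) oo M = fps_const (of_real s powr (- 3/2)) * (fps_binomial (- 3/2) oo ?Q)"
    unfolding kern_series_def by (simp add: fps_compose_mult_distrib[OF M0] fps_compose_const_mult[OF M0])
  then have "automorphy_series (- 3/2) \<gamma> x * (kern_series (of_real s) oo M) =
      fps_const (lower_power u c (- 3/2) * of_real s powr (- 3/2)) * ((fps_binomial (- 3/2) oo ?P) * (fps_binomial (- 3/2) oo ?Q))"
    unfolding A by (simp add: fps_const_mult[symmetric] mult_ac del: fps_const_mult)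
  also have "(fps_binomial (- 3/2) oo ?P) * (fps_binomial (- 3/2) oo ?Q) = fps_binomial (- 3/2) oo (fps_const (\<i> / W) * fps_X)"
    by (subst fps_binomial_compose_mult) (use M0 sum in simp_all)
  finally show ?thesis unfolding M_def .
qed

text \<open>All powers are exponentials of the real logarithms of \<open>\<bar>u\<bar>\<close> and \<open>s\<close> and of \<open>Ln l\<close>, whose imaginary part is less than
  \<open>pi / 2\<close>. For negative \<open>u\<close> the principal root of \<open>u / l\<close> adds \<open>\<plusminus>\<i> * pi\<close> to the logarithm, with the sign of \<open>c\<close>, and
  \<open>lower_power\<close> subtracts the same amount, so that together they contribute \<open>exp (\<plusminus>2 * \<i> * pi) = 1\<close>.\<close>
theorem geodesic_branch:
  fixes u s :: real and c :: int
  assumes u: "u \<noteq> 0" and s: "s > 0" and c: "c \<noteq> 0"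
  defines "l \<equiv> 1 - \<i> * of_real (of_int c * u * s)"
  shows "csqrt (of_real u / l) * (lower_power u c (- 3/2) * of_real s powr (- 3/2)) =
    (of_real u / l) ^ 2 * (of_real (u ^ 2 * s) / l) powr (- 3/2)"
proof -
  have l: "Re l = 1" "Im l = - (of_int c * u * s)" by (simp_all add: l_def)
  have l0: "l \<noteq> 0" using l(1) by force
  define L where "L = Ln l"
  have expL: "exp L = l" using l0 by (simp add: L_def)
  have ImL: "\<bar>Im L\<bar> < pi / 2" unfolding L_def using Re_Ln_pos_lt[OF l0] l(1) by simp
  define v where "v = ln \<bar>u\<bar>"
  have expv: "exp (complex_of_real v) = of_real \<bar>u\<bar>" using u by (simp add: v_def exp_of_real)
  define t where "t = ln s"
  have expt: "exp (complex_of_real t) = of_real s" using s by (simp add: t_def exp_of_real)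
  have W: "(of_real (u ^ 2 * s) / l) powr (- 3/2) = exp (- 3/2 * (2 * of_real v + of_real t - L))"
  proof -
    have "Ln (of_real (u ^ 2 * s) / l) = 2 * of_real v + of_real t - L"
    proof (rule Ln_unique)
      have "exp (2 * complex_of_real v) = of_real (u ^ 2)"
        by (simp add: exp_double expv flip: of_real_power)
      then show "exp (2 * of_real v + of_real t - L) = of_real (u ^ 2 * s) / l"
        by (simp add: exp_diff exp_add expt expL)
    qed (use ImL in auto)
    then show ?thesis using u s l0 by (simp add: powr_def)
  qed
  have S: "of_real s powr (- 3/2) = exp (- 3/2 * complex_of_real t)"
    using s by (simp add: powr_def t_def Ln_of_real)
  have g2: "(of_real u / l) ^ 2 = exp (2 * of_real v - 2 * L)"
  proof -
    have "exp (2 * of_real v - 2 * L) = (exp (of_real v - L)) ^ 2" by (simp add: exp_double[symmetric] algebra_simps)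
    also have "\<dots> = (of_real \<bar>u\<bar> / l) ^ 2" by (simp add: exp_diff expv expL)
    finally show ?thesis by (simp add: power_divide flip: of_real_power)
  qed
  have key: "csqrt (of_real u / l) * lower_power u c (- 3/2) = exp (- of_real v - L / 2)"
  proof (cases "u > 0")
    case True
    have "Ln (of_real u / l) = of_real v - L"
      by (rule Ln_unique) (use ImL True in \<open>auto simp: exp_diff expv expL\<close>)
    then have "csqrt (of_real u / l) = exp ((of_real v - L) / 2)"
      using u l0 by (subst csqrt_exp_Ln) auto
    moreover have "lower_power u c (- 3/2) = exp (- 3/2 * of_real v)"
      using True by (simp add: lower_power_def Ln_of_real v_def)
    ultimately show ?thesis by (simp only: mult_exp_exp) (rule arg_cong[of _ _ exp], simp add: field_simps)
  next
    case False
    then have neg: "u < 0" using u by simp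
    have Lnu: "Ln (complex_of_real u) = of_real v + \<i> * of_real pi"
      by (rule Ln_unique) (use neg in \<open>auto simp: exp_add expv\<close>)
    define \<sigma> :: real where "\<sigma> = (if c > 0 then 1 else - 1)"
    have "Im L * of_int c > 0"
    proof -
      have "0 < Im l \<longleftrightarrow> c > 0" using neg s c by (auto simp: l mult_less_0_iff zero_less_mult_iff)
      moreover have "Im l < 0 \<longleftrightarrow> c < 0" using neg s c by (auto simp: l mult_less_0_iff zero_less_mult_iff)
      ultimately show ?thesis
        using c Im_Ln_pos_lt_imp[of l] Im_Ln_pos_lt[OF l0] ImL l0 unfolding L_def
        by (metis Im_Ln_eq_0 Im_Ln_pos_le linorder_cases mult_neg_neg mult_pos_pos of_int_0_less_iff of_int_less_0_iff order.strict_implies_order not_less less_irrefl Im_Ln_le_pi Im_Ln_pos_lt)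
    qed
    then have Im: "\<bar>Im (of_real v - L + \<i> * of_real (\<sigma> * pi))\<bar> < pi"
      using ImL by (auto simp: \<sigma>_def zero_less_mult_iff abs_less_iff)
    have "exp (of_real v - L + \<i> * of_real (\<sigma> * pi)) = of_real u / l"
      using neg by (simp add: exp_add exp_diff expv expL \<sigma>_def exp_minus)
    then have "Ln (of_real u / l) = of_real v - L + \<i> * of_real (\<sigma> * pi)"
      using Im by (intro Ln_unique) auto
    then have "csqrt (of_real u / l) = exp ((of_real v - L + \<i> * of_real (\<sigma> * pi)) / 2)"
      using u l0 by (subst csqrt_exp_Ln) auto
    moreover have "lower_power u c (- 3/2) = exp (- 3/2 * (of_real v - \<i> * of_real (\<sigma> * pi)))"
      unfolding lower_power_def Lnu by (simp add: \<sigma>_def)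
    ultimately have "csqrt (of_real u / l) * lower_power u c (- 3/2) =
        exp (- of_real v - L / 2 + 2 * (\<i> * of_real (\<sigma> * pi)))"
      by (simp only: mult_exp_exp) (rule arg_cong[of _ _ exp], simp add: field_simps)
    also have "\<dots> = exp (- of_real v - L / 2) * exp (2 * (\<i> * of_real (\<sigma> * pi)))" by (rule exp_add)
    also have "exp (2 * (\<i> * complex_of_real (\<sigma> * pi))) = 1"
      by (auto simp: \<sigma>_def exp_minus exp_double)
    finally show ?thesis by simp
  qed
  have "csqrt (of_real u / l) * (lower_power u c (- 3/2) * of_real s powr (- 3/2)) = exp (- of_real v - L / 2) * exp (- 3/2 * of_real t)"
    unfolding S using key by (simp add: mult.assoc[symmetric])
  also have "\<dots> = exp (2 * of_real v - 2 * L) * exp (- 3/2 * (2 * of_real v + of_real t - L))"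
    unfolding mult_exp_exp by (rule arg_cong[of _ _ exp]) (simp add: field_simps)
  finally show ?thesis unfolding g2 W .
qed

section \<open>The period function\<close>

lemma norm_powr_of_real: "norm (W powr of_real a) = norm W powr a" if "W \<noteq> 0" for W :: complex
  using that by (simp add: powr_def)

text \<open>Both \<open>W\<close> and \<open>W + \<i> * \<epsilon>\<close> lie in the right half plane, where principal powers of quotients are quotients of
  principal powers.\<close>
lemma kern_sums:
  assumes "Re W > 0" "\<bar>\<epsilon>\<bar> < norm W"
  shows "(\<lambda>n. kern n W * of_real \<epsilon> ^ n) sums ((W + \<i> * of_real \<epsilon>) powr (- 3/2))"
proof -
  define z where "z = \<i> * of_real \<epsilon> / W"
  have W0: "W \<noteq> 0" using assms by auto
  have z: "norm z < 1" using assms W0 by (simp add: z_def norm_mult norm_divide)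
  have A: "W + \<i> * of_real \<epsilon> = W * (1 + z)" using W0 by (simp add: z_def field_simps)
  have ReA: "Re (W + \<i> * of_real \<epsilon>) > 0" using assms by simp
  then have A0: "W + \<i> * of_real \<epsilon> \<noteq> 0" by (metis less_irrefl zero_complex.sel(1))
  then have z0: "1 + z \<noteq> 0" unfolding A by auto
  have "Ln (1 + z) = Ln (W + \<i> * of_real \<epsilon>) - Ln W" by (rule Ln_quotient_halfplane[OF ReA assms(1) A])
  then have L: "Ln (W + \<i> * of_real \<epsilon>) = Ln (1 + z) + Ln W" by simp
  have eq: "(1 + z) powr (- 3/2) * W powr (- 3/2) = (W + \<i> * of_real \<epsilon>) powr (- 3/2)"
    using W0 A0 z0 by (simp only: powr_def if_False mult_exp_exp L distrib_left)
  have "(\<lambda>n. ((- 3/2) gchoose n) * z ^ n * W powr (- 3/2)) sums ((1 + z) powr (- 3/2) * W powr (- 3/2))"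
    by (rule sums_mult2[OF gen_binomial_complex[OF z]])
  moreover have "((- 3/2) gchoose n) * z ^ n * W powr (- 3/2) = kern n W * of_real \<epsilon> ^ n" for n
    by (simp add: kern_def z_def power_divide power_mult_distrib)
  ultimately show ?thesis unfolding eq by simp
qed

lemma vertical_kernel_bound:
  fixes \<eta> :: real
  assumes N: "N > 0" and "\<eta> > 0"
  obtains C where "C > 0" "\<And>z s b. Im z = 0 \<Longrightarrow> s > 0 \<Longrightarrow> \<bar>b\<bar> \<ge> \<eta> \<Longrightarrow>
    norm (theta N r (z + \<i> * of_real s) * (of_real s + \<i> * of_real b) powr (- 3/2)) \<le> C * half_line_majorant s"
proof -
  obtain C0 where C0: "C0 > 0" "\<And>\<tau>. Im \<tau> > 0 \<Longrightarrow> norm (theta N r \<tau>) \<le> C0 * (1 + 1 / sqrt (Im \<tau>))"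
    using theta_bound[OF N] by metis
  show ?thesis
  proof (rule that[of "C0 * (2 * (1 + \<eta> powr (- 3/2)))"])
    show "C0 * (2 * (1 + \<eta> powr (- 3/2))) > 0" using C0 by (simp add: add_pos_nonneg)
    fix z :: complex and s b :: real assume a: "Im z = 0" "s > 0" "\<bar>b\<bar> \<ge> \<eta>"
    define W where "W = of_real s + \<i> * complex_of_real b"
    have W: "norm W \<ge> s" "norm W \<ge> \<eta>"
      using complex_Re_le_cmod[of W] abs_Im_le_cmod[of W] a by (auto simp: W_def)
    then have W0: "W \<noteq> 0" using assms(2) by auto
    have nW: "norm (W powr (- 3/2)) = norm W powr (- 3/2)" using norm_powr_of_real[OF W0, of "- 3/2"] by simp
    have "norm (theta N r (z + \<i> * of_real s)) \<le> C0 * (1 + 1 / sqrt s)"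
      using C0(2)[of "z + \<i> * of_real s"] a by simp
    then have "norm (theta N r (z + \<i> * of_real s) * W powr (- 3/2)) \<le> C0 * (1 + 1 / sqrt s) * norm W powr (- 3/2)"
      unfolding norm_mult nW by (rule mult_right_mono) simp
    also have "\<dots> = C0 * ((1 + 1 / sqrt s) * norm W powr (- 3/2))" by simp
    also have "\<dots> \<le> C0 * (2 * (1 + \<eta> powr (- 3/2)) * half_line_majorant s)"
    proof (rule mult_left_mono)
      show "(1 + 1 / sqrt s) * norm W powr (- 3/2) \<le> 2 * (1 + \<eta> powr (- 3/2)) * half_line_majorant s"
      proof (cases "s \<le> 1")
        case True
        have sq: "1 / sqrt s = s powr (- 1/2)" using a by (simp add: powr_minus_divide powr_half_sqrt)
        have "1 \<le> 1 / sqrt s" using a True by simp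
        then have "1 + 1 / sqrt s \<le> 2 * s powr (- 1/2)" unfolding sq[symmetric] by linarith
        moreover have "norm W powr (- 3/2) \<le> \<eta> powr (- 3/2)"
          using W assms(2) by (intro powr_mono2') auto
        then have "norm W powr (- 3/2) \<le> 1 + \<eta> powr (- 3/2)" by simp
        ultimately have "(1 + 1 / sqrt s) * norm W powr (- 3/2) \<le> (2 * s powr (- 1/2)) * (1 + \<eta> powr (- 3/2))"
          by (intro mult_mono) auto
        then show ?thesis by (simp only: half_line_majorant_le1[OF a(2) True] mult_ac)
      next
        case False
        have "1 / sqrt s \<le> 1" using False by simp
        moreover have "norm W powr (- 3/2) \<le> s powr (- 3/2)"
          using W a by (intro powr_mono2') auto
        ultimately have "(1 + 1 / sqrt s) * norm W powr (- 3/2) \<le> 2 * s powr (- 3/2)"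
          by (intro mult_mono) auto
        also have "\<dots> \<le> 2 * (1 + \<eta> powr (- 3/2)) * s powr (- 3/2)" by (intro mult_right_mono) auto
        finally show ?thesis using False by (simp add: half_line_majorant_ge1)
      qed
    qed (use C0 in simp)
    finally show "norm (theta N r (z + \<i> * of_real s) * (of_real s + \<i> * of_real b) powr (- 3/2)) \<le> C0 * (2 * (1 + \<eta> powr (- 3/2))) * half_line_majorant s"
      by (simp add: W_def mult_ac)
  qed
qed

lemma vertical_kernel_integrable:
  assumes N: "N > 0" and z: "Im z = 0" and b: "b \<noteq> 0"
  shows "set_integrable lborel {0<..} (\<lambda>s. theta N r (z + \<i> * of_real s) * kern n (of_real s + \<i> * of_real b))"
proof -
  obtain C where C: "C > 0" "\<And>z s b'. Im z = 0 \<Longrightarrow> s > 0 \<Longrightarrow> \<bar>b'\<bar> \<ge> \<bar>b\<bar> \<Longrightarrow>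
    norm (theta N r (z + \<i> * of_real s) * (of_real s + \<i> * of_real b') powr (- 3/2)) \<le> C * half_line_majorant s"
    using vertical_kernel_bound[OF N, of "\<bar>b\<bar>"] b by (metis zero_less_abs_iff)
  show ?thesis
  proof (rule half_line_integrableI)
    show "continuous_on {0<..} (\<lambda>s. theta N r (z + \<i> * of_real s) * kern n (of_real s + \<i> * of_real b))"
      unfolding kern_def
      by (intro continuous_intros theta_vertical_continuous[OF N z])
        (auto simp: complex_eq_iff complex_nonpos_Reals_iff)
    fix s :: real assume s: "s > 0"
    define W where "W = of_real s + \<i> * complex_of_real b"
    have W: "norm W \<ge> \<bar>b\<bar>" using abs_Im_le_cmod[of W] by (simp add: W_def)
    have "norm ((\<i> / W) ^ n) = (1 / norm W) ^ n" by (simp add: norm_power norm_divide)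
    also have "\<dots> \<le> (1 / \<bar>b\<bar>) ^ n" using W b by (intro power_mono divide_left_mono mult_pos_pos) (auto intro: less_le_trans[of 0 "\<bar>b\<bar>"])
    finally have p: "norm ((\<i> / W) ^ n) \<le> (1 / \<bar>b\<bar>) ^ n" .
    have "norm (theta N r (z + \<i> * of_real s) * kern n W) =
      norm ((- 3/2 :: complex) gchoose n) * norm ((\<i> / W) ^ n) * norm (theta N r (z + \<i> * of_real s) * W powr (- 3/2))"
      by (simp add: kern_def norm_mult mult_ac)
    also have "\<dots> \<le> norm ((- 3/2 :: complex) gchoose n) * (1 / \<bar>b\<bar>) ^ n * (C * half_line_majorant s)"
      unfolding W_def using p[unfolded W_def] C(2)[OF z s, of b]
      by (intro mult_mono mult_left_mono) auto
    finally show "norm (theta N r (z + \<i> * of_real s) * kern n (of_real s + \<i> * of_real b)) \<le>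
        (norm ((- 3/2 :: complex) gchoose n) * (1 / \<bar>b\<bar>) ^ n * C) * half_line_majorant s"
      by (simp add: W_def mult.assoc)
  qed
qed

text \<open>The Eichler integral of \<open>theta\<close> from \<open>s0\<close> to \<open>\<i>\<infinity>\<close> with singularity at \<open>y\<close>.\<close>
definition period_function :: "nat \<Rightarrow> int \<Rightarrow> real \<Rightarrow> real \<Rightarrow> complex"
  where "period_function N r s0 y =
    (LINT s:{0<..}|lborel. theta N r (of_real s0 + \<i> * of_real s) * (of_real s + \<i> * of_real (y - s0)) powr (- 3/2))"

text \<open>On the line above \<open>s0\<close> the kernel at \<open>y0\<close> has a base of absolute value at least \<open>\<bar>y0 - s0\<bar>\<close>, so its expansion converges
  for \<open>\<bar>y - y0\<bar> < \<bar>y0 - s0\<bar>\<close> uniformly enough to be integrated termwise.\<close>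
theorem period_function_expansion:
  assumes N: "N > 0" and y0: "y0 \<noteq> s0"
  shows "real_fps_expansion (period_function N r s0) y0
    (Abs_fps (\<lambda>n. LINT s:{0<..}|lborel. theta N r (of_real s0 + \<i> * of_real s) * kern n (of_real s + \<i> * of_real (y0 - s0))))"
proof -
  define b where "b = y0 - s0"
  define \<eta> where "\<eta> = \<bar>b\<bar>"
  have \<eta>: "\<eta> > 0" "b \<noteq> 0" using y0 by (auto simp: \<eta>_def b_def)
  define th where "th s = theta N r (of_real s0 + \<i> * of_real s)" for s
  obtain C where C: "C > 0" "\<And>z s b. Im z = 0 \<Longrightarrow> s > 0 \<Longrightarrow> \<bar>b\<bar> \<ge> \<eta> \<Longrightarrow>
    norm (theta N r (z + \<i> * of_real s) * (of_real s + \<i> * of_real b) powr (- 3/2)) \<le> C * half_line_majorant s"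
    using vertical_kernel_bound[OF N \<eta>(1)] by metis
  show ?thesis
    unfolding real_fps_expansion_def
  proof (intro exI conjI allI impI)
    show "\<eta> > 0" by (rule \<eta>(1))
    fix y assume "\<bar>y - y0\<bar> < \<eta>"
    define \<epsilon> where "\<epsilon> = y - y0"
    have \<epsilon>: "\<bar>\<epsilon>\<bar> < \<eta>" using \<open>\<bar>y - y0\<bar> < \<eta>\<close> by (simp add: \<epsilon>_def)
    define f where "f n s = th s * kern n (of_real s + \<i> * of_real b) * of_real \<epsilon> ^ n" for n s
    define B where "B n = norm ((- 3/2 :: complex) gchoose n) * (\<bar>\<epsilon>\<bar> / \<eta>) ^ n" for n
    have Bs: "summable B"
    proof -
      have q: "\<bar>\<epsilon>\<bar> / \<eta> < 1" "0 \<le> \<bar>\<epsilon>\<bar> / \<eta>" using \<epsilon> \<eta> by auto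
      define q' where "q' = (\<bar>\<epsilon>\<bar> / \<eta> + 1) / 2"
      have between: "\<rho> < (\<rho> + 1) / 2 \<and> (\<rho> + 1) / 2 < 1 \<and> 0 \<le> (\<rho> + 1) / 2" if "\<rho> < 1" "0 \<le> \<rho>" for \<rho> :: real
        using that by auto
      have q': "\<bar>\<epsilon>\<bar> / \<eta> < q'" "q' < 1" "0 \<le> q'" unfolding q'_def using between[OF q] by blast+
      have "summable (\<lambda>n. norm (((- 3/2 :: complex) gchoose n) * (of_real (\<bar>\<epsilon>\<bar> / \<eta>)) ^ n))"
      proof (rule powser_insidea)
        show "summable (\<lambda>n. ((- 3/2 :: complex) gchoose n) * (of_real q') ^ n)"
          by (rule sums_summable[OF gen_binomial_complex]) (use q' in simp)
        show "norm (complex_of_real (\<bar>\<epsilon>\<bar> / \<eta>)) < norm (complex_of_real q')"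
          unfolding norm_of_real using q' q by simp
      qed
      then show ?thesis unfolding B_def norm_mult norm_power norm_of_real using \<eta> by simp
    qed
    have fb: "norm (f n s) \<le> B n * (C * half_line_majorant s)" if s: "s > 0" for n s
    proof -
      define W where "W = of_real s + \<i> * complex_of_real b"
      have W: "norm W \<ge> \<eta>" using abs_Im_le_cmod[of W] by (simp add: W_def \<eta>_def)
      have "norm ((\<i> / W) ^ n) * norm (complex_of_real \<epsilon> ^ n) = (\<bar>\<epsilon>\<bar> / norm W) ^ n"
        by (simp add: norm_power norm_divide power_divide)
      also have "\<dots> \<le> (\<bar>\<epsilon>\<bar> / \<eta>) ^ n" using W \<eta>(1) by (intro power_mono divide_left_mono mult_pos_pos) (auto intro: less_le_trans[of 0 \<eta>])
      finally have p: "norm ((- 3/2 :: complex) gchoose n) * (norm ((\<i> / W) ^ n) * norm (complex_of_real \<epsilon> ^ n)) \<le> B n"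
        unfolding B_def by (rule mult_left_mono) simp
      have "norm (f n s) = (norm ((- 3/2 :: complex) gchoose n) * (norm ((\<i> / W) ^ n) * norm (complex_of_real \<epsilon> ^ n))) * norm (th s * W powr (- 3/2))"
        by (simp add: f_def kern_def norm_mult W_def mult_ac)
      also have "\<dots> \<le> B n * (C * half_line_majorant s)"
        using p C(2)[of "of_real s0" s b] s by (intro mult_mono) (auto simp: W_def th_def \<eta>_def B_def)
      finally show ?thesis .
    qed
    have fi: "set_integrable lborel {0<..} (f n)" for n
      unfolding f_def th_def
      by (rule set_integrable_mult_left) (rule vertical_kernel_integrable, use N \<eta> in auto)
    have fv: "(LINT s:{0<..}|lborel. f n s) = (LINT s:{0<..}|lborel. th s * kern n (of_real s + \<i> * of_real b)) * of_real \<epsilon> ^ n" for n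
      unfolding f_def by (rule set_integral_mult_left)
    have pws: "(\<Sum>n. f n s) = th s * (of_real s + \<i> * of_real (y - s0)) powr (- 3/2)" if s: "s > 0" for s
    proof -
      define W where "W = of_real s + \<i> * complex_of_real b"
      have W: "norm W \<ge> \<eta>" using abs_Im_le_cmod[of W] by (simp add: W_def \<eta>_def)
      have "(\<lambda>n. kern n W * of_real \<epsilon> ^ n) sums ((W + \<i> * of_real \<epsilon>) powr (- 3/2))"
        by (rule kern_sums) (use s W \<epsilon> in \<open>auto simp: W_def\<close>)
      then have "(\<lambda>n. th s * (kern n W * of_real \<epsilon> ^ n)) sums (th s * (W + \<i> * of_real \<epsilon>) powr (- 3/2))"
        by (rule sums_mult)
      moreover have "W + \<i> * of_real \<epsilon> = of_real s + \<i> * of_real (y - s0)"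
        by (simp add: W_def b_def \<epsilon>_def algebra_simps)
      moreover have "f n s = th s * (kern n W * of_real \<epsilon> ^ n)" for n
        by (simp only: f_def W_def mult.assoc)
      ultimately have "(\<lambda>n. f n s) sums (th s * (of_real s + \<i> * of_real (y - s0)) powr (- 3/2))" by (simp only:)
      then show ?thesis by (rule sums_unique[symmetric])
    qed
    have "(\<lambda>n. LINT s:{0<..}|lborel. f n s) sums (LINT s:{0<..}|lborel. \<Sum>n. f n s)"
    proof (rule set_integral_series(2)[OF fi])
      show "summable (\<lambda>n. norm (f n s))" if "s \<in> {0<..}" for s
        by (rule summable_comparison_test'[OF summable_mult2[OF Bs], of 0]) (use fb that in simp)
      show "summable (\<lambda>n. LINT s:{0<..}|lborel. norm (f n s))"
      proof (rule summable_comparison_test'[OF summable_mult2[OF Bs], of 0])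
        fix n
        have "(LINT s:{0<..}|lborel. norm (f n s)) \<le> (LINT s:{0<..}|lborel. (B n * C) * half_line_majorant s)"
          by (intro set_integral_mono set_integrable_norm fi set_integrable_mult_right half_line_majorant_integrable)
            (use fb in \<open>simp add: mult.assoc\<close>)
        also have "\<dots> = B n * (C * (LINT s:{0<..}|lborel. half_line_majorant s))"
          by (simp add: set_integral_mult_right)
        finally have "(LINT s:{0<..}|lborel. norm (f n s)) \<le> B n * (C * (LINT s:{0<..}|lborel. half_line_majorant s))" .
        moreover have "0 \<le> (LINT s:{0<..}|lborel. norm (f n s))"
          unfolding set_lebesgue_integral_def by (intro Bochner_Integration.integral_nonneg) (auto simp: indicator_def)
        ultimately show "norm (LINT s:{0<..}|lborel. norm (f n s)) \<le> B n * (C * (LINT s:{0<..}|lborel. half_line_majorant s))"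
          by simp
      qed
    qed
    moreover have "(LINT s:{0<..}|lborel. \<Sum>n. f n s) = period_function N r s0 y"
      unfolding period_function_def by (rule set_lebesgue_integral_cong) (auto simp: pws th_def)
    ultimately show "(\<lambda>n. fps_nth (Abs_fps (\<lambda>n. LINT s:{0<..}|lborel. theta N r (of_real s0 + \<i> * of_real s) * kern n (of_real s + \<i> * of_real (y0 - s0)))) n * of_real (y - y0) ^ n)
        sums period_function N r s0 y"
      unfolding fv by (simp add: th_def b_def \<epsilon>_def)
  qed
qed

section \<open>The automorphy factor and the finite part\<close>

text \<open>Each coefficient involves finitely many coefficients of \<open>F\<close>. Therefore the formal substitution can be carried out
  under the integral sign, where \<open>F\<close> is a kernel.\<close>
lemma fps_mult_compose_nth:
  fixes A F M :: "complex fps"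
  assumes M: "fps_nth M 0 = 0"
  shows "fps_nth (A * (F oo M)) n = (\<Sum>k\<in>{0..n}. fps_nth F k * fps_nth (A * M ^ k) n)"
proof -
  have comp: "fps_nth (F oo M) i = (\<Sum>k\<in>{0..n}. fps_nth F k * fps_nth (M ^ k) i)" if "i \<le> n" for i
    unfolding fps_compose_nth using that startsby_zero_power_prefix[OF M]
    by (intro sum.mono_neutral_left) auto
  have "fps_nth (A * (F oo M)) n = (\<Sum>i=0..n. \<Sum>k=0..n. fps_nth F k * (fps_nth A i * fps_nth (M ^ k) (n - i)))"
    unfolding fps_mult_nth by (intro sum.cong refl) (simp add: comp sum_distrib_left mult_ac)
  also have "\<dots> = (\<Sum>k=0..n. \<Sum>i=0..n. fps_nth F k * (fps_nth A i * fps_nth (M ^ k) (n - i)))"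
    by (rule sum.swap)
  finally show ?thesis by (simp only: fps_mult_nth sum_distrib_left)
qed

lemma real_fps_expansion_cmult:
  assumes "real_fps_expansion f x F"
  shows "real_fps_expansion (\<lambda>y. a * f y) x (fps_const a * F)"
proof -
  obtain \<delta> where "\<delta> > 0" "\<And>y. \<bar>y - x\<bar> < \<delta> \<Longrightarrow> (\<lambda>n. fps_nth F n * of_real (y - x) ^ n) sums f y"
    using assms unfolding real_fps_expansion_def by blast
  then show ?thesis unfolding real_fps_expansion_def fps_mult_left_const_nth mult.assoc
    by (intro exI[of _ \<delta>]) (auto intro!: sums_mult simp del: of_real_diff)
qed

text \<open>Every prime factor of \<open>d\<close> is coprime to \<open>2Nc\<close>.\<close>
lemma theta_multiplier_nonzero:
  fixes \<gamma> :: "int ^ 2 ^ 2"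
  assumes \<gamma>: "\<gamma> \<in> Gamma1 (2 * N)"
  shows "theta_multiplier N r \<gamma> \<noteq> 0"
proof -
  define c d where "c = \<gamma>$2$1" "d = \<gamma>$2$2"
  note cd = c_d_def
  have unit: "unit_exp z \<noteq> 0" for z by (simp add: unit_exp_def)
  have "shimura_symbol (2 * int N * c) d \<noteq> 0"
  proof
    assume "shimura_symbol (2 * int N * c) d = 0"
    then obtain p where p: "p \<in># prime_factorization \<bar>d\<bar>" "Legendre (2 * int N * c) p = 0"
      unfolding shimura_symbol_def by (auto split: if_splits)
    have pp: "prime p" "p dvd d" using p(1) by (auto simp: in_prime_factors_iff)
    have "p dvd 2 * int N * c" using p(2) by (simp add: Legendre_def cong_0_iff split: if_splits)
    then consider "p dvd 2 * int N" | "p dvd c" using pp(1) by (auto simp: prime_dvd_mult_iff)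
    then have "p dvd 1"
    proof cases
      case 1
      then have "p dvd d - 1" using Gamma1_entries(4)[OF \<gamma>] by (metis cd(2) cong_iff_dvd_diff dvd_trans)
      then show ?thesis using dvd_diff[OF pp(2), of "d - 1"] by simp
    next
      case 2
      then show ?thesis using Gamma1_entries(1)[OF \<gamma>] pp(2) by (metis cd dvd_diff dvd_mult)
    qed
    then show False using pp(1) by (simp add: not_prime_unit)
  qed
  then show ?thesis using unit by (simp add: theta_multiplier_def Let_def cd)
qed

lemma lower_power_mult_pos:
  assumes "u \<noteq> 0" "\<rho> > 0"
  shows "lower_power (u * \<rho>) c s = lower_power u c s * of_real \<rho> powr of_real s"
proof -
  have "Ln (of_real (u * \<rho>)) = of_real (ln \<rho>) + Ln (of_real u)"
    using Ln_times_of_real[OF assms(2), of "of_real u"] assms by (simp add: mult.commute Ln_of_real)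
  then show ?thesis
    using assms by (auto simp: lower_power_def powr_def Ln_of_real distrib_left exp_add)
qed

text \<open>All factors are holomorphic near \<open>y0\<close>, and \<open>lower_power\<close> is a principal power up to a constant because \<open>c * y + d\<close>
  does not change its sign near \<open>y0\<close>.\<close>
lemma slash_defect_expansion:
  fixes a b c d :: int and y0 u :: real
  assumes u: "u = of_int c * y0 + of_int d" "u \<noteq> 0"
  shows "real_fps_expansion (\<lambda>y. lower_power (of_int c * y + of_int d) c s *
      theta_defect N r ((of_int a * of_real y + of_int b) / (of_int c * of_real y + of_int d))) y0
    (fps_const (lower_power u c s) * (fps_binomial (of_real s) oo (fps_const (of_int c / of_real u) * fps_X)) *
      (defect_series N r ((of_int a * of_real y0 + of_int b) / (of_int c * of_real y0 + of_int d)) oo moebius_shift_at a b c d (of_real y0)))"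
proof (rule has_fps_expansion_imp_real)
  define m :: complex where "m = (of_int a * of_real y0 + of_int b) / (of_int c * of_real y0 + of_int d)"
  have u0: "of_int c * complex_of_real y0 + of_int d \<noteq> 0"
  proof -
    have "of_int c * complex_of_real y0 + of_int d = of_real u" by (simp add: u(1))
    then show ?thesis using u(2) by simp
  qed
  let ?k = "of_int c / complex_of_real u"
  let ?M = "\<lambda>\<epsilon>. (of_int a * (of_real y0 + \<epsilon>) + of_int b) * inverse (of_int c * (of_real y0 + \<epsilon>) + of_int d) - m"
  have M: "?M has_fps_expansion moebius_shift_at a b c d (of_real y0)"
    unfolding moebius_shift_at_def m_def
    by (intro has_fps_expansion_diff has_fps_expansion_mult has_fps_expansion_inverse has_fps_expansion_add
        has_fps_expansion_const has_fps_expansion_fps_X) (use u0 in simp)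
  have "((\<lambda>x. (1 + x) powr of_real s) \<circ> (\<lambda>\<epsilon>. ?k * \<epsilon>)) has_fps_expansion (fps_binomial (of_real s) oo (fps_const ?k * fps_X))"
    by (intro has_fps_expansion_compose has_fps_expansion_binomial_complex has_fps_expansion_cmult_left has_fps_expansion_fps_X) simp
  moreover have "((\<lambda>\<epsilon>. theta_defect N r (m + \<epsilon>)) \<circ> ?M) has_fps_expansion (defect_series N r m oo moebius_shift_at a b c d (of_real y0))"
    by (intro has_fps_expansion_compose defect_has_fps_expansion M moebius_shift_at_0 u0)
  ultimately show "(\<lambda>\<epsilon>. lower_power u c s * ((\<lambda>x. (1 + x) powr of_real s) \<circ> (\<lambda>\<epsilon>. ?k * \<epsilon>)) \<epsilon> * ((\<lambda>\<epsilon>. theta_defect N r (m + \<epsilon>)) \<circ> ?M) \<epsilon>) has_fps_expansion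
    (fps_const (lower_power u c s) * (fps_binomial (of_real s) oo (fps_const (of_int c / of_real u) * fps_X)) *
      (defect_series N r ((of_int a * of_real y0 + of_int b) / (of_int c * of_real y0 + of_int d)) oo moebius_shift_at a b c d (of_real y0)))"
    unfolding m_def[symmetric] by (intro has_fps_expansion_mult has_fps_expansion_const)
  have "((\<lambda>y. 1 + of_int c / u * (y - y0)) \<longlongrightarrow> 1 + of_int c / u * (y0 - y0)) (nhds y0)"
    by (intro tendsto_intros filterlim_ident)
  then have "\<forall>\<^sub>F y in nhds y0. 0 < 1 + of_int c / u * (y - y0)" by (rule order_tendstoD) simp
  then show "\<forall>\<^sub>F y in nhds y0. lower_power (of_int c * y + of_int d) c s *
      theta_defect N r ((of_int a * of_real y + of_int b) / (of_int c * of_real y + of_int d)) =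
     lower_power u c s * ((\<lambda>x. (1 + x) powr of_real s) \<circ> (\<lambda>\<epsilon>. ?k * \<epsilon>)) (of_real (y - y0)) * ((\<lambda>\<epsilon>. theta_defect N r (m + \<epsilon>)) \<circ> ?M) (of_real (y - y0))"
  proof eventually_elim
    case (elim y)
    have "of_int c * y + of_int d = u * (1 + of_int c / u * (y - y0))"
      using u(2) by (simp add: distrib_left) (simp add: u(1) algebra_simps)
    then have l: "lower_power (of_int c * y + of_int d) c s = lower_power u c s * of_real (1 + of_int c / u * (y - y0)) powr of_real s"
      using lower_power_mult_pos[OF u(2) elim] by simp
    have y: "complex_of_real y0 + of_real (y - y0) = of_real y" by simp
    show ?case unfolding l o_def y by (simp add: divide_inverse)
  qed
qed

section \<open>The ideal triangle\<close>

lemma norm_kern: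
  assumes "W \<noteq> 0"
  shows "norm (kern n W) = norm ((- 3/2 :: complex) gchoose n) * (1 / norm W) ^ n * norm W powr (- 3/2)"
  using norm_powr_of_real[OF assms, of "- 3/2"] by (simp add: kern_def norm_mult norm_power norm_divide)

lemma norm_kern_le:
  assumes "norm W \<ge> \<eta>" "\<eta> > 0"
  shows "norm (kern n W) \<le> norm ((- 3/2 :: complex) gchoose n) * (1 / \<eta>) ^ n * \<eta> powr (- 3/2)"
proof -
  have W0: "W \<noteq> 0" using assms by auto
  have "1 / norm W \<le> 1 / \<eta>" using assms by (intro divide_left_mono mult_pos_pos) auto
  then show ?thesis unfolding norm_kern[OF W0]
    using assms by (intro mult_mono power_mono powr_mono2') auto
qed

lemma eichler_integrable:
  assumes N: "N > 0" "even N" and x: "x \<in> quantum_set N r"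
  shows "set_integrable lborel {0<..} (\<lambda>s. theta N r (of_rat x + \<i> * of_real s) * kern n (of_real s))"
proof -
  obtain C where C: "\<And>s. s > 0 \<Longrightarrow> norm (theta N r (of_rat x + \<i> * of_real s)) \<le> C * min (s ^ Suc n) 1"
    using theta_vertical_rapid[OF N x, of "Suc n"] by blast
  have "set_integrable lborel {0<..} (\<lambda>s. (of_real ((- 3/2) gchoose n) * \<i> ^ n) * (theta N r (of_rat x + \<i> * of_real s) * of_real (s powr (- 3/2 - real n))))"
    by (intro set_integrable_mult_right moment_integrable[OF _ C] theta_vertical_continuous N) auto
  then show ?thesis by (subst (asm) set_integrable_cong[OF refl refl]) (auto simp: kern_of_real)
qed

text \<open>The paths from \<open>x\<close> to \<open>\<i>\<infinity>\<close>, from \<open>x\<close> to \<open>s0\<close> along the geodesic \<open>x + \<i> * W s\<close>, and from \<open>s0\<close> to \<open>\<i>\<infinity>\<close> bound an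
  ideal triangle, and \<open>\<i> * g s ^ 2\<close> is the derivative of the second path. A primitive on the half plane evaluates all
  three integrals; near each vertex the end points of two paths are compared along a short horizontal segment.\<close>
theorem ideal_triangle:
  fixes x :: rat and c d :: int and u s0 :: real
  assumes N: "N > 0" "even N" and x: "x \<in> quantum_set N r"
    and c: "c \<noteq> 0" and u: "u = of_int c * of_rat x + of_int d" "u \<noteq> 0" and s0: "s0 = - of_int d / of_int c"
  defines "W \<equiv> (\<lambda>s::real. of_real (u ^ 2 * s) / (1 - \<i> * of_real (of_int c * u * s)))"
    and "g \<equiv> (\<lambda>s::real. of_real u / (1 - \<i> * of_real (of_int c * u * s)))"
  assumes int: "set_integrable lborel {0<..} (\<lambda>s. theta N r (of_rat x + \<i> * W s) * kern n (W s) * g s ^ 2)"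
  shows "(LINT s:{0<..}|lborel. theta N r (of_rat x + \<i> * of_real s) * kern n (of_real s)) -
      (LINT s:{0<..}|lborel. theta N r (of_rat x + \<i> * W s) * kern n (W s) * g s ^ 2) =
      (LINT s:{0<..}|lborel. theta N r (of_real s0 + \<i> * of_real s) * kern n (of_real s + \<i> * of_real (of_rat x - s0)))"
proof -
  define X where "X = (of_rat x :: real)"
  have cx: "complex_of_rat x = of_real X" by (simp add: X_def complex_of_rat_eq)
  have Xs0: "X - s0 = u / of_int c" using c by (simp add: u(1) s0 X_def field_simps)
  have Xs0_nz: "X - s0 \<noteq> 0" unfolding Xs0 using u(2) c by simp
  define T where "T s = 1 + (of_int c * u * s) ^ 2" for s :: real
  have T: "T s \<ge> 1" for s by (simp add: T_def)
  have T0: "T s > 0" for s using T[of s] by linarith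
  have den: "1 - \<i> * of_real t \<noteq> 0" for t :: real by (simp add: complex_eq_iff)
  have ReW: "Re (W s) = u ^ 2 * s / T s" and ImW: "Im (W s) = u ^ 2 * s * (of_int c * u * s) / T s" for s
    by (simp_all add: W_def T_def Re_divide Im_divide power2_eq_square)
  define Y where "Y s = u ^ 2 * s / T s" for s
  have Y: "Y s > 0" if "s > 0" for s using that u(2) T0[of s] by (simp add: Y_def)
  define H where "H = {\<tau>. Im \<tau> > 0}"
  define G where "G w = theta N r w * kern n (- \<i> * (w - of_real X))" for w
  have "G holomorphic_on H"
    unfolding G_def kern_def H_def
    by (intro holomorphic_intros theta_holomorphic[OF N(1)]) (auto simp: complex_nonpos_Reals_iff complex_eq_iff)
  moreover have "convex H" "open H" unfolding H_def by (rule convex_halfspace_Im_gt, rule open_halfspace_Im_gt)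
  ultimately obtain \<Phi> where \<Phi>': "\<And>w. w \<in> H \<Longrightarrow> (\<Phi> has_field_derivative G w) (at w within H)"
    using holomorphic_convex_primitive'[of H G] by blast
  have \<Phi>: "(\<Phi> has_field_derivative G w) (at w)" if "Im w > 0" for w
  proof -
    have w: "w \<in> H" using that by (simp add: H_def)
    show ?thesis using \<Phi>'[OF w] unfolding at_within_open[OF w \<open>open H\<close>] .
  qed
  obtain C0 where C0: "C0 > 0" "\<And>\<tau>. Im \<tau> > 0 \<Longrightarrow> norm (theta N r \<tau>) \<le> C0 * (1 + 1 / sqrt (Im \<tau>))"
    using theta_bound[OF N(1)] by metis
  obtain C1 where C1: "C1 > 0" "\<And>w. w \<noteq> 0 \<Longrightarrow> norm w \<le> 1/4 \<Longrightarrow> norm w \<le> 4 * Re w \<Longrightarrow> norm (theta N r (of_rat x + \<i> * w)) \<le> C1 * norm w ^ (n + 2)"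
    using theta_cusp_decay[OF N x] by metis
  define b where "b = norm ((- 3/2 :: complex) gchoose n)"
  have b: "b \<ge> 0" by (simp add: b_def)
  \<comment> \<open>Comparison of two points at equal height, in the coordinate \<open>W = -i(w - x)\<close>.\<close>
  have horiz: "norm (\<Phi> (of_real X + \<i> * (of_real y + \<i> * of_real p)) - \<Phi> (of_real X + \<i> * (of_real y + \<i> * of_real q))) \<le> B * \<bar>p - q\<bar>"
    if y: "y > 0" and B: "\<And>t. t \<in> closed_segment p q \<Longrightarrow> norm (G (of_real X + \<i> * (of_real y + \<i> * of_real t))) \<le> B" for y p q B
  proof -
    let ?z = "\<lambda>t. complex_of_real X + \<i> * (of_real y + \<i> * of_real t)"
    have seg: "\<exists>t\<in>closed_segment p q. z = ?z t" if zin: "z \<in> closed_segment (?z p) (?z q)" for z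
    proof -
      obtain v where v': "0 \<le> v \<and> v \<le> 1 \<and> z = (1 - v) *\<^sub>R ?z p + v *\<^sub>R ?z q"
        by (rule exE[OF zin[unfolded in_segment]])
      note v = conjunct1[OF v'] conjunct1[OF conjunct2[OF v']] conjunct2[OF conjunct2[OF v']]
      have "z = ?z ((1 - v) *\<^sub>R p + v *\<^sub>R q)" unfolding v(3) by (simp add: scaleR_conv_of_real algebra_simps)
      moreover have "(1 - v) *\<^sub>R p + v *\<^sub>R q \<in> closed_segment p q" unfolding in_segment by (intro exI[of _ v] conjI v refl)
      ultimately show ?thesis by blast
    qed
    have "norm (\<Phi> (?z p) - \<Phi> (?z q)) \<le> B * norm (?z p - ?z q)"
    proof (rule field_differentiable_bound[where S = "closed_segment (?z p) (?z q)" and f' = G])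
      fix z assume "z \<in> closed_segment (?z p) (?z q)"
      then obtain t where t: "t \<in> closed_segment p q" "z = ?z t" using seg by blast
      show "(\<Phi> has_field_derivative G z) (at z within closed_segment (?z p) (?z q))"
        by (rule has_field_derivative_at_within[OF \<Phi>]) (use t y in simp)
      show "norm (G z) \<le> B" using B t by blast
    qed auto
    also have "?z p - ?z q = of_real (q - p)" by (simp add: algebra_simps)
    finally show ?thesis unfolding norm_of_real by (simp add: abs_minus_commute)
  qed
  have Gval: "G (of_real X + \<i> * V) = theta N r (of_rat x + \<i> * V) * kern n V" for V
    by (simp add: G_def cx mult.assoc[symmetric])
  define S where "S k = real (Suc k)" for k
  have S: "S k \<ge> 1" "S k > 0" for k by (auto simp: S_def)
  have S_top: "filterlim S at_top sequentially"
    unfolding S_def by (rule filterlim_compose[OF filterlim_real_sequentially filterlim_Suc])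
  define a where "a k = 1 / S k" for k
  have a: "a k > 0" "a \<longlonglongrightarrow> 0" for k
    using S(2)[of k] LIMSEQ_Suc[OF lim_1_over_n] by (auto simp: a_def[abs_def] S_def[abs_def])
  have Ya: "(\<lambda>k. Y (a k)) \<longlonglongrightarrow> 0"
  proof (rule Lim_null_comparison[OF always_eventually])
    show "\<forall>k. norm (Y (a k)) \<le> u ^ 2 * a k"
    proof
      fix k
      have "Y (a k) \<le> u ^ 2 * a k / 1" unfolding Y_def using T[of "a k"] a(1)[of k] by (intro divide_left_mono) auto
      then show "norm (Y (a k)) \<le> u ^ 2 * a k" using Y[OF a(1)[of k]] by simp
    qed
    show "(\<lambda>k. u ^ 2 * a k) \<longlonglongrightarrow> 0" using tendsto_mult_right_zero[OF a(2)] .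
  qed
  define \<kappa> where "\<kappa> = (of_int c * u) ^ 2"
  have \<kappa>: "\<kappa> > 0" using c u(2) by (simp add: \<kappa>_def)
  have TS: "T (S k) = 1 + \<kappa> * real (Suc k) ^ 2" for k by (simp add: T_def S_def \<kappa>_def power_mult_distrib)
  have invT: "(\<lambda>k. 1 / T (S k)) \<longlonglongrightarrow> 0" "(\<lambda>k. 1 / sqrt (T (S k))) \<longlonglongrightarrow> 0"
    unfolding TS using \<kappa> by real_asymp+
  have YS: "(\<lambda>k. Y (S k)) \<longlonglongrightarrow> 0"
  proof -
    have "(\<lambda>k. u ^ 2 * (real (Suc k) / (1 + \<kappa> * real (Suc k) ^ 2))) \<longlonglongrightarrow> 0"
      using \<kappa> by real_asymp
    then show ?thesis unfolding Y_def TS by (simp add: S_def)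
  qed
  \<comment> \<open>The vertex \<open>i\<infinity>\<close>.\<close>
  have v1: "(\<lambda>k. \<Phi> (of_real X + \<i> * of_real (S k)) - \<Phi> (of_real s0 + \<i> * of_real (S k))) \<longlonglongrightarrow> 0"
  proof (rule Lim_null_comparison[OF always_eventually])
    show "\<forall>k. norm (\<Phi> (of_real X + \<i> * of_real (S k)) - \<Phi> (of_real s0 + \<i> * of_real (S k))) \<le> 2 * C0 * b * \<bar>X - s0\<bar> * S k powr (- 3/2)"
    proof
      fix k
      have "norm (\<Phi> (of_real X + \<i> * (of_real (S k) + \<i> * of_real 0)) - \<Phi> (of_real X + \<i> * (of_real (S k) + \<i> * of_real (X - s0)))) \<le>
          (C0 * 2) * (b * S k powr (- 3/2)) * \<bar>0 - (X - s0)\<bar>"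
      proof (rule horiz[OF S(2)])
        fix t :: real
        define V where "V = of_real (S k) + \<i> * complex_of_real t"
        have V: "norm V \<ge> S k" using complex_Re_le_cmod[of V] by (simp add: V_def)
        have "1 / sqrt (S k) \<le> 1" using S(1)[of k] by simp
        then have "C0 * (1 + 1 / sqrt (S k)) \<le> C0 * 2" using C0 by (intro mult_left_mono) auto
        then have th: "norm (theta N r (of_rat x + \<i> * V)) \<le> C0 * 2"
          using C0(2)[of "of_rat x + \<i> * V"] S(2)[of k] by (simp add: V_def)
        have "(1 / S k) ^ n \<le> 1" using S(1)[of k] by (intro power_le_one) auto
        then have "b * (1 / S k) ^ n * S k powr (- 3/2) \<le> b * 1 * S k powr (- 3/2)"
          using b by (intro mult_right_mono mult_left_mono) auto
        then have "norm (kern n V) \<le> b * S k powr (- 3/2)"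
          using norm_kern_le[OF V S(2), of n] by (simp add: b_def)
        then show "norm (G (of_real X + \<i> * (of_real (S k) + \<i> * of_real t))) \<le> (C0 * 2) * (b * S k powr (- 3/2))"
          unfolding V_def[symmetric] Gval norm_mult using th C0 by (intro mult_mono) auto
      qed
      moreover have "of_real X + \<i> * (of_real (S k) + \<i> * of_real (X - s0)) = of_real s0 + \<i> * complex_of_real (S k)"
        by (simp add: algebra_simps)
      ultimately show "norm (\<Phi> (of_real X + \<i> * of_real (S k)) - \<Phi> (of_real s0 + \<i> * of_real (S k))) \<le> 2 * C0 * b * \<bar>X - s0\<bar> * S k powr (- 3/2)"
        by (simp add: mult_ac abs_minus_commute)
    qed
    have "(\<lambda>k. S k powr (- 3/2)) \<longlonglongrightarrow> 0" unfolding S_def by real_asymp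
    then show "(\<lambda>k. 2 * C0 * b * \<bar>X - s0\<bar> * S k powr (- 3/2)) \<longlonglongrightarrow> 0" by (rule tendsto_mult_right_zero)
  qed
  \<comment> \<open>The vertex \<open>x\<close>, where theta decays faster than any power.\<close>
  have v2: "(\<lambda>k. \<Phi> (of_real X + \<i> * of_real (Y (a k))) - \<Phi> (of_real X + \<i> * W (a k))) \<longlonglongrightarrow> 0"
  proof (rule Lim_null_comparison)
    have "(\<lambda>k. C1 * b * Y (a k)) \<longlonglongrightarrow> 0" using tendsto_mult_right_zero[OF Ya] .
    then show "(\<lambda>k. C1 * b * Y (a k)) \<longlonglongrightarrow> 0" .
    have "(\<lambda>k. \<bar>of_int c * u\<bar> * a k) \<longlonglongrightarrow> 0" using tendsto_mult_right_zero[OF a(2)] .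
    then have "\<forall>\<^sub>F k in sequentially. \<bar>of_int c * u\<bar> * a k < 1" by (rule order_tendstoD) simp
    moreover have "\<forall>\<^sub>F k in sequentially. Y (a k) < 1/8" using Ya by (rule order_tendstoD) simp
    ultimately show "\<forall>\<^sub>F k in sequentially. norm (\<Phi> (of_real X + \<i> * of_real (Y (a k))) - \<Phi> (of_real X + \<i> * W (a k))) \<le> C1 * b * Y (a k)"
    proof eventually_elim
      case (elim k)
      define y where "y = Y (a k)"
      define q where "q = Im (W (a k))"
      have y: "y > 0" "y < 1/8" using Y[OF a(1)[of k]] elim by (auto simp: y_def)
      have Wk: "W (a k) = of_real y + \<i> * of_real q" by (simp add: complex_eq_iff y_def q_def Y_def ReW)
      have "q = y * (of_int c * u * a k)" by (simp add: q_def ImW y_def Y_def)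
      then have "\<bar>q\<bar> = y * (\<bar>of_int c * u\<bar> * a k)" using y a(1)[of k] by (simp add: abs_mult)
      also have "\<dots> \<le> y * 1" using elim y by (intro mult_left_mono) auto
      finally have q: "\<bar>q\<bar> \<le> y" by simp
      have "norm (\<Phi> (of_real X + \<i> * (of_real y + \<i> * of_real 0)) - \<Phi> (of_real X + \<i> * (of_real y + \<i> * of_real q))) \<le> C1 * b * \<bar>0 - q\<bar>"
      proof (rule horiz[OF y(1)])
        fix t assume "t \<in> closed_segment 0 q"
        then have "\<bar>t\<bar> \<le> \<bar>q\<bar>" by (auto simp: closed_segment_eq_real_ivl split: if_splits)
        then have t: "\<bar>t\<bar> \<le> y" using q by linarith
        define V where "V = of_real y + \<i> * complex_of_real t"
        have V0: "V \<noteq> 0" using y by (auto simp: V_def complex_eq_iff)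
        have ReV: "Re V = y" by (simp add: V_def)
        have nV: "norm V \<le> 2 * y" using cmod_le[of V] t y by (simp add: V_def)
        have nV1: "norm V \<le> 1" "norm V > 0" using nV y V0 by auto
        have th: "norm (theta N r (of_rat x + \<i> * V)) \<le> C1 * norm V ^ (n + 2)"
          by (rule C1(2)[OF V0]) (use nV y ReV in auto)
        have "norm V ^ (n + 2) * ((1 / norm V) ^ n * norm V powr (- 3/2)) = norm V powr 2 * norm V powr (- 3/2)"
          using nV1 by (simp add: power_add power_divide powr_realpow[of _ 2, simplified] power2_eq_square)
        also have "\<dots> = norm V powr (1/2)" by (subst powr_add[symmetric]) simp
        also have "\<dots> \<le> 1" using nV1 by (simp add: powr_le1)
        finally have p: "norm V ^ (n + 2) * ((1 / norm V) ^ n * norm V powr (- 3/2)) \<le> 1" .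
        have "norm (G (of_real X + \<i> * V)) \<le> C1 * norm V ^ (n + 2) * (b * (1 / norm V) ^ n * norm V powr (- 3/2))"
          unfolding Gval norm_mult norm_kern[OF V0] b_def[symmetric] using th by (rule mult_right_mono) (use b in auto)
        also have "\<dots> = C1 * b * (norm V ^ (n + 2) * ((1 / norm V) ^ n * norm V powr (- 3/2)))" by (simp only: mult_ac)
        also have "\<dots> \<le> C1 * b * 1" using p C1(1) b by (intro mult_left_mono) auto
        finally show "norm (G (of_real X + \<i> * (of_real y + \<i> * of_real t))) \<le> C1 * b" by (simp add: V_def)
      qed
      also have "C1 * b * \<bar>0 - q\<bar> \<le> C1 * b * y" using q C1(1) b by (intro mult_left_mono) auto
      finally show ?case unfolding Wk y_def[symmetric] by simp
    qed
  qed
  \<comment> \<open>The vertex \<open>s\<^sub>0\<close>, where theta grows at most like the inverse square root of the height.\<close>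
  define \<eta> where "\<eta> = \<bar>X - s0\<bar> / 2"
  have \<eta>: "\<eta> > 0" using Xs0_nz by (simp add: \<eta>_def)
  have v3: "(\<lambda>k. \<Phi> (of_real s0 + \<i> * of_real (Y (S k))) - \<Phi> (of_real X + \<i> * W (S k))) \<longlonglongrightarrow> 0"
  proof (rule Lim_null_comparison)
    define K where "K = C0 * (b * (1 / \<eta>) ^ n * \<eta> powr (- 3/2)) * \<bar>X - s0\<bar>"
    have K: "K \<ge> 0" using C0 b \<eta> by (simp add: K_def)
    have "(\<lambda>k. K * (1 / T (S k) + 1 / \<bar>u\<bar> * (1 / sqrt (T (S k))))) \<longlonglongrightarrow> K * (0 + 1 / \<bar>u\<bar> * 0)"
      by (intro tendsto_intros invT)
    then show "(\<lambda>k. K * (1 / T (S k) + 1 / \<bar>u\<bar> * (1 / sqrt (T (S k))))) \<longlonglongrightarrow> 0" by simp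
    have "\<forall>\<^sub>F k in sequentially. 1 / T (S k) < 1/2" using invT(1) by (rule order_tendstoD) simp
    then show "\<forall>\<^sub>F k in sequentially. norm (\<Phi> (of_real s0 + \<i> * of_real (Y (S k))) - \<Phi> (of_real X + \<i> * W (S k))) \<le> K * (1 / T (S k) + 1 / \<bar>u\<bar> * (1 / sqrt (T (S k))))"
    proof eventually_elim
      case (elim k)
      define y where "y = Y (S k)"
      define q where "q = Im (W (S k))"
      define \<tau> where "\<tau> = T (S k)"
      have \<tau>: "\<tau> > 0" "1 / \<tau> < 1/2" using T0[of "S k"] elim by (auto simp: \<tau>_def)
      have y: "y > 0" using Y[OF S(2)[of k]] by (simp add: y_def)
      have Wk: "W (S k) = of_real y + \<i> * of_real q" by (simp add: complex_eq_iff y_def q_def Y_def ReW)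
      have "q = (X - s0) * ((of_int c * u * S k) ^ 2 / \<tau>)"
        unfolding Xs0 q_def ImW \<tau>_def using c by (simp add: field_simps power2_eq_square)
      also have "(of_int c * u * S k) ^ 2 = \<tau> - 1" by (simp add: \<tau>_def T_def)
      finally have pq: "(X - s0) - q = (X - s0) * (1 / \<tau>)" using \<tau> by (simp add: field_simps)
      have "norm (\<Phi> (of_real X + \<i> * (of_real y + \<i> * of_real (X - s0))) - \<Phi> (of_real X + \<i> * (of_real y + \<i> * of_real q))) \<le>
         C0 * (1 + 1 / sqrt y) * (b * (1 / \<eta>) ^ n * \<eta> powr (- 3/2)) * \<bar>(X - s0) - q\<bar>"
      proof (rule horiz[OF y])
        fix t assume t: "t \<in> closed_segment (X - s0) q"
        have "\<bar>(X - s0) - t\<bar> \<le> \<bar>(X - s0) - q\<bar>" using t by (auto simp: closed_segment_eq_real_ivl split: if_splits)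
        also have "\<dots> = \<bar>X - s0\<bar> * (1 / \<tau>)" unfolding pq abs_mult using \<tau> by simp
        also have "\<dots> \<le> \<bar>X - s0\<bar> * (1/2)" using \<tau> by (intro mult_left_mono) auto
        finally have "\<bar>(X - s0) - t\<bar> \<le> \<bar>X - s0\<bar> * (1/2)" .
        then have t1: "\<bar>t\<bar> \<ge> \<eta>" using abs_triangle_ineq[of "(X - s0) - t" t] by (simp add: \<eta>_def)
        define V where "V = of_real y + \<i> * complex_of_real t"
        have V: "norm V \<ge> \<eta>" using abs_Im_le_cmod[of V] t1 by (simp add: V_def)
        have th: "norm (theta N r (of_rat x + \<i> * V)) \<le> C0 * (1 + 1 / sqrt y)"
          using C0(2)[of "of_rat x + \<i> * V"] y by (simp add: V_def)
        show "norm (G (of_real X + \<i> * (of_real y + \<i> * of_real t))) \<le> C0 * (1 + 1 / sqrt y) * (b * (1 / \<eta>) ^ n * \<eta> powr (- 3/2))"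
          unfolding V_def[symmetric] Gval norm_mult using th norm_kern_le[OF V \<eta>, of n] C0 y
          by (intro mult_mono) (auto simp: b_def)
      qed
      also have "\<dots> = K * ((1 + 1 / sqrt y) * (1 / \<tau>))"
        unfolding pq abs_mult K_def using \<tau> by (simp add: mult_ac)
      also have "\<dots> \<le> K * (1 / \<tau> + 1 / \<bar>u\<bar> * (1 / sqrt \<tau>))"
      proof (rule mult_left_mono[OF _ K])
        have "u ^ 2 * 1 / \<tau> \<le> y" unfolding y_def Y_def \<tau>_def[symmetric]
          using S(1)[of k] \<tau> by (intro divide_right_mono mult_left_mono) auto
        then have "sqrt (u ^ 2 / \<tau>) \<le> sqrt y" by simp
        then have "\<bar>u\<bar> / sqrt \<tau> \<le> sqrt y" by (simp add: real_sqrt_divide)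
        moreover have up: "\<bar>u\<bar> / sqrt \<tau> > 0" using u(2) \<tau> by simp
        ultimately have "1 / sqrt y \<le> 1 / (\<bar>u\<bar> / sqrt \<tau>)" using y by (intro divide_left_mono mult_pos_pos) auto
        then have "1 / sqrt y * (1 / \<tau>) \<le> (sqrt \<tau> / \<bar>u\<bar>) * (1 / \<tau>)" using \<tau> by (intro mult_right_mono) auto
        also have "\<dots> = 1 / \<bar>u\<bar> * (sqrt \<tau> / \<tau>)" by simp
        also have "sqrt \<tau> / \<tau> = 1 / sqrt \<tau>" using \<tau> real_div_sqrt[of \<tau>] by (simp add: field_simps)
        finally show "(1 + 1 / sqrt y) * (1 / \<tau>) \<le> 1 / \<tau> + 1 / \<bar>u\<bar> * (1 / sqrt \<tau>)"
          by (simp add: add_divide_distrib)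
      qed
      finally have "norm (\<Phi> (of_real X + \<i> * (of_real y + \<i> * of_real (X - s0))) - \<Phi> (of_real X + \<i> * (of_real y + \<i> * of_real q))) \<le> K * (1 / \<tau> + 1 / \<bar>u\<bar> * (1 / sqrt \<tau>))" .
      moreover have "of_real X + \<i> * (of_real y + \<i> * of_real (X - s0)) = of_real s0 + \<i> * complex_of_real y"
        by (simp add: algebra_simps)
      ultimately show ?case unfolding Wk y_def[symmetric] \<tau>_def[symmetric] by simp
    qed
  qed
  \<comment> \<open>The three integrals as limits of differences of the primitive.\<close>
  have cancel1: "v * \<i> / \<i> = v" for v :: complex by (rule nonzero_mult_div_cancel_right) simp
  have cancel2: "v * (\<i> * p) / \<i> = v * p" for v p :: complex
    using cancel1[of "v * p"] by (simp only: mult_ac)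
  have vert: "((\<lambda>s. \<Phi> (of_real z + \<i> * of_real s) / \<i>) has_vector_derivative G (of_real z + \<i> * of_real s)) (at s)" if "s > 0" for z s :: real
  proof -
    have "((\<lambda>w. \<Phi> (of_real z + \<i> * w) / \<i>) has_field_derivative (G (of_real z + \<i> * of_real s) * \<i>) / \<i>) (at (of_real s))"
      using that by (intro DERIV_cdivide DERIV_chain2[OF \<Phi>]) (auto intro!: derivative_eq_intros)
    from has_vector_derivative_real_field[OF this, of UNIV] show ?thesis unfolding cancel1 .
  qed
  note m = eichler_integrable[OF N x, of n]
  have J1: "(\<lambda>k. \<Phi> (of_real X + \<i> * of_real (S k)) / \<i> - \<Phi> (of_real X + \<i> * of_real (Y (a k))) / \<i>) \<longlonglongrightarrow>
      (LINT s:{0<..}|lborel. theta N r (of_rat x + \<i> * of_real s) * kern n (of_real s))"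
    by (rule improper_FTC_seq[OF m _ _ Ya S_top]) (use vert[of _ X] Y a in \<open>auto simp: Gval\<close>)
  have J3: "(\<lambda>k. \<Phi> (of_real s0 + \<i> * of_real (S k)) / \<i> - \<Phi> (of_real s0 + \<i> * of_real (Y (S k))) / \<i>) \<longlonglongrightarrow>
      (LINT s:{0<..}|lborel. theta N r (of_real s0 + \<i> * of_real s) * kern n (of_real s + \<i> * of_real (of_rat x - s0)))"
  proof (rule improper_FTC_seq[OF _ _ _ YS S_top])
    show "set_integrable lborel {0<..} (\<lambda>s. theta N r (of_real s0 + \<i> * of_real s) * kern n (of_real s + \<i> * of_real (of_rat x - s0)))"
      by (rule vertical_kernel_integrable[OF N(1)]) (use Xs0_nz in \<open>auto simp: X_def\<close>)
    fix s :: real assume s: "s > 0"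
    have "G (of_real s0 + \<i> * of_real s) = theta N r (of_real s0 + \<i> * of_real s) * kern n (of_real s + \<i> * of_real (of_rat x - s0))"
      unfolding G_def X_def[symmetric] by (rule arg_cong[of _ _ "\<lambda>V. theta N r (of_real s0 + \<i> * of_real s) * kern n V"]) (simp add: algebra_simps)
    then show "((\<lambda>s. \<Phi> (of_real s0 + \<i> * of_real s) / \<i>) has_vector_derivative theta N r (of_real s0 + \<i> * of_real s) * kern n (of_real s + \<i> * of_real (of_rat x - s0))) (at s)"
      using vert[OF s, of s0] by simp
  qed (use Y S in auto)
  have J2: "(\<lambda>k. \<Phi> (of_real X + \<i> * W (S k)) / \<i> - \<Phi> (of_real X + \<i> * W (a k)) / \<i>) \<longlonglongrightarrow>
      (LINT s:{0<..}|lborel. theta N r (of_rat x + \<i> * W s) * kern n (W s) * g s ^ 2)"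
  proof (rule improper_FTC_seq[OF int _ a S_top])
    fix s :: real assume s: "s > 0"
    let ?l = "\<lambda>z::complex. 1 - \<i> * (of_int c * of_real u * z)"
    define Wc where "Wc z = of_real (u ^ 2) * z / ?l z" for z
    have l0: "?l (of_real s) \<noteq> 0" using den[of "of_int c * u * s"] by simp
    have Ws: "W t = Wc (of_real t)" for t by (simp add: W_def Wc_def)
    have gs: "g s = of_real u / ?l (of_real s)" by (simp add: g_def)
    have "(Wc has_field_derivative (of_real (u ^ 2) * ?l (of_real s) - of_real (u ^ 2) * of_real s * (- (\<i> * (of_int c * of_real u)))) / (?l (of_real s) * ?l (of_real s))) (at (of_real s))"
      unfolding Wc_def using l0 by (auto intro!: derivative_eq_intros)
    also have "of_real (u ^ 2) * ?l (of_real s) - of_real (u ^ 2) * of_real s * (- (\<i> * (of_int c * of_real u))) = complex_of_real u ^ 2"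
      by (simp add: algebra_simps power2_eq_square)
    also have "complex_of_real u ^ 2 / (?l (of_real s) * ?l (of_real s)) = g s ^ 2"
      unfolding gs by (simp add: power2_eq_square)
    finally have dW: "(Wc has_field_derivative g s ^ 2) (at (of_real s))" .
    have "Im (of_real X + \<i> * Wc (of_real s)) > 0" using Y[OF s] by (simp add: Ws[symmetric] ReW Y_def)
    then have "((\<lambda>z. \<Phi> (of_real X + \<i> * Wc z) / \<i>) has_field_derivative (G (of_real X + \<i> * Wc (of_real s)) * (\<i> * g s ^ 2)) / \<i>) (at (of_real s))"
      by (intro DERIV_cdivide DERIV_chain2[OF \<Phi>]) (auto intro!: derivative_eq_intros dW)
    then have "((\<lambda>t. \<Phi> (of_real X + \<i> * Wc (of_real t)) / \<i>) has_vector_derivative (G (of_real X + \<i> * Wc (of_real s)) * (\<i> * g s ^ 2)) / \<i>) (at s)"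
      by (rule has_vector_derivative_real_field)
    then show "((\<lambda>t. \<Phi> (of_real X + \<i> * W t) / \<i>) has_vector_derivative theta N r (of_rat x + \<i> * W s) * kern n (W s) * g s ^ 2) (at s)"
      unfolding Ws Gval cancel2 .
  qed
  have L1: "(\<lambda>k. ((\<Phi> (of_real X + \<i> * of_real (S k)) - \<Phi> (of_real s0 + \<i> * of_real (S k))) -
      (\<Phi> (of_real X + \<i> * of_real (Y (a k))) - \<Phi> (of_real X + \<i> * W (a k))) +
      (\<Phi> (of_real s0 + \<i> * of_real (Y (S k))) - \<Phi> (of_real X + \<i> * W (S k)))) / \<i>) \<longlonglongrightarrow> (0 - 0 + 0) / \<i>"
    by (intro tendsto_intros v1 v2 v3) auto
  have L2: "(\<lambda>k. (\<Phi> (of_real X + \<i> * of_real (S k)) / \<i> - \<Phi> (of_real X + \<i> * of_real (Y (a k))) / \<i>) -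
      (\<Phi> (of_real X + \<i> * W (S k)) / \<i> - \<Phi> (of_real X + \<i> * W (a k)) / \<i>) -
      (\<Phi> (of_real s0 + \<i> * of_real (S k)) / \<i> - \<Phi> (of_real s0 + \<i> * of_real (Y (S k))) / \<i>)) \<longlonglongrightarrow>
     (LINT s:{0<..}|lborel. theta N r (of_rat x + \<i> * of_real s) * kern n (of_real s)) -
      (LINT s:{0<..}|lborel. theta N r (of_rat x + \<i> * W s) * kern n (W s) * g s ^ 2) -
      (LINT s:{0<..}|lborel. theta N r (of_real s0 + \<i> * of_real s) * kern n (of_real s + \<i> * of_real (of_rat x - s0)))"
    by (intro tendsto_diff J1 J2 J3)
  have combine: "(p1 / \<i> - p2 / \<i>) - (p3 / \<i> - p4 / \<i>) - (p5 / \<i> - p6 / \<i>) = ((p1 - p5) - (p2 - p4) + (p6 - p3)) / \<i>" for p1 p2 p3 p4 p5 p6 :: complex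
    by (simp add: algebra_simps)
  show ?thesis using LIMSEQ_unique[OF L2[unfolded combine] L1] by simp
qed

section \<open>Quantum modularity\<close>

text \<open>The substitution \<open>\<gamma>\<close> turns the Eichler integral at \<open>\<gamma>x\<close> into an integral over the geodesic from \<open>x\<close> to
  \<open>\<gamma>\<inverse>\<infinity> = s0\<close>. The weight \<open>1/2\<close> of \<open>theta\<close> and the weight \<open>3/2\<close> of the kernel add up to the square of the automorphy
  factor, which is the derivative of the path up to the factor \<open>\<i>\<close>. The difference to the Eichler integral at \<open>x\<close> is the third side of the
  ideal triangle.\<close>
theorem eichler_period:
  fixes \<gamma> :: "int ^ 2 ^ 2" and x :: rat and u s0 :: real
  assumes N: "N > 0" "even N" and \<gamma>: "\<gamma> \<in> Gamma1 (2 * N)" and x: "x \<in> quantum_set N r"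
    and cd: "c = \<gamma>$2$1" "d = \<gamma>$2$2" "c \<noteq> 0"
    and u: "u = of_int c * of_rat x + of_int d" "u \<noteq> 0" and s0: "s0 = - of_int d / of_int c"
  shows "eichler_series N r x - fps_const (inverse (theta_multiplier N r \<gamma>)) *
      (automorphy_series (- 3/2) \<gamma> x * (eichler_series N r (moebius_rat \<gamma> x) oo moebius_shift \<gamma> x)) =
    Abs_fps (\<lambda>n. LINT s:{0<..}|lborel. theta N r (of_real s0 + \<i> * of_real s) * kern n (of_real s + \<i> * of_real (of_rat x - s0)))"
proof (rule fps_ext)
  fix n
  define a b where ab: "a = \<gamma>$1$1" "b = \<gamma>$1$2"
  define A where "A = automorphy_series (- 3/2) \<gamma> x"
  define M where "M = moebius_shift \<gamma> x"
  define \<nu> where "\<nu> = theta_multiplier N r \<gamma>"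
  define y where "y = moebius_rat \<gamma> x"
  have \<nu>0: "\<nu> \<noteq> 0" unfolding \<nu>_def by (rule theta_multiplier_nonzero[OF \<gamma>])
  have det: "a * d - b * c = 1" using Gamma1_entries(1)[OF \<gamma>] by (simp only: ab cd)
  have uc: "of_int c * complex_of_rat x + of_int d = of_real u" by (simp add: u(1) complex_of_rat_eq)
  have "u = of_rat (of_int c * x + of_int d)" by (simp add: u(1) of_rat_add of_rat_mult)
  then have ur: "of_int c * x + of_int d \<noteq> 0" using u(2) by auto
  have yQ: "y \<in> quantum_set N r" unfolding y_def
    by (rule quantum_set_moebius[OF N \<gamma> x]) (use ur in \<open>simp only: cd not_False_eq_True\<close>)
  have M0: "fps_nth M 0 = 0"
    unfolding M_def moebius_shift_eq[OF ab cd(1,2)] by (rule moebius_shift_at_0) (use uc u(2) in simp)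
  define W where "W = (\<lambda>s::real. complex_of_real (u ^ 2 * s) / (1 - \<i> * of_real (of_int c * u * s)))"
  define g where "g = (\<lambda>s::real. complex_of_real u / (1 - \<i> * of_real (of_int c * u * s)))"
  define Z where "Z s = (\<Sum>k\<in>{0..n}. fps_nth (A * M ^ k) n * (theta N r (of_rat y + \<i> * of_real s) * kern k (of_real s)))" for s :: real
  \<comment> \<open>The matrix maps the geodesic \<open>x + iW(s)\<close> to the vertical line above \<open>\<gamma>x\<close>.\<close>
  have pt: "theta N r (of_rat x + \<i> * W s) * kern n (W s) * g s ^ 2 = inverse \<nu> * Z s" if s: "s > 0" for s
  proof -
    define l where "l = 1 - \<i> * complex_of_real (of_int c * u * s)"
    have l0: "l \<noteq> 0" by (simp add: l_def complex_eq_iff)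
    have Wl: "W s = of_real (u ^ 2 * s) / l" and gl: "g s = of_real u / l" by (simp_all add: W_def g_def l_def)
    define w where "w = of_rat x + \<i> * W s"
    have "Re (W s) = u ^ 2 * s / (1 + (of_int c * u * s) ^ 2)"
      by (simp add: W_def Re_divide power2_eq_square)
    moreover have "\<dots> > 0" using u(2) s by (intro divide_pos_pos mult_pos_pos add_pos_nonneg) auto
    ultimately have Imw: "Im w > 0" by (simp add: w_def)
    have cw: "of_int c * w + of_int d = of_real u / l"
    proof -
      have "(of_int c * w + of_int d) * l = (of_int c * complex_of_rat x + of_int d) * l + \<i> * of_int c * (W s * l)"
        by (simp add: w_def algebra_simps)
      also have "W s * l = of_real (u ^ 2 * s)" using l0 by (simp add: Wl)
      also have "(of_int c * complex_of_rat x + of_int d) * l + \<i> * of_int c * of_real (u ^ 2 * s) = of_real u"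
        unfolding uc by (simp add: l_def algebra_simps power2_eq_square)
      finally show ?thesis using l0 by (simp add: eq_divide_eq)
    qed
    have yu: "of_rat y * complex_of_real u = of_int a * of_rat x + of_int b"
    proof -
      have "y = (of_int a * x + of_int b) / (of_int c * x + of_int d)" by (simp only: y_def moebius_rat_def ab cd)
      then have "of_rat y = (of_int a * of_rat x + of_int b) / (of_int c * complex_of_rat x + of_int d)"
        by (simp add: of_rat_divide of_rat_add of_rat_mult)
      then show ?thesis unfolding uc using u(2) by simp
    qed
    have "(of_int a * w + of_int b) * l = (of_rat y + \<i> * of_real s) * of_real u"
    proof -
      have detc: "of_int a * complex_of_int d - of_int b * of_int c = 1" using det by (simp flip: of_int_mult of_int_diff)
      have "(of_int a * w + of_int b) * l = (of_int a * of_rat x + of_int b) * l + \<i> * of_int a * (W s * l)"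
        by (simp add: w_def algebra_simps)
      also have "W s * l = of_real u * of_real u * of_real s" using l0 by (simp add: Wl power2_eq_square)
      also have "(of_int a * of_rat x + of_int b) * l = (of_int a * of_rat x + of_int b) - \<i> * of_real s * of_real u * (of_int c * (of_int a * of_rat x + of_int b))"
        by (simp add: l_def algebra_simps)
      also have "of_int c * (of_int a * of_rat x + of_int b) = of_int a * complex_of_real u - 1"
        unfolding uc[symmetric] detc[symmetric] by (simp add: algebra_simps)
      also have "(of_int a * complex_of_rat x + of_int b) - \<i> * of_real s * of_real u * (of_int a * complex_of_real u - 1) + \<i> * of_int a * (of_real u * of_real u * of_real s)
         = (of_rat y + \<i> * of_real s) * of_real u"
        unfolding yu[symmetric] by (simp add: algebra_simps)
      finally show ?thesis .
    qed
    then have aw: "(of_int a * w + of_int b) / (of_int c * w + of_int d) = of_rat y + \<i> * of_real s"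
      unfolding cw using l0 u(2) by (simp add: field_simps)
    define L where "L = lower_power u c (- 3/2) * of_real s powr (- 3/2)"
    have th: "theta N r (of_rat y + \<i> * of_real s) = \<nu> * csqrt (of_real u / l) * theta N r w"
      using theta_transform[OF N \<gamma> Imw, of r] by (simp only: ab[symmetric] cd(1,2)[symmetric] cw aw[unfolded cw] \<nu>_def)
    have "fps_nth (A * (kern_series (of_real s) oo M)) n = L * (((- 3/2) gchoose n) * (\<i> / W s) ^ n)"
      unfolding A_def M_def kern_series_moebius[OF ab cd(1,2) det u s W_def[THEN fun_cong]] L_def[symmetric] fps_compose_linear
      by (simp add: mult_ac)
    then have "theta N r (of_rat y + \<i> * of_real s) * fps_nth (A * (kern_series (of_real s) oo M)) n =
      \<nu> * theta N r w * (((- 3/2) gchoose n) * (\<i> / W s) ^ n) * (csqrt (of_real u / l) * L)"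
      unfolding th by (simp only: mult_ac)
    also have "csqrt (of_real u / l) * L = g s ^ 2 * W s powr (- 3/2)"
      unfolding L_def l_def gl[unfolded l_def] Wl[unfolded l_def] by (rule geodesic_branch[OF u(2) s cd(3)])
    finally have "theta N r (of_rat y + \<i> * of_real s) * fps_nth (A * (kern_series (of_real s) oo M)) n =
      \<nu> * (theta N r w * kern n (W s) * g s ^ 2)"
      unfolding kern_def by (simp only: mult_ac)
    moreover have "theta N r (of_rat y + \<i> * of_real s) * fps_nth (A * (kern_series (of_real s) oo M)) n = Z s"
      unfolding fps_mult_compose_nth[OF M0] kern_series_nth Z_def sum_distrib_left by (simp only: mult_ac)
    ultimately have "Z s = \<nu> * (theta N r w * kern n (W s) * g s ^ 2)" by (simp only:)
    then show ?thesis using \<nu>0 by (simp add: w_def mult.assoc[symmetric])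
  qed
  have I: "set_integrable lborel {0<..} (\<lambda>s. fps_nth (A * M ^ k) n * (theta N r (of_rat y + \<i> * of_real s) * kern k (of_real s)))" for k
    by (intro set_integrable_mult_right impI eichler_integrable[OF N yQ])
  have Zi: "set_integrable lborel {0<..} Z"
    unfolding set_integrable_def Z_def scaleR_sum_right
    by (intro Bochner_Integration.integrable_sum I[unfolded set_integrable_def])
  have "(LINT s:{0<..}|lborel. Z s) = (\<Sum>k\<in>{0..n}. LINT s:{0<..}|lborel. fps_nth (A * M ^ k) n * (theta N r (of_rat y + \<i> * of_real s) * kern k (of_real s)))"
    unfolding set_lebesgue_integral_def Z_def scaleR_sum_right
    by (intro Bochner_Integration.integral_sum I[unfolded set_integrable_def])
  also have "\<dots> = (\<Sum>k\<in>{0..n}. fps_nth (eichler_series N r y) k * fps_nth (A * M ^ k) n)"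
    unfolding set_integral_mult_right by (simp add: eichler_series_def mult.commute)
  also have "\<dots> = fps_nth (A * (eichler_series N r y oo M)) n" by (rule fps_mult_compose_nth[OF M0, symmetric])
  finally have ZI: "(LINT s:{0<..}|lborel. Z s) = fps_nth (A * (eichler_series N r y oo M)) n" .
  have int: "set_integrable lborel {0<..} (\<lambda>s. theta N r (of_rat x + \<i> * W s) * kern n (W s) * g s ^ 2)"
  proof -
    have "set_integrable lborel {0<..} (\<lambda>s. inverse \<nu> * Z s)" by (intro set_integrable_mult_right impI Zi)
    also have "?this \<longleftrightarrow> ?thesis" by (rule set_integrable_cong) (simp_all add: pt)
    finally show ?thesis .
  qed
  have I2: "(LINT s:{0<..}|lborel. theta N r (of_rat x + \<i> * W s) * kern n (W s) * g s ^ 2) =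
      inverse \<nu> * fps_nth (A * (eichler_series N r y oo M)) n"
  proof -
    have "(LINT s:{0<..}|lborel. theta N r (of_rat x + \<i> * W s) * kern n (W s) * g s ^ 2) = (LINT s:{0<..}|lborel. inverse \<nu> * Z s)"
      by (rule set_lebesgue_integral_cong) (simp_all add: pt)
    then show ?thesis by (simp only: set_integral_mult_right ZI)
  qed
  show "fps_nth (eichler_series N r x - fps_const (inverse (theta_multiplier N r \<gamma>)) *
      (automorphy_series (- 3/2) \<gamma> x * (eichler_series N r (moebius_rat \<gamma> x) oo moebius_shift \<gamma> x))) n =
    fps_nth (Abs_fps (\<lambda>n. LINT s:{0<..}|lborel. theta N r (of_real s0 + \<i> * of_real s) * kern n (of_real s + \<i> * of_real (of_rat x - s0)))) n"
    using ideal_triangle[OF N x cd(3) u s0 int[unfolded W_def g_def]]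
    unfolding W_def[THEN fun_cong, symmetric] g_def[THEN fun_cong, symmetric] I2
    unfolding A_def M_def y_def \<nu>_def
    by (simp only: fps_sub_nth fps_mult_left_const_nth fps_nth_Abs_fps eichler_series_def[of N r x])
qed

text \<open>If \<open>c = 0\<close> then \<open>\<gamma>\<close> is a translation, since \<open>- 1\<close> is not congruent to \<open>1\<close> modulo \<open>2N \<ge> 4\<close>.\<close>
lemma eichler_translation:
  fixes \<gamma> :: "int ^ 2 ^ 2" and x :: rat
  assumes N: "N > 0" "even N" and \<gamma>: "\<gamma> \<in> Gamma1 (2 * N)" and c: "\<gamma>$2$1 = 0"
  shows "eichler_series N r x - fps_const (inverse (theta_multiplier N r \<gamma>)) *
      (automorphy_series (- 3/2) \<gamma> x * (eichler_series N r (moebius_rat \<gamma> x) oo moebius_shift \<gamma> x)) = 0"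
proof -
  define b where "b = \<gamma>$1$2"
  have ad: "\<gamma>$1$1 * \<gamma>$2$2 = 1" using Gamma1_entries(1)[OF \<gamma>] c by simp
  have d: "\<gamma>$2$2 = 1"
  proof (rule ccontr)
    assume "\<gamma>$2$2 \<noteq> 1"
    then have "\<gamma>$2$2 = - 1" using ad by (auto simp: zmult_eq_1_iff)
    then have "2 * int N dvd - 2" using Gamma1_entries(4)[OF \<gamma>] by (simp add: cong_iff_dvd_diff)
    then have "2 * int N \<le> 2" by (intro zdvd_imp_le) auto
    then show False using N by auto
  qed
  have a: "\<gamma>$1$1 = 1" using ad d by simp
  have lp: "lower_power 1 0 s = 1" for s by (simp add: lower_power_def)
  have bin: "fps_binomial s oo (fps_const 0 * fps_X) = (1 :: complex fps)" for s
    unfolding fps_compose_linear by (rule fps_ext) (simp add: power_0_left)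
  have aut: "automorphy_series (- 3/2) \<gamma> x = 1"
    unfolding automorphy_series_def Let_def c d using bin lp by simp
  have y: "moebius_rat \<gamma> x = x + of_int b" by (simp add: moebius_rat_def a b_def c d)
  have shift: "moebius_shift \<gamma> x = fps_X"
    unfolding moebius_shift_def y a c d by (simp add: b_def of_rat_add flip: fps_const_add)
  have th: "theta N r (of_rat (x + of_int b) + \<i> * of_real s) = theta_multiplier N r \<gamma> * theta N r (of_rat x + \<i> * of_real s)"
    if "s > 0" for s
    using theta_transform[OF N \<gamma>, of "of_rat x + \<i> * of_real s" r] that
    by (simp add: a c d b_def of_rat_add add_ac)
  have "eichler_series N r (x + of_int b) = fps_const (theta_multiplier N r \<gamma>) * eichler_series N r x"
  proof (rule fps_ext)
    fix n
    have "(LINT s:{0<..}|lborel. theta N r (of_rat (x + of_int b) + \<i> * of_real s) * kern n (of_real s)) =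
      (LINT s:{0<..}|lborel. theta_multiplier N r \<gamma> * (theta N r (of_rat x + \<i> * of_real s) * kern n (of_real s)))"
      by (rule set_lebesgue_integral_cong) (simp_all add: th mult.assoc)
    then show "fps_nth (eichler_series N r (x + of_int b)) n = fps_nth (fps_const (theta_multiplier N r \<gamma>) * eichler_series N r x) n"
      by (simp only: eichler_series_def fps_nth_Abs_fps fps_mult_left_const_nth set_integral_mult_right)
  qed
  then show ?thesis
    using theta_multiplier_nonzero[OF \<gamma>, of r] unfolding aut y shift fps_compose_fps_X
    by (simp add: mult.assoc[symmetric])
qed

theorem theorem1p5:
  fixes N :: nat and r :: int
  assumes "N > 0" and "even N"
  shows "strong_quantum_modular_form (partial_theta N r) (3 / 2) (Gamma1 (2 * N))
           (theta_multiplier N r) (quantum_set N r)"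
  unfolding strong_quantum_modular_form_def
proof (intro conjI ballI)
  fix x assume x: "x \<in> quantum_set N r"
  show "\<exists>a. has_asymptotic_expansion (partial_theta N r) x a"
    using partial_theta_eps_expansion[OF assms x] by (rule eps_expansion_imp_asymptotic) blast
next
  fix \<gamma> assume \<gamma>: "\<gamma> \<in> Gamma1 (2 * N)"
  define a b c d where "a = \<gamma>$1$1" "b = \<gamma>$1$2" "c = \<gamma>$2$1" "d = \<gamma>$2$2"
  note abcd = a_b_c_d_def
  define \<nu> where "\<nu> = theta_multiplier N r \<gamma>"
  define E where "E = eichler_const N"
  define s0 where "s0 = - real_of_int d / of_int c"
  define P where "P y = (if c = 0 then 0 else
    Abs_fps (\<lambda>n. LINT s:{0<..}|lborel. theta N r (of_real s0 + \<i> * of_real s) * kern n (of_real s + \<i> * of_real (y - s0))))" for y :: real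
  define D where "D y = defect_series N r (of_real y) - fps_const (inverse \<nu>) *
     (fps_const (lower_power (of_int c * y + of_int d) c (- 3/2)) * (fps_binomial (of_real (- 3/2)) oo (fps_const (of_int c / of_real (of_int c * y + of_int d)) * fps_X)) *
      (defect_series N r ((of_int a * of_real y + of_int b) / (of_int c * of_real y + of_int d)) oo moebius_shift_at a b c d (of_real y)))" for y :: real
  \<comment> \<open>The period function takes care of the Eichler integral, the other terms of the finite sum.\<close>
  define h where "h y = E * (if c = 0 then 0 else period_function N r s0 y) +
    (theta_defect N r (of_real y) - inverse \<nu> * (lower_power (of_int c * y + of_int d) c (- 3/2) *
      theta_defect N r ((of_int a * of_real y + of_int b) / (of_int c * of_real y + of_int d))))" for y :: real
  have h: "real_fps_expansion h y (fps_const E * P y + D y)" if y: "of_int c * y + of_int d \<noteq> 0" for y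
  proof -
    have "real_fps_expansion (\<lambda>y. if c = 0 then 0 else period_function N r s0 y) y (P y)"
    proof (cases "c = 0")
      case True
      then show ?thesis unfolding P_def real_fps_expansion_def by (auto intro: exI[of _ 1])
    next
      case False
      then have "y \<noteq> s0" using y by (auto simp: s0_def)
      then show ?thesis using period_function_expansion[OF assms(1)] False by (simp only: P_def if_False)
    qed
    moreover have "real_fps_expansion (\<lambda>y. theta_defect N r (of_real y)) y (defect_series N r (of_real y))"
      by (rule has_fps_expansion_imp_real[OF defect_has_fps_expansion]) simp
    ultimately show ?thesis
      unfolding h_def D_def
      by (intro real_fps_expansion_add real_fps_expansion_diff real_fps_expansion_cmult slash_defect_expansion refl y)
  qed
  show "\<exists>h. real_analytic_on h {y. of_int (\<gamma> $ 2 $ 1) * y + of_int (\<gamma> $ 2 $ 2) \<noteq> 0} \<and>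
    (\<forall>x\<in>quantum_set N r. of_int (\<gamma> $ 2 $ 1) * x + of_int (\<gamma> $ 2 $ 2) \<noteq> 0 \<longrightarrow>
      (\<exists>a a'. has_asymptotic_expansion (partial_theta N r) x a \<and>
        has_asymptotic_expansion (partial_theta N r) (moebius_rat \<gamma> x) a' \<and>
        eps_series a - fps_const (inverse (theta_multiplier N r \<gamma>)) * automorphy_series (- (3 / 2)) \<gamma> x *
          (eps_series a' oo moebius_shift \<gamma> x) = taylor_series h (of_rat x)))"
  proof (intro exI[of _ h] conjI ballI impI)
    show "real_analytic_on h {y. of_int (\<gamma> $ 2 $ 1) * y + of_int (\<gamma> $ 2 $ 2) \<noteq> 0}"
      unfolding abcd[symmetric] by (rule real_analytic_onI) (use h in blast)
    fix x assume x: "x \<in> quantum_set N r" and nz: "of_int (\<gamma> $ 2 $ 1) * x + of_int (\<gamma> $ 2 $ 2) \<noteq> 0"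
    define y where "y = moebius_rat \<gamma> x"
    have yQ: "y \<in> quantum_set N r" unfolding y_def by (rule quantum_set_moebius[OF assms \<gamma> x nz])
    obtain p where p: "has_asymptotic_expansion (partial_theta N r) x p"
      "eps_series p = fps_const E * eichler_series N r x + defect_series N r (of_rat x)"
      using eps_expansion_imp_asymptotic[OF partial_theta_eps_expansion[OF assms x]] unfolding E_def by blast
    obtain q where q: "has_asymptotic_expansion (partial_theta N r) y q"
      "eps_series q = fps_const E * eichler_series N r y + defect_series N r (of_rat y)"
      using eps_expansion_imp_asymptotic[OF partial_theta_eps_expansion[OF assms yQ]] unfolding E_def by blast
    define u where "u = of_int c * of_rat x + real_of_int d"
    have "u = of_rat (of_int c * x + of_int d)" by (simp add: u_def of_rat_add of_rat_mult)
    then have u0: "u \<noteq> 0" using nz by (simp add: abcd)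
    define A where "A = automorphy_series (- 3/2) \<gamma> x"
    define M where "M = moebius_shift \<gamma> x"
    have M: "M = moebius_shift_at a b c d (of_rat x)" unfolding M_def by (rule moebius_shift_eq) (simp_all only: abcd)
    have uc: "of_int c * complex_of_rat x + of_int d = of_real u" by (simp add: u_def complex_of_rat_eq)
    have M0: "fps_nth M 0 = 0" unfolding M by (rule moebius_shift_at_0) (use uc u0 in simp)
    have eich: "eichler_series N r x - fps_const (inverse \<nu>) * (A * (eichler_series N r y oo M)) = P (of_rat x)"
    proof (cases "c = 0")
      case True
      then have "\<gamma>$2$1 = 0" "P (of_rat x) = 0" by (simp_all add: P_def abcd)
      then show ?thesis using eichler_translation[OF assms \<gamma>, of r x] unfolding \<nu>_def A_def M_def y_def by simp
    next
      case False
      show ?thesis unfolding \<nu>_def A_def M_def y_def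
        using eichler_period[OF assms \<gamma> x abcd(3,4) False u_def u0 s0_def] False by (simp only: P_def if_False)
    qed
    have defect: "defect_series N r (of_rat x) - fps_const (inverse \<nu>) * (A * (defect_series N r (of_rat y) oo M)) = D (of_rat x)"
    proof -
      have "of_rat y = (of_int a * complex_of_rat x + of_int b) / (of_int c * of_rat x + of_int d)"
        by (simp add: y_def moebius_rat_def of_rat_divide of_rat_add of_rat_mult abcd)
      moreover have "A = fps_const (lower_power u c (- 3/2)) * (fps_binomial (of_real (- 3/2)) oo (fps_const (of_int c / of_real u) * fps_X))"
        by (simp only: A_def automorphy_series_def Let_def abcd u_def)
      ultimately show ?thesis unfolding D_def M complex_of_rat_eq u_def[symmetric] by (simp only:)
    qed
    have "eps_series p - fps_const (inverse \<nu>) * A * (eps_series q oo M) =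
      fps_const E * (eichler_series N r x - fps_const (inverse \<nu>) * (A * (eichler_series N r y oo M))) +
      (defect_series N r (of_rat x) - fps_const (inverse \<nu>) * (A * (defect_series N r (of_rat y) oo M)))"
      unfolding p(2) q(2) fps_compose_add_distrib fps_compose_mult_distrib[OF M0] fps_const_compose
      by (simp add: algebra_simps)
    also have "\<dots> = taylor_series h (of_rat x)"
      unfolding eich defect by (rule taylor_series_eqI[OF h, symmetric]) (use u0 in \<open>simp only: u_def not_False_eq_True\<close>)
    finally have *: "eps_series p - fps_const (inverse \<nu>) * A * (eps_series q oo M) = taylor_series h (of_rat x)" .
    have "automorphy_series (- (3/2)) \<gamma> x = A" by (simp add: A_def)
    with * show "\<exists>a a'. has_asymptotic_expansion (partial_theta N r) x a \<and>
        has_asymptotic_expansion (partial_theta N r) (moebius_rat \<gamma> x) a' \<and>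
        eps_series a - fps_const (inverse (theta_multiplier N r \<gamma>)) * automorphy_series (- (3 / 2)) \<gamma> x *
          (eps_series a' oo moebius_shift \<gamma> x) = taylor_series h (of_rat x)"
      using p(1) q(1) unfolding \<nu>_def M_def y_def by (intro exI[of _ p] exI[of _ q]) simp
  qed
qed

end
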